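(* Let $M$ be a compact smooth manifold of dimension $d\ge1$ that is Hausdorff, connected and without boundary, and let $1\le r\le\infty$. Then the Polish group $\mathrm{Diff}^r(M)$ admits an ergodic free probability preserving spatial action. Hence $\mathrm{Diff}^r(M)$ is not a Lévy group.
   Context: $\mathrm{Diff}^r(M)$ is the group of all $C^r$-diffeomorphisms of $M$ onto itself, a Polish group with the compact-open $C^r$-topology. A probability preserving spatial action of a Polish group $G$ on a standard probability space $(X,\mathcal{B},\mu)$ (a standard Borel space with a non-atomic Borel probability measure) is a jointly Borel map $G\times X\to X$, $(g,x)\mapsto T_g(x)$, with $T_e=\mathrm{Id}_X$, $T_g\circ T_h=T_{gh}$ for all $g,h\in G$, and $\mu\circ T_g^{-1}=\mu$ for every $g\in G$. It is ergodic if every $A\in\mathcal{B}$ with $\mu(A\triangle T_g^{-1}(A))=0$ for every $g\in G$ satisfies $\mu(A)\in\{0,1\}$. It is free if $T_g(x)\neq x$ for every $x$ in the space and every $g\ne e$ (obtained, if necessary, by restricting to an invariant conull Borel set). A Polish group $G$ is a Lévy group if there is an increasing sequence $K_1\subset K_2\subset\cdots$ of compact subgroups of $G$ with dense union in $G$, with normalized Haar measures $m_n$ on $K_n$, such that for every neighborhood $U$ of the identity in $G$ and all Borel sets $A_n\subset K_n$ with $\liminf_n m_n(A_n)>0$ one has $m_n(K_n\cap A_nU)\to1$. *)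

theory Defs
  imports "HOL-Analysis.Analysis" "HOL-Probability.Probability_Measure"
    "HOL-Algebra.Bij" "HOL-Algebra.Coset"
begin

section \<open>Differentiability classes\<close>

text \<open>Iterated directional derivatives, the head of the list being taken last.\<close>

primrec iter_deriv ::
    "'e list \<Rightarrow> ('e::real_normed_vector \<Rightarrow> 'f::real_normed_vector) \<Rightarrow> 'e \<Rightarrow> 'f" where
  "iter_deriv [] f = f"
| "iter_deriv (v # vs) f = (\<lambda>x. frechet_derivative (iter_deriv vs f) (at x) v)"

definition C_on ::
    "enat \<Rightarrow> 'e::euclidean_space set \<Rightarrow> ('e \<Rightarrow> 'f::real_normed_vector) \<Rightarrow> bool" where
  "C_on r S f \<longleftrightarrow>
     (\<forall>vs. set vs \<subseteq> Basis \<and> enat (length vs) \<le> r \<longrightarrow>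
        continuous_on S (iter_deriv vs f) \<and>
        (enat (length vs) < r \<longrightarrow> (\<forall>x\<in>S. iter_deriv vs f differentiable (at x))))"
    \<comment> \<open>meant for open sets only, since the derivatives are unrestricted\<close>


section \<open>Smooth manifolds\<close>

text \<open>A chart is a pair of its domain and its coordinate map; values of the map off the
  domain are irrelevant. The dimension of the manifold is the dimension of the model space,
  which is positive for every type of class \<open>euclidean_space\<close>. Charts map onto
  open subsets of the model space, so there is no boundary.\<close>

type_synonym ('m, 'e) chart = "'m set \<times> ('m \<Rightarrow> 'e)"

definition chart_on :: "'m topology \<Rightarrow> ('m, 'e::euclidean_space) chart \<Rightarrow> bool" where
  "chart_on X = (\<lambda>(U, \<phi>). openin X U \<and> open (\<phi> ` U) \<and>
     homeomorphic_map (subtopology X U) (top_of_set (\<phi> ` U)) \<phi>)"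

definition smooth_atlas ::
    "'m topology \<Rightarrow> ('m, 'e::euclidean_space) chart set \<Rightarrow> bool" where
  "smooth_atlas X A \<longleftrightarrow>
     (\<forall>c\<in>A. chart_on X c) \<and>
     (\<Union>c\<in>A. fst c) = topspace X \<and>
     (\<forall>(U, \<phi>)\<in>A. \<forall>(V, \<psi>)\<in>A. C_on \<infinity> (\<phi> ` (U \<inter> V)) (\<psi> \<circ> inv_into U \<phi>))"

definition local_rep ::
    "('m, 'e) chart \<Rightarrow> ('m, 'e) chart \<Rightarrow> ('m \<Rightarrow> 'm) \<Rightarrow> 'e \<Rightarrow> 'e" where
  "local_rep c d f = snd d \<circ> f \<circ> inv_into (fst c) (snd c)"

definition C_map ::
    "enat \<Rightarrow> 'm topology \<Rightarrow> ('m, 'e::euclidean_space) chart set \<Rightarrow> ('m \<Rightarrow> 'm) \<Rightarrow> bool" where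
  "C_map r X A f \<longleftrightarrow>
     continuous_map X X f \<and>
     (\<forall>c\<in>A. \<forall>d\<in>A. C_on r (snd c ` (fst c \<inter> f -` fst d)) (local_rep c d f))"

definition diffeos ::
    "enat \<Rightarrow> 'm topology \<Rightarrow> ('m, 'e::euclidean_space) chart set \<Rightarrow> ('m \<Rightarrow> 'm) set" where
  "diffeos r X A =
     {f \<in> Bij (topspace X). C_map r X A f \<and> C_map r X A (inv_into (topspace X) f)}"

definition Diff ::
    "enat \<Rightarrow> 'm topology \<Rightarrow> ('m, 'e::euclidean_space) chart set \<Rightarrow> ('m \<Rightarrow> 'm) monoid" where
  "Diff r X A = (BijGroup (topspace X))\<lparr>carrier := diffeos r X A\<rparr>"

text \<open>Subbasic sets of the compact-open (weak) \<open>C\<^sup>r\<close>-topology: closeness of all partial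
  derivatives of order at most \<open>k\<close> in a pair of charts, uniformly on a compact set.\<close>

definition diff_nhd ::
    "enat \<Rightarrow> 'm topology \<Rightarrow> ('m, 'e::euclidean_space) chart set \<Rightarrow>
     nat \<Rightarrow> ('m \<Rightarrow> 'm) \<Rightarrow> ('m, 'e) chart \<Rightarrow> ('m, 'e) chart \<Rightarrow> 'm set \<Rightarrow> real \<Rightarrow>
     ('m \<Rightarrow> 'm) set" where
  "diff_nhd r X A k f c d K \<epsilon> =
     {g \<in> diffeos r X A. g ` K \<subseteq> fst d \<and>
        (\<forall>x \<in> snd c ` K. \<forall>vs. set vs \<subseteq> Basis \<and> length vs \<le> k \<longrightarrow>
           norm (iter_deriv vs (local_rep c d g) x - iter_deriv vs (local_rep c d f) x) < \<epsilon>)}"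

text \<open>Only finite orders occur; for \<open>r = \<infinity>\<close> this is the join of the
  \<open>C\<^sup>k\<close>-topologies over all finite \<open>k\<close>.\<close>

definition Diff_topology ::
    "enat \<Rightarrow> 'm topology \<Rightarrow> ('m, 'e::euclidean_space) chart set \<Rightarrow> ('m \<Rightarrow> 'm) topology" where
  "Diff_topology r X A = topology_generated_by
     {diff_nhd r X A k f c d K \<epsilon> | k f c d K \<epsilon>.
        enat k \<le> r \<and> f \<in> diffeos r X A \<and> c \<in> A \<and> d \<in> A \<and>
        compactin X K \<and> K \<subseteq> fst c \<and> f ` K \<subseteq> fst d \<and> 0 < \<epsilon>}"


section \<open>Polish groups and standard probability spaces\<close>

definition topological_group :: "('g, 'b) monoid_scheme \<Rightarrow> 'g topology \<Rightarrow> bool" where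
  "topological_group G \<tau> \<longleftrightarrow>
     group G \<and> topspace \<tau> = carrier G \<and>
     continuous_map (prod_topology \<tau> \<tau>) \<tau> (\<lambda>(g, h). g \<otimes>\<^bsub>G\<^esub> h) \<and>
     continuous_map \<tau> \<tau> (\<lambda>g. inv\<^bsub>G\<^esub> g)"

definition polish_topology :: "'x topology \<Rightarrow> bool" where
  "polish_topology \<tau> \<longleftrightarrow> completely_metrizable_space \<tau> \<and> separable_space \<tau>"

definition polish_group :: "('g, 'b) monoid_scheme \<Rightarrow> 'g topology \<Rightarrow> bool" where
  "polish_group G \<tau> \<longleftrightarrow> topological_group G \<tau> \<and> polish_topology \<tau>"

definition borel_of :: "'x topology \<Rightarrow> 'x measure" where
  "borel_of \<tau> = sigma (topspace \<tau>) {U. openin \<tau> U}"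

definition nonatomic :: "'x measure \<Rightarrow> bool" where
  "nonatomic P \<longleftrightarrow>
     (\<forall>A\<in>sets P. 0 < emeasure P A \<longrightarrow>
        (\<exists>B\<in>sets P. B \<subseteq> A \<and> 0 < emeasure P B \<and> emeasure P B < emeasure P A))"

definition standard_prob_space :: "'x measure \<Rightarrow> bool" where
  "standard_prob_space P \<longleftrightarrow>
     prob_space P \<and> nonatomic P \<and>
     (\<exists>\<tau>. polish_topology \<tau> \<and> topspace \<tau> = space P \<and> sets P = sets (borel_of \<tau>))"


section \<open>Spatial actions\<close>

definition spatial_action ::
    "('g, 'b) monoid_scheme \<Rightarrow> 'g topology \<Rightarrow> 'x measure \<Rightarrow> ('g \<Rightarrow> 'x \<Rightarrow> 'x) \<Rightarrow> bool" where
  "spatial_action G \<tau> P T \<longleftrightarrow>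
     (\<lambda>(g, x). T g x) \<in> borel_of \<tau> \<Otimes>\<^sub>M P \<rightarrow>\<^sub>M P \<and>
     (\<forall>x\<in>space P. T \<one>\<^bsub>G\<^esub> x = x) \<and>
     (\<forall>g\<in>carrier G. \<forall>h\<in>carrier G. \<forall>x\<in>space P. T g (T h x) = T (g \<otimes>\<^bsub>G\<^esub> h) x) \<and>
     (\<forall>g\<in>carrier G. \<forall>B\<in>sets P. emeasure P (T g -` B \<inter> space P) = emeasure P B)"

definition ergodic_action ::
    "('g, 'b) monoid_scheme \<Rightarrow> 'x measure \<Rightarrow> ('g \<Rightarrow> 'x \<Rightarrow> 'x) \<Rightarrow> bool" where
  "ergodic_action G P T \<longleftrightarrow>
     (\<forall>B\<in>sets P. (\<forall>g\<in>carrier G. emeasure P (sym_diff B (T g -` B \<inter> space P)) = 0) \<longrightarrow>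
        emeasure P B = 0 \<or> emeasure P B = 1)"

definition free_action ::
    "('g, 'b) monoid_scheme \<Rightarrow> 'x measure \<Rightarrow> ('g \<Rightarrow> 'x \<Rightarrow> 'x) \<Rightarrow> bool" where
  "free_action G P T \<longleftrightarrow>
     (\<forall>x\<in>space P. \<forall>g\<in>carrier G. g \<noteq> \<one>\<^bsub>G\<^esub> \<longrightarrow> T g x \<noteq> x)"


section \<open>Levy groups\<close>

definition normalized_haar ::
    "('g, 'b) monoid_scheme \<Rightarrow> 'g topology \<Rightarrow> 'g set \<Rightarrow> 'g measure \<Rightarrow> bool" where
  "normalized_haar G \<tau> K m \<longleftrightarrow>
     space m = K \<and> sets m = sets (borel_of (subtopology \<tau> K)) \<and> prob_space m \<and>
     (\<forall>k\<in>K. \<forall>B\<in>sets m. emeasure m (k <#\<^bsub>G\<^esub> B) = emeasure m B)"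

text \<open>Neighbourhoods of the identity are taken open, which makes \<open>A\<^sub>n U\<close> open and hence
  measurable; this does not change the notion.\<close>

definition levy_group :: "('g, 'b) monoid_scheme \<Rightarrow> 'g topology \<Rightarrow> bool" where
  "levy_group G \<tau> \<longleftrightarrow>
     (\<exists>K m. (\<forall>n. subgroup (K n) G \<and> compactin \<tau> (K n) \<and> K n \<subseteq> K (Suc n) \<and>
                 normalized_haar G \<tau> (K n) (m n)) \<and>
        \<tau> closure_of (\<Union>n::nat. K n) = carrier G \<and>
        (\<forall>U A. openin \<tau> U \<and> \<one>\<^bsub>G\<^esub> \<in> U \<and> (\<forall>n. A n \<in> sets (m n)) \<and>
               0 < liminf (\<lambda>n. emeasure (m n) (A n)) \<longrightarrow>
           (\<lambda>n. measure (m n) (K n \<inter> (A n <#>\<^bsub>G\<^esub> U))) \<longlonglongrightarrow> 1))"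

end

theory Submission
  imports Defs "HOL-Probability.Probability"
begin

text \<open>
 Write \<open>D\<close> for the group of diffeomorphisms of the compact manifold \<open>M\<close>. The three claims rest on
 different ideas.

 \<^emph>\<open>Polish.\<close> A map from a space \<open>S\<close> into \<open>D\<close> is continuous exactly if the corresponding family of
 maps of \<open>M\<close> has local representations whose derivatives are jointly continuous in the parameter and
 the point (\<open>continuous_map_imp_smooth_family\<close>, \<open>smooth_family_imp_continuous_map\<close>). This universal
 property turns continuity of the group laws into calculus: such families are stable under composition
 and, by compactness of \<open>M\<close> and the inverse map theorem, under inversion. For completeness, a
 diffeomorphism is recorded by the derivatives of finitely many test functions composed with it and with
 its inverse. This embeds \<open>D\<close> into a countable product of Banach spaces, and the image is closed since
 uniform limits of derivatives are derivatives (\<open>closed_jets_diffeos\<close>).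

 \<^emph>\<open>The action.\<close> Volume on \<open>M\<close> is not invariant, but the measure \<open>dx dt\<close> on \<open>M \<times> (0,\<infinity>)\<close> is
 invariant under \<open>(x, t) \<mapsto> (g x, t / J g x)\<close>, where \<open>J\<close> is the Jacobian; a third coordinate in \<open>[0,1)\<close>, the
 mark, is left fixed. The group therefore acts on the locally finite subsets of this infinite measure space and
 preserves the law of the Poisson process there. Diffeomorphisms that squeeze all but a small part of \<open>M\<close>
 into a set of small measure (\<open>squeeze\<close>) make sets of finite measure asymptotically disjoint
 (\<open>act_mixing\<close>), so that the Poisson action is mixing along a sequence, hence ergodic. It is free at
 every point: only configurations are admitted whose points have distinct marks and are dense in \<open>M\<close>, which
 are almost all; marks being fixed, an element that fixes a configuration fixes each of its points and is
 the identity.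

 \<^emph>\<open>Not Levy.\<close> A diffeomorphism that maps a closed ball well into its interior has neighbours of the same
 kind only, and no power of these is close to the identity, whereas every element of a compact
 group has powers close to the identity. Compact subgroups thus miss a nonempty open set
 (\<open>not_levy_group_Diff\<close>).
\<close>

section \<open>Families of maps with jointly continuous derivatives\<close>

abbreviation dd :: "'a::real_normed_vector => ('a => 'b::real_normed_vector) => 'a => 'b" where
 "dd v f \<equiv> (%x. frechet_derivative f (at x) v)"

text \<open>The parameter tends to \<open>s0\<close> along \<open>F\<close> while the point tends to \<open>x0\<close>; derivatives are taken in the
 point only. The one-point parameter space gives germs of maps, the neighbourhoods of a diffeomorphism
 give the topology of the group.\<close>

primrec C_family :: "nat => 's filter => 's =>
  ('s => 'a::euclidean_space => 'b::real_normed_vector) => 'a => bool" where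
 "C_family 0 F s0 f x0 \<longleftrightarrow> ((%(s, x). f s x) \<longlongrightarrow> f s0 x0) (F \<times>\<^sub>F nhds x0)"
| "C_family (Suc n) F s0 f x0 \<longleftrightarrow> ((%(s, x). f s x) \<longlongrightarrow> f s0 x0) (F \<times>\<^sub>F nhds x0) &
   (\<forall>\<^sub>F (s, x) in F \<times>\<^sub>F nhds x0. f s differentiable (at x)) &
   (\<forall>v\<in>Basis. C_family n F s0 (%s. dd v (f s)) x0)"

text \<open>Identities that hold eventually can therefore be differentiated: they hold near each nearby point.\<close>

lemma eventually_family_nhds:
 assumes "\<forall>\<^sub>F (s, x) in F \<times>\<^sub>F nhds x0. P s x"
 shows "\<forall>\<^sub>F (s, x) in F \<times>\<^sub>F nhds x0. \<forall>\<^sub>F y in nhds x. P s y"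
proof -
 obtain Pf Pg where *: "eventually Pf F" "eventually Pg (nhds x0)" "!!s x. Pf s ==> Pg x ==> P s x"
  using assms unfolding eventually_prod_filter by auto
 have "\<forall>\<^sub>F x in nhds x0. \<forall>\<^sub>F y in nhds x. Pg y" using *(2) by (simp add: eventually_eventually)
 thus ?thesis unfolding eventually_prod_filter by (intro exI[of _ Pf] exI[of _ "%x. \<forall>\<^sub>F y in nhds x. Pg y"])
    (use * in \<open>auto elim: eventually_mono\<close>)
qed

lemma frechet_derivative_cong_nhds:
 assumes "\<forall>\<^sub>F y in nhds x. f y = g y"
 shows "frechet_derivative f (at x) = frechet_derivative g (at x)"
  and "f differentiable (at x) \<longleftrightarrow> g differentiable (at x)"
proof -
 have "(f has_derivative D) (at x) \<longleftrightarrow> (g has_derivative D) (at x)" for D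
 proof -
  have "f x = g x" using assms by (rule eventually_nhds_x_imp_x)
  moreover have "\<forall>\<^sub>F y in at x. f y = g y" using assms by (simp add: eventually_nhds_conv_at)
  ultimately show ?thesis by (metis (mono_tags, lifting) has_derivative_transform_eventually UNIV_I eventually_mono)
 qed
 thus "frechet_derivative f (at x) = frechet_derivative g (at x)"
  and "f differentiable (at x) \<longleftrightarrow> g differentiable (at x)" by (simp_all add: frechet_derivative_def differentiable_def)
qed

lemma C_family_reparam:
 assumes "filterlim sig F F0" and "C_family n F (sig s0) f x0"
 shows "C_family n F0 s0 (%s. f (sig s)) x0"
proof -
 have lim: "filterlim (%(s, x). (sig s, x)) (F \<times>\<^sub>F nhds x0) (F0 \<times>\<^sub>F nhds x0)"
  using filterlim_compose[OF assms(1) filterlim_fst] by (auto simp: case_prod_unfold intro!: filterlim_Pair filterlim_snd)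
 show ?thesis using assms(2)
 proof (induction n arbitrary: f)
  case 0
  thus ?case using filterlim_compose[OF _ lim] by (fastforce simp: case_prod_unfold)
 next
  case (Suc n)
  from Suc.prems have 1: "((%(s, x). f s x) \<longlongrightarrow> f (sig s0) x0) (F \<times>\<^sub>F nhds x0)"
   and 2: "\<forall>\<^sub>F (s, x) in F \<times>\<^sub>F nhds x0. f s differentiable (at x)"
   and 3: "!!v. v \<in> Basis ==> C_family n F (sig s0) (%s. dd v (f s)) x0" by auto
  from filterlim_compose[OF 1 lim] eventually_compose_filterlim[OF 2 lim] Suc.IH[OF 3]
  show ?case by (simp add: case_prod_unfold)
 qed
qed

lemma C_family_tendsto: "C_family n F s0 f x0 ==> ((%(s, x). f s x) \<longlongrightarrow> f s0 x0) (F \<times>\<^sub>F nhds x0)"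
 by (cases n) auto

lemma C_family_filterlim_Pair:
 assumes "C_family n F s0 f x0"
 shows "filterlim (%(s, x). (s, f s x)) (F \<times>\<^sub>F nhds (f s0 x0)) (F \<times>\<^sub>F nhds x0)"
 using C_family_tendsto[OF assms] filterlim_fst by (auto simp: case_prod_unfold intro!: filterlim_Pair)

lemma C_family_Suc_D: "C_family (Suc n) F s0 f x0 ==> C_family n F s0 f x0"
 by (induction n arbitrary: f) auto

lemma frechet_derivative_works_Basis:
 fixes f :: "'a::euclidean_space => 'b::real_normed_vector"
 assumes "f differentiable (at x)"
 shows "frechet_derivative f (at x) h = (\<Sum>b\<in>Basis. (h \<bullet> b) *\<^sub>R frechet_derivative f (at x) b)"
proof -
 have lin: "linear (frechet_derivative f (at x))" using assms by (rule linear_frechet_derivative)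
 have "frechet_derivative f (at x) h = frechet_derivative f (at x) (\<Sum>b\<in>Basis. (h \<bullet> b) *\<^sub>R b)"
  by (simp add: euclidean_representation)
 also have "\<dots> = (\<Sum>b\<in>Basis. (h \<bullet> b) *\<^sub>R frechet_derivative f (at x) b)" using lin by (simp add: linear_sum linear_cmul)
 finally show ?thesis .
qed

context
 fixes F :: "'s filter" and s0 :: 's
 assumes F: "principal {s0} <= F"
begin

lemma eventually_family_centre:
 assumes "\<forall>\<^sub>F (s, x) in F \<times>\<^sub>F nhds x0. P s x"
 shows "\<forall>\<^sub>F x in nhds x0. P s0 x"
proof -
 obtain Pf Pg where *: "eventually Pf F" "eventually Pg (nhds x0)" "!!s x. Pf s ==> Pg x ==> P s x"
  using assms unfolding eventually_prod_filter by auto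
 have "Pf s0" using F *(1) by (auto simp: le_filter_def eventually_principal)
 thus ?thesis using * by (auto elim: eventually_mono)
qed

lemma eventually_family_at:
 assumes "\<forall>\<^sub>F (s, x) in F \<times>\<^sub>F nhds x0. P s x"
 shows "P s0 x0" using eventually_family_centre[OF assms] by (rule eventually_nhds_x_imp_x)

lemma C_family_cong_imp:
 assumes "\<forall>\<^sub>F (s, x) in F \<times>\<^sub>F nhds x0. f s x = g s x" and "C_family n F s0 f x0"
 shows "C_family n F s0 g x0" using assms
proof (induction n arbitrary: f g)
 case 0
 have "f s0 x0 = g s0 x0" using eventually_family_at[OF 0(1)] .
 moreover have "((%(s, x). f s x) \<longlongrightarrow> f s0 x0) (F \<times>\<^sub>F nhds x0)" using 0 by simp
 hence "((%(s, x). g s x) \<longlongrightarrow> f s0 x0) (F \<times>\<^sub>F nhds x0)"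
  by (rule Lim_transform_eventually) (use 0(1) in \<open>auto simp: case_prod_unfold\<close>)
 ultimately show ?case by simp
next
 case (Suc n)
 have "f s0 x0 = g s0 x0" using eventually_family_at[OF Suc.prems(1)] .
 moreover have "((%(s, x). f s x) \<longlongrightarrow> f s0 x0) (F \<times>\<^sub>F nhds x0)" using Suc.prems by simp
 hence "((%(s, x). g s x) \<longlongrightarrow> f s0 x0) (F \<times>\<^sub>F nhds x0)"
  by (rule Lim_transform_eventually) (use Suc.prems(1) in \<open>auto simp: case_prod_unfold\<close>)
 moreover note ev = eventually_family_nhds[OF Suc.prems(1)]
 have "\<forall>\<^sub>F (s, x) in F \<times>\<^sub>F nhds x0. g s differentiable (at x)"
  using ev Suc.prems(2)[unfolded C_family.simps, THEN conjunct2, THEN conjunct1] by eventually_elim (auto dest: frechet_derivative_cong_nhds)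
 moreover have "C_family n F s0 (%s. dd v (g s)) x0" if "v \<in> Basis" for v
 proof (rule Suc.IH)
  show "\<forall>\<^sub>F (s, x) in F \<times>\<^sub>F nhds x0. dd v (f s) x = dd v (g s) x"
   using ev by eventually_elim (auto dest: frechet_derivative_cong_nhds)
  show "C_family n F s0 (%s. dd v (f s)) x0" using Suc.prems(2) that by simp
 qed
 ultimately show ?case by simp
qed

lemma C_family_SucI:
 assumes "((%(s, x). f s x) \<longlongrightarrow> f s0 x0) (F \<times>\<^sub>F nhds x0)"
  and "\<forall>\<^sub>F (s, x) in F \<times>\<^sub>F nhds x0. (f s has_derivative D s x) (at x)"
  and "!!v. v \<in> Basis ==> C_family n F s0 (%s x. D s x v) x0"
 shows "C_family (Suc n) F s0 f x0"
proof -
 have "\<forall>\<^sub>F (s, x) in F \<times>\<^sub>F nhds x0. D s x v = dd v (f s) x" for v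
  using assms(2) by eventually_elim (auto dest: frechet_derivative_at)
 moreover have "\<forall>\<^sub>F (s, x) in F \<times>\<^sub>F nhds x0. f s differentiable (at x)"
  using assms(2) by eventually_elim (auto simp: differentiable_def)
 ultimately show ?thesis using assms(1,3) by (auto intro: C_family_cong_imp[rotated])
qed

lemma C_family_const: "C_family n F s0 (%s x. c) x0"
proof (induction n arbitrary: c)
 case (Suc n)
 show ?case by (rule C_family_SucI[where D = "%_ _ _. 0"]) (auto simp: case_prod_unfold Suc)
qed (auto simp: case_prod_unfold)

lemma C_family_bounded_linear:
 assumes "bounded_linear L"
 shows "C_family n F s0 (%s x. L x) x0"
proof -
 have t: "((%(s, x). L x) \<longlongrightarrow> L x0) (F \<times>\<^sub>F nhds x0)"
  unfolding case_prod_unfold by (rule bounded_linear.tendsto[OF assms filterlim_snd])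
 show ?thesis
 proof (cases n)
  case (Suc m)
  show ?thesis unfolding Suc by (rule C_family_SucI[where D = "%_ _. L"])
     (use t in \<open>simp_all add: case_prod_unfold bounded_linear_imp_has_derivative assms C_family_const\<close>)
 qed (use t in simp)
qed

lemma C_family_linear_image:
 assumes L: "bounded_linear L" and "C_family n F s0 f x0"
 shows "C_family n F s0 (%s x. L (f s x)) x0" using assms(2)
proof (induction n arbitrary: f)
 case 0
 thus ?case using bounded_linear.tendsto[OF L] by (auto simp: case_prod_unfold)
next
 case (Suc n)
 show ?case
 proof (rule C_family_SucI[where D = "%s x v. L (dd v (f s) x)"])
  show "((%(s, x). L (f s x)) \<longlongrightarrow> L (f s0 x0)) (F \<times>\<^sub>F nhds x0)"
   using Suc.prems bounded_linear.tendsto[OF L] by (auto simp: case_prod_unfold)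
  show "\<forall>\<^sub>F (s, x) in F \<times>\<^sub>F nhds x0.
    ((%x. L (f s x)) has_derivative (%v. L (dd v (f s) x))) (at x)" using Suc.prems[simplified, THEN conjunct2, THEN conjunct1] by eventually_elim
     (auto simp: frechet_derivative_works intro: bounded_linear.has_derivative[OF L])
 qed (use Suc in auto)
qed

lemma C_family_bilinear:
 assumes B: "bounded_bilinear B" and "C_family n F s0 f x0" "C_family n F s0 g x0"
 shows "C_family n F s0 (%s x. B (f s x) (g s x)) x0" using assms(2,3)
proof (induction n arbitrary: f g)
 case 0
 thus ?case using bounded_bilinear.tendsto[OF B] by (auto simp: case_prod_unfold)
next
 case (Suc n)
 have add: "C_family m F s0 (%s x. u s x + w s x) x0"
  if "C_family m F s0 u x0" "C_family m F s0 w x0" for m and u w :: "'s => 'd => 'c" using that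
 proof (induction m arbitrary: u w)
  case 0
  thus ?case using tendsto_add by (fastforce simp: case_prod_unfold)
 next
  case (Suc m)
  show ?case
  proof (rule C_family_SucI[where D = "%s x v. dd v (u s) x + dd v (w s) x"])
   show "((%(s, x). u s x + w s x) \<longlongrightarrow> u s0 x0 + w s0 x0) (F \<times>\<^sub>F nhds x0)"
    using Suc.prems tendsto_add by (fastforce simp: case_prod_unfold)
   show "\<forall>\<^sub>F (s, x) in F \<times>\<^sub>F nhds x0.
     ((%x. u s x + w s x) has_derivative (%v. dd v (u s) x + dd v (w s) x)) (at x)"
    using Suc.prems(1)[simplified, THEN conjunct2, THEN conjunct1] Suc.prems(2)[simplified, THEN conjunct2, THEN conjunct1]
    by eventually_elim (auto simp: frechet_derivative_works intro: has_derivative_add)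
  qed (use Suc in auto)
 qed
 show ?case
 proof (rule C_family_SucI[where D = "%s x v. B (f s x) (dd v (g s) x) + B (dd v (f s) x) (g s x)"])
  show "((%(s, x). B (f s x) (g s x)) \<longlongrightarrow> B (f s0 x0) (g s0 x0)) (F \<times>\<^sub>F nhds x0)"
   using Suc.prems bounded_bilinear.tendsto[OF B] by (auto simp: case_prod_unfold)
  show "\<forall>\<^sub>F (s, x) in F \<times>\<^sub>F nhds x0. ((%x. B (f s x) (g s x)) has_derivative
    (%v. B (f s x) (dd v (g s) x) + B (dd v (f s) x) (g s x))) (at x)"
   using Suc.prems(1)[simplified, THEN conjunct2, THEN conjunct1] Suc.prems(2)[simplified, THEN conjunct2, THEN conjunct1]
   by eventually_elim (auto simp: frechet_derivative_works intro: bounded_bilinear.FDERIV[OF B])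
  fix v :: 'd assume v: "v \<in> Basis"
  show "C_family n F s0 (%s x. B (f s x) (dd v (g s) x) + B (dd v (f s) x) (g s x)) x0"
   using Suc.prems v by (intro add Suc.IH) (auto intro: C_family_Suc_D)
 qed
qed

lemma C_family_add:
 assumes "C_family n F s0 u x0" "C_family n F s0 w x0"
 shows "C_family n F s0 (%s x. u s x + w s x) x0" using assms
proof (induction n arbitrary: u w)
 case 0
 thus ?case using tendsto_add by (fastforce simp: case_prod_unfold)
next
 case (Suc m)
 show ?case
 proof (rule C_family_SucI[where D = "%s x v. dd v (u s) x + dd v (w s) x"])
  show "((%(s, x). u s x + w s x) \<longlongrightarrow> u s0 x0 + w s0 x0) (F \<times>\<^sub>F nhds x0)"
   using Suc.prems tendsto_add by (fastforce simp: case_prod_unfold)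
  show "\<forall>\<^sub>F (s, x) in F \<times>\<^sub>F nhds x0.
    ((%x. u s x + w s x) has_derivative (%v. dd v (u s) x + dd v (w s) x)) (at x)"
   using Suc.prems(1)[simplified, THEN conjunct2, THEN conjunct1] Suc.prems(2)[simplified, THEN conjunct2, THEN conjunct1]
   by eventually_elim (auto simp: frechet_derivative_works intro: has_derivative_add)
 qed (use Suc in auto)
qed

lemmas C_family_scaleR = C_family_bilinear[OF bounded_bilinear_scaleR]
lemmas C_family_mult = C_family_bilinear[OF bounded_bilinear_mult]

lemma C_family_minus:
 assumes "C_family n F s0 f x0" "C_family n F s0 g x0"
 shows "C_family n F s0 (%s x. f s x - g s x) x0"
 using C_family_add[OF assms(1) C_family_linear_image[OF bounded_linear_minus[OF bounded_linear_ident] assms(2)]] by simp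

lemma C_family_sum:
 assumes "!!i. i \<in> I ==> C_family n F s0 (f i) x0"
 shows "C_family n F s0 (%s x. \<Sum>i\<in>I. f i s x) x0"
 using assms by (induction I rule: infinite_finite_induct) (auto intro: C_family_const C_family_add)

lemma C_family_prod:
 fixes f :: "'i => 's => 'a::euclidean_space => real"
 assumes "!!i. i \<in> I ==> C_family n F s0 (f i) x0"
 shows "C_family n F s0 (%s x. \<Prod>i\<in>I. f i s x) x0"
 using assms by (induction I rule: infinite_finite_induct) (auto intro: C_family_const C_family_mult)

lemma C_family_compose:
 fixes f :: "'s => 'a::euclidean_space => 'b::euclidean_space"
  and g :: "'s => 'b => 'c::real_normed_vector"
 assumes "C_family n F s0 f x0" "C_family n F s0 g (f s0 x0)"
 shows "C_family n F s0 (%s x. g s (f s x)) x0" using assms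
proof (induction n arbitrary: g)
 case 0
 thus ?case using filterlim_compose[OF C_family_tendsto[OF 0(2)] C_family_filterlim_Pair[OF 0(1)]] by (simp add: case_prod_unfold)
next
 case (Suc n)
 let ?D = "%s x v. \<Sum>b\<in>Basis. (dd v (f s) x \<bullet> b) *\<^sub>R dd b (g s) (f s x)"
 show ?case
 proof (rule C_family_SucI[where D = ?D])
  show "((%(s, x). g s (f s x)) \<longlongrightarrow> g s0 (f s0 x0)) (F \<times>\<^sub>F nhds x0)"
   using filterlim_compose[OF C_family_tendsto[OF Suc.prems(2)] C_family_filterlim_Pair[OF Suc.prems(1)]] by (simp add: case_prod_unfold)
  have "\<forall>\<^sub>F (s, x) in F \<times>\<^sub>F nhds x0. g s differentiable (at (f s x))"
   using eventually_compose_filterlim[OF _ C_family_filterlim_Pair[OF Suc.prems(1)], of "%(s, x). g s differentiable (at x)"] Suc.prems(2)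
   by (simp add: case_prod_unfold)
  moreover have "\<forall>\<^sub>F (s, x) in F \<times>\<^sub>F nhds x0. f s differentiable (at x)" using Suc.prems(1) by simp
  ultimately show "\<forall>\<^sub>F (s, x) in F \<times>\<^sub>F nhds x0. ((%x. g s (f s x)) has_derivative ?D s x) (at x)"
  proof (eventually_elim, clarify)
   fix s x assume d: "g s differentiable at (f s x)" "f s differentiable at x"
   have "((%x. g s (f s x)) has_derivative (%v. frechet_derivative (g s) (at (f s x)) (dd v (f s) x))) (at x)"
    using d[unfolded frechet_derivative_works] diff_chain_at[unfolded o_def] by fastforce
   thus "((%x. g s (f s x)) has_derivative ?D s x) (at x)" by (subst (asm) frechet_derivative_works_Basis[OF d(1)])
  qed
  fix v :: 'a assume "v \<in> Basis"
  thus "C_family n F s0 (%s x. ?D s x v) x0" using Suc.prems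
   by (intro C_family_sum C_family_scaleR C_family_linear_image[OF bounded_linear_inner_left] Suc.IH)
     (auto intro: C_family_Suc_D)
 qed
qed

lemma C_family_inverse_real:
 fixes f :: "'s => 'a::euclidean_space => real"
 assumes "C_family n F s0 f x0" "f s0 x0 ~= 0"
 shows "C_family n F s0 (%s x. inverse (f s x)) x0" using assms(1)
proof (induction n)
 case 0
 thus ?case using assms(2) by (auto simp: case_prod_unfold intro!: tendsto_inverse)
next
 case (Suc n)
 have t: "((%(s, x). f s x) \<longlongrightarrow> f s0 x0) (F \<times>\<^sub>F nhds x0)" using Suc.prems by simp
 let ?D = "%s x v. - (inverse (f s x) * dd v (f s) x * inverse (f s x))"
 show ?case
 proof (rule C_family_SucI[where D = ?D])
  show "((%(s, x). inverse (f s x)) \<longlongrightarrow> inverse (f s0 x0)) (F \<times>\<^sub>F nhds x0)"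
   using t assms(2) by (auto simp: case_prod_unfold intro!: tendsto_inverse)
  have "\<forall>\<^sub>F (s, x) in F \<times>\<^sub>F nhds x0. f s x ~= 0"
   using tendsto_imp_eventually_ne[OF t assms(2)] by (simp add: case_prod_unfold)
  moreover have "\<forall>\<^sub>F (s, x) in F \<times>\<^sub>F nhds x0. f s differentiable (at x)" using Suc.prems(1) by simp
  ultimately show "\<forall>\<^sub>F (s, x) in F \<times>\<^sub>F nhds x0. ((%x. inverse (f s x)) has_derivative ?D s x) (at x)"
   by eventually_elim (auto simp: frechet_derivative_works intro: has_derivative_inverse)
  fix v :: 'a assume "v \<in> Basis"
  thus "C_family n F s0 (%s x. ?D s x v) x0" using Suc.prems Suc.IH[OF C_family_Suc_D[OF Suc.prems]]
   by (intro C_family_linear_image[OF bounded_linear_minus[OF bounded_linear_ident]] C_family_mult) auto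
 qed
qed

end

lemma iter_deriv_append: "iter_deriv (us @ vs) f = iter_deriv us (iter_deriv vs f)"
 by (induction us) auto

text \<open>The recursion splits off the derivative taken first, the head of a list is the one taken last; the proof
 reconciles the two orders.\<close>

lemma C_family_iff_iter_deriv:
 fixes f :: "'s => 'a::euclidean_space => 'b::real_normed_vector"
 shows "C_family n F s0 f x0 \<longleftrightarrow> (\<forall>vs. set vs \<subseteq> Basis & length vs <= n -->
   ((%(s, x). iter_deriv vs (f s) x) \<longlongrightarrow> iter_deriv vs (f s0) x0) (F \<times>\<^sub>F nhds x0) &
   (length vs < n --> (\<forall>\<^sub>F (s, x) in F \<times>\<^sub>F nhds x0. iter_deriv vs (f s) differentiable (at x))))"
proof (induction n arbitrary: f)
 case (Suc n)
 let ?P = "%n (f :: 's => 'a => 'b) (vs :: 'a list). ((%(s, x). iter_deriv vs (f s) x) \<longlongrightarrow> iter_deriv vs (f s0) x0) (F \<times>\<^sub>F nhds x0) &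
   (length vs < n --> (\<forall>\<^sub>F (s, x) in F \<times>\<^sub>F nhds x0. iter_deriv vs (f s) differentiable (at x)))"
 have *: "?P (Suc n) f (vs @ [v]) \<longleftrightarrow> ?P n (%s. dd v (f s)) vs" for vs v by (simp add: iter_deriv_append)
 have "(\<forall>vs. set vs \<subseteq> Basis & length vs <= Suc n --> ?P (Suc n) f vs) \<longleftrightarrow>
  ?P (Suc n) f [] & (\<forall>v\<in>Basis. \<forall>vs. set vs \<subseteq> Basis & length vs <= n --> ?P n (%s. dd v (f s)) vs)"
  (is "?L \<longleftrightarrow> ?R")
 proof
  assume L: ?L
  have "\<forall>v\<in>Basis. \<forall>vs. set vs \<subseteq> Basis & length vs <= n --> ?P n (%s. dd v (f s)) vs"
  proof (rule ballI, rule allI, rule impI)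
   fix v :: 'a and vs :: "'a list" assume "v \<in> Basis" "set vs \<subseteq> Basis & length vs <= n"
   hence "?P (Suc n) f (vs @ [v])" using L[rule_format, of "vs @ [v]"] by simp
   thus "?P n (%s. dd v (f s)) vs" using * by blast
  qed
  moreover have "?P (Suc n) f []" using L by (metis empty_subsetI le0 list.set(1) list.size(3))
  ultimately show ?R by blast
 next
  assume R: ?R
  show ?L
  proof (rule allI, rule impI)
   fix vs :: "'a list" assume vs: "set vs \<subseteq> Basis & length vs <= Suc n"
   show "?P (Suc n) f vs"
   proof (cases vs rule: rev_cases)
    case (snoc ws v)
    hence "?P n (%s. dd v (f s)) ws" using R vs by auto
    thus ?thesis using * snoc by blast
   qed (use R in auto)
  qed
 qed
 thus ?case using Suc by simp
qed (auto simp: )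

abbreviation C_germ :: "nat => ('a::euclidean_space => 'b::real_normed_vector) => 'a => bool" where
 "C_germ n f x \<equiv> C_family n (principal {()}) () (%_. f) x"

lemma C_germ_family:
 assumes "C_germ n f x0" shows "C_family n F s0 (%_. f) x0" using C_family_reparam[of "%_. ()" "principal {()}" F n s0 "%_. f" x0] assms
 by (simp add: filterlim_principal)

lemma eventually_unit_times: "(\<forall>\<^sub>F (s, x) in principal {()} \<times>\<^sub>F G. P x) \<longleftrightarrow> eventually P G"
 unfolding eventually_prod_filter by (auto simp: eventually_principal elim: eventually_mono)

lemma tendsto_unit_times: "((%(s, x). f x) \<longlongrightarrow> l) (principal {()} \<times>\<^sub>F G) \<longleftrightarrow> (f \<longlongrightarrow> l) G"
 unfolding tendsto_def eventually_prod_filter by (auto simp: eventually_principal elim!: eventually_mono)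

text \<open>Being a condition on germs, the class is insensitive to changes away from the point.\<close>

lemma C_on_iff_germ:
 assumes "open U"
 shows "C_on r U f \<longleftrightarrow> (\<forall>x\<in>U. \<forall>n. enat n <= r --> C_germ n f x)"
proof
 assume C: "C_on r U f"
 show "\<forall>x\<in>U. \<forall>n. enat n <= r --> C_germ n f x"
 proof (intro ballI allI impI)
  fix x n assume x: "x \<in> U" and n: "enat n <= r"
  show "C_germ n f x" unfolding C_family_iff_iter_deriv
  proof (intro allI impI conjI)
   fix vs :: "'a list" assume vs: "set vs \<subseteq> Basis & length vs <= n"
   hence le: "enat (length vs) <= r" using n by (meson enat_ord_simps(1) order_trans)
   hence "continuous_on U (iter_deriv vs f)" using C vs by (auto simp: C_on_def)
   thus "((%(s, x). iter_deriv vs f x) \<longlongrightarrow> iter_deriv vs f x) (principal {()} \<times>\<^sub>F nhds x)"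
    using x assms unfolding tendsto_unit_times by (auto simp: continuous_on_eq_continuous_at isCont_def tendsto_at_iff_tendsto_nhds)
   assume "length vs < n"
   hence "enat (length vs) < r" using n by (meson enat_ord_simps(2) order_less_le_trans)
   hence "\<forall>x\<in>U. iter_deriv vs f differentiable at x" using C vs le by (auto simp: C_on_def)
   thus "\<forall>\<^sub>F (s, x) in principal {()} \<times>\<^sub>F nhds x. iter_deriv vs f differentiable at x"
    unfolding eventually_unit_times using x assms by (auto simp: eventually_nhds)
  qed
 qed
next
 assume G: "\<forall>x\<in>U. \<forall>n. enat n <= r --> C_germ n f x"
 show "C_on r U f" unfolding C_on_def
 proof (intro allI impI conjI)
  fix vs :: "'a list" assume vs: "set vs \<subseteq> Basis & enat (length vs) <= r"
  have "((%x. iter_deriv vs f x) \<longlongrightarrow> iter_deriv vs f x) (nhds x)" if "x \<in> U" for x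
   using G[rule_format, OF that, of "length vs"] vs unfolding C_family_iff_iter_deriv tendsto_unit_times by auto
  thus "continuous_on U (iter_deriv vs f)" using assms by (auto simp: continuous_on_eq_continuous_at isCont_def tendsto_at_iff_tendsto_nhds)
  assume "enat (length vs) < r"
  hence "enat (Suc (length vs)) <= r" by (simp add: Suc_ile_eq)
  hence "\<forall>\<^sub>F x in nhds x. iter_deriv vs f differentiable at x" if "x \<in> U" for x
   using G[rule_format, OF that, of "Suc (length vs)"] vs unfolding C_family_iff_iter_deriv eventually_unit_times by auto
  thus "\<forall>x\<in>U. iter_deriv vs f differentiable at x" by (auto dest: eventually_nhds_x_imp_x)
 qed
qed

section \<open>Determinants on Euclidean spaces and inverse maps\<close>

text \<open>An index type for the basis. Determinants and the change of variables formula concern vectors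
 indexed by a finite well-ordered type.\<close>

typedef (overloaded) ('e::euclidean_space) coord = "{..<DIM('e)}" using DIM_positive by blast

instantiation coord :: (euclidean_space) wellorder
begin
definition "i <= j \<longleftrightarrow> Rep_coord i <= Rep_coord j"
definition "i < j \<longleftrightarrow> Rep_coord i < Rep_coord j"
instance
proof
 fix P :: "'a coord => bool" and a
 assume *: "!!x. (!!y. y < x ==> P y) ==> P x"
 show "P a" by (induction "Rep_coord a" arbitrary: a rule: less_induct) (use * in \<open>auto simp: less_coord_def\<close>)
qed (auto simp: less_eq_coord_def less_coord_def Rep_coord_inject)
end

instance coord :: (euclidean_space) finite
proof
 show "finite (UNIV :: 'a coord set)" by (metis finite_imageI finite_lessThan type_definition.Abs_image type_definition_coord)
qed

definition basis_vec :: "'e::euclidean_space coord => 'e" where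
 "basis_vec i = (SOME f. bij_betw f {..<DIM('e)} Basis) (Rep_coord i)"

lemma bij_betw_basis_vec: "bij_betw (basis_vec :: 'e::euclidean_space coord => 'e) UNIV Basis"
proof -
 have "\<exists>f. bij_betw f {..<DIM('e)} (Basis :: 'e set)" using ex_bij_betw_nat_finite[of "Basis :: 'e set"] by (simp add: atLeast0LessThan)
 hence "bij_betw (SOME f. bij_betw f {..<DIM('e)} (Basis :: 'e set)) {..<DIM('e)} Basis" by (rule someI_ex)
 moreover have "bij_betw Rep_coord (UNIV :: 'e coord set) {..<DIM('e)}"
  using type_definition_coord by (metis bij_betw_def inj_onI Rep_coord_inject type_definition.Rep_range)
 ultimately show ?thesis using bij_betw_trans unfolding basis_vec_def[abs_def] by (fastforce simp: o_def)
qed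

lemma basis_vec_in [simp]: "basis_vec i \<in> Basis"
 using bij_betw_basis_vec by (auto simp: bij_betw_def)

lemma basis_vec_inner: "basis_vec i \<bullet> basis_vec j = (if i = j then 1 else 0)"
 using bij_betw_basis_vec[THEN bij_betw_imp_inj_on] by (auto simp: inner_Basis dest: injD)

lemma sum_Basis_coord: "(\<Sum>b\<in>Basis. f b) = (\<Sum>i\<in>UNIV. f (basis_vec i))"
 using sum.reindex_bij_betw[OF bij_betw_basis_vec, of f] by simp

lemma prod_Basis_coord: "(\<Prod>b\<in>Basis. f b) = (\<Prod>i\<in>UNIV. f (basis_vec i))"
 using prod.reindex_bij_betw[OF bij_betw_basis_vec, of f] by simp

definition to_vec :: "'e::euclidean_space => real^'e coord" where
 "to_vec x = (\<chi> i. x \<bullet> basis_vec i)"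

definition of_vec :: "real^'e coord => 'e::euclidean_space" where
 "of_vec v = (\<Sum>i\<in>UNIV. (v $ i) *\<^sub>R basis_vec i)"

lemma of_vec_to_vec [simp]: "of_vec (to_vec x) = x"
 using euclidean_representation[of x] by (simp add: of_vec_def to_vec_def sum_Basis_coord)

lemma to_vec_of_vec [simp]: "to_vec (of_vec v) = v"
 by (simp add: of_vec_def to_vec_def vec_eq_iff inner_sum_left basis_vec_inner if_distrib[of "%c. _ * c"] cong: if_cong)

lemma linear_to_vec: "linear to_vec"
 by (rule linearI) (auto simp: to_vec_def vec_eq_iff inner_add_left)

lemma linear_of_vec: "linear of_vec"
 by (rule linearI) (auto simp: of_vec_def scaleR_add_left sum.distrib scaleR_sum_right)

definition matrix_of :: "('e::euclidean_space => 'e) => real^'e coord^'e coord" where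
 "matrix_of L = (\<chi> i j. L (basis_vec j) \<bullet> basis_vec i)"

lemma matrix_of_eq: "matrix_of L = matrix (to_vec \<circ> L \<circ> of_vec)"
proof -
 have "of_vec (axis j 1) = basis_vec j" for j :: "'a coord" by (simp add: of_vec_def axis_def if_distrib[of "%c. c *\<^sub>R _"] cong: if_cong)
 thus ?thesis by (simp add: matrix_of_def matrix_def to_vec_def)
qed

lemma linear_to_vec_conj: "linear L ==> linear (to_vec \<circ> L \<circ> of_vec)"
 by (intro linear_compose linear_to_vec linear_of_vec)

lemma matrix_of_mult: "linear L ==> matrix_of L *v to_vec x = to_vec (L x)"
 unfolding matrix_of_eq using matrix_works[OF linear_matrix_vector_mul_eq[THEN iffD2, OF linear_to_vec_conj], of L "to_vec x"] by simp

lemma matrix_of_compose: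
 assumes "linear L" "linear M" shows "matrix_of (L \<circ> M) = matrix_of L ** matrix_of M"
 using matrix_compose[OF linear_to_vec_conj[OF assms(2)] linear_to_vec_conj[OF assms(1)]] by (simp add: matrix_of_eq o_def)

lemma matrix_of_id: "matrix_of (%x. x) = mat 1"
 by (auto simp: matrix_of_def mat_def vec_eq_iff basis_vec_inner)

abbreviation jdet :: "('e::euclidean_space => 'e) => real" where
 "jdet L \<equiv> det (matrix_of L)"

lemma jdet_compose: "linear L ==> linear M ==> jdet (L \<circ> M) = jdet L * jdet M"
 by (simp add: matrix_of_compose det_mul)

lemma jdet_id: "jdet (%x. x) = 1"
 by (simp add: matrix_of_id)

lemma jdet_nonzero_iff_inj:
 assumes "linear L" shows "jdet L ~= 0 \<longleftrightarrow> inj L"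
proof -
 have "jdet L ~= 0 \<longleftrightarrow> inj (to_vec \<circ> L \<circ> of_vec)"
  unfolding matrix_of_eq by (rule det_nz_iff_inj[OF linear_to_vec_conj[OF assms]])
 also have "\<dots> \<longleftrightarrow> inj L" unfolding inj_def o_def by (metis of_vec_to_vec to_vec_of_vec)
 finally show ?thesis .
qed

lemma C_family_det:
 fixes A :: "'i::finite => 'i => 's => 'a::euclidean_space => real"
 assumes F: "principal {s0} <= F" and "!!i j. C_family n F s0 (A i j) x0"
 shows "C_family n F s0 (%s x. det (\<chi> i j. A i j s x)) x0" unfolding det_def
 by (intro C_family_sum[OF F] C_family_mult[OF F] C_family_const[OF F] C_family_prod[OF F]) (simp add: assms)

text \<open>One order at a time: by Cramer's rule the derivative of \<open>h\<close> is a rational expression in the derivatives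
 of \<open>f\<close> composed with \<open>h\<close>, and is as regular as \<open>h\<close> is already known to be.\<close>

lemma C_family_inverse:
 fixes f h :: "'s => 'a::euclidean_space => 'a"
 assumes F: "principal {s0} <= F"
  and "C_family n F s0 f x0"
  and h0: "C_family 0 F s0 h y0" "h s0 y0 = x0"
  and inv: "\<forall>\<^sub>F (s, y) in F \<times>\<^sub>F nhds y0. f s (h s y) = y"
  and cont: "\<forall>\<^sub>F (s, y) in F \<times>\<^sub>F nhds y0. isCont (h s) y"
  and det: "jdet (frechet_derivative (f s0) (at x0)) ~= 0"
 shows "C_family n F s0 h y0" using assms(2)
proof (induction n)
 case (Suc n)
 have IH: "C_family n F s0 h y0" by (rule Suc.IH[OF C_family_Suc_D[OF Suc.prems]])
 define D where "D = (%s y. frechet_derivative (f s) (at (h s y)))"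
 have entries: "C_family n F s0 (%s y. D s y v \<bullet> b) y0" if "v \<in> Basis" for v b unfolding D_def
  by (intro C_family_linear_image[OF F bounded_linear_inner_left] C_family_compose[OF F IH, of "%s. dd v (f s)"])
    (use Suc.prems h0 that in auto)
 define num where "num = (%s y v k. det (\<chi> i j. if j = k then v \<bullet> basis_vec i else D s y (basis_vec j) \<bullet> basis_vec i))"
 define den where "den = (%s y. jdet (D s y))"
 have den: "C_family n F s0 den y0" unfolding den_def matrix_of_def by (rule C_family_det[OF F entries]) simp
 have num: "C_family n F s0 (%s y. num s y v k) y0" for v k unfolding num_def
 proof (rule C_family_det[OF F])
  show "C_family n F s0 (%s y. if j = k then v \<bullet> basis_vec i else D s y (basis_vec j) \<bullet> basis_vec i) y0" for i j
   by (cases "j = k") (simp_all add: entries C_family_const[OF F])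
 qed
 have den0: "den s0 y0 ~= 0" using det h0 by (simp add: den_def D_def)
 hence ev_den: "\<forall>\<^sub>F (s, y) in F \<times>\<^sub>F nhds y0. den s y ~= 0"
  using tendsto_imp_eventually_ne[OF C_family_tendsto[OF den]] by (simp add: case_prod_unfold)
 define E where "E = (%s y v. \<Sum>k\<in>UNIV. (num s y v k * inverse (den s y)) *\<^sub>R basis_vec k)"
 have ev_diff: "\<forall>\<^sub>F (s, y) in F \<times>\<^sub>F nhds y0. f s differentiable (at (h s y))"
  using eventually_compose_filterlim[OF _ C_family_filterlim_Pair[OF h0(1)], of "%(s, x). f s differentiable (at x)"]
   Suc.prems h0(2) by (simp add: case_prod_unfold)
 show ?case
 proof (rule C_family_SucI[OF F, where D = E])
  show "((%(s, y). h s y) \<longlongrightarrow> h s0 y0) (F \<times>\<^sub>F nhds y0)" using h0 by simp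
  show "\<forall>\<^sub>F (s, y) in F \<times>\<^sub>F nhds y0. (h s has_derivative E s y) (at y)"
   using ev_den ev_diff cont eventually_family_nhds[OF inv]
  proof (eventually_elim, clarify)
   fix s y
   assume d: "den s y ~= 0" and diff: "f s differentiable at (h s y)" and c: "isCont (h s) y"
    and "\<forall>\<^sub>F z in nhds y. f s (h s z) = z"
   then obtain T where T: "open T" "y \<in> T" "!!z. z \<in> T ==> f s (h s z) = z" by (auto simp: eventually_nhds)
   have der: "(f s has_derivative D s y) (at (h s y))" using diff by (simp add: D_def frechet_derivative_works)
   hence lin: "linear (D s y)" by (rule has_derivative_linear)
   have "inj (D s y)" using d jdet_nonzero_iff_inj[OF lin] by (simp add: den_def)
   then obtain g where g: "linear g" "g \<circ> D s y = id" using lin linear_injective_left_inverse by blast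
   hence gr: "D s y \<circ> g = id" using lin linear_inverse_left by blast
   have "(h s has_derivative g) (at y)"
    by (rule has_derivative_inverse_basic[OF der _ g(2) _ T]) (use c g in \<open>auto simp: linear_conv_bounded_linear\<close>)
   moreover have "g v = E s y v" for v
   proof -
    have "matrix_of (D s y) *v to_vec (g v) = to_vec v" using matrix_of_mult[OF lin] gr by (metis comp_apply id_apply)
    moreover have "num s y v k = det (\<chi> i j. if j = k then to_vec v $ i else matrix_of (D s y) $ i $ j)" for k
     by (simp add: num_def to_vec_def matrix_of_def cong: if_cong)
    ultimately have "to_vec (g v) = (\<chi> k. num s y v k / den s y)" using cramer[of "matrix_of (D s y)"] d unfolding den_def by simp
    hence "of_vec (to_vec (g v)) = of_vec (\<chi> k. num s y v k / den s y)" by simp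
    thus ?thesis unfolding of_vec_to_vec by (simp add: of_vec_def E_def divide_inverse)
   qed
   ultimately show "(h s has_derivative E s y) (at y)" by (metis ext)
  qed
  show "C_family n F s0 (%s y. E s y v) y0" for v unfolding E_def
   by (intro C_family_sum[OF F] C_family_scaleR[OF F] C_family_mult[OF F] num C_family_const[OF F]
     C_family_inverse_real[OF F den den0])
 qed
qed (use h0 in simp)

section \<open>A smooth function that vanishes on a half line\<close>

text \<open>The powers of \<open>1/x\<close> make the family closed under differentiation.\<close>

definition flat_exp :: "nat => real => real" where
 "flat_exp k x = (if x > 0 then exp (- inverse x) * inverse x ^ k else 0)"

lemma flat_exp_tendsto_0: "(flat_exp k \<longlongrightarrow> 0) (at 0)"
proof -
 have "((%x. inverse x ^ k / exp (inverse x)) \<longlongrightarrow> (0::real)) (at_right 0)"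
  using filterlim_compose[OF tendsto_power_div_exp_0 filterlim_inverse_at_top_right] .
 hence "(flat_exp k \<longlongrightarrow> 0) (at_right 0)" by (rule Lim_transform_eventually)
    (auto simp: flat_exp_def exp_minus field_simps eventually_at_filter)
 moreover have "(flat_exp k \<longlongrightarrow> 0) (at_left 0)"
  by (rule Lim_transform_eventually[OF tendsto_const]) (auto simp: flat_exp_def eventually_at_filter)
 ultimately show ?thesis by (simp add: filterlim_split_at)
qed

lemma flat_exp_has_derivative:
 "(flat_exp k has_real_derivative flat_exp (k + 2) x - real k * flat_exp (k + 1) x) (at x)"
proof (cases "x = 0")
 case True
 have "((%h. flat_exp k h / h) \<longlongrightarrow> 0) (at 0)" by (rule Lim_transform_eventually[OF flat_exp_tendsto_0[of "Suc k"]])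
    (auto simp: flat_exp_def eventually_at_filter field_simps)
 thus ?thesis using True by (simp add: DERIV_def flat_exp_def)
next
 case False
 show ?thesis
 proof (cases "x > 0")
  case True
  have "((%x. exp (- inverse x) * inverse x ^ k) has_real_derivative
    flat_exp (k + 2) x - real k * flat_exp (k + 1) x) (at x)" using True
   by (auto intro!: derivative_eq_intros simp: flat_exp_def power2_eq_square power_add)
     (cases k; simp add: field_simps)
  thus ?thesis by (rule has_field_derivative_transform_within_open[of _ _ _ "{0<..}"])
     (use True in \<open>auto simp: flat_exp_def\<close>)
 next
  case F: False
  have "((%x. 0) has_real_derivative flat_exp (k + 2) x - real k * flat_exp (k + 1) x) (at x)" using F by (simp add: flat_exp_def)
  thus ?thesis by (rule has_field_derivative_transform_within_open[of _ _ _ "{..<0}"])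
     (use F False in \<open>auto simp: flat_exp_def\<close>)
 qed
qed

text \<open>Induction on the order for all \<open>k\<close> at once, as the derivative combines two other members of the family.\<close>

lemma C_germ_flat_exp: "C_germ n (flat_exp k) x"
proof (induction n arbitrary: k)
 case 0
 have "isCont (flat_exp k) x" using flat_exp_has_derivative by (rule DERIV_isCont)
 thus ?case by (simp add: tendsto_unit_times isCont_def tendsto_at_iff_tendsto_nhds)
next
 case (Suc n)
 have F: "principal {()} <= principal {()}" by simp
 show ?case
 proof (rule C_family_SucI[OF F, where D = "%_ x v. (flat_exp (k + 2) x - real k * flat_exp (k + 1) x) * v"])
  show "((%(s, x). flat_exp k x) \<longlongrightarrow> flat_exp k x) (principal {()} \<times>\<^sub>F nhds x)"
   using DERIV_isCont[OF flat_exp_has_derivative] by (simp add: tendsto_unit_times isCont_def tendsto_at_iff_tendsto_nhds)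
  show "\<forall>\<^sub>F (s, x) in principal {()} \<times>\<^sub>F nhds x.
    (flat_exp k has_derivative (*) (flat_exp (k + 2) x - real k * flat_exp (k + 1) x)) (at x)"
   using flat_exp_has_derivative[of k] by (simp add: has_field_derivative_def case_prod_unfold)
  show "C_germ n (%x. (flat_exp (k + 2) x - real k * flat_exp (k + 1) x) * v) x" for v
   by (intro C_family_mult[OF F] C_family_minus[OF F] C_family_const[OF F] Suc)
 qed
qed

lemma flat_exp_bounds: "0 <= flat_exp 0 x" "flat_exp 0 x < 1" "flat_exp 0 x > 0 \<longleftrightarrow> x > 0"
 by (auto simp: flat_exp_def)

lemma flat_exp_mono: "x <= y ==> flat_exp 0 x <= flat_exp 0 y"
 by (auto simp: flat_exp_def le_imp_inverse_le)

section \<open>Limits of maps with uniformly convergent derivatives\<close>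

text \<open>Uniform convergence of the derivatives permits differentiating the limit; the limits \<open>G vs\<close> are
 therefore derivatives of \<open>G []\<close>.\<close>

lemma C_on_uniform_limit:
 fixes f :: "nat => 'a::euclidean_space => 'b::banach"
 assumes U: "open U"
  and f: "!!m. C_on r U (f m)"
  and lim: "!!vs. set vs \<subseteq> Basis ==> enat (length vs) <= r ==>
    uniform_limit U (%m. iter_deriv vs (f m)) (G vs) sequentially"
 shows "C_on r U (G [])"
  and "!!vs x. set vs \<subseteq> Basis ==> enat (length vs) <= r ==> x \<in> U ==> iter_deriv vs (G []) x = G vs x"
proof -
 have cont: "continuous_on U (G vs)" if "set vs \<subseteq> Basis" "enat (length vs) <= r" for vs
  using lim[OF that] by (rule uniform_limit_theorem[rotated]) (use f that in \<open>auto simp: C_on_def\<close>)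
 have der: "(G vs has_derivative (%h. \<Sum>b\<in>Basis. (h \<bullet> b) *\<^sub>R G (b # vs) x)) (at x)"
  if vs: "set vs \<subseteq> Basis" "enat (length vs) < r" and x: "x \<in> U" for vs x
 proof -
  obtain e where e: "e > 0" "ball x e \<subseteq> U" using U x by (meson open_contains_ball)
  let ?f' = "%m x h. \<Sum>b\<in>Basis. (h \<bullet> b) *\<^sub>R iter_deriv (b # vs) (f m) x"
  let ?g' = "%x h. \<Sum>b\<in>Basis. (h \<bullet> b) *\<^sub>R G (b # vs) x"
  have vs': "set (b # vs) \<subseteq> Basis" "enat (length (b # vs)) <= r" if "b \<in> Basis" for b using vs that by (auto simp: Suc_ile_eq)
  have "\<exists>g. \<forall>y\<in>ball x e. (%m. iter_deriv vs (f m) y) \<longlonglongrightarrow> g y & (g has_derivative ?g' y) (at y within ball x e)"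
  proof (rule has_derivative_sequence)
   show "(iter_deriv vs (f m) has_derivative ?f' m y) (at y within ball x e)" if "y \<in> ball x e" for m y
   proof -
    have d: "iter_deriv vs (f m) differentiable (at y)" using f[of m] vs e that unfolding C_on_def by (metis order_less_imp_le subsetD)
    have "?f' m y h = frechet_derivative (iter_deriv vs (f m)) (at y) h" for h by (subst frechet_derivative_works_Basis[OF d, of h]) simp
    hence "?f' m y = frechet_derivative (iter_deriv vs (f m)) (at y)" by (rule ext)
    thus ?thesis using d[unfolded frechet_derivative_works] by (simp add: has_derivative_at_withinI)
   qed
   show "\<forall>\<^sub>F m in sequentially. \<forall>y\<in>ball x e. \<forall>h. norm (?f' m y h - ?g' y h) <= c * norm h" if "c > 0" for c
   proof -
    let ?c = "c / DIM('a)"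
    have c': "?c > 0" using that by simp
    have "\<forall>\<^sub>F m in sequentially. \<forall>b\<in>Basis. \<forall>y\<in>U. dist (iter_deriv (b # vs) (f m) y) (G (b # vs) y) < ?c"
     using lim[OF vs'] c' by (auto simp: uniform_limit_iff eventually_ball_finite_distrib)
    thus ?thesis
    proof (eventually_elim, intro ballI allI)
     fix m y h assume *: "\<forall>b\<in>Basis. \<forall>y\<in>U. dist (iter_deriv (b # vs) (f m) y) (G (b # vs) y) < ?c"
      and y: "y \<in> ball x e"
     have "norm (?f' m y h - ?g' y h) = norm (\<Sum>b\<in>Basis. (h \<bullet> b) *\<^sub>R (iter_deriv (b # vs) (f m) y - G (b # vs) y))"
      by (simp only: sum_subtractf scaleR_diff_right)
     also have "\<dots> <= (\<Sum>b\<in>(Basis::'a set). norm h * ?c)"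
     proof (rule sum_norm_le)
      fix b :: 'a assume b: "b \<in> Basis"
      have "norm (iter_deriv (b # vs) (f m) y - G (b # vs) y) <= ?c" using * b y e by (force simp: dist_norm)
      moreover have "\<bar>h \<bullet> b\<bar> <= norm h" using b by (rule Basis_le_norm)
      ultimately show "norm ((h \<bullet> b) *\<^sub>R (iter_deriv (b # vs) (f m) y - G (b # vs) y)) <= norm h * ?c"
      unfolding norm_scaleR by (intro mult_mono) auto
     qed
     also have "\<dots> = c * norm h" by simp
     finally show "norm (?f' m y h - ?g' y h) <= c * norm h" .
    qed
   qed
   show "x \<in> ball x e" using e by simp
   show "(%m. iter_deriv vs (f m) x) \<longlonglongrightarrow> G vs x" by (rule tendsto_uniform_limitI[OF lim x]) (use vs in auto)
  qed (rule convex_ball)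
  then obtain g where g: "!!y. y \<in> ball x e ==> (%m. iter_deriv vs (f m) y) \<longlonglongrightarrow> g y"
   "!!y. y \<in> ball x e ==> (g has_derivative ?g' y) (at y within ball x e)" by blast
  have "g y = G vs y" if "y \<in> ball x e" for y
  proof -
   have "(%m. iter_deriv vs (f m) y) \<longlonglongrightarrow> G vs y" by (rule tendsto_uniform_limitI[OF lim]) (use vs e that in auto)
   thus ?thesis using g(1)[OF that] LIMSEQ_unique by blast
  qed
  moreover have "(g has_derivative ?g' x) (at x)" using g(2)[of x] e by (simp add: at_within_open[of x "ball x e"])
  ultimately show ?thesis by (metis (no_types, lifting) has_derivative_transform_within_open centre_in_ball e(1) open_ball)
 qed
 show eq: "iter_deriv vs (G []) x = G vs x" if "set vs \<subseteq> Basis" "enat (length vs) <= r" "x \<in> U" for vs x using that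
 proof (induction vs arbitrary: x)
  case (Cons v vs)
  have lt: "enat (length vs) < r" using Cons.prems by (simp add: Suc_ile_eq)
  have "\<forall>\<^sub>F y in nhds x. iter_deriv vs (G []) y = G vs y" using Cons.IH Cons.prems lt U by (auto simp: eventually_nhds)
  hence "frechet_derivative (iter_deriv vs (G [])) (at x) = frechet_derivative (G vs) (at x)" by (rule frechet_derivative_cong_nhds)
  also have "\<dots> = (%h. \<Sum>b\<in>Basis. (h \<bullet> b) *\<^sub>R G (b # vs) x)"
   using frechet_derivative_at[OF der[OF _ lt]] Cons.prems by auto
  finally show ?case using Cons.prems by (simp add: inner_Basis if_distrib[of "%c. c *\<^sub>R _"] cong: if_cong)
 qed simp
 show "C_on r U (G [])" unfolding C_on_def
 proof (intro allI impI conjI ballI)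
  fix vs :: "'a list" assume vs: "set vs \<subseteq> Basis & enat (length vs) <= r"
  thus "continuous_on U (iter_deriv vs (G []))" using cont[of vs] eq[of vs] by (simp cong: continuous_on_cong)
  fix x assume lt: "enat (length vs) < r" and x: "x \<in> U"
  have "\<forall>\<^sub>F y in nhds x. iter_deriv vs (G []) y = G vs y" using eq vs x U by (auto simp: eventually_nhds)
  thus "iter_deriv vs (G []) differentiable (at x)" using frechet_derivative_cong_nhds(2) der[OF _ lt x] vs differentiableI by blast
 qed
qed

section \<open>Charts and neighbourhood filters\<close>

lemma continuous_map_iff_nhdsin:
 "continuous_map S T h \<longleftrightarrow>
   (\<forall>s\<in>topspace S. h s \<in> topspace T & filterlim h (nhdsin T (h s)) (nhdsin S s))"
proof
 assume h: "continuous_map S T h"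
 show "\<forall>s\<in>topspace S. h s \<in> topspace T & filterlim h (nhdsin T (h s)) (nhdsin S s)"
 proof (intro ballI conjI)
  fix s assume s: "s \<in> topspace S"
  show hs: "h s \<in> topspace T" using h s by (auto simp: continuous_map_def)
  show "filterlim h (nhdsin T (h s)) (nhdsin S s)" unfolding filterlim_iff
  proof (intro allI impI)
   fix P assume "eventually P (nhdsin T (h s))"
   then obtain V where V: "openin T V" "h s \<in> V" "\<forall>x\<in>V. P x" using hs by (auto simp: eventually_nhdsin)
   hence "openin S {x \<in> topspace S. h x \<in> V}" using h by (auto simp: continuous_map_def)
   thus "\<forall>\<^sub>F x in nhdsin S s. P (h x)" using V s by (auto simp: eventually_nhdsin)
  qed
 qed
next
 assume R: "\<forall>s\<in>topspace S. h s \<in> topspace T & filterlim h (nhdsin T (h s)) (nhdsin S s)"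
 show "continuous_map S T h" unfolding continuous_map_def
 proof (intro conjI allI impI)
  fix V assume V: "openin T V"
  show "openin S {x \<in> topspace S. h x \<in> V}"
  proof (subst openin_subopen, clarify)
   fix s assume s: "s \<in> topspace S" "h s \<in> V"
   hence "eventually (%y. y \<in> V) (nhdsin T (h s))" using V by (auto simp: eventually_nhdsin)
   hence "\<forall>\<^sub>F x in nhdsin S s. h x \<in> V" using R s by (auto simp: filterlim_iff)
   then obtain W where "openin S W" "s \<in> W" "\<forall>x\<in>W. h x \<in> V" using s by (auto simp: eventually_nhdsin)
   thus "\<exists>T. openin S T & s \<in> T & T \<subseteq> {x \<in> topspace S. h x \<in> V}" using openin_subset by (intro exI[of _ W]) auto
  qed
 qed (use R in auto)
qed

lemma nhdsin_euclidean [simp]: "nhdsin euclidean x = nhds x"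
 by (rule filter_eqI) (auto simp: eventually_nhdsin eventually_nhds)

lemma nhdsin_unit: "nhdsin (discrete_topology (UNIV :: unit set)) () = principal {()}"
 by (rule filter_eqI) (auto simp: eventually_nhdsin eventually_principal)

lemma principal_le_nhdsin: "s \<in> topspace S ==> principal {s} <= nhdsin S s"
 by (auto simp: le_filter_def eventually_principal eventually_nhdsin)

lemma eventually_nhdsin_topspace: "\<forall>\<^sub>F x in nhdsin X a. x \<in> topspace X"
 by (cases "a \<in> topspace X") (auto simp: eventually_nhdsin)

lemma eventually_nhdsin_open: "openin X V ==> a \<in> V ==> \<forall>\<^sub>F x in nhdsin X a. x \<in> V"
 by (auto simp: eventually_nhdsin)

lemma openin_iff_nhdsin:
 "openin X V \<longleftrightarrow> V \<subseteq> topspace X & (\<forall>x\<in>V. \<forall>\<^sub>F y in nhdsin X x. y \<in> V)"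
proof
 assume "openin X V"
 thus "V \<subseteq> topspace X & (\<forall>x\<in>V. \<forall>\<^sub>F y in nhdsin X x. y \<in> V)"
  using openin_subset eventually_nhdsin_open by metis
next
 assume V: "V \<subseteq> topspace X & (\<forall>x\<in>V. \<forall>\<^sub>F y in nhdsin X x. y \<in> V)"
 show "openin X V"
 proof (rule iffD2[OF openin_subopen], rule ballI)
  fix x assume x: "x \<in> V"
  hence "eventually (%y. y \<in> V) (nhdsin X x)" "x \<in> topspace X" using V by auto
  thus "\<exists>T. openin X T & x \<in> T & T \<subseteq> V" unfolding eventually_nhdsin by blast
 qed
qed

text \<open>The tube lemma in terms of filters.\<close>

lemma eventually_compactin_uniform:
 assumes K: "compactin X K"
  and ev: "!!x. x \<in> K ==> \<forall>\<^sub>F (s, y) in F \<times>\<^sub>F nhdsin X x. P s y"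
 shows "\<forall>\<^sub>F s in F. \<forall>x\<in>K. P s x"
proof -
 have "\<exists>p. eventually (fst p) F & openin X (snd p) & x \<in> snd p & (\<forall>s y. fst p s --> y \<in> snd p --> P s y)"
  if xK: "x \<in> K" for x
 proof -
  have "x \<in> topspace X" using K xK by (auto simp: compactin_def)
  obtain Q R where *: "eventually Q F" "eventually R (nhdsin X x)" "!!s y. Q s ==> R y ==> P s y"
   using ev[OF xK] unfolding eventually_prod_filter by auto
  then obtain V where "openin X V" "x \<in> V" "\<forall>y\<in>V. R y" using \<open>x \<in> topspace X\<close> by (auto simp: eventually_nhdsin)
  thus ?thesis using * by (intro exI[of _ "(Q, V)"]) auto
 qed
 hence "\<forall>x\<in>K. \<exists>p. eventually (fst p) F & openin X (snd p) & x \<in> snd p & (\<forall>s y. fst p s --> y \<in> snd p --> P s y)"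
  by blast
 from bchoice[OF this] obtain p where p: "\<forall>x\<in>K. eventually (fst (p x)) F & openin X (snd (p x)) &
   x \<in> snd (p x) & (\<forall>s y. fst (p x) s --> y \<in> snd (p x) --> P s y)" ..
 have "\<forall>U\<in>(%x. snd (p x)) ` K. openin X U" "K \<subseteq> \<Union>((%x. snd (p x)) ` K)" using p by auto
 then obtain \<F> where \<F>: "finite \<F>" "\<F> \<subseteq> (%x. snd (p x)) ` K" "K \<subseteq> \<Union>\<F>"
  using K[unfolded compactin_def, THEN conjunct2, rule_format, of "(%x. snd (p x)) ` K"] by auto
 then obtain J where J: "finite J" "J \<subseteq> K" "\<F> = (%x. snd (p x)) ` J" using finite_subset_image by meson
 have "\<forall>\<^sub>F s in F. \<forall>x\<in>J. fst (p x) s" using J p by (auto simp: eventually_ball_finite_distrib)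
 thus ?thesis
 proof eventually_elim
  case (elim s)
  show ?case
  proof
   fix x assume "x \<in> K"
   then obtain y where "y \<in> J" "x \<in> snd (p y)" using \<F> J by auto
   thus "P s x" using elim p J by blast
  qed
 qed
qed

lemma filterlim_chart_family:
 assumes h: "filterlim (%(s, x). h s x) G (F \<times>\<^sub>F F1)" and k: "filterlim k F1 F2"
 shows "filterlim (%(s, y). h s (k y)) G (F \<times>\<^sub>F F2)"
proof -
 have "filterlim (%(s, y). (s, k y)) (F \<times>\<^sub>F F1) (F \<times>\<^sub>F F2)" using filterlim_compose[OF k filterlim_snd]
  by (auto simp: case_prod_unfold intro!: filterlim_Pair filterlim_fst)
 from filterlim_compose[OF h this] show ?thesis by (simp add: case_prod_unfold)
qed

locale compact_manifold =
 fixes X :: "'m topology" and A :: "('m, 'e::euclidean_space) chart set"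
 assumes atlas: "smooth_atlas X A"
  and nonempty: "topspace X ~= {}"
  and compact: "compact_space X" and Hausdorff: "Hausdorff_space X"
begin

abbreviation "Xs \<equiv> topspace X"

abbreviation ichart :: "('m, 'e) chart => 'e => 'm" where
 "ichart c \<equiv> inv_into (fst c) (snd c)"

lemma chart_facts:
 assumes "c \<in> A"
 shows "openin X (fst c)" "open (snd c ` fst c)" "inj_on (snd c) (fst c)"
  "continuous_map (subtopology X (fst c)) euclidean (snd c)"
  "continuous_map (top_of_set (snd c ` fst c)) X (ichart c)"
proof -
 have c: "chart_on X (fst c, snd c)" using atlas assms by (simp add: smooth_atlas_def)
 hence op: "openin X (fst c)" and hm: "homeomorphic_map (subtopology X (fst c)) (top_of_set (snd c ` fst c)) (snd c)"
  and "open (snd c ` fst c)" unfolding chart_on_def by (simp_all add: split_beta)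
 have ts: "topspace (subtopology X (fst c)) = fst c" using openin_subset[OF op] by auto
 show "openin X (fst c)" "open (snd c ` fst c)" by fact+
 show inj: "inj_on (snd c) (fst c)" using hm ts by (metis homeomorphic_imp_injective_map)
 have ct: "continuous_map (subtopology X (fst c)) (top_of_set (snd c ` fst c)) (snd c)" using hm homeomorphic_imp_continuous_map by blast
 thus "continuous_map (subtopology X (fst c)) euclidean (snd c)" using continuous_map_into_fulltopology by blast
 obtain g where g: "homeomorphic_maps (subtopology X (fst c)) (top_of_set (snd c ` fst c)) (snd c) g" using hm homeomorphic_map_maps by blast
 have "continuous_map (top_of_set (snd c ` fst c)) (subtopology X (fst c)) g" using g by (simp add: homeomorphic_maps_def)
 hence "continuous_map (top_of_set (snd c ` fst c)) X g" using continuous_map_into_fulltopology by blast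
 moreover have "g y = ichart c y" if "y \<in> snd c ` fst c" for y using g that inj ts unfolding homeomorphic_maps_def by (auto simp: inv_into_f_f)
 ultimately show "continuous_map (top_of_set (snd c ` fst c)) X (ichart c)" by (auto intro: continuous_map_eq)
qed

lemma chart_subset: "c \<in> A ==> fst c \<subseteq> Xs"
 using chart_facts(1) openin_subset by blast

lemma chart_exists: "x \<in> Xs ==> \<exists>c\<in>A. x \<in> fst c"
 using atlas by (auto simp: smooth_atlas_def)

lemma chart_inverse [simp]: "c \<in> A ==> x \<in> fst c ==> ichart c (snd c x) = x"
 using chart_facts(3) by (simp add: inv_into_f_f)

lemma ichart_in: "y \<in> snd c ` fst c ==> ichart c y \<in> fst c"
 by (rule inv_into_into)

lemma filterlim_chart:
 assumes "c \<in> A" "x \<in> fst c"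
 shows "filterlim (snd c) (nhds (snd c x)) (nhdsin X x)"
proof -
 have "filterlim (snd c) (nhds (snd c x)) (nhdsin (subtopology X (fst c)) x)"
  using chart_facts(4)[OF assms(1)] assms chart_subset[OF assms(1)] unfolding continuous_map_iff_nhdsin by auto
 moreover have "nhdsin (subtopology X (fst c)) x = nhdsin X x" using chart_facts(1)[OF assms(1)] assms(2) chart_subset[OF assms(1)]
  by (intro filter_eqI) (auto simp: eventually_nhdsin openin_open_subtopology; metis IntD1 IntD2 IntI openin_Int Int_lower2)
 ultimately show ?thesis by simp
qed

lemma filterlim_ichart:
 assumes "c \<in> A" "x \<in> fst c"
 shows "filterlim (ichart c) (nhdsin X x) (nhds (snd c x))"
proof -
 have o: "open (snd c ` fst c)" using chart_facts(2) assms by blast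
 have "filterlim (ichart c) (nhdsin X (ichart c (snd c x))) (nhdsin (top_of_set (snd c ` fst c)) (snd c x))"
  using chart_facts(5)[OF assms(1)] assms unfolding continuous_map_iff_nhdsin by auto
 moreover have "nhdsin (top_of_set (snd c ` fst c)) (snd c x) = nhds (snd c x)" using o assms(2)
  by (intro filter_eqI) (auto simp: eventually_nhdsin eventually_nhds openin_open_eq; metis IntD1 IntD2 IntI open_Int Int_lower2 imageI)
 ultimately show ?thesis using assms by simp
qed

lemma eventually_in_chart:
 assumes "c \<in> A" "x \<in> fst c"
 shows "\<forall>\<^sub>F y in nhds (snd c x). y \<in> snd c ` fst c" using chart_facts(2)[OF assms(1)] assms(2) by (auto simp: eventually_nhds)

lemma open_chart_image:
 assumes c: "c \<in> A" and V: "openin X V" "V \<subseteq> fst c"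
 shows "open (snd c ` V)"
proof (subst open_subopen, clarify)
 fix x assume x: "x \<in> V"
 have "\<forall>\<^sub>F y in nhds (snd c x). ichart c y \<in> V"
  using filterlim_ichart[OF c, of x] x V eventually_nhdsin_open[OF V(1) x] by (auto simp: filterlim_iff)
 moreover have "\<forall>\<^sub>F y in nhds (snd c x). y \<in> snd c ` fst c" using eventually_in_chart c x V by blast
 ultimately have "\<forall>\<^sub>F y in nhds (snd c x). y \<in> snd c ` V" by eventually_elim (rule image_eqI[OF f_inv_into_f[symmetric]])
 thus "\<exists>T. open T & snd c x \<in> T & T \<subseteq> snd c ` V" by (auto simp: eventually_nhds)
qed

lemma openin_chart_preimage:
 assumes c: "c \<in> A" and W: "open W"
 shows "openin X {x \<in> fst c. snd c x \<in> W}" unfolding openin_iff_nhdsin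
proof (intro conjI ballI)
 fix x assume x: "x \<in> {x \<in> fst c. snd c x \<in> W}"
 have "\<forall>\<^sub>F y in nhdsin X x. snd c y \<in> W" using filterlim_chart[OF c, of x] x W by (auto simp: filterlim_iff eventually_nhds)
 moreover have "\<forall>\<^sub>F y in nhdsin X x. y \<in> fst c" using eventually_nhdsin_open[OF chart_facts(1)[OF c]] x by simp
 ultimately show "\<forall>\<^sub>F y in nhdsin X x. y \<in> {x \<in> fst c. snd c x \<in> W}" by eventually_elim simp
qed (use chart_subset[OF c] in auto)

lemma compactin_ichart:
 assumes c: "c \<in> A" and K: "compact K" "K \<subseteq> snd c ` fst c"
 shows "compactin X (ichart c ` K)"
proof (rule image_compactin[OF _ chart_facts(5)[OF c]])
 show "compactin (top_of_set (snd c ` fst c)) K" unfolding compactin_subtopology compactin_euclidean_iff using K by (rule conjI)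
qed

lemma chart_ichart: "y \<in> snd c ` fst c ==> snd c (ichart c y) = y"
 by (rule f_inv_into_f)

text \<open>Smoothness of the transition maps makes every chart as good as another.\<close>

lemma transition_germ:
 assumes "c \<in> A" "d \<in> A" "x \<in> fst c" "x \<in> fst d"
 shows "C_germ n (snd d \<circ> ichart c) (snd c x)"
proof -
 have "C_on \<infinity> (snd c ` (fst c Int fst d)) (snd d \<circ> ichart c)"
  using atlas assms(1,2) unfolding smooth_atlas_def by (auto simp: case_prod_unfold)
 moreover have "open (snd c ` (fst c Int fst d))" using assms openin_Int[OF chart_facts(1)[OF assms(1)] chart_facts(1)[OF assms(2)]]
  by (intro open_chart_image) auto
 ultimately show ?thesis using assms by (subst (asm) C_on_iff_germ) auto
qed

section \<open>Families of maps of a manifold\<close>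

text \<open>Required in all pairs of charts; one pair suffices by \<open>smooth_family_atI\<close>.\<close>

definition smooth_family_at :: "enat => 's topology => ('s => 'm => 'm) => 's => 'm => bool" where
 "smooth_family_at r S h s0 x0 \<longleftrightarrow> h s0 x0 \<in> Xs &
   filterlim (%(s, x). h s x) (nhdsin X (h s0 x0)) (nhdsin S s0 \<times>\<^sub>F nhdsin X x0) &
   (\<forall>c\<in>A. \<forall>d\<in>A. x0 \<in> fst c --> h s0 x0 \<in> fst d --> (\<forall>n. enat n <= r -->
    C_family n (nhdsin S s0) s0 (%s. local_rep c d (h s)) (snd c x0)))"

abbreviation smooth_family :: "enat => 's topology => ('s => 'm => 'm) => bool" where
 "smooth_family r S h \<equiv> (\<forall>s\<in>topspace S. \<forall>x\<in>Xs. smooth_family_at r S h s x)"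

lemma eventually_family_chart:
 assumes c: "c \<in> A" "x0 \<in> fst c"
  and h: "filterlim (%(s, x). h s x) (nhdsin X z) (nhdsin S s0 \<times>\<^sub>F nhdsin X x0)"
  and V: "openin X V" "z \<in> V"
 shows "\<forall>\<^sub>F (s, y) in nhdsin S s0 \<times>\<^sub>F nhds (snd c x0). h s (ichart c y) \<in> V"
 using filterlim_chart_family[OF h filterlim_ichart[OF c]] eventually_nhdsin_open[OF V] by (auto simp: filterlim_iff case_prod_unfold)

lemma eventually_family_in_chart:
 assumes c: "c \<in> A" "x0 \<in> fst c" and V: "openin X V" "x0 \<in> V"
 shows "\<forall>\<^sub>F (s, y) in F \<times>\<^sub>F nhds (snd c x0). y \<in> snd c ` fst c & ichart c y \<in> V"
proof -
 have "\<forall>\<^sub>F y in nhds (snd c x0). y \<in> snd c ` fst c & ichart c y \<in> V"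
  using eventually_in_chart[OF c] filterlim_ichart[OF c] eventually_nhdsin_open[OF V] by (auto simp: filterlim_iff intro: eventually_conj)
 thus ?thesis unfolding case_prod_unfold by (rule eventually_compose_filterlim[OF _ filterlim_snd])
qed

text \<open>Any other pair of charts differs from the given one by transition maps, and the chain rule applies.\<close>

lemma smooth_family_atI:
 assumes s0: "s0 \<in> topspace S"
  and c: "c \<in> A" "x0 \<in> fst c" and d: "d \<in> A" "h s0 x0 \<in> fst d"
  and h: "filterlim (%(s, x). h s x) (nhdsin X (h s0 x0)) (nhdsin S s0 \<times>\<^sub>F nhdsin X x0)"
  and C: "!!n. enat n <= r ==> C_family n (nhdsin S s0) s0 (%s. local_rep c d (h s)) (snd c x0)"
 shows "smooth_family_at r S h s0 x0" unfolding smooth_family_at_def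
proof (intro conjI ballI impI allI)
 note F = principal_le_nhdsin[OF s0]
 fix c' d' n assume c': "c' \<in> A" "x0 \<in> fst c'" and d': "d' \<in> A" "h s0 x0 \<in> fst d'" and n: "enat n <= r"
 let ?sig = "snd c \<circ> ichart c'" and ?tau = "snd d' \<circ> ichart d"
 have sig: "C_family n (nhdsin S s0) s0 (%_. ?sig) (snd c' x0)" by (rule C_germ_family[OF transition_germ[OF c'(1) c(1) c'(2) c(2)]])
 have tau: "C_family n (nhdsin S s0) s0 (%_. ?tau) (snd d (h s0 x0))" by (rule C_germ_family[OF transition_germ[OF d(1) d'(1) d(2) d'(2)]])
 have 1: "C_family n (nhdsin S s0) s0 (%s y. local_rep c d (h s) (?sig y)) (snd c' x0)"
  by (rule C_family_compose[OF F sig, of "%s. local_rep c d (h s)"]) (use C[OF n] c c' in simp)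
 have 2: "C_family n (nhdsin S s0) s0 (%s y. ?tau (local_rep c d (h s) (?sig y))) (snd c' x0)"
  by (rule C_family_compose[OF F 1, of "%_. ?tau"]) (use tau c c' d in \<open>simp add: local_rep_def\<close>)
 show "C_family n (nhdsin S s0) s0 (%s. local_rep c' d' (h s)) (snd c' x0)"
 proof (rule C_family_cong_imp[OF F _ 2])
  have o: "openin X (fst c Int fst c')" "openin X (fst d Int fst d')" using c c' d d' by (simp_all add: openin_Int chart_facts(1))
  show "\<forall>\<^sub>F (s, y) in nhdsin S s0 \<times>\<^sub>F nhds (snd c' x0).
    ?tau (local_rep c d (h s) (?sig y)) = local_rep c' d' (h s) y"
   using eventually_family_chart[OF c' h o(2), simplified] eventually_family_in_chart[OF c' o(1), of "nhdsin S s0", simplified]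
   by (rule eventually_elim2) (use c c' d d' in \<open>auto simp: local_rep_def\<close>)
 qed
qed (rule subsetD[OF chart_subset[OF d(1)] d(2)], rule h)

lemma smooth_family_at_C:
 assumes "smooth_family_at r S h s0 x0" "c \<in> A" "d \<in> A" "x0 \<in> fst c" "h s0 x0 \<in> fst d" "enat n <= r"
 shows "C_family n (nhdsin S s0) s0 (%s. local_rep c d (h s)) (snd c x0)" using assms unfolding smooth_family_at_def by blast

lemma smooth_family_at_lim:
 assumes "smooth_family_at r S h s0 x0"
 shows "filterlim (%(s, x). h s x) (nhdsin X (h s0 x0)) (nhdsin S s0 \<times>\<^sub>F nhdsin X x0)" "h s0 x0 \<in> Xs"
 using assms unfolding smooth_family_at_def by blast+

lemma eventually_family_topspace:
 assumes "s0 \<in> topspace S"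
 shows "\<forall>\<^sub>F (s, x) in nhdsin S s0 \<times>\<^sub>F nhdsin X x0. s \<in> topspace S & x \<in> Xs" unfolding eventually_prod_filter
 by (intro exI conjI) (auto intro: eventually_nhdsin_topspace)

lemma smooth_family_at_cong:
 assumes s0: "s0 \<in> topspace S" and x0: "x0 \<in> Xs"
  and eq: "!!s x. s \<in> topspace S ==> x \<in> Xs ==> h s x = k s x"
  and "smooth_family_at r S h s0 x0"
 shows "smooth_family_at r S k s0 x0"
proof -
 note F = principal_le_nhdsin[OF s0]
 have e: "h s0 x0 = k s0 x0" using eq s0 x0 by blast
 obtain c where c: "c \<in> A" "x0 \<in> fst c" using chart_exists x0 by blast
 obtain d where d: "d \<in> A" "h s0 x0 \<in> fst d" using chart_exists smooth_family_at_lim[OF assms(4)] by blast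
 have lim: "filterlim (%(s, x). k s x) (nhdsin X (k s0 x0)) (nhdsin S s0 \<times>\<^sub>F nhdsin X x0)"
 proof (rule filterlim_mono_eventually[OF smooth_family_at_lim(1)[OF assms(4)]])
  show "\<forall>\<^sub>F p in nhdsin S s0 \<times>\<^sub>F nhdsin X x0. (case p of (s, x) => h s x) = (case p of (s, x) => k s x)"
   using eventually_family_topspace[OF s0, of x0] by (rule eventually_mono) (auto simp: eq)
 qed (simp_all add: e)
 show ?thesis
 proof (rule smooth_family_atI[where h = k, OF s0 c d(1) _ lim])
  fix n assume n: "enat n <= r"
  have 1: "C_family n (nhdsin S s0) s0 (%s. local_rep c d (h s)) (snd c x0)" by (rule smooth_family_at_C[OF assms(4) c(1) d(1) c(2) d(2) n])
  have "\<forall>\<^sub>F (s, y) in nhdsin S s0 \<times>\<^sub>F nhds (snd c x0). s \<in> topspace S" unfolding case_prod_unfold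
   by (rule eventually_compose_filterlim[OF eventually_nhdsin_topspace filterlim_fst])
  moreover have "\<forall>\<^sub>F (s, y) in nhdsin S s0 \<times>\<^sub>F nhds (snd c x0). y \<in> snd c ` fst c & ichart c y \<in> fst c"
   by (rule eventually_family_in_chart[OF c chart_facts(1)[OF c(1)] c(2)])
  ultimately have "\<forall>\<^sub>F (s, y) in nhdsin S s0 \<times>\<^sub>F nhds (snd c x0). local_rep c d (h s) y = local_rep c d (k s) y"
   by (rule eventually_elim2) (use chart_subset[OF c(1)] in \<open>auto simp: local_rep_def eq subset_iff\<close>)
  thus "C_family n (nhdsin S s0) s0 (%s. local_rep c d (k s)) (snd c x0)" by (rule C_family_cong_imp[OF F _ 1])
 qed (use e d in simp)
qed

lemma smooth_family_at_compose:
 assumes s0: "s0 \<in> topspace S" and x0: "x0 \<in> Xs"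
  and f: "smooth_family_at r S f s0 x0" and g: "smooth_family_at r S g s0 (f s0 x0)"
 shows "smooth_family_at r S (%s x. g s (f s x)) s0 x0"
proof -
 note F = principal_le_nhdsin[OF s0]
 note limf = smooth_family_at_lim[OF f] and limg = smooth_family_at_lim[OF g]
 obtain c where c: "c \<in> A" "x0 \<in> fst c" using chart_exists x0 by blast
 obtain d where d: "d \<in> A" "f s0 x0 \<in> fst d" using chart_exists limf by blast
 obtain e where e: "e \<in> A" "g s0 (f s0 x0) \<in> fst e" using chart_exists limg by blast
 have "filterlim (%(s, x). (s, f s x)) (nhdsin S s0 \<times>\<^sub>F nhdsin X (f s0 x0)) (nhdsin S s0 \<times>\<^sub>F nhdsin X x0)"
  using limf(1) filterlim_fst by (auto simp: case_prod_unfold intro!: filterlim_Pair)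
 from filterlim_compose[OF limg(1) this]
 have lim: "filterlim (%(s, x). g s (f s x)) (nhdsin X (g s0 (f s0 x0))) (nhdsin S s0 \<times>\<^sub>F nhdsin X x0)" by (simp add: case_prod_unfold)
 show ?thesis
 proof (rule smooth_family_atI[where h = "%s x. g s (f s x)", OF s0 c e lim])
  fix n assume n: "enat n <= r"
  have 1: "C_family n (nhdsin S s0) s0 (%s y. local_rep d e (g s) (local_rep c d (f s) y)) (snd c x0)"
   by (rule C_family_compose[OF F smooth_family_at_C[OF f c(1) d(1) c(2) d(2) n], of "%s. local_rep d e (g s)"])
     (use smooth_family_at_C[OF g d(1) e(1) d(2) e(2) n] c in \<open>simp add: local_rep_def\<close>)
  show "C_family n (nhdsin S s0) s0 (%s. local_rep c e (%x. g s (f s x))) (snd c x0)"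
  proof (rule C_family_cong_imp[OF F _ 1])
   show "\<forall>\<^sub>F (s, y) in nhdsin S s0 \<times>\<^sub>F nhds (snd c x0).
     local_rep d e (g s) (local_rep c d (f s) y) = local_rep c e (%x. g s (f s x)) y"
    using eventually_family_chart[OF c limf(1) chart_facts(1)[OF d(1)] d(2)]
    by (rule eventually_mono) (use d in \<open>auto simp: local_rep_def\<close>)
  qed
 qed
qed

abbreviation "one_point \<equiv> discrete_topology (UNIV :: unit set)"

lemma filterlim_unit_times:
 "filterlim (%(s, x). f x) G (principal {()} \<times>\<^sub>F F) \<longleftrightarrow> filterlim f G F" unfolding filterlim_iff eventually_prod_filter
 by (auto simp: eventually_principal elim!: eventually_mono)

lemma C_map_iff_smooth_family: "C_map r X A f \<longleftrightarrow> smooth_family r one_point (%_. f)"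
proof -
 have op: "open (snd c ` (fst c Int f -` fst d))" if "continuous_map X X f" "c \<in> A" "d \<in> A" for c d
 proof (rule open_chart_image[OF that(2)])
  have "openin X {x \<in> Xs. f x \<in> fst d}" using that chart_facts(1) by (auto simp: continuous_map_def)
  moreover have "fst c Int f -` fst d = fst c Int {x \<in> Xs. f x \<in> fst d}" using chart_subset[OF that(2)] by auto
  ultimately show "openin X (fst c Int f -` fst d)" using openin_Int[OF chart_facts(1)[OF that(2)]] by simp
 qed auto
 have "C_map r X A f \<longleftrightarrow> continuous_map X X f &
   (\<forall>c\<in>A. \<forall>d\<in>A. \<forall>x\<in>fst c Int f -` fst d. \<forall>n. enat n <= r --> C_germ n (local_rep c d f) (snd c x))"
 proof -
  have "C_on r (snd c ` (fst c Int f -` fst d)) (local_rep c d f) \<longleftrightarrow>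
    (\<forall>x\<in>fst c Int f -` fst d. \<forall>n. enat n <= r --> C_germ n (local_rep c d f) (snd c x))"
   if "continuous_map X X f" "c \<in> A" "d \<in> A" for c d using C_on_iff_germ[OF op[OF that]] by blast
  thus ?thesis unfolding C_map_def by blast
 qed
 also have "\<dots> \<longleftrightarrow> smooth_family r one_point (%_. f)"
  unfolding smooth_family_at_def continuous_map_iff_nhdsin using chart_subset by (simp add: nhdsin_unit filterlim_unit_times) blast
 finally show ?thesis .
qed

lemma C_map_cong:
 assumes "!!x. x \<in> Xs ==> f x = g x" "C_map r X A f" shows "C_map r X A g"
 using assms smooth_family_at_cong[of _ one_point _ "%_. f" "%_. g"] unfolding C_map_iff_smooth_family by blast

lemma C_map_compose:
 assumes f: "C_map r X A f" and g: "C_map r X A g" shows "C_map r X A (%x. g (f x))" unfolding C_map_iff_smooth_family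
proof (intro ballI)
 fix s :: unit and x assume s: "s \<in> topspace one_point" and x: "x \<in> Xs"
 have fs: "smooth_family_at r one_point (%_. f) s x" using f s x by (simp add: C_map_iff_smooth_family)
 moreover have "smooth_family_at r one_point (%_. g) s (f x)" using g s smooth_family_at_lim(2)[OF fs] by (simp add: C_map_iff_smooth_family)
 ultimately show "smooth_family_at r one_point (%_ x. g (f x)) s x" by (rule smooth_family_at_compose[OF s x, where f = "%_. f" and g = "%_. g"])
qed

lemma C_map_in: "C_map r X A f ==> x \<in> Xs ==> f x \<in> Xs"
 by (simp add: C_map_def continuous_map_def Pi_iff)

lemma C_map_ident: "C_map r X A (%x. x)"
 unfolding C_map_iff_smooth_family
proof (intro ballI)
 fix s :: unit and x assume s: "s \<in> topspace one_point" and x: "x \<in> Xs"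
 obtain c where c: "c \<in> A" "x \<in> fst c" using chart_exists x by blast
 show "smooth_family_at r one_point (%_ x. x) s x" by (rule smooth_family_atI[where h = "%_ x. x", OF s c c])
    (use c transition_germ[OF c(1) c(1) c(2) c(2)] in
     \<open>auto simp: local_rep_def o_def nhdsin_unit filterlim_unit_times filterlim_ident\<close>)
qed

text \<open>Points outside a neighbourhood of the preimage stay away from the image, uniformly by compactness; hence
 the inverses are jointly continuous. Their derivatives follow from \<open>C_family_inverse\<close>, the Jacobian being
 nonzero because each \<open>k s\<close> is differentiable.\<close>

lemma smooth_family_inverse:
 assumes h: "smooth_family r S h" and r: "1 <= r"
  and dif: "!!s. s \<in> topspace S ==> C_map r X A (k s)"
  and hk: "!!s x. s \<in> topspace S ==> x \<in> Xs ==> h s (k s x) = x"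
  and kh: "!!s x. s \<in> topspace S ==> x \<in> Xs ==> k s (h s x) = x"
 shows "smooth_family r S k"
proof (intro ballI)
 fix s0 y0 assume s0: "s0 \<in> topspace S" and y0: "y0 \<in> Xs"
 note F = principal_le_nhdsin[OF s0]
 define x0 where "x0 = k s0 y0"
 have kin: "k s x \<in> Xs" if "s \<in> topspace S" "x \<in> Xs" for s x using C_map_in dif that by blast
 have x0: "x0 \<in> Xs" using s0 y0 kin by (simp add: x0_def)
 have hx0: "h s0 x0 = y0" using hk s0 y0 by (simp add: x0_def)
 have lim: "filterlim (%(s, y). k s y) (nhdsin X x0) (nhdsin S s0 \<times>\<^sub>F nhdsin X y0)" unfolding filterlim_iff
 proof (intro allI impI)
  fix P assume "eventually P (nhdsin X x0)"
  then obtain V where V: "openin X V" "x0 \<in> V" "\<forall>x\<in>V. P x" using x0 by (auto simp: eventually_nhdsin)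
  have K: "compactin X (Xs - V)" using V compact by (simp add: closedin_compact_space closedin_def openin_subset Diff_Diff_Int inf.absorb2)
  have "\<forall>\<^sub>F p in nhdsin S s0 \<times>\<^sub>F nhdsin X y0. \<forall>x\<in>Xs - V. h (fst p) x ~= snd p"
  proof (rule eventually_compactin_uniform[OF K])
   fix x assume x: "x \<in> Xs - V"
   have hx: "h s0 x \<in> Xs" using h s0 x smooth_family_at_lim(2) by fastforce
   have "h s0 x ~= y0" using x V kh[OF s0, of x] by (auto simp: x0_def)
   then obtain W1 W2 where W: "openin X W1" "openin X W2" "h s0 x \<in> W1" "y0 \<in> W2" "disjnt W1 W2"
    using Hausdorff hx y0 unfolding Hausdorff_space_def by metis
   have "\<forall>\<^sub>F (s, x') in nhdsin S s0 \<times>\<^sub>F nhdsin X x. h s x' \<in> W1"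
    using smooth_family_at_lim(1)[of r S h s0 x] h s0 x eventually_nhdsin_open[OF W(1,3)] by (auto simp: filterlim_iff case_prod_unfold)
   then obtain Q R where QR: "eventually Q (nhdsin S s0)" "eventually R (nhdsin X x)"
    "!!s x'. Q s ==> R x' ==> h s x' \<in> W1" unfolding eventually_prod_filter by auto
   have "\<forall>\<^sub>F p in nhdsin S s0 \<times>\<^sub>F nhdsin X y0. Q (fst p) & snd p \<in> W2"
    unfolding eventually_prod_filter using QR eventually_nhdsin_open[OF W(2,4)] by (intro exI[of _ Q] exI[of _ "%y. y \<in> W2"]) auto
   thus "\<forall>\<^sub>F (p, x') in (nhdsin S s0 \<times>\<^sub>F nhdsin X y0) \<times>\<^sub>F nhdsin X x. h (fst p) x' ~= snd p"
    unfolding eventually_prod_filter[of _ "nhdsin S s0 \<times>\<^sub>F nhdsin X y0"] using QR W(5)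
    by (intro exI[of _ "%p. Q (fst p) & snd p \<in> W2"] exI[of _ R]) (auto simp: disjnt_iff)
  qed
  thus "\<forall>\<^sub>F p in nhdsin S s0 \<times>\<^sub>F nhdsin X y0. P (case p of (s, y) => k s y)" using eventually_family_topspace[OF s0, of y0]
   by eventually_elim (use V kin hk in \<open>auto; metis DiffI\<close>)
 qed
 obtain c where c: "c \<in> A" "x0 \<in> fst c" using chart_exists x0 by blast
 obtain d where d: "d \<in> A" "y0 \<in> fst d" using chart_exists y0 by blast
 show "smooth_family_at r S k s0 y0"
 proof (rule smooth_family_atI[where h = k, OF s0 d c(1)])
  show "k s0 y0 \<in> fst c" using c by (simp add: x0_def)
  show "filterlim (%(s, y). k s y) (nhdsin X (k s0 y0)) (nhdsin S s0 \<times>\<^sub>F nhdsin X y0)" using lim by (simp add: x0_def)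
  fix n assume n: "enat n <= r"
  let ?f = "%s. local_rep c d (h s)" and ?k = "%s. local_rep d c (k s)"
  have evk: "\<forall>\<^sub>F (s, y) in nhdsin S s0 \<times>\<^sub>F nhds (snd d y0). k s (ichart d y) \<in> fst c"
   by (rule eventually_family_chart[OF d lim chart_facts(1)[OF c(1)] c(2)])
  have evd: "\<forall>\<^sub>F (s, y) in nhdsin S s0 \<times>\<^sub>F nhds (snd d y0). y \<in> snd d ` fst d & ichart d y \<in> fst d"
   by (rule eventually_family_in_chart[OF d chart_facts(1)[OF d(1)] d(2)])
  have evs: "\<forall>\<^sub>F (s, y) in nhdsin S s0 \<times>\<^sub>F nhds (snd d y0). s \<in> topspace S" unfolding case_prod_unfold
   by (rule eventually_compose_filterlim[OF eventually_nhdsin_topspace filterlim_fst])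
  have inv: "\<forall>\<^sub>F (s, y) in nhdsin S s0 \<times>\<^sub>F nhds (snd d y0). ?f s (?k s y) = y" using evk evd evs
   by eventually_elim (use c d hk chart_subset[OF d(1)] chart_ichart in \<open>auto simp: local_rep_def\<close>)
  have kC: "C_germ m (local_rep d c (k s)) (snd d x)"
   if "s \<in> topspace S" "x \<in> fst d" "k s x \<in> fst c" "enat m <= r" for s x m
   using smooth_family_at_C[of r one_point "%_. k s" "()" x d c m] dif[OF that(1)] that chart_subset[OF d(1)] c d
   by (auto simp: C_map_iff_smooth_family nhdsin_unit)
  show "C_family n (nhdsin S s0) s0 ?k (snd d y0)"
  proof (rule C_family_inverse[OF F, where f = ?f and ?x0.0 = "snd c x0"])
   show "C_family n (nhdsin S s0) s0 ?f (snd c x0)" using h s0 x0 c d hx0 n by (intro smooth_family_at_C) auto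
   show "?k s0 (snd d y0) = snd c x0" using d by (simp add: local_rep_def x0_def)
   have "((%(s, y). snd c (k s (ichart d y))) \<longlongrightarrow> snd c x0) (nhdsin S s0 \<times>\<^sub>F nhds (snd d y0))"
    using filterlim_compose[OF filterlim_chart[OF c] filterlim_chart_family[OF lim filterlim_ichart[OF d]]] by (simp add: case_prod_unfold)
   thus "C_family 0 (nhdsin S s0) s0 ?k (snd d y0)" using d by (simp add: local_rep_def x0_def)
   show "\<forall>\<^sub>F (s, y) in nhdsin S s0 \<times>\<^sub>F nhds (snd d y0). ?f s (?k s y) = y" by (rule inv)
   show "\<forall>\<^sub>F (s, y) in nhdsin S s0 \<times>\<^sub>F nhds (snd d y0). isCont (?k s) y" using evk evd evs
   proof (eventually_elim, clarify)
    fix s y x assume *: "k s (ichart d (snd d x)) \<in> fst c" "ichart d (snd d x) \<in> fst d" "s \<in> topspace S" "x \<in> fst d"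
    hence "C_germ 0 (?k s) (snd d x)" using kC[of s x 0] d by (simp add: zero_enat_def[symmetric])
    thus "isCont (?k s) (snd d x)" by (simp add: tendsto_unit_times isCont_def tendsto_at_iff_tendsto_nhds)
   qed
   have 1: "enat 1 <= r" using r by (simp add: one_enat_def)
   have df: "?f s0 differentiable (at (snd c x0))"
   proof -
    have "C_family 1 (nhdsin S s0) s0 ?f (snd c x0)" using h s0 x0 c d hx0 1 by (intro smooth_family_at_C) auto
    hence "\<forall>\<^sub>F (s, x) in nhdsin S s0 \<times>\<^sub>F nhds (snd c x0). ?f s differentiable (at x)" by simp
    thus ?thesis by (rule eventually_family_at[OF F])
   qed
   have dk: "?k s0 differentiable (at (snd d y0))" using kC[of s0 y0 1] s0 d c 1
    by (auto simp: x0_def case_prod_unfold dest!: eventually_unit_times[THEN iffD1, unfolded case_prod_unfold]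
      eventually_nhds_x_imp_x)
   let ?Df = "frechet_derivative (?f s0) (at (snd c x0))" and ?Dk = "frechet_derivative (?k s0) (at (snd d y0))"
   have kx: "?k s0 (snd d y0) = snd c x0" using d by (simp add: local_rep_def x0_def)
   have "(?f s0 \<circ> ?k s0 has_derivative ?Df \<circ> ?Dk) (at (snd d y0))"
    by (rule diff_chain_at) (use df dk kx in \<open>simp_all add: frechet_derivative_works\<close>)
   hence "((%y. y) has_derivative ?Df \<circ> ?Dk) (at (snd d y0))" using eventually_family_centre[OF F inv] kx
    by (elim has_derivative_transform_eventually)
      (auto simp: eventually_nhds_conv_at o_def elim: eventually_mono)
   hence "?Df \<circ> ?Dk = (%y. y)" using has_derivative_ident has_derivative_unique by blast
   hence "jdet ?Df * jdet ?Dk = 1" using jdet_compose[of ?Df ?Dk] df dk by (simp add: linear_frechet_derivative jdet_id)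
   thus "jdet ?Df ~= 0" by auto
  qed
 qed
qed

end

section \<open>The topological group of diffeomorphisms\<close>

context compact_manifold
begin

lemma C_map_germ:
 assumes "C_map r X A f" "c \<in> A" "d \<in> A" "x \<in> fst c" "f x \<in> fst d" "enat n <= r"
 shows "C_germ n (local_rep c d f) (snd c x)"
proof -
 have "x \<in> Xs" using chart_subset[OF assms(2)] assms(4) by blast
 hence "smooth_family_at r one_point (%_. f) () x" using assms(1) by (simp add: C_map_iff_smooth_family)
 from smooth_family_at_C[OF this assms(2-6)] show ?thesis by (simp add: nhdsin_unit)
qed

lemma diffeosD:
 assumes "f \<in> diffeos r X A"
 shows "bij_betw f (Xs) (Xs)" "f \<in> extensional (Xs)" "C_map r X A f"
  "C_map r X A (inv_into (Xs) f)" using assms by (auto simp: diffeos_def Bij_def)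

lemma diffeosI:
 assumes "bij_betw f (Xs) (Xs)" "C_map r X A f" "C_map r X A (inv_into (Xs) f)"
 shows "restrict f (Xs) \<in> diffeos r X A"
proof -
 have b: "bij_betw (restrict f (Xs)) (Xs) (Xs)" using assms(1) by (simp add: bij_betw_restrict_eq)
 have "inv_into (Xs) (restrict f (Xs)) x = inv_into (Xs) f x" if "x \<in> Xs" for x using that b assms(1)
  by (intro inv_into_f_eq[where x = "inv_into (Xs) f x"])
    (auto simp: bij_betw_def inv_into_into f_inv_into_f)
 thus ?thesis using assms b C_map_cong[of f "restrict f (Xs)" r]
   C_map_cong[of "inv_into (Xs) f" "inv_into (Xs) (restrict f (Xs))" r] by (auto simp: diffeos_def Bij_def)
qed

lemma diffeo_in: "f \<in> diffeos r X A ==> x \<in> Xs ==> f x \<in> Xs"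
 using diffeosD(3) C_map_in by blast

lemma diffeo_inv:
 assumes "f \<in> diffeos r X A" "x \<in> Xs"
 shows "f (inv_into (Xs) f x) = x" "inv_into (Xs) f (f x) = x" "inv_into (Xs) f x \<in> Xs" using diffeosD(1)[OF assms(1)] assms(2)
 by (auto simp: bij_betw_def f_inv_into_f inv_into_f_f inv_into_into)

lemma openin_diff_nhd:
 assumes "enat k <= r" "f \<in> diffeos r X A" "c \<in> A" "d \<in> A" "compactin X K" "K \<subseteq> fst c" "f ` K \<subseteq> fst d" "0 < eps"
 shows "openin (Diff_topology r X A) (diff_nhd r X A k f c d K eps)" unfolding Diff_topology_def by (rule topology_generated_by_Basis, rule CollectI,
   rule exI[of _ k], rule exI[of _ f], rule exI[of _ c], rule exI[of _ d], rule exI[of _ K], rule exI[of _ eps])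
   (use assms in simp)

lemma topspace_Diff_topology [simp]: "topspace (Diff_topology r X A) = diffeos r X A"
proof
 show "topspace (Diff_topology r X A) \<subseteq> diffeos r X A" unfolding Diff_topology_def topology_generated_by_topspace diff_nhd_def by auto
 show "diffeos r X A \<subseteq> topspace (Diff_topology r X A)"
 proof
  fix f assume f: "f \<in> diffeos r X A"
  obtain c where c: "c \<in> A" using nonempty chart_exists by blast
  have "openin (Diff_topology r X A) (diff_nhd r X A 0 f c c {} 1)"
   by (rule openin_diff_nhd) (use f c in \<open>simp_all add: zero_enat_def[symmetric]\<close>)
  moreover have "f \<in> diff_nhd r X A 0 f c c {} 1" using f by (simp add: diff_nhd_def)
  ultimately show "f \<in> topspace (Diff_topology r X A)" using openin_subset by blast
 qed
qed

text \<open>A subbasic neighbourhood of \<open>h s0\<close>, taken on a closed coordinate ball around the point, controls the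
 derivatives near that point for all nearby parameters.\<close>

lemma continuous_map_imp_smooth_family:
 assumes h: "continuous_map S (Diff_topology r X A) h"
 shows "smooth_family r S h"
proof (intro ballI)
 fix s0 x0 assume s0: "s0 \<in> topspace S" and x0: "x0 \<in> Xs"
 have hS: "h s \<in> diffeos r X A" if "s \<in> topspace S" for s using h that by (auto simp: continuous_map_def)
 define f0 where "f0 = h s0"
 have f0: "f0 \<in> diffeos r X A" using hS s0 by (simp add: f0_def)
 note Cf0 = diffeosD(3)[OF f0]
 obtain c where c: "c \<in> A" "x0 \<in> fst c" using chart_exists x0 by blast
 obtain d where d: "d \<in> A" "f0 x0 \<in> fst d" using chart_exists diffeo_in[OF f0 x0] by blast
 define y0 where "y0 = snd c x0"
 let ?R = "local_rep c d"
 have "continuous_map X X f0" using Cf0 by (simp add: C_map_def)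
 hence "openin X {x \<in> Xs. f0 x \<in> fst d}" using chart_facts(1)[OF d(1)] by (auto simp: continuous_map_def)
 hence "openin X (fst c Int {x \<in> Xs. f0 x \<in> fst d})" using openin_Int[OF chart_facts(1)[OF c(1)]] by blast
 hence "open (snd c ` (fst c Int {x \<in> Xs. f0 x \<in> fst d}))" by (rule open_chart_image[OF c(1)]) simp
 moreover have "y0 \<in> snd c ` (fst c Int {x \<in> Xs. f0 x \<in> fst d})" using c d x0 by (auto simp: y0_def)
 ultimately obtain e where e: "e > 0" "cball y0 e \<subseteq> snd c ` (fst c Int {x \<in> Xs. f0 x \<in> fst d})" using open_contains_cball by blast
 define K where "K = ichart c ` cball y0 e"
 have K: "compactin X K" unfolding K_def by (rule compactin_ichart[OF c(1)]) (use e in auto)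
 have Kc: "K \<subseteq> fst c" "f0 ` K \<subseteq> fst d" using e c(1) by (auto simp: K_def)
 have snK: "snd c ` K = cball y0 e"
 proof -
  have "snd c (ichart c y) = y" if "y \<in> cball y0 e" for y using e that by (intro chart_ichart) auto
  thus ?thesis by (force simp: K_def image_iff)
 qed
 have ev: "\<forall>\<^sub>F s in nhdsin S s0. h s \<in> diff_nhd r X A k f0 c d K eps" if "enat k <= r" "eps > 0" for k eps
 proof -
  have "openin (Diff_topology r X A) (diff_nhd r X A k f0 c d K eps)" by (rule openin_diff_nhd[OF that(1) f0 c(1) d(1) K Kc that(2)])
  moreover have "f0 \<in> diff_nhd r X A k f0 c d K eps" using f0 Kc that by (auto simp: diff_nhd_def)
  ultimately have "\<forall>\<^sub>F g in nhdsin (Diff_topology r X A) (h s0). g \<in> diff_nhd r X A k f0 c d K eps"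
   unfolding f0_def by (rule eventually_nhdsin_open)
  thus ?thesis using h s0 unfolding continuous_map_iff_nhdsin filterlim_iff by blast
 qed
 have evy: "\<forall>\<^sub>F y in nhds y0. y \<in> cball y0 e" using e by (auto simp: eventually_nhds intro!: exI[of _ "ball y0 e"])
 have ten: "((%(s, y). iter_deriv vs (?R (h s)) y) \<longlongrightarrow> iter_deriv vs (?R f0) y0) (nhdsin S s0 \<times>\<^sub>F nhds y0)"
  if vs: "set vs \<subseteq> Basis" "enat (length vs) <= r" for vs
 proof (rule tendstoI)
  fix eps :: real assume eps: "eps > 0"
  have "C_germ (length vs) (?R f0) y0" unfolding y0_def by (rule C_map_germ[OF Cf0 c(1) d(1) c(2) d(2) vs(2)])
  hence "(iter_deriv vs (?R f0) \<longlongrightarrow> iter_deriv vs (?R f0) y0) (nhds y0)"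
   using vs unfolding C_family_iff_iter_deriv tendsto_unit_times by blast
  hence "\<forall>\<^sub>F y in nhds y0. dist (iter_deriv vs (?R f0) y) (iter_deriv vs (?R f0) y0) < eps / 2" using eps by (intro tendstoD) auto
  with evy have "\<forall>\<^sub>F y in nhds y0. y \<in> cball y0 e & dist (iter_deriv vs (?R f0) y) (iter_deriv vs (?R f0) y0) < eps / 2"
   by (rule eventually_conj)
  from eventually_prodI[OF ev[OF vs(2), of "eps / 2"] this]
  show "\<forall>\<^sub>F p in nhdsin S s0 \<times>\<^sub>F nhds y0.
    dist (case p of (s, y) => iter_deriv vs (?R (h s)) y) (iter_deriv vs (?R f0) y0) < eps"
  proof (rule eventually_mono)
   show "eps / 2 > 0" using eps by simp
   fix p :: "_ \<times> 'e" assume p: "h (fst p) \<in> diff_nhd r X A (length vs) f0 c d K (eps / 2) & snd p \<in> cball y0 e &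
     dist (iter_deriv vs (?R f0) (snd p)) (iter_deriv vs (?R f0) y0) < eps / 2"
   hence "dist (iter_deriv vs (?R (h (fst p))) (snd p)) (iter_deriv vs (?R f0) (snd p)) < eps / 2"
    using vs unfolding diff_nhd_def snK dist_norm by blast
   thus "dist (case p of (s, y) => iter_deriv vs (?R (h s)) y) (iter_deriv vs (?R f0) y0) < eps"
    using p dist_triangle_half_l[of "iter_deriv vs (?R (h (fst p))) (snd p)"] by (auto simp: case_prod_unfold dist_commute intro: dist_triangle_half_r)
  qed
 qed
 have 0: "enat 0 <= r" by (simp add: zero_enat_def[symmetric])
 have evK: "\<forall>\<^sub>F s in nhdsin S s0. h s \<in> diffeos r X A & h s ` K \<subseteq> fst d"
  using ev[OF 0, of 1] by (auto simp: diff_nhd_def elim: eventually_mono)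
 show "smooth_family_at r S h s0 x0"
 proof (rule smooth_family_atI[where h = h, OF s0 c d(1)])
  show "h s0 x0 \<in> fst d" using d by (simp add: f0_def)
  have "((%(s, y). ?R (h s) y) \<longlongrightarrow> ?R f0 y0) (nhdsin S s0 \<times>\<^sub>F nhds y0)" using ten[of "[]"] 0 by simp
  from filterlim_chart_family[OF this filterlim_chart[OF c, folded y0_def]]
  have "((%(s, x). ?R (h s) (snd c x)) \<longlongrightarrow> snd d (f0 x0)) (nhdsin S s0 \<times>\<^sub>F nhdsin X x0)"
   using c by (simp add: local_rep_def y0_def)
  from filterlim_compose[OF filterlim_ichart[OF d] this]
  have "filterlim (%(s, x). ichart d (?R (h s) (snd c x))) (nhdsin X (f0 x0)) (nhdsin S s0 \<times>\<^sub>F nhdsin X x0)"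
   by (simp add: case_prod_unfold)
  thus "filterlim (%(s, x). h s x) (nhdsin X (h s0 x0)) (nhdsin S s0 \<times>\<^sub>F nhdsin X x0)" unfolding f0_def[symmetric]
  proof (rule filterlim_mono_eventually)
   have "\<forall>\<^sub>F x in nhdsin X x0. snd c x \<in> cball y0 e" using evy filterlim_chart[OF c, folded y0_def] unfolding filterlim_iff by blast
   with eventually_nhdsin_open[OF chart_facts(1)[OF c(1)] c(2)]
   have "\<forall>\<^sub>F x in nhdsin X x0. x \<in> fst c & snd c x \<in> cball y0 e" by (rule eventually_conj)
   from eventually_prodI[OF evK this]
   show "\<forall>\<^sub>F p in nhdsin S s0 \<times>\<^sub>F nhdsin X x0.
     (case p of (s, x) => ichart d (?R (h s) (snd c x))) = (case p of (s, x) => h s x)"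
   proof (rule eventually_mono)
    fix p assume p: "(h (fst p) \<in> diffeos r X A & h (fst p) ` K \<subseteq> fst d) &
      snd p \<in> fst c & snd c (snd p) \<in> cball y0 e"
    hence "snd p \<in> K" using c(1) by (force simp: K_def image_iff)
    thus "(case p of (s, x) => ichart d (?R (h s) (snd c x))) = (case p of (s, x) => h s x)"
     using p c(1) d(1) by (auto simp: case_prod_unfold local_rep_def)
   qed
  qed auto
  fix n assume n: "enat n <= r"
  show "C_family n (nhdsin S s0) s0 (%s. ?R (h s)) (snd c x0)" unfolding C_family_iff_iter_deriv y0_def[symmetric]
  proof (intro allI impI conjI)
   fix vs :: "'e list" assume vs: "set vs \<subseteq> Basis & length vs <= n"
   hence "enat (length vs) <= r" using n by (meson enat_ord_simps(1) order_trans)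
   thus "((%(s, y). iter_deriv vs (?R (h s)) y) \<longlongrightarrow> iter_deriv vs (?R (h s0)) y0) (nhdsin S s0 \<times>\<^sub>F nhds y0)"
    using ten[of vs] vs by (simp add: f0_def)
   assume lt: "length vs < n"
   from eventually_prodI[OF evK evy]
   show "\<forall>\<^sub>F (s, y) in nhdsin S s0 \<times>\<^sub>F nhds y0. iter_deriv vs (?R (h s)) differentiable at y"
   proof (rule eventually_mono, clarify)
    fix s y assume p: "h (fst (s, y)) \<in> diffeos r X A" "h (fst (s, y)) ` K \<subseteq> fst d" "snd (s, y) \<in> cball y0 e"
    hence y: "ichart c y \<in> fst c" "h s (ichart c y) \<in> fst d" "snd c (ichart c y) = y" using Kc e by (auto simp: K_def intro!: chart_ichart)
    have "C_germ n (?R (h s)) (snd c (ichart c y))" by (rule C_map_germ[OF diffeosD(3)[of "h s"] c(1) d(1) y(1) y(2) n]) (use p in simp)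
    hence "\<forall>\<^sub>F y in nhds y. iter_deriv vs (?R (h s)) differentiable at y"
     using vs lt unfolding C_family_iff_iter_deriv eventually_unit_times y(3) by blast
    thus "iter_deriv vs (?R (h s)) differentiable at y" by (rule eventually_nhds_x_imp_x)
   qed
  qed
 qed
qed

text \<open>Joint continuity at each point of a compact set becomes uniform by the tube lemma.\<close>

lemma smooth_family_imp_continuous_map:
 assumes h: "smooth_family r S h" and dif: "!!s. s \<in> topspace S ==> h s \<in> diffeos r X A"
 shows "continuous_map S (Diff_topology r X A) h" unfolding Diff_topology_def
proof (rule continuous_on_generated_topo)
 have "h ` topspace S \<subseteq> topspace (Diff_topology r X A)" using dif by auto
 thus "h ` topspace S \<subseteq> \<Union> {diff_nhd r X A k f c d K eps |k f c d K eps. enat k <= r & f \<in> diffeos r X A &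
    c \<in> A & d \<in> A & compactin X K & K \<subseteq> fst c & f ` K \<subseteq> fst d & 0 < eps}"
  unfolding Diff_topology_def topology_generated_by_topspace .
 fix U assume "U \<in> {diff_nhd r X A k f c d K eps |k f c d K eps. enat k <= r & f \<in> diffeos r X A &
    c \<in> A & d \<in> A & compactin X K & K \<subseteq> fst c & f ` K \<subseteq> fst d & 0 < eps}"
 then obtain k f c d K eps where U: "U = diff_nhd r X A k f c d K eps" and k: "enat k <= r" and f: "f \<in> diffeos r X A"
  and c: "c \<in> A" and d: "d \<in> A" and K: "compactin X K" and Kc: "K \<subseteq> fst c" "f ` K \<subseteq> fst d" and eps: "0 < eps" by blast
 show "openin S (h -` U Int topspace S)" unfolding openin_iff_nhdsin
 proof (intro conjI ballI)
  fix s0 assume s0': "s0 \<in> h -` U Int topspace S"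
  hence s0: "s0 \<in> topspace S" and hU: "h s0 \<in> diff_nhd r X A k f c d K eps" using U by auto
  let ?L = "{vs. set vs \<subseteq> Basis & length vs <= k} :: 'e list set"
  let ?R = "local_rep c d"
  have fin: "finite ?L" by (rule finite_lists_length_le) simp
  have "\<forall>\<^sub>F s in nhdsin S s0. \<forall>x\<in>K. h s x \<in> fst d &
    (x \<in> fst c --> (\<forall>vs\<in>?L. norm (iter_deriv vs (?R (h s)) (snd c x) - iter_deriv vs (?R f) (snd c x)) < eps))"
  proof (rule eventually_compactin_uniform[OF K])
   fix x assume x: "x \<in> K"
   hence xX: "x \<in> Xs" and xc: "x \<in> fst c" and fxd: "f x \<in> fst d" using Kc chart_subset[OF c] by auto
   have hxd: "h s0 x \<in> fst d" using hU x by (auto simp: diff_nhd_def)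
   have at: "smooth_family_at r S h s0 x" using h s0 xX by blast
   have "\<forall>\<^sub>F (s, x') in nhdsin S s0 \<times>\<^sub>F nhdsin X x. h s x' \<in> fst d"
    using smooth_family_at_lim(1)[OF at] eventually_nhdsin_open[OF chart_facts(1)[OF d] hxd] unfolding filterlim_iff case_prod_unfold by blast
   moreover have "\<forall>\<^sub>F (s, x') in nhdsin S s0 \<times>\<^sub>F nhdsin X x.
     \<forall>vs\<in>?L. norm (iter_deriv vs (?R (h s)) (snd c x') - iter_deriv vs (?R f) (snd c x')) < eps" unfolding case_prod_unfold
   proof (rule eventually_ball_finite[OF fin], rule ballI)
    fix vs assume vs: "vs \<in> ?L"
    have 1: "((%(s, y). iter_deriv vs (?R (h s)) y) \<longlongrightarrow> iter_deriv vs (?R (h s0)) (snd c x)) (nhdsin S s0 \<times>\<^sub>F nhds (snd c x))"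
     using smooth_family_at_C[OF at c d xc hxd k] vs unfolding C_family_iff_iter_deriv by blast
    have "C_family k (nhdsin S s0) s0 (%_. ?R f) (snd c x)" by (rule C_germ_family[OF C_map_germ[OF diffeosD(3)[OF f] c d xc fxd k]])
    hence 2: "((%(s, y). iter_deriv vs (?R f) y) \<longlongrightarrow> iter_deriv vs (?R f) (snd c x)) (nhdsin S s0 \<times>\<^sub>F nhds (snd c x))"
     using vs unfolding C_family_iff_iter_deriv by blast
    have "((%(s, y). norm (iter_deriv vs (?R (h s)) y - iter_deriv vs (?R f) y)) \<longlongrightarrow>
      norm (iter_deriv vs (?R (h s0)) (snd c x) - iter_deriv vs (?R f) (snd c x))) (nhdsin S s0 \<times>\<^sub>F nhds (snd c x))"
     using tendsto_norm[OF tendsto_diff[OF 1 2]] by (simp add: case_prod_unfold)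
    from filterlim_chart_family[OF this filterlim_chart[OF c xc]]
    have "((%(s, x'). norm (iter_deriv vs (?R (h s)) (snd c x') - iter_deriv vs (?R f) (snd c x'))) \<longlongrightarrow>
      norm (iter_deriv vs (?R (h s0)) (snd c x) - iter_deriv vs (?R f) (snd c x))) (nhdsin S s0 \<times>\<^sub>F nhdsin X x)" .
    moreover have "norm (iter_deriv vs (?R (h s0)) (snd c x) - iter_deriv vs (?R f) (snd c x)) < eps" using hU x vs unfolding diff_nhd_def by auto
    ultimately show "\<forall>\<^sub>F p in nhdsin S s0 \<times>\<^sub>F nhdsin X x.
      norm (iter_deriv vs (?R (h (fst p))) (snd c (snd p)) - iter_deriv vs (?R f) (snd c (snd p))) < eps"
     unfolding case_prod_unfold by (rule order_tendstoD(2))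
   qed
   ultimately show "\<forall>\<^sub>F (s, x') in nhdsin S s0 \<times>\<^sub>F nhdsin X x. h s x' \<in> fst d &
     (x' \<in> fst c --> (\<forall>vs\<in>?L. norm (iter_deriv vs (?R (h s)) (snd c x') - iter_deriv vs (?R f) (snd c x')) < eps))"
    by (rule eventually_elim2) auto
  qed
  moreover have "\<forall>\<^sub>F s in nhdsin S s0. s \<in> topspace S" by (rule eventually_nhdsin_topspace)
  ultimately show "\<forall>\<^sub>F s in nhdsin S s0. s \<in> h -` U Int topspace S"
   by (rule eventually_elim2) (use dif Kc in \<open>auto simp: U diff_nhd_def\<close>)
 qed auto
qed

lemma carrier_Diff [simp]: "carrier (Diff r X A) = diffeos r X A"
 by (simp add: Diff_def)

lemma one_Diff [simp]: "\<one>\<^bsub>Diff r X A\<^esub> = (\<lambda>x\<in>Xs. x)"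
 by (simp add: Diff_def BijGroup_def)

lemma mult_Diff:
 "f \<in> diffeos r X A ==> g \<in> diffeos r X A ==> f \<otimes>\<^bsub>Diff r X A\<^esub> g = compose (Xs) f g"
 by (simp add: Diff_def BijGroup_def diffeos_def)

lemma mult_Diff_apply:
 "f \<in> diffeos r X A ==> g \<in> diffeos r X A ==> x \<in> Xs ==> (f \<otimes>\<^bsub>Diff r X A\<^esub> g) x = f (g x)"
 by (simp add: mult_Diff compose_eq)

lemma subgroup_diffeos: "subgroup (diffeos r X A) (BijGroup (Xs))"
proof -
 interpret B: group "BijGroup (Xs)" by (rule group_BijGroup)
 have inv: "inv\<^bsub>BijGroup (Xs)\<^esub> f = restrict (inv_into (Xs) f) (Xs)" if "f \<in> diffeos r X A" for f
  using that by (auto simp: diffeos_def intro!: inv_BijGroup)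
 show ?thesis
 proof
  show "diffeos r X A \<subseteq> carrier (BijGroup (Xs))" by (auto simp: diffeos_def BijGroup_def)
  show "\<one>\<^bsub>BijGroup (Xs)\<^esub> \<in> diffeos r X A"
  proof -
   have "restrict (%x. x) (Xs) \<in> diffeos r X A"
   proof (rule diffeosI)
    have "inv_into (Xs) (%x. x) x = x" if "x \<in> Xs" for x using that by (simp add: inv_into_f_eq)
    thus "C_map r X A (inv_into (Xs) (%x. x))" by (intro C_map_cong[OF _ C_map_ident]) simp
   qed (auto simp: C_map_ident bij_betw_def)
   thus ?thesis by (simp add: BijGroup_def)
  qed
  fix f g assume f: "f \<in> diffeos r X A" and g: "g \<in> diffeos r X A"
  have fg: "bij_betw (%x. f (g x)) (Xs) (Xs)" using bij_betw_trans[OF diffeosD(1)[OF g] diffeosD(1)[OF f]] by (simp add: o_def)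
  have "restrict (%x. f (g x)) (Xs) \<in> diffeos r X A"
  proof (rule diffeosI[OF fg])
   show "C_map r X A (%x. f (g x))" by (rule C_map_compose[OF diffeosD(3)[OF g] diffeosD(3)[OF f]])
   have C1: "C_map r X A (%x. inv_into (Xs) g (inv_into (Xs) f x))" by (rule C_map_compose[OF diffeosD(4)[OF f] diffeosD(4)[OF g]])
   have eq: "inv_into (Xs) (%x. f (g x)) x = inv_into (Xs) g (inv_into (Xs) f x)"
    if "x \<in> Xs" for x using fg that diffeo_inv[OF f] diffeo_inv[OF g] by (intro inv_into_f_eq) (auto simp: bij_betw_def)
   show "C_map r X A (inv_into (Xs) (%x. f (g x)))" by (rule C_map_cong[OF eq[symmetric] C1])
  qed
  thus "f \<otimes>\<^bsub>BijGroup (Xs)\<^esub> g \<in> diffeos r X A" using f g by (simp add: BijGroup_def diffeos_def compose_def)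
  let ?k = "inv_into (Xs) f"
  have k: "bij_betw ?k (Xs) (Xs)" using diffeosD(1)[OF f] by (rule bij_betw_inv_into)
  have "restrict ?k (Xs) \<in> diffeos r X A"
  proof (rule diffeosI[OF k diffeosD(4)[OF f]])
   show "C_map r X A (inv_into (Xs) ?k)" by (rule C_map_cong[OF _ diffeosD(3)[OF f]])
      (use diffeosD(1)[OF f] in \<open>simp add: inv_into_inv_into_eq\<close>)
  qed
  thus "inv\<^bsub>BijGroup (Xs)\<^esub> f \<in> diffeos r X A" using inv[OF f] by simp
 qed
qed

lemma group_Diff: "group (Diff r X A)"
 unfolding Diff_def by (rule subgroup.subgroup_is_group[OF subgroup_diffeos group_BijGroup])

lemma inv_Diff_apply:
 assumes "f \<in> diffeos r X A" "x \<in> Xs"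
 shows "(inv\<^bsub>Diff r X A\<^esub> f) x = inv_into (Xs) f x"
proof -
 interpret G: group "Diff r X A" by (rule group_Diff)
 have i: "inv\<^bsub>Diff r X A\<^esub> f \<in> diffeos r X A" using G.inv_closed assms(1) by simp
 have "f ((inv\<^bsub>Diff r X A\<^esub> f) x) = x" using G.r_inv[of f] assms mult_Diff_apply[OF assms(1) i assms(2)] by simp
 thus ?thesis using diffeo_inv(2)[OF assms(1) diffeo_in[OF i assms(2)]] by simp
qed

text \<open>Both group laws send the tautological families to smooth families.\<close>

lemma topological_group_Diff:
 assumes r: "1 <= r"
 shows "topological_group (Diff r X A) (Diff_topology r X A)" unfolding topological_group_def
proof (intro conjI)
 interpret G: group "Diff r X A" by (rule group_Diff)
 let ?tau = "Diff_topology r X A"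
 let ?P = "prod_topology ?tau ?tau"
 show "group (Diff r X A)" by (rule group_Diff)
 show "topspace ?tau = carrier (Diff r X A)" by simp
 have 1: "smooth_family r ?P fst" and 2: "smooth_family r ?P snd"
  by (rule continuous_map_imp_smooth_family, rule continuous_map_fst continuous_map_snd)+
 have "smooth_family r ?P (%p x. fst p (snd p x))"
 proof (intro ballI)
  fix p x assume p: "p \<in> topspace ?P" and x: "x \<in> Xs"
  show "smooth_family_at r ?P (%p x. fst p (snd p x)) p x" using smooth_family_at_compose[OF p x, of r snd fst] 1 2 p x diffeo_in by auto
 qed
 hence "smooth_family r ?P (%p. fst p \<otimes>\<^bsub>Diff r X A\<^esub> snd p)"
  using smooth_family_at_cong[of _ ?P _ "%p x. fst p (snd p x)" "%p. fst p \<otimes>\<^bsub>Diff r X A\<^esub> snd p" r]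
  by (auto simp: mult_Diff_apply)
 hence "continuous_map ?P ?tau (%p. fst p \<otimes>\<^bsub>Diff r X A\<^esub> snd p)"
  by (rule smooth_family_imp_continuous_map) (use G.m_closed in auto)
 thus "continuous_map ?P ?tau (%(g, h). g \<otimes>\<^bsub>Diff r X A\<^esub> h)" by (simp add: case_prod_unfold)
 have id: "smooth_family r ?tau (%g. g)" by (rule continuous_map_imp_smooth_family) simp
 have "smooth_family r ?tau (%g. inv_into (Xs) g)" by (rule smooth_family_inverse[OF id r]) (auto simp: diffeo_inv diffeosD)
 hence "smooth_family r ?tau (%g. inv\<^bsub>Diff r X A\<^esub> g)"
  using smooth_family_at_cong[of _ ?tau _ "%g. inv_into (Xs) g" "%g. inv\<^bsub>Diff r X A\<^esub> g" r] by (auto simp: inv_Diff_apply)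
 thus "continuous_map ?tau ?tau (%g. inv\<^bsub>Diff r X A\<^esub> g)" by (rule smooth_family_imp_continuous_map) (use G.inv_closed in auto)
qed

end

section \<open>Test functions\<close>

lemma iter_deriv_cong_open:
 assumes "open U" "!!x. x \<in> U ==> f x = g x" "x \<in> U"
 shows "iter_deriv vs f x = iter_deriv vs g x" using assms(3)
proof (induction vs arbitrary: x)
 case (Cons v vs)
 have "\<forall>\<^sub>F y in nhds x. iter_deriv vs f y = iter_deriv vs g y" using Cons assms(1) by (auto simp: eventually_nhds)
 thus ?case using frechet_derivative_cong_nhds(1) by fastforce
qed (simp add: assms)

definition bump :: "'e::euclidean_space => real => 'e => real" where
 "bump p rho y = flat_exp 0 (4 - (norm (y - p) / rho)\<^sup>2) *
   inverse (flat_exp 0 (4 - (norm (y - p) / rho)\<^sup>2) + flat_exp 0 ((norm (y - p) / rho)\<^sup>2 - 1))"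

lemma bump_pos_denominator: "flat_exp 0 (4 - s) + flat_exp 0 (s - 1) > (0::real)"
proof (cases "s < 4")
 case True
 hence "flat_exp 0 (4 - s) > 0" by (simp add: flat_exp_bounds(3))
 thus ?thesis using flat_exp_bounds(1)[of "s - 1"] by linarith
next
 case False
 hence "flat_exp 0 (s - 1) > 0" by (simp add: flat_exp_bounds(3))
 thus ?thesis using flat_exp_bounds(1)[of "4 - s"] by linarith
qed

lemma C_germ_norm_square: "C_germ n (%y. (norm (y - p) / rho)\<^sup>2) y"
proof -
 have F: "principal {()} <= principal {()}" by simp
 have id: "C_germ n (%y. y - p) y" by (intro C_family_minus[OF F] C_family_const[OF F] C_family_bounded_linear[OF F bounded_linear_ident])
 have "C_germ n (%y. ((y - p) \<bullet> (y - p)) * inverse (rho\<^sup>2)) y"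
  by (intro C_family_mult[OF F] C_family_bilinear[OF F bounded_bilinear_inner] id C_family_const[OF F])
 moreover have "(norm (y - p) / rho)\<^sup>2 = ((y - p) \<bullet> (y - p)) * inverse (rho\<^sup>2)" for y
  by (simp add: dot_square_norm divide_inverse power_mult_distrib power_inverse)
 ultimately show ?thesis by simp
qed

lemma C_germ_flat_exp_compose:
 assumes "C_germ n g y" shows "C_germ n (%y. flat_exp k (g y)) y"
 by (rule C_family_compose[OF _ assms, of "%_. flat_exp k"]) (simp_all add: C_germ_flat_exp)

lemma C_germ_bump: "C_germ n (bump p rho) y"
proof -
 have F: "principal {()} <= principal {()}" by simp
 let ?s = "%y. (norm (y - p) / rho)\<^sup>2"
 have 1: "C_germ n (%y. flat_exp 0 (4 - ?s y)) y" and 2: "C_germ n (%y. flat_exp 0 (?s y - 1)) y"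
  by (intro C_germ_flat_exp_compose C_family_minus[OF F] C_family_const[OF F] C_germ_norm_square)+
 show ?thesis unfolding bump_def[abs_def] by (intro C_family_mult[OF F] 1 C_family_inverse_real[OF F] C_family_add[OF F] 2)
    (use bump_pos_denominator in \<open>simp add: less_imp_neq[symmetric]\<close>)
qed

lemma bump_eq_1: "0 < rho ==> dist p y <= rho ==> bump p rho y = 1"
proof -
 assume "0 < rho" "dist p y <= rho"
 hence "norm (y - p) / rho <= 1" by (simp add: dist_norm norm_minus_commute)
 hence s: "(norm (y - p) / rho)\<^sup>2 <= 1" using \<open>0 < rho\<close> by (simp add: power_le_one)
 have "flat_exp 0 ((norm (y - p) / rho)\<^sup>2 - 1) = 0" using s by (simp add: flat_exp_def)
 moreover have "flat_exp 0 (4 - (norm (y - p) / rho)\<^sup>2) > 0" using s by (simp add: flat_exp_bounds(3))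
 ultimately show ?thesis by (simp add: bump_def)
qed

lemma bump_eq_0: "0 < rho ==> 2 * rho <= dist p y ==> bump p rho y = 0"
proof -
 assume "0 < rho" "2 * rho <= dist p y"
 hence "2 <= norm (y - p) / rho" by (simp add: dist_norm norm_minus_commute field_simps)
 hence "2\<^sup>2 <= (norm (y - p) / rho)\<^sup>2" by (rule power_mono) simp
 thus ?thesis by (simp add: bump_def flat_exp_def)
qed

text \<open>Balls of half the admissible radius cover the manifold, which leaves room for cut-off functions.\<close>

locale covered_manifold = compact_manifold X A
 for X :: "'m topology" and A :: "('m, 'e::euclidean_space) chart set" +
 fixes N :: nat and c :: "nat => ('m, 'e) chart" and a :: "nat => 'e" and R :: "nat => real"
 assumes cA: "i < N ==> c i \<in> A"
  and R: "i < N ==> 0 < R i" "i < N ==> R i <= 1"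
  and cball_chart: "i < N ==> cball (a i) (2 * R i) \<subseteq> snd (c i) ` fst (c i)"
  and cover: "x \<in> Xs ==> \<exists>i<N. x \<in> fst (c i) & snd (c i) x \<in> ball (a i) (R i)"

lemma (in compact_manifold) finite_chart_cover:
 obtains N c a R where "covered_manifold X A N c a R"
proof -
 have "\<exists>q. fst q \<in> A & x \<in> fst (fst q) & 0 < snd q & snd q <= 1 &
   cball (snd (fst q) x) (2 * snd q) \<subseteq> snd (fst q) ` fst (fst q)" if xX: "x \<in> Xs" for x
 proof -
  obtain d where d: "d \<in> A" "x \<in> fst d" using chart_exists[OF xX] by blast
  then obtain e where e: "e > 0" "cball (snd d x) e \<subseteq> snd d ` fst d" using chart_facts(2)[OF d(1)] open_contains_cball by (metis imageI)
  have "cball (snd d x) (2 * min 1 (e / 2)) \<subseteq> snd d ` fst d" using subset_trans[OF subset_cball e(2)] by auto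
  thus ?thesis using d e by (intro exI[of _ "(d, min 1 (e / 2))"]) auto
 qed
 hence "\<forall>x\<in>Xs. \<exists>q. fst q \<in> A & x \<in> fst (fst q) & 0 < snd q & snd q <= 1 &
   cball (snd (fst q) x) (2 * snd q) \<subseteq> snd (fst q) ` fst (fst q)" by blast
 from bchoice[OF this] obtain q where q: "\<forall>x\<in>Xs. fst (q x) \<in> A & x \<in> fst (fst (q x)) & 0 < snd (q x) &
   snd (q x) <= 1 & cball (snd (fst (q x)) x) (2 * snd (q x)) \<subseteq> snd (fst (q x)) ` fst (fst (q x))" ..
 define V where "V = (%x. {z \<in> fst (fst (q x)). snd (fst (q x)) z \<in> ball (snd (fst (q x)) x) (snd (q x))})"
 have "openin X (V x)" "x \<in> V x" if "x \<in> Xs" for x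
  using q that openin_chart_preimage[of "fst (q x)" "ball (snd (fst (q x)) x) (snd (q x))"] by (auto simp: V_def)
 hence "\<forall>U\<in>V ` Xs. openin X U" "Xs \<subseteq> \<Union>(V ` Xs)" by auto
 then obtain \<F> where \<F>: "finite \<F>" "\<F> \<subseteq> V ` Xs" "Xs \<subseteq> \<Union>\<F>" using compact unfolding compact_space_alt by meson
 then obtain J where J: "finite J" "J \<subseteq> Xs" "\<F> = V ` J" using finite_subset_image by meson
 obtain xs where xs: "set xs = J" using J finite_list by blast
 have in_xs: "xs ! i \<in> Xs" if "i < length xs" for i using that xs J by (metis nth_mem subsetD)
 have "covered_manifold X A (length xs) (%i. fst (q (xs ! i))) (%i. snd (fst (q (xs ! i))) (xs ! i)) (%i. snd (q (xs ! i)))"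
 proof
  fix x assume "x \<in> Xs"
  then obtain z where z: "z \<in> J" "x \<in> V z" using \<F> J by auto
  then obtain i where "i < length xs" "xs ! i = z" using xs by (metis in_set_conv_nth)
  thus "\<exists>i<length xs. x \<in> fst (fst (q (xs ! i))) &
    snd (fst (q (xs ! i))) x \<in> ball (snd (fst (q (xs ! i))) (xs ! i)) (snd (q (xs ! i)))" using z by (auto simp: V_def)
 qed (use q in_xs in auto)
 thus ?thesis by (rule that)
qed

context covered_manifold
begin

definition V :: "nat => 'm set" where
 "V i = {x \<in> fst (c i). snd (c i) x \<in> ball (a i) (R i)}"

lemma openin_V: "i < N ==> openin X (V i)"
 unfolding V_def by (rule openin_chart_preimage[OF cA open_ball])

lemma V_subset: "V i \<subseteq> fst (c i)"
 by (auto simp: V_def)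

lemma V_cover: "x \<in> Xs ==> \<exists>i<N. x \<in> V i"
 using cover by (auto simp: V_def)

lemma ball_chart: "i < N ==> cball (a i) (R i) \<subseteq> snd (c i) ` fst (c i)"
 using cball_chart[of i] R[of i] subset_cball[of "R i" "2 * R i" "a i"] by auto

text \<open>The second component records the cut-off, so that the coordinates can be recovered where it does not vanish.\<close>

definition profile :: "nat => 'e => 'e \<times> real" where
 "profile j y = (bump (a j) (R j) y *\<^sub>R y, bump (a j) (R j) y)"

definition test :: "nat => 'm => 'e \<times> real" where
 "test j x = (if x \<in> fst (c j) then profile j (snd (c j) x) else 0)"

definition test_rep :: "nat => nat => ('m => 'm) => 'e => 'e \<times> real" where
 "test_rep i j f = test j \<circ> f \<circ> ichart (c i)"

lemma C_germ_profile: "C_germ n (profile j) y"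
proof -
 have F: "principal {()} <= principal {()}" by simp
 have 1: "bounded_linear (%x::'e. (x, 0::real))" and 2: "bounded_linear (%x::real. (0::'e, x))"
  by (intro bounded_linear_Pair bounded_linear_ident bounded_linear_zero)+
 have "C_germ n (%y. (bump (a j) (R j) y *\<^sub>R y, 0::real) + (0, bump (a j) (R j) y)) y"
  by (intro C_family_add[OF F] C_family_linear_image[OF F 1] C_family_linear_image[OF F 2] C_family_scaleR[OF F]
    C_germ_bump C_family_bounded_linear[OF F bounded_linear_ident])
 thus ?thesis by (simp add: profile_def[abs_def])
qed

lemma test_V: "i < N ==> x \<in> V i ==> test i x = (snd (c i) x, 1)"
 using R[of i] bump_eq_1[of "R i" "a i" "snd (c i) x"] by (auto simp: test_def V_def profile_def)

lemma test_outside: "i < N ==> x \<notin> ichart (c i) ` cball (a i) (2 * R i) ==> test i x = 0"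
proof -
 assume i: "i < N" and x: "x \<notin> ichart (c i) ` cball (a i) (2 * R i)"
 have "bump (a i) (R i) (snd (c i) x) = 0" if xc: "x \<in> fst (c i)"
 proof (rule bump_eq_0)
  have "snd (c i) x \<notin> cball (a i) (2 * R i)" using x chart_inverse[OF cA[OF i] xc] by (metis imageI)
  thus "2 * R i <= dist (a i) (snd (c i) x)" by simp
 qed (use R i in auto)
 thus ?thesis by (simp add: test_def profile_def zero_prod_def)
qed

lemma support_subset: "j < N ==> ichart (c j) ` cball (a j) (2 * R j) \<subseteq> fst (c j)"
 by (auto intro!: ichart_in[OF subsetD[OF cball_chart]] simp del: mem_cball)

lemma test_injective:
 assumes "x \<in> Xs" "!!j. j < N ==> test j x = test j y"
 shows "x = y"
proof -
 obtain j where j: "j < N" "x \<in> V j" using V_cover assms(1) by blast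
 have t: "test j y = (snd (c j) x, 1)" using assms(2)[OF j(1)] test_V[OF j] by simp
 hence y: "y \<in> fst (c j)" by (auto simp: test_def zero_prod_def split: if_splits)
 hence "snd (c j) y = snd (c j) x" using t by (auto simp: test_def profile_def)
 thus ?thesis using y j chart_inverse[OF cA[OF j(1)]] V_subset by (metis subsetD)
qed

lemma filterlim_test:
 assumes "x \<in> Xs" "j < N"
 shows "(test j \<longlongrightarrow> test j x) (nhdsin X x)"
proof (cases "x \<in> fst (c j)")
 case True
 have "(profile j \<longlongrightarrow> profile j (snd (c j) x)) (nhds (snd (c j) x))"
  using C_family_tendsto[OF C_germ_profile[of 0 j "snd (c j) x"]] by (simp add: tendsto_unit_times)
 from filterlim_compose[OF this filterlim_chart[OF cA[OF assms(2)] True]]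
 have "((%x. profile j (snd (c j) x)) \<longlongrightarrow> profile j (snd (c j) x)) (nhdsin X x)" .
 moreover have "\<forall>\<^sub>F y in nhdsin X x. profile j (snd (c j) y) = test j y"
  using eventually_nhdsin_open[OF chart_facts(1)[OF cA[OF assms(2)]] True] by (rule eventually_mono) (simp add: test_def)
 ultimately show ?thesis using True by (simp add: test_def[of j x] Lim_transform_eventually)
next
 case False
 have "closedin X (ichart (c j) ` cball (a j) (2 * R j))"
  by (rule compactin_imp_closedin[OF Hausdorff compactin_ichart[OF cA compact_cball cball_chart]]) (use assms in auto)
 hence op: "openin X (Xs - ichart (c j) ` cball (a j) (2 * R j))" by blast
 have "x \<notin> ichart (c j) ` cball (a j) (2 * R j)" using False support_subset[OF assms(2)] by auto
 hence "\<forall>\<^sub>F y in nhdsin X x. y \<in> Xs - ichart (c j) ` cball (a j) (2 * R j)" using eventually_nhdsin_open[OF op] assms(1) by simp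
 hence "\<forall>\<^sub>F y in nhdsin X x. 0 = test j y" by (rule eventually_mono) (simp add: test_outside[OF assms(2)])
 thus ?thesis using False by (auto simp: test_def[of j x] intro: Lim_transform_eventually[OF tendsto_const])
qed

text \<open>On \<open>V j\<close> the test function is the chart, so convergence of its values is convergence in the manifold.\<close>

lemma test_limit:
 assumes j: "j < N" "z \<in> V j" and t: "((%s. test j (u s)) \<longlongrightarrow> test j z) F"
 shows "\<forall>\<^sub>F s in F. u s \<in> V j" "((%s. snd (c j) (u s)) \<longlongrightarrow> snd (c j) z) F" "filterlim u (nhdsin X z) F"
proof -
 have z: "test j z = (snd (c j) z, 1)" "z \<in> fst (c j)" using test_V[OF j] j V_subset by auto
 have b: "((%s. snd (test j (u s))) \<longlongrightarrow> 1) F" using tendsto_snd[OF t] z by simp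
 have w: "((%s. inverse (snd (test j (u s))) *\<^sub>R fst (test j (u s))) \<longlongrightarrow> snd (c j) z) F"
  using tendsto_scaleR[OF tendsto_inverse[OF b] tendsto_fst[OF t]] z by simp
 have ev: "\<forall>\<^sub>F s in F. u s \<in> fst (c j) & inverse (snd (test j (u s))) *\<^sub>R fst (test j (u s)) = snd (c j) (u s)"
  using tendsto_imp_eventually_ne[OF b, of 0] by (rule eventually_mono) (auto simp: test_def profile_def split: if_splits)
 thus lim: "((%s. snd (c j) (u s)) \<longlongrightarrow> snd (c j) z) F" by (intro Lim_transform_eventually[OF w]) (auto elim: eventually_mono)
 have "\<forall>\<^sub>F s in F. snd (c j) (u s) \<in> ball (a j) (R j)" using topological_tendstoD[OF lim open_ball] j by (simp add: V_def)
 with ev show "\<forall>\<^sub>F s in F. u s \<in> V j" by eventually_elim (simp add: V_def)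
 have "filterlim (%s. ichart (c j) (snd (c j) (u s))) (nhdsin X z) F" by (rule filterlim_compose[OF filterlim_ichart[OF cA[OF j(1)] z(2)] lim])
 thus "filterlim u (nhdsin X z) F" by (rule filterlim_mono_eventually) (use ev cA[OF j(1)] in \<open>auto elim: eventually_mono\<close>)
qed

lemma C_family_test_rep:
 assumes s0: "s0 \<in> topspace S" and h: "smooth_family_at r S h s0 x0"
  and i: "i < N" "x0 \<in> fst (c i)" and j: "j < N" and n: "enat n <= r"
 shows "C_family n (nhdsin S s0) s0 (%s. test_rep i j (h s)) (snd (c i) x0)"
proof (cases "h s0 x0 \<in> fst (c j)")
 case True
 note F = principal_le_nhdsin[OF s0]
 have 1: "C_family n (nhdsin S s0) s0 (%s y. profile j (local_rep (c i) (c j) (h s) y)) (snd (c i) x0)"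
  by (rule C_family_compose[OF F smooth_family_at_C[OF h cA[OF i(1)] cA[OF j] i(2) True n], of "%_. profile j"])
    (rule C_germ_family[OF C_germ_profile])
 show ?thesis
 proof (rule C_family_cong_imp[OF F _ 1])
  show "\<forall>\<^sub>F (s, y) in nhdsin S s0 \<times>\<^sub>F nhds (snd (c i) x0).
    profile j (local_rep (c i) (c j) (h s) y) = test_rep i j (h s) y"
   using eventually_family_chart[OF cA[OF i(1)] i(2) smooth_family_at_lim(1)[OF h] chart_facts(1)[OF cA[OF j]] True]
   by (rule eventually_mono) (auto simp: test_rep_def test_def local_rep_def)
 qed
next
 case False
 note F = principal_le_nhdsin[OF s0]
 have "closedin X (ichart (c j) ` cball (a j) (2 * R j))"
  by (rule compactin_imp_closedin[OF Hausdorff compactin_ichart[OF cA compact_cball cball_chart]]) (use j in auto)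
 hence op: "openin X (Xs - ichart (c j) ` cball (a j) (2 * R j))" by blast
 have hin: "h s0 x0 \<in> Xs - ichart (c j) ` cball (a j) (2 * R j)" using False support_subset[OF j] smooth_family_at_lim(2)[OF h] by auto
 show ?thesis
 proof (rule C_family_cong_imp[OF F _ C_family_const[OF F, of n 0]])
  show "\<forall>\<^sub>F (s, y) in nhdsin S s0 \<times>\<^sub>F nhds (snd (c i) x0). 0 = test_rep i j (h s) y"
   using eventually_family_chart[OF cA[OF i(1)] i(2) smooth_family_at_lim(1)[OF h] op hin]
   by (rule eventually_mono) (auto simp: test_rep_def test_outside[OF j])
 qed
qed

text \<open>Finitely many globally defined functions detect smoothness, without choosing charts around the image.\<close>

lemma smooth_family_at_test:
 assumes s0: "s0 \<in> topspace S" and hx: "h s0 x0 \<in> Xs"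
  and i: "i < N" "x0 \<in> fst (c i)"
  and C: "!!j n. j < N ==> enat n <= r ==> C_family n (nhdsin S s0) s0 (%s. test_rep i j (h s)) (snd (c i) x0)"
 shows "smooth_family_at r S h s0 x0"
proof -
 note F = principal_le_nhdsin[OF s0]
 obtain j where j: "j < N" "h s0 x0 \<in> V j" using V_cover hx by blast
 have 0: "enat 0 <= r" by (simp add: zero_enat_def[symmetric])
 have "((%(s, y). test_rep i j (h s) y) \<longlongrightarrow> test_rep i j (h s0) (snd (c i) x0)) (nhdsin S s0 \<times>\<^sub>F nhds (snd (c i) x0))"
  by (rule C_family_tendsto[OF C[OF j(1) 0]])
 hence t: "((%p. test j (h (fst p) (ichart (c i) (snd p)))) \<longlongrightarrow> test j (h s0 x0)) (nhdsin S s0 \<times>\<^sub>F nhds (snd (c i) x0))"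
  using i cA[OF i(1)] by (simp add: test_rep_def case_prod_unfold)
 have "filterlim (%(s, y). h s (ichart (c i) y)) (nhdsin X (h s0 x0)) (nhdsin S s0 \<times>\<^sub>F nhds (snd (c i) x0))"
  using test_limit(3)[OF j t] by (simp add: case_prod_unfold)
 from filterlim_chart_family[OF this filterlim_chart[OF cA[OF i(1)] i(2)]]
 have "filterlim (%(s, x). h s (ichart (c i) (snd (c i) x))) (nhdsin X (h s0 x0)) (nhdsin S s0 \<times>\<^sub>F nhdsin X x0)" .
 hence lim: "filterlim (%(s, x). h s x) (nhdsin X (h s0 x0)) (nhdsin S s0 \<times>\<^sub>F nhdsin X x0)"
 proof (rule filterlim_mono_eventually)
  have "\<forall>\<^sub>F p in nhdsin S s0 \<times>\<^sub>F nhdsin X x0. snd p \<in> fst (c i)"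
   by (rule eventually_compose_filterlim[OF eventually_nhdsin_open[OF chart_facts(1)[OF cA[OF i(1)]] i(2)] filterlim_snd])
  thus "\<forall>\<^sub>F p in nhdsin S s0 \<times>\<^sub>F nhdsin X x0.
    (case p of (s, x) => h s (ichart (c i) (snd (c i) x))) = (case p of (s, x) => h s x)"
   by (rule eventually_mono) (use cA[OF i(1)] in \<open>auto simp: case_prod_unfold\<close>)
 qed auto
 show ?thesis
 proof (rule smooth_family_atI[where h = h, OF s0 cA[OF i(1)] i(2) cA[OF j(1)] _ lim])
  show "h s0 x0 \<in> fst (c j)" using j V_subset by blast
  fix n assume n: "enat n <= r"
  show "C_family n (nhdsin S s0) s0 (%s. local_rep (c i) (c j) (h s)) (snd (c i) x0)"
  proof (rule C_family_cong_imp[OF F _ C_family_linear_image[OF F bounded_linear_fst C[OF j(1) n]]])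
   show "\<forall>\<^sub>F (s, y) in nhdsin S s0 \<times>\<^sub>F nhds (snd (c i) x0).
     fst (test_rep i j (h s) y) = local_rep (c i) (c j) (h s) y" using test_limit(1)[OF j t]
    by (rule eventually_mono) (auto simp: test_rep_def local_rep_def test_V[OF j(1)])
  qed
 qed
qed

lemma C_germ_test_rep:
 assumes "C_map r X A f" "i < N" "j < N" "y \<in> snd (c i) ` fst (c i)" "enat n <= r"
 shows "C_germ n (test_rep i j f) y"
proof -
 obtain x where x: "x \<in> fst (c i)" "y = snd (c i) x" using assms(4) by blast
 have "x \<in> Xs" using chart_subset[OF cA[OF assms(2)]] x by blast
 hence "smooth_family_at r one_point (%_. f) () x" using assms(1) by (simp add: C_map_iff_smooth_family)
 from C_family_test_rep[OF _ this assms(2) x(1) assms(3,5)] show ?thesis using x by (simp add: nhdsin_unit)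
qed

lemma C_on_test_rep:
 assumes "C_map r X A f" "i < N" "j < N" "U \<subseteq> snd (c i) ` fst (c i)" "open U"
 shows "C_on r U (test_rep i j f)" unfolding C_on_iff_germ[OF assms(5)] using C_germ_test_rep[OF assms(1-3)] assms(4) by blast

abbreviation "BCF \<equiv> apply_bcontfun"

lemma isCont_apply_bcontfun: "isCont (BCF f) x"
 using continuous_on_apply_bcontfun[of UNIV f] continuous_on_eq_continuous_at[OF open_UNIV] by blast

section \<open>The diffeomorphism group is Polish\<close>

text \<open>Composition with this retraction extends a function on the closed ball to a bounded continuous one.\<close>

definition proj :: "nat => 'e => 'e" where
 "proj i = closest_point (cball (a i) (R i))"

lemma proj_in: "i < N ==> proj i y \<in> cball (a i) (R i)"
 unfolding proj_def using R[of i] by (intro closest_point_in_set) auto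

lemma proj_self: "y \<in> cball (a i) (R i) ==> proj i y = y"
 unfolding proj_def by (rule closest_point_self)

lemma continuous_proj: "i < N ==> continuous_on UNIV (proj i)"
 unfolding proj_def using R[of i] by (intro continuous_on_closest_point) auto

lemma jet_bcontfun:
 assumes f: "C_map r X A f" and i: "i < N" and j: "j < N" and vs: "set vs \<subseteq> Basis" "enat (length vs) <= r"
 shows "(%y. iter_deriv vs (test_rep i j f) (proj i y)) \<in> bcontfun"
proof -
 have "C_on r (snd (c i) ` fst (c i)) (test_rep i j f)" by (rule C_on_test_rep[OF f i j subset_refl chart_facts(2)[OF cA[OF i]]])
 hence "continuous_on (snd (c i) ` fst (c i)) (iter_deriv vs (test_rep i j f))" using vs by (auto simp: C_on_def)
 hence cont: "continuous_on (cball (a i) (R i)) (iter_deriv vs (test_rep i j f))" using ball_chart[OF i] continuous_on_subset by blast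
 have "continuous_on UNIV (%y. iter_deriv vs (test_rep i j f) (proj i y))"
  by (rule continuous_on_compose2[OF cont continuous_proj[OF i]]) (use proj_in[OF i] in auto)
 moreover have "bounded (range (%y. iter_deriv vs (test_rep i j f) (proj i y)))"
  using compact_imp_bounded[OF compact_continuous_image[OF cont compact_cball]] by (rule bounded_subset) (use proj_in[OF i] in auto)
 ultimately show ?thesis by (simp add: bcontfun_def)
qed

lemma set_map_basis_vec: "set (map basis_vec us) \<subseteq> Basis"
 by auto

type_synonym ('f) jet_index = "(nat \<times> nat \<times> 'f coord list) \<times> bool"

definition jet :: "enat => nat \<times> nat \<times> 'e coord list => ('m => 'm) => 'e \<Rightarrow>\<^sub>C ('e \<times> real)" where
 "jet r = (%(i, j, us) f. if i < N & j < N & enat (length us) <= r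
   then Bcontfun (%y. iter_deriv (map basis_vec us) (test_rep i j f) (proj i y)) else 0)"

text \<open>The map and its inverse are both recorded, since a limit of diffeomorphisms need not be injective.\<close>

definition jets :: "enat => ('m => 'm) => 'e jet_index => 'e \<Rightarrow>\<^sub>C ('e \<times> real)" where
 "jets r f = (%(k, b). jet r k (if b then f else inv_into (Xs) f))"

lemma jet_apply:
 assumes "C_map r X A f" "i < N" "j < N" "enat (length us) <= r"
 shows "BCF (jet r (i, j, us) f) y = iter_deriv (map basis_vec us) (test_rep i j f) (proj i y)"
 using jet_bcontfun[OF assms(1-3) set_map_basis_vec, of us] assms by (simp add: jet_def Bcontfun_inverse)

lemma continuous_map_jet:
 assumes h: "smooth_family r S h" and C: "!!s. s \<in> topspace S ==> C_map r X A (h s)"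
 shows "continuous_map S euclidean (%s. jet r k (h s))"
proof -
 obtain i j us where k: "k = (i, j, us)" by (metis prod_cases3)
 show ?thesis
 proof (cases "i < N & j < N & enat (length us) <= r")
  case False
  hence "jet r k f = 0" for f by (auto simp: k jet_def)
  thus ?thesis by simp
 next
  case True
  hence i: "i < N" and j: "j < N" and us: "enat (length us) <= r" by auto
  let ?D = "%s. iter_deriv (map basis_vec us) (test_rep i j (h s))"
  show ?thesis unfolding continuous_map_iff_nhdsin
  proof (intro ballI conjI)
   fix s0 assume s0: "s0 \<in> topspace S"
   have "((%s. jet r k (h s)) \<longlongrightarrow> jet r k (h s0)) (nhdsin S s0)"
   proof (rule tendstoI)
    fix eps :: real assume eps: "eps > 0"
    have "\<forall>\<^sub>F s in nhdsin S s0. \<forall>y\<in>cball (a i) (R i). dist (?D s y) (?D s0 y) < eps / 2"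
    proof (rule eventually_compactin_uniform[where X = euclidean])
     show "compactin euclidean (cball (a i) (R i))" by simp
     fix y assume y: "y \<in> cball (a i) (R i)"
     then obtain x where x: "x \<in> fst (c i)" "y = snd (c i) x" using ball_chart[OF i] by blast
     have xX: "x \<in> Xs" using chart_subset[OF cA[OF i]] x by blast
     have C1: "C_family (length us) (nhdsin S s0) s0 (%s. test_rep i j (h s)) y" using C_family_test_rep[OF s0 _ i x(1) j us] h s0 xX x by blast
     have 1: "((%(s, y). ?D s y) \<longlongrightarrow> ?D s0 y) (nhdsin S s0 \<times>\<^sub>F nhds y)"
      using C1[unfolded C_family_iff_iter_deriv, THEN spec[of _ "map basis_vec us"]] set_map_basis_vec[of us] by simp
     have C2: "C_germ (length us) (test_rep i j (h s0)) y" using C_germ_test_rep[OF C[OF s0] i j _ us] x by blast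
     have 2: "((%(s, y). ?D s0 y) \<longlongrightarrow> ?D s0 y) (nhdsin S s0 \<times>\<^sub>F nhds y)"
      using C_germ_family[OF C2, of "nhdsin S s0" s0, unfolded C_family_iff_iter_deriv, THEN spec[of _ "map basis_vec us"]]
      set_map_basis_vec[of us] by simp
     have "((%(s, y). dist (?D s y) (?D s0 y)) \<longlongrightarrow> 0) (nhdsin S s0 \<times>\<^sub>F nhds y)"
      using tendsto_dist[OF 1 2] by (simp add: case_prod_unfold)
     hence "\<forall>\<^sub>F p in nhdsin S s0 \<times>\<^sub>F nhds y. (case p of (s, y) => dist (?D s y) (?D s0 y)) < eps / 2"
      using eps by (intro order_tendstoD(2)) auto
     thus "\<forall>\<^sub>F (s, y') in nhdsin S s0 \<times>\<^sub>F nhdsin euclidean y. dist (?D s y') (?D s0 y') < eps / 2"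
      by (simp add: case_prod_unfold)
    qed
    thus "\<forall>\<^sub>F s in nhdsin S s0. dist (jet r k (h s)) (jet r k (h s0)) < eps" using eventually_nhdsin_topspace
    proof eventually_elim
     case (elim s)
     have "dist (jet r k (h s)) (jet r k (h s0)) <= eps / 2"
      using elim proj_in[OF i] by (intro dist_bound) (auto simp: k jet_apply[OF C] s0 i j us intro!: less_imp_le)
     thus ?case using eps by simp
    qed
   qed
   thus "filterlim (%s. jet r k (h s)) (nhdsin euclidean (jet r k (h s0))) (nhdsin S s0)" by simp
  qed simp
 qed
qed

lemma smooth_family_jet:
 assumes C: "!!s. s \<in> topspace S ==> C_map r X A (h s)"
  and lim: "!!i j us y0 s0. s0 \<in> topspace S ==> i < N ==> j < N ==> enat (length us) <= r ==> y0 \<in> ball (a i) (R i) ==>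
   ((%(s, y). iter_deriv (map basis_vec us) (test_rep i j (h s)) y) \<longlongrightarrow>
    iter_deriv (map basis_vec us) (test_rep i j (h s0)) y0) (nhdsin S s0 \<times>\<^sub>F nhds y0)"
 shows "smooth_family r S h"
proof (intro ballI)
 fix s0 x0 assume s0: "s0 \<in> topspace S" and x0: "x0 \<in> Xs"
 obtain i where i: "i < N" "x0 \<in> V i" using V_cover x0 by blast
 hence xi: "x0 \<in> fst (c i)" "snd (c i) x0 \<in> ball (a i) (R i)" by (auto simp: V_def)
 show "smooth_family_at r S h s0 x0"
 proof (rule smooth_family_at_test[where h = h, OF s0 C_map_in[OF C[OF s0] x0] i(1) xi(1)])
  fix j n assume j: "j < N" and n: "enat n <= r"
  show "C_family n (nhdsin S s0) s0 (%s. test_rep i j (h s)) (snd (c i) x0)" unfolding C_family_iff_iter_deriv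
  proof (intro allI impI conjI)
   fix vs :: "'e list" assume vs: "set vs \<subseteq> Basis & length vs <= n"
   define us where "us = map (inv_into UNIV basis_vec) vs"
   have us: "map basis_vec us = vs"
   proof -
    have "basis_vec (inv_into UNIV basis_vec v) = v" if "v \<in> set vs" for v
     using that vs bij_betw_basis_vec by (intro f_inv_into_f) (auto simp: bij_betw_def)
    thus ?thesis by (simp add: us_def map_idI)
   qed
   have "enat (length us) <= r" using vs n by (simp add: us_def) (meson enat_ord_simps(1) order_trans)
   from lim[OF s0 i(1) j this xi(2)]
   show "((%(s, y). iter_deriv vs (test_rep i j (h s)) y) \<longlongrightarrow>
    iter_deriv vs (test_rep i j (h s0)) (snd (c i) x0)) (nhdsin S s0 \<times>\<^sub>F nhds (snd (c i) x0))" unfolding us .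
   assume lt: "length vs < n"
   have "\<forall>\<^sub>F y in nhds (snd (c i) x0). y \<in> snd (c i) ` fst (c i)" by (rule eventually_in_chart[OF cA[OF i(1)] xi(1)])
   from eventually_prodI[OF eventually_nhdsin_topspace this]
   show "\<forall>\<^sub>F (s, y) in nhdsin S s0 \<times>\<^sub>F nhds (snd (c i) x0). iter_deriv vs (test_rep i j (h s)) differentiable at y"
   proof (rule eventually_mono)
    fix p assume p: "fst p \<in> topspace S & snd p \<in> snd (c i) ` fst (c i)"
    have "C_germ n (test_rep i j (h (fst p))) (snd p)" by (rule C_germ_test_rep[OF C i(1) j _ n]) (use p in auto)
    hence "\<forall>\<^sub>F y in nhds (snd p). iter_deriv vs (test_rep i j (h (fst p))) differentiable at y"
     using vs lt unfolding C_family_iff_iter_deriv eventually_unit_times by blast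
    hence "iter_deriv vs (test_rep i j (h (fst p))) differentiable at (snd p)" by (rule eventually_nhds_x_imp_x)
    thus "case p of (s, y) => iter_deriv vs (test_rep i j (h s)) differentiable at y" by (simp add: case_prod_unfold)
   qed
  qed
 qed
qed

lemma smooth_family_continuous_jets:
 assumes C: "!!s. s \<in> topspace S ==> C_map r X A (h s)"
  and cont: "!!k. continuous_map S euclidean (%s. jet r k (h s))"
 shows "smooth_family r S h"
proof (rule smooth_family_jet[OF C])
 fix i j and us :: "'e coord list" and y0 s0 assume s0: "s0 \<in> topspace S" and i: "i < N" and j: "j < N" and us: "enat (length us) <= r"
  and y0: "y0 \<in> ball (a i) (R i)"
 let ?J = "%s. jet r (i, j, us) (h s)"
 have ap: "BCF (?J s) y = iter_deriv (map basis_vec us) (test_rep i j (h s)) y"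
  if "s \<in> topspace S" "y \<in> ball (a i) (R i)" for s y using jet_apply[OF C[OF that(1)] i j us, of y] proj_self[of y i] that by simp
 have "(?J \<longlongrightarrow> ?J s0) (nhdsin S s0)" using cont[of "(i, j, us)"] s0 unfolding continuous_map_iff_nhdsin by simp
 have "((%p. BCF (?J (fst p)) (snd p)) \<longlongrightarrow> BCF (?J s0) y0) (nhdsin S s0 \<times>\<^sub>F nhds y0)"
 proof (rule tendstoI)
  fix eps :: real assume eps: "eps > 0"
  have 1: "\<forall>\<^sub>F s in nhdsin S s0. dist (?J s) (?J s0) < eps / 2"
   using \<open>(?J \<longlongrightarrow> ?J s0) (nhdsin S s0)\<close> eps by (intro tendstoD) auto
  have 2: "\<forall>\<^sub>F y in nhds y0. dist (BCF (?J s0) y) (BCF (?J s0) y0) < eps / 2"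
   using eps isCont_apply_bcontfun[where f = "?J s0" and x = y0] by (intro tendstoD) (auto simp: isCont_def tendsto_at_iff_tendsto_nhds)
  from eventually_prodI[OF 1 2]
  show "\<forall>\<^sub>F p in nhdsin S s0 \<times>\<^sub>F nhds y0. dist (BCF (?J (fst p)) (snd p)) (BCF (?J s0) y0) < eps"
  proof (rule eventually_mono)
   fix p assume p: "dist (?J (fst p)) (?J s0) < eps / 2 &
     dist (BCF (?J s0) (snd p)) (BCF (?J s0) y0) < eps / 2"
   hence "dist (BCF (?J (fst p)) (snd p)) (BCF (?J s0) (snd p)) < eps / 2" using dist_fun_lt_imp_dist_val_lt by blast
   thus "dist (BCF (?J (fst p)) (snd p)) (BCF (?J s0) y0) < eps" using p dist_triangle_lt[of _ "BCF (?J s0) (snd p)" _ eps]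
    by (metis (no_types, lifting) add_strict_mono dist_commute field_sum_of_halves)
  qed
 qed
 moreover have "\<forall>\<^sub>F y in nhds y0. y \<in> ball (a i) (R i)" using y0 eventually_nhds by blast
 from eventually_prodI[OF eventually_nhdsin_topspace this]
 have "\<forall>\<^sub>F p in nhdsin S s0 \<times>\<^sub>F nhds y0. BCF (?J (fst p)) (snd p) =
   iter_deriv (map basis_vec us) (test_rep i j (h (fst p))) (snd p)" by (rule eventually_mono) (use ap in auto)
 ultimately show "((%(s, y). iter_deriv (map basis_vec us) (test_rep i j (h s)) y) \<longlongrightarrow>
    iter_deriv (map basis_vec us) (test_rep i j (h s0)) y0) (nhdsin S s0 \<times>\<^sub>F nhds y0)"
  using ap[OF s0 y0] Lim_transform_eventually by (fastforce simp: case_prod_unfold)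
qed

end

text \<open>Pick a point from each nonempty finite intersection of subbasic sets.\<close>

lemma separable_space_countable_subbase:
 assumes "countable \<B>"
 shows "separable_space (topology_generated_by \<B>)"
proof -
 define \<F> where "\<F> = {F. finite F & F \<subseteq> \<B>}"
 define pick where "pick = (%F. SOME x. x \<in> \<Inter>F Int \<Union>\<B>)"
 define C where "C = pick ` {F \<in> \<F>. \<Inter>F Int \<Union>\<B> ~= {}}"
 have cF: "countable \<F>" unfolding \<F>_def using assms by (rule countable_Collect_finite_subset)
 have C: "countable C" unfolding C_def by (rule countable_image, rule countable_subset[OF _ cF]) blast
 have pick: "pick F \<in> \<Inter>F Int \<Union>\<B>" if "\<Inter>F Int \<Union>\<B> ~= {}" for F
  using that unfolding pick_def by (simp only: some_in_eq not_False_eq_True)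
 have sub: "C \<subseteq> \<Union>\<B>"
 proof
  fix x assume "x \<in> C"
  then obtain F where "\<Inter>F Int \<Union>\<B> ~= {}" "x = pick F" unfolding C_def by blast
  thus "x \<in> \<Union>\<B>" using pick[of F] by simp
 qed
 have base: "\<exists>F\<in>\<F>. x \<in> \<Inter>F & \<Inter>F Int \<Union>\<B> \<subseteq> U" if "generate_topology_on \<B> U" "x \<in> U" for U x
  using that
 proof (induction arbitrary: x rule: generate_topology_on.induct)
  case (Int a b)
  obtain F where F: "F \<in> \<F>" "x \<in> \<Inter>F" "\<Inter>F Int \<Union>\<B> \<subseteq> a" using Int.IH(1)[of x] Int.prems by blast
  obtain G where G: "G \<in> \<F>" "x \<in> \<Inter>G" "\<Inter>G Int \<Union>\<B> \<subseteq> b" using Int.IH(2)[of x] Int.prems by blast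
  show ?case
  proof (rule bexI[of _ "F Un G"])
   show "F Un G \<in> \<F>" using F G by (auto simp: \<F>_def)
   show "x \<in> \<Inter> (F Un G) & \<Inter> (F Un G) Int \<Union> \<B> \<subseteq> a Int b" using F G by blast
  qed
 next
  case (UN K)
  then obtain k where k: "k \<in> K" "x \<in> k" by blast
  obtain F where F: "F \<in> \<F>" "x \<in> \<Inter>F & \<Inter>F Int \<Union>\<B> \<subseteq> k" using UN.IH[OF k(1) k(2)] ..
  have "\<Inter>F Int \<Union>\<B> \<subseteq> \<Union>K" using order_trans[OF conjunct2[OF F(2)] Union_upper[OF k(1)]] .
  thus ?case using conjunct1[OF F(2)] by (intro bexI[OF _ F(1)] conjI)
 next
  case (Basis s)
  thus ?case by (intro bexI[of _ "{s}"]) (auto simp: \<F>_def)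
 qed simp
 have "x \<in> topology_generated_by \<B> closure_of C" if x: "x \<in> \<Union>\<B>" for x unfolding in_closure_of topology_generated_by_topspace
 proof (intro conjI x allI impI)
  fix U assume U: "x \<in> U & openin (topology_generated_by \<B>) U"
  hence gen: "generate_topology_on \<B> U" by (simp add: openin_topology_generated_by_iff)
  obtain F where F: "F \<in> \<F>" "x \<in> \<Inter>F" "\<Inter>F Int \<Union>\<B> \<subseteq> U" using base[OF gen conjunct1[OF U]] by blast
  hence ne: "\<Inter>F Int \<Union>\<B> ~= {}" using x by blast
  hence "pick F \<in> C" using F by (auto simp: C_def)
  thus "\<exists>y. y \<in> C & y \<in> U" using pick[OF ne] F by blast
 qed
 thus ?thesis unfolding separable_space_def topology_generated_by_topspace
  using C sub closure_of_subset_topspace[of "topology_generated_by \<B>" C] by (intro exI[of _ C]) auto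
qed

context covered_manifold
begin

text \<open>The topology generated by asking that a derivative map a member of one countable base into a member
 of another is at least as fine, again by the universal property.\<close>

lemma separable_space_Diff: "separable_space (Diff_topology r X A)"
proof -
 obtain \<C> where \<C>: "countable \<C>" "!!C. C \<in> \<C> ==> open C" "!!S :: 'e set. open S ==> \<exists>U. U \<subseteq> \<C> & S = \<Union>U"
  using univ_second_countable by blast
 obtain \<D> where \<D>: "countable \<D>" "!!D. D \<in> \<D> ==> open D" "!!S :: ('e \<times> real) set. open S ==> \<exists>U. U \<subseteq> \<D> & S = \<Union>U"
  using univ_second_countable by blast
 define W where "W = (%(i, j, us, C, D). {g \<in> diffeos r X A. \<forall>y\<in>C Int ball (a i) (R i).
   iter_deriv (map basis_vec us) (test_rep i j g) y \<in> D})"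
 define \<B> where "\<B> = insert (diffeos r X A) (W ` (UNIV \<times> UNIV \<times> (UNIV :: 'e coord list set) \<times> \<C> \<times> \<D>))"
 have "countable \<B>" unfolding \<B>_def using \<C>(1) \<D>(1) by (intro countable_insert countable_image countable_SIGMA) auto
 let ?T = "topology_generated_by \<B>"
 have ts: "topspace ?T = diffeos r X A" unfolding topology_generated_by_topspace by (auto simp: \<B>_def W_def)
 have fam: "smooth_family r ?T (%g. g)"
 proof (rule smooth_family_jet)
  show "C_map r X A g" if "g \<in> topspace ?T" for g using that ts diffeosD(3) by blast
  fix i j and us :: "'e coord list" and y0 g0
  assume g0: "g0 \<in> topspace ?T" and i: "i < N" and j: "j < N" and us: "enat (length us) <= r" and y0: "y0 \<in> ball (a i) (R i)"
  let ?D = "%g. iter_deriv (map basis_vec us) (test_rep i j g)"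
  have "((%p. ?D (fst p) (snd p)) \<longlongrightarrow> ?D g0 y0) (nhdsin ?T g0 \<times>\<^sub>F nhds y0)"
  proof (rule topological_tendstoI)
   fix S :: "('e \<times> real) set" assume S: "open S" "?D g0 y0 \<in> S"
   obtain D where D: "D \<in> \<D>" "?D g0 y0 \<in> D" "D \<subseteq> S" using \<D>(3)[OF S(1)] S(2) by blast
   have "C_on r (ball (a i) (R i)) (test_rep i j g0)" by (rule C_on_test_rep[OF _ i j _ open_ball])
      (use g0 ts diffeosD(3) ball_chart[OF i] in \<open>auto simp: subset_iff\<close>)
   hence "continuous_on (ball (a i) (R i)) (?D g0)" using us set_map_basis_vec[of us] by (auto simp: C_on_def)
   hence "open (?D g0 -` D Int ball (a i) (R i))" using continuous_on_open_vimage[OF open_ball] \<D>(2)[OF D(1)] by metis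
   from \<C>(3)[OF this] obtain Us where Us: "Us \<subseteq> \<C>" "?D g0 -` D Int ball (a i) (R i) = \<Union>Us" by (elim exE conjE)
   have "y0 \<in> \<Union>Us" using D y0 unfolding Us(2)[symmetric] by simp
   then obtain C where CU: "C \<in> Us" "y0 \<in> C" by (rule UnionE)
   have C: "C \<in> \<C>" "y0 \<in> C" "C \<subseteq> ?D g0 -` D Int ball (a i) (R i)" unfolding Us(2) using CU Us(1) by auto
   let ?W = "W (i, j, us, C, D)"
   have "?W \<in> \<B>" unfolding \<B>_def using C(1) D(1) by blast
   hence "openin ?T ?W" by (rule topology_generated_by_Basis)
   moreover have "g0 \<in> ?W" using C g0 ts by (auto simp: W_def)
   ultimately have 1: "\<forall>\<^sub>F g in nhdsin ?T g0. g \<in> ?W" by (rule eventually_nhdsin_open)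
   have 2: "\<forall>\<^sub>F y in nhds y0. y \<in> C Int ball (a i) (R i)" using C \<C>(2)[OF C(1)] y0 by (intro eventually_nhds_in_open) auto
   show "\<forall>\<^sub>F p in nhdsin ?T g0 \<times>\<^sub>F nhds y0. ?D (fst p) (snd p) \<in> S"
    using eventually_prodI[OF 1 2] by (rule eventually_mono) (use D(3) in \<open>auto simp: W_def\<close>)
  qed
  thus "((%(g, y). ?D g y) \<longlongrightarrow> ?D g0 y0) (nhdsin ?T g0 \<times>\<^sub>F nhds y0)" by (simp add: case_prod_unfold)
 qed
 have cont: "continuous_map ?T (Diff_topology r X A) (%g. g)" by (rule smooth_family_imp_continuous_map[OF fam]) (use ts in blast)
 show ?thesis by (rule separable_space_continuous_map_image[OF separable_space_countable_subbase[OF \<open>countable \<B>\<close>] cont])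
    (use ts in simp)
qed

text \<open>Otherwise, by compactness, the values along \<open>u\<close> would eventually differ from all values of the test
 functions.\<close>

lemma test_pointwise_limit:
 assumes u: "!!m. u m \<in> Xs" and l: "!!j. j < N ==> (%m. test j (u m)) \<longlonglongrightarrow> l j"
 shows "\<exists>y\<in>Xs. \<forall>j<N. test j y = l j"
proof (rule ccontr)
 assume no: "~ ?thesis"
 have "\<forall>\<^sub>F m in sequentially. \<forall>y\<in>Xs. \<exists>j<N. test j y ~= test j (u m)"
 proof (rule eventually_compactin_uniform[where X = X])
  show "compactin X (Xs)" using compact by (simp add: compact_space_def)
  fix y assume y: "y \<in> Xs"
  then obtain j where j: "j < N" "test j y ~= l j" using no by blast
  have 1: "((%p. test j (u (fst p))) \<longlongrightarrow> l j) (sequentially \<times>\<^sub>F nhdsin X y)"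
   by (rule filterlim_compose[OF l[OF j(1)] filterlim_fst])
  have 2: "((%p. test j (snd p)) \<longlongrightarrow> test j y) (sequentially \<times>\<^sub>F nhdsin X y)"
   by (rule filterlim_compose[OF filterlim_test[OF y j(1)] filterlim_snd])
  have "((%p. test j (snd p) - test j (u (fst p))) \<longlongrightarrow> test j y - l j) (sequentially \<times>\<^sub>F nhdsin X y)"
   by (rule tendsto_diff[OF 2 1])
  from tendsto_imp_eventually_ne[OF this, of 0] j
  have "\<forall>\<^sub>F p in sequentially \<times>\<^sub>F nhdsin X y. test j (snd p) - test j (u (fst p)) ~= 0" by simp
  thus "\<forall>\<^sub>F (m, y') in sequentially \<times>\<^sub>F nhdsin X y. \<exists>j<N. test j y' ~= test j (u m)"
   by (rule eventually_mono) (use j in auto)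
 qed
 then obtain m where "\<forall>y\<in>Xs. \<exists>j<N. test j y ~= test j (u m)" using eventually_happens'[OF sequentially_bot] by blast
 thus False using u by blast
qed

text \<open>The limits of the test functions determine \<open>g\<close> pointwise, and \<open>C_on_uniform_limit\<close> makes it smooth. The
 last clause is continuous convergence, which passes to compositions.\<close>

lemma jet_limit:
 assumes f: "!!m. C_map r X A (f m)" and L: "!!k. (%m. jet r k (f m)) \<longlonglongrightarrow> L k"
 shows "\<exists>g. C_map r X A g & (\<forall>k. jet r k g = L k) &
  (\<forall>u x. (\<forall>m. u m \<in> Xs) & x \<in> Xs & (\<forall>j<N. (%m. test j (u m)) \<longlonglongrightarrow> test j x) -->
    (\<forall>j<N. (%m. test j (f m (u m))) \<longlonglongrightarrow> test j (g x)))"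
proof -
 have 0: "enat 0 <= r" by (simp add: zero_enat_def[symmetric])
 have ul: "uniform_limit UNIV (%m. BCF (jet r k (f m))) (BCF (L k)) sequentially" for k using L by (rule tendsto_bcontfun_uniform_limit)
 have ap: "BCF (jet r (i, j, us) (f m)) y = iter_deriv (map basis_vec us) (test_rep i j (f m)) (proj i y)"
  if "i < N" "j < N" "enat (length us) <= r" for i j us m y by (rule jet_apply[OF f that])
 have conv: "(%m. test j (f m (u m))) \<longlonglongrightarrow> BCF (L (i, j, [])) (snd (c i) x)"
  if i: "i < N" "x \<in> V i" and j: "j < N" and u: "(%m. test i (u m)) \<longlonglongrightarrow> test i x" for i j u x
 proof -
  have 1: "\<forall>\<^sub>F m in sequentially. u m \<in> V i" and 2: "(%m. snd (c i) (u m)) \<longlonglongrightarrow> snd (c i) x"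
   using test_limit[OF i u] by blast+
  let ?L = "BCF (L (i, j, []))"
  have 3: "(%m. ?L (snd (c i) (u m))) \<longlonglongrightarrow> ?L (snd (c i) x)" by (rule isCont_tendsto_compose[OF isCont_apply_bcontfun 2])
  have "(%m. BCF (jet r (i, j, []) (f m)) (snd (c i) (u m)) - ?L (snd (c i) (u m))) \<longlonglongrightarrow> 0"
  proof (rule Lim_null_comparison)
   show "\<forall>\<^sub>F m in sequentially. norm (BCF (jet r (i, j, []) (f m)) (snd (c i) (u m)) - ?L (snd (c i) (u m)))
     <= dist (jet r (i, j, []) (f m)) (L (i, j, []))" using dist_bounded[of "jet r (i, j, []) (f _)" _ "L (i, j, [])"] by (simp add: dist_norm)
   show "(%m. dist (jet r (i, j, []) (f m)) (L (i, j, []))) \<longlonglongrightarrow> 0"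
    using tendsto_dist[OF L[of "(i, j, [])"] tendsto_const[of "L (i, j, [])"]] by simp
  qed
  from tendsto_add[OF this 3]
  have "(%m. BCF (jet r (i, j, []) (f m)) (snd (c i) (u m))) \<longlonglongrightarrow> ?L (snd (c i) x)" by simp
  thus ?thesis
  proof (rule Lim_transform_eventually)
   show "\<forall>\<^sub>F m in sequentially. BCF (jet r (i, j, []) (f m)) (snd (c i) (u m)) = test j (f m (u m))" using 1
   proof eventually_elim
    case (elim m)
    hence "proj i (snd (c i) (u m)) = snd (c i) (u m)" "u m \<in> fst (c i)" by (auto simp: V_def intro!: proj_self)
    thus ?case using ap[OF i(1) j, of "[]" m] 0 cA[OF i(1)] by (simp add: test_rep_def)
   qed
  qed
 qed
 have "\<exists>y\<in>Xs. \<forall>i<N. \<forall>j<N. x \<in> V i --> test j y = BCF (L (i, j, [])) (snd (c i) x)"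
  if x: "x \<in> Xs" for x
 proof -
  obtain i0 where i0: "i0 < N" "x \<in> V i0" using V_cover x by blast
  have lim: "(%m. test j (f m x)) \<longlonglongrightarrow> BCF (L (i, j, [])) (snd (c i) x)" if "i < N" "x \<in> V i" "j < N" for i j
   using conv[OF that, of "%_. x"] by simp
  obtain y where y: "y \<in> Xs" "\<forall>j<N. test j y = BCF (L (i0, j, [])) (snd (c i0) x)"
   using test_pointwise_limit[of "%m. f m x" "%j. BCF (L (i0, j, [])) (snd (c i0) x)"] lim[OF i0] C_map_in[OF f x] by blast
  have "test j y = BCF (L (i, j, [])) (snd (c i) x)" if "i < N" "j < N" "x \<in> V i" for i j
   using y(2) that lim[OF i0 that(2)] lim[OF that(1,3,2)] LIMSEQ_unique by fastforce
  thus ?thesis using y(1) by blast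
 qed
 hence "\<forall>x\<in>Xs. \<exists>y. y \<in> Xs & (\<forall>i<N. \<forall>j<N. x \<in> V i --> test j y = BCF (L (i, j, [])) (snd (c i) x))"
  by blast
 from bchoice[OF this] obtain g where g: "\<forall>x\<in>Xs. g x \<in> Xs &
   (\<forall>i<N. \<forall>j<N. x \<in> V i --> test j (g x) = BCF (L (i, j, [])) (snd (c i) x))" ..
 let ?us = "map (inv_into UNIV basis_vec) :: 'e list => 'e coord list"
 have us: "map basis_vec (?us vs) = vs" if "set vs \<subseteq> Basis" for vs
 proof -
  have "basis_vec (inv_into UNIV basis_vec v) = v" if "v \<in> set vs" for v
   using that \<open>set vs \<subseteq> Basis\<close> bij_betw_basis_vec by (intro f_inv_into_f) (auto simp: bij_betw_def)
  thus ?thesis by (simp add: map_idI)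
 qed
 have rep: "test_rep i j g y = BCF (L (i, j, [])) y" if "i < N" "j < N" "y \<in> ball (a i) (R i)" for i j y
 proof -
  have y: "y \<in> snd (c i) ` fst (c i)" using ball_chart[OF that(1)] that(3) by auto
  hence "ichart (c i) y \<in> V i" "snd (c i) (ichart (c i) y) = y" using that ichart_in chart_ichart by (auto simp: V_def)
  moreover have "ichart (c i) y \<in> Xs" using ichart_in[OF y] chart_subset[OF cA[OF that(1)]] by blast
  ultimately show ?thesis using g that by (auto simp: test_rep_def)
 qed
 have lims: "C_on r (ball (a i) (R i)) (BCF (L (i, j, [])))"
  "!!vs y. set vs \<subseteq> Basis ==> enat (length vs) <= r ==> y \<in> ball (a i) (R i) ==>
    iter_deriv vs (BCF (L (i, j, []))) y = BCF (L (i, j, ?us vs)) y"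
  if i: "i < N" and j: "j < N" for i j
 proof -
  let ?G = "%vs. BCF (L (i, j, ?us vs))"
  have C: "C_on r (ball (a i) (R i)) (test_rep i j (f m))" for m by (rule C_on_test_rep[OF f i j _ open_ball]) (use ball_chart[OF i] in auto)
  have U: "uniform_limit (ball (a i) (R i)) (%m. iter_deriv vs (test_rep i j (f m))) (?G vs) sequentially"
   if vs: "set vs \<subseteq> Basis" "enat (length vs) <= r" for vs
  proof -
   have "uniform_limit (ball (a i) (R i)) (%m. BCF (jet r (i, j, ?us vs) (f m))) (?G vs) sequentially" by (rule uniform_limit_on_subset[OF ul]) simp
   thus ?thesis
   proof (rule uniform_limit_cong'[THEN iffD1, rotated 2])
    fix y m assume "y \<in> ball (a i) (R i)"
    thus "BCF (jet r (i, j, ?us vs) (f m)) y = iter_deriv vs (test_rep i j (f m)) y"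
     using ap[OF i j, of "?us vs" m y] vs us[OF vs(1)] proj_self[of y i] by simp
   qed simp
  qed
  show "C_on r (ball (a i) (R i)) (BCF (L (i, j, [])))" using C_on_uniform_limit(1)[where G = ?G, OF open_ball C U] by simp
  show "iter_deriv vs (BCF (L (i, j, []))) y = BCF (L (i, j, ?us vs)) y"
   if "set vs \<subseteq> Basis" "enat (length vs) <= r" "y \<in> ball (a i) (R i)" for vs y
   using C_on_uniform_limit(2)[where G = ?G, OF open_ball C U that] by simp
 qed
 have Cg: "C_map r X A g" unfolding C_map_iff_smooth_family
 proof (intro ballI)
  fix s :: unit and x assume s: "s \<in> topspace one_point" and x: "x \<in> Xs"
  obtain i where i: "i < N" "x \<in> V i" using V_cover x by blast
  have xb: "snd (c i) x \<in> ball (a i) (R i)" using i by (simp add: V_def)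
  show "smooth_family_at r one_point (%_. g) s x"
  proof (rule smooth_family_at_test[where h = "%_. g", OF s _ i(1)])
   show "g x \<in> Xs" using g x by blast
   show "x \<in> fst (c i)" using i V_subset by blast
   fix j n assume j: "j < N" and n: "enat n <= r"
   have 1: "C_germ n (BCF (L (i, j, []))) (snd (c i) x)" using lims(1)[OF i(1) j] xb n unfolding C_on_iff_germ[OF open_ball] by blast
   have "C_germ n (test_rep i j g) (snd (c i) x)"
   proof (rule C_family_cong_imp[OF _ _ 1])
    have "\<forall>\<^sub>F y in nhds (snd (c i) x). BCF (L (i, j, [])) y = test_rep i j g y"
     using eventually_nhds_in_open[OF open_ball xb] by (rule eventually_mono) (simp add: rep[OF i(1) j])
    thus "\<forall>\<^sub>F (s, y) in principal {()} \<times>\<^sub>F nhds (snd (c i) x). BCF (L (i, j, [])) y = test_rep i j g y"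
     by (simp add: eventually_unit_times)
   qed simp
   thus "C_family n (nhdsin one_point s) s (%s. test_rep i j g) (snd (c i) x)" by (simp add: nhdsin_unit)
  qed
 qed
 moreover have "jet r k g = L k" for k
 proof -
  obtain i j us where k: "k = (i, j, us)" by (metis prod_cases3)
  show ?thesis
  proof (cases "i < N & j < N & enat (length us) <= r")
   case False
   hence "jet r k h = 0" for h by (auto simp: k jet_def)
   thus ?thesis using L[of k] by (simp add: LIMSEQ_const_iff)
  next
   case True
   hence i: "i < N" and j: "j < N" and us': "enat (length us) <= r" by auto
   have Lproj: "BCF (L k) y = BCF (L k) (proj i y)" for y
   proof -
    have "BCF (jet r k (f m)) y = BCF (jet r k (f m)) (proj i y)" for m unfolding k by (simp add: ap[OF i j us'] proj_self[OF proj_in[OF i]])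
    hence "(%m. BCF (jet r k (f m)) y) = (%m. BCF (jet r k (f m)) (proj i y))" by (rule ext)
    moreover have "(%m. BCF (jet r k (f m)) y) \<longlonglongrightarrow> BCF (L k) y" for y using ul[of k] by (rule tendsto_uniform_limitI) simp
    from this[of y] this[of "proj i y"] calculation show ?thesis using LIMSEQ_unique by simp
   qed
   have inball: "BCF (jet r k g) y = BCF (L k) y" if y: "y \<in> ball (a i) (R i)" for y
   proof -
    have "BCF (jet r k g) y = iter_deriv (map basis_vec us) (test_rep i j g) y" using jet_apply[OF Cg i j us', of y] proj_self[of y i] y k by simp
    also have "\<dots> = iter_deriv (map basis_vec us) (BCF (L (i, j, []))) y" by (rule iter_deriv_cong_open[OF open_ball _ y]) (rule rep[OF i j])
    also have "\<dots> = BCF (L (i, j, ?us (map basis_vec us))) y" by (rule lims(2)[OF i j set_map_basis_vec _ y]) (use us' in simp)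
    also have "?us (map basis_vec us) = us" by (simp add: o_def inv_f_f bij_betw_imp_inj_on[OF bij_betw_basis_vec])
    finally show ?thesis by (simp add: k)
   qed
   have "BCF (jet r k g) y = BCF (L k) y" if "y \<in> cball (a i) (R i)" for y
   proof -
    have "closed {y. BCF (jet r k g) y = BCF (L k) y}" by (rule closed_Collect_eq) auto
    hence "closure (ball (a i) (R i)) \<subseteq> {y. BCF (jet r k g) y = BCF (L k) y}" using inball by (intro closure_minimal) auto
    thus ?thesis using that R(1)[OF i] by (auto simp: closure_ball)
   qed
   moreover have "BCF (jet r k g) y = BCF (jet r k g) (proj i y)" for y
    unfolding k by (simp add: jet_apply[OF Cg i j us'] proj_self[OF proj_in[OF i]])
   ultimately show ?thesis by (intro bcontfun_eqI) (metis Lproj proj_in[OF i])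
  qed
 qed
 moreover have "(%m. test j (f m (u m))) \<longlonglongrightarrow> test j (g x)"
  if u: "\<forall>m. u m \<in> Xs" and x: "x \<in> Xs" and t: "\<forall>j<N. (%m. test j (u m)) \<longlonglongrightarrow> test j x" and j: "j < N" for u x j
 proof -
  obtain i where i: "i < N" "x \<in> V i" using V_cover x by blast
  have "(%m. test j (f m (u m))) \<longlonglongrightarrow> BCF (L (i, j, [])) (snd (c i) x)" by (rule conv[OF i j]) (use t i(1) in blast)
  thus ?thesis using g x j i by auto
 qed
 ultimately show ?thesis by blast
qed

lemma jets_inj:
 assumes f: "f \<in> diffeos r X A" and g: "g \<in> diffeos r X A" and eq: "!!k. jet r k f = jet r k g"
 shows "f = g"
proof (rule extensionalityI[OF diffeosD(2)[OF f] diffeosD(2)[OF g]])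
 fix x assume x: "x \<in> Xs"
 obtain i where i: "i < N" "x \<in> V i" using V_cover x by blast
 have 0: "enat 0 <= r" by (simp add: zero_enat_def[symmetric])
 have "test j (f x) = test j (g x)" if j: "j < N" for j
 proof -
  have "BCF (jet r (i, j, []) h) (snd (c i) x) = test j (h x)" if "C_map r X A h" for h
   using jet_apply[OF that i(1) j, of "[]" "snd (c i) x"] 0 i proj_self[of "snd (c i) x" i] cA[OF i(1)] by (auto simp: V_def test_rep_def)
  thus ?thesis using eq[of "(i, j, [])"] diffeosD(3) f g by metis
 qed
 thus "f x = g x" by (intro test_injective diffeo_in[OF f x])
qed

text \<open>The limits of the maps and of their inverses are inverse to each other by continuous convergence.\<close>

lemma closed_jets_diffeos: "closed (jets r ` diffeos r X A)"
 unfolding closed_sequential_limits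
proof (intro allI impI, elim conjE)
 fix e L assume e: "\<forall>m. e m \<in> jets r ` diffeos r X A" and lim: "e \<longlonglongrightarrow> L"
 have "\<forall>m. \<exists>f. f \<in> diffeos r X A & e m = jets r f" using e by blast
 from choice[OF this] obtain f where f: "!!m. f m \<in> diffeos r X A" "!!m. e m = jets r (f m)" by blast
 have co: "(%m. e m k) \<longlonglongrightarrow> L k" for k
 proof -
  have "isCont (%x :: 'e jet_index => 'e \<Rightarrow>\<^sub>C ('e \<times> real). x k) L"
   using continuous_on_product_coordinates[of k] continuous_on_eq_continuous_at[OF open_UNIV] by blast
  thus ?thesis by (rule isCont_tendsto_compose[OF _ lim])
 qed
 let ?k = "%m. inv_into (Xs) (f m)"
 have L1: "(%m. jet r k (f m)) \<longlonglongrightarrow> L (k, True)" and L2: "(%m. jet r k (?k m)) \<longlonglongrightarrow> L (k, False)" for k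
  using co[of "(k, True)"] co[of "(k, False)"] by (simp_all add: f jets_def)
 obtain g where g: "C_map r X A g" "!!k. jet r k g = L (k, True)"
  and g': "!!u x j. (!!m. u m \<in> Xs) ==> x \<in> Xs ==> (!!j. j < N ==> (%m. test j (u m)) \<longlonglongrightarrow> test j x) ==>
    j < N ==> (%m. test j (f m (u m))) \<longlonglongrightarrow> test j (g x)" using jet_limit[OF diffeosD(3)[OF f(1)] L1] by blast
 obtain h where h: "C_map r X A h" "!!k. jet r k h = L (k, False)"
  and h': "!!u x j. (!!m. u m \<in> Xs) ==> x \<in> Xs ==> (!!j. j < N ==> (%m. test j (u m)) \<longlonglongrightarrow> test j x) ==>
    j < N ==> (%m. test j (?k m (u m))) \<longlonglongrightarrow> test j (h x)" using jet_limit[OF diffeosD(4)[OF f(1)] L2] by blast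
 have gh: "g (h x) = x" if x: "x \<in> Xs" for x
 proof -
  have "test j x = test j (g (h x))" if j: "j < N" for j
  proof -
   have "(%m. test j (f m (?k m x))) \<longlonglongrightarrow> test j (g (h x))"
    by (rule g'[OF diffeo_inv(3)[OF f(1) x] C_map_in[OF h(1) x] h'[OF x x] j]) simp
   thus ?thesis by (simp add: diffeo_inv(1)[OF f(1) x] LIMSEQ_const_iff)
  qed
  thus ?thesis using test_injective[OF x] by metis
 qed
 have hg: "h (g x) = x" if x: "x \<in> Xs" for x
 proof -
  have "test j x = test j (h (g x))" if j: "j < N" for j
  proof -
   have "(%m. test j (?k m (f m x))) \<longlonglongrightarrow> test j (h (g x))"
    by (rule h'[OF diffeo_in[OF f(1) x] C_map_in[OF g(1) x] g'[OF x x] j]) simp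
   thus ?thesis by (simp add: diffeo_inv(2)[OF f(1) x] LIMSEQ_const_iff)
  qed
  thus ?thesis using test_injective[OF x] by metis
 qed
 have bij: "bij_betw g (Xs) (Xs)" by (rule bij_betw_byWitness[where f' = h]) (use gh hg C_map_in[OF g(1)] C_map_in[OF h(1)] in auto)
 have inv: "inv_into (Xs) g x = h x" if "x \<in> Xs" for x using bij that gh C_map_in[OF h(1)] by (intro inv_into_f_eq) (auto simp: bij_betw_def)
 let ?g = "restrict g (Xs)"
 have mem: "?g \<in> diffeos r X A" by (rule diffeosI[OF bij g(1)]) (rule C_map_cong[OF _ h(1)], simp add: inv)
 have jc: "jet r k u = jet r k v" if "!!x. x \<in> Xs ==> u x = v x" for k u v
 proof -
  obtain i j us where k: "k = (i, j, us)" by (metis prod_cases3)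
  have "iter_deriv (map basis_vec us) (test_rep i j u) (proj i y) = iter_deriv (map basis_vec us) (test_rep i j v) (proj i y)"
   if i: "i < N" for y
  proof (rule iter_deriv_cong_open[OF chart_facts(2)[OF cA[OF i]]])
   show "proj i y \<in> snd (c i) ` fst (c i)" using proj_in[OF i] ball_chart[OF i] by blast
   show "test_rep i j u y = test_rep i j v y" if "y \<in> snd (c i) ` fst (c i)" for y
    using ichart_in[OF that] chart_subset[OF cA[OF i]] \<open>!!x. x \<in> Xs ==> u x = v x\<close>
    by (auto simp: test_rep_def)
  qed
  thus ?thesis by (simp add: k jet_def)
 qed
 have "jets r ?g = L"
 proof (rule ext)
  fix kb :: "'e jet_index"
  obtain k b where kb: "kb = (k, b)" by (cases kb)
  have 1: "jet r k ?g = jet r k g" by (rule jc) simp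
  have "inv_into (Xs) ?g x = h x" if x: "x \<in> Xs" for x using diffeo_inv(2)[OF mem C_map_in[OF h(1) x]] C_map_in[OF h(1) x] gh[OF x] by simp
  hence 2: "jet r k (inv_into (Xs) ?g) = jet r k h" by (rule jc)
  show "jets r ?g kb = L kb" using 1 2 g(2) h(2) by (cases b) (auto simp: jets_def kb)
 qed
 thus "L \<in> jets r ` diffeos r X A" using mem by blast
qed

text \<open>Both directions of the embedding are continuous by the universal property.\<close>

lemma polish_topology_Diff:
 assumes r: "1 <= r"
 shows "polish_topology (Diff_topology r X A)"
proof -
 let ?tau = "Diff_topology r X A" and ?D = "diffeos r X A"
 let ?S = "subtopology euclidean (jets r ` ?D)"
 let ?g = "inv_into ?D (jets r)"
 have inj: "inj_on (jets r) ?D"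
 proof (rule inj_onI)
  fix f g assume fg: "f \<in> ?D" "g \<in> ?D" "jets r f = jets r g"
  have "jet r k f = jet r k g" for k using fun_cong[OF fg(3), of "(k, True)"] by (simp add: jets_def)
  thus "f = g" by (rule jets_inj[OF fg(1,2)])
 qed
 have id: "smooth_family r ?tau (%g. g)" by (rule continuous_map_imp_smooth_family) simp
 have inv: "smooth_family r ?tau (%g. inv_into (Xs) g)" by (rule smooth_family_inverse[OF id r]) (auto simp: diffeo_inv diffeosD)
 have "continuous_map ?tau euclidean (%f. jets r f kb)" for kb
 proof -
  obtain k b where kb: "kb = (k, b)" by (cases kb)
  have "continuous_map ?tau euclidean (%f. jet r k f)" by (rule continuous_map_jet[OF id]) (simp add: diffeosD)
  moreover have "continuous_map ?tau euclidean (%f. jet r k (inv_into (Xs) f))" by (rule continuous_map_jet[OF inv]) (simp add: diffeosD)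
  ultimately show ?thesis by (cases b) (simp_all add: jets_def kb)
 qed
 hence c1: "continuous_map ?tau euclidean (jets r)" unfolding euclidean_product_topology[symmetric] continuous_map_componentwise_UNIV by blast
 have gm: "?g s \<in> ?D" "jets r (?g s) = s" if "s \<in> topspace ?S" for s using that by (auto simp: inv_into_into f_inv_into_f)
 have c2: "continuous_map ?S ?tau ?g"
 proof (rule smooth_family_imp_continuous_map)
  show "smooth_family r ?S ?g"
  proof (rule smooth_family_continuous_jets)
   show "C_map r X A (?g s)" if "s \<in> topspace ?S" for s using gm(1)[OF that] diffeosD(3) by blast
   have id: "continuous_map ?S euclidean (%s. s)" by (simp add: continuous_map_from_subtopology)
   fix k
   have "continuous_map ?S euclidean (%s. s (k, True))"
    using id unfolding euclidean_product_topology[symmetric] continuous_map_componentwise_UNIV by blast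
   thus "continuous_map ?S euclidean (%s. jet r k (?g s))"
   proof (rule continuous_map_eq)
    fix s assume "s \<in> topspace ?S"
    hence "jets r (?g s) (k, True) = s (k, True)" by (simp only: gm(2))
    thus "s (k, True) = jet r k (?g s)" by (simp add: jets_def)
   qed
  qed
 qed (rule gm(1))
 have "homeomorphic_maps ?tau ?S (jets r) ?g" unfolding homeomorphic_maps_def using c1 c2 gm inj by (auto simp: continuous_map_in_subtopology)
 hence "?tau homeomorphic_space ?S" by (auto simp: homeomorphic_space_def)
 moreover have "completely_metrizable_space ?S" by (rule completely_metrizable_space_closedin[OF completely_metrizable_space_euclidean])
    (use closed_jets_diffeos in \<open>simp add: closed_closedin[symmetric]\<close>)
 ultimately have "completely_metrizable_space ?tau" using homeomorphic_completely_metrizable_space by blast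
 thus ?thesis using separable_space_Diff by (simp add: polish_topology_def)
qed

end

lemma (in compact_manifold) polish_group_Diff:
 assumes "1 <= r"
 shows "polish_group (Diff r X A) (Diff_topology r X A)"
proof -
 obtain N c a R where "covered_manifold X A N c a R" by (rule finite_chart_cover)
 then interpret covered_manifold X A N c a R .
 show ?thesis using polish_topology_Diff[OF assms] topological_group_Diff[OF assms] by (simp add: polish_group_def)
qed

section \<open>Borel subsets of Polish spaces\<close>

text \<open>Such a set inherits a Polish topology from the graph, which lies in a Polish space.\<close>

definition closed_graph_set :: "'a::polish_space set => bool" where
 "closed_graph_set B \<longleftrightarrow> (\<exists>b :: 'a => nat => real. b \<in> borel_measurable borel & closed {(x, b x) |x. x \<in> B})"

lemma closed_graph_set_closed: "closed B ==> closed_graph_set B"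
 unfolding closed_graph_set_def
proof (intro exI[of _ "%_ _. 0"] conjI)
 assume B: "closed B"
 have "{(x, %_. 0) |x. x \<in> B} = B \<times> {(%_. 0) :: nat => real}" by auto
 thus "closed {(x, (%_. 0) :: nat => real) |x. x \<in> B}" using B by (simp add: closed_Times)
qed simp

lemma closed_graph_set_open:
 assumes B: "open (B :: 'a::polish_space set)" shows "closed_graph_set B"
proof (cases "B = UNIV")
 case False
 let ?d = "%x. infdist x (- B)"
 let ?b = "%x (n::nat). inverse (?d x)"
 have d0: "?d x = 0 \<longleftrightarrow> x \<notin> B" for x using in_closed_iff_infdist_zero[of "- B" x] B False by (auto simp: closed_Compl)
 have meas: "?b \<in> borel_measurable borel"
  by (intro measurable_coordinatewise_then_product borel_measurable_inverse borel_measurable_continuous_onI continuous_on_infdist continuous_on_id)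
 have "{(x, ?b x) |x. x \<in> B} = {p. \<forall>n. snd p n * ?d (fst p) = 1}" (is "?L = ?R")
 proof
  show "?L \<subseteq> ?R"
  proof clarify
   fix x n assume "x \<in> B"
   hence "?d x ~= 0" using d0 by blast
   thus "snd (x, ?b x) n * ?d (fst (x, ?b x)) = 1" by simp
  qed
  show "?R \<subseteq> ?L"
  proof (rule subsetI)
   fix p assume "p \<in> ?R"
   hence p: "snd p n * ?d (fst p) = 1" for n by blast
   hence "?d (fst p) ~= 0" by (metis mult_zero_right zero_neq_one)
   hence "fst p \<in> B" using d0 by blast
   moreover have "snd p n = inverse (?d (fst p))" for n using inverse_unique[of "?d (fst p)" "snd p n"] p[of n] by (simp add: mult.commute)
   hence "p = (fst p, ?b (fst p))" by (simp add: prod_eq_iff fun_eq_iff)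
   ultimately show "p \<in> ?L" by blast
  qed
 qed
 moreover have "closed ?R" by (intro closed_Collect_all closed_Collect_eq continuous_intros continuous_on_infdist
    continuous_on_compose2[OF continuous_on_product_coordinates continuous_on_snd]) auto
 ultimately show ?thesis unfolding closed_graph_set_def using meas by auto
qed (simp add: closed_graph_set_closed)

lemma closed_graph_set_preimage:
 assumes "closed (G :: ('a::polish_space \<times> (nat => real)) set)"
 shows "closed {p :: 'a \<times> (nat => real). (fst p, %m. snd p (k m)) \<in> G}"
proof -
 have "continuous_on UNIV (%p :: 'a \<times> (nat => real). (fst p, %m. snd p (k m)))"
  by (intro continuous_intros continuous_on_coordinatewise_then_product
    continuous_on_compose2[OF continuous_on_product_coordinates continuous_on_snd]) auto
 hence "closed ((%p :: 'a \<times> (nat => real). (fst p, %m. snd p (k m))) -` G)" using assms closed_vimage by blast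
 thus ?thesis by (simp add: vimage_def)
qed

lemma measurable_function_coordinate:
 "(f :: 'a => 'i::countable => 'b::second_countable_topology) \<in> borel_measurable M ==> (%x. f x i) \<in> borel_measurable M"
 by (rule measurable_compose[OF _ borel_measurable_continuous_onI[OF continuous_on_product_coordinates]])

text \<open>The functions for the members are interleaved into a single sequence.\<close>

lemma closed_graph_set_Inter:
 assumes "!!i :: nat. closed_graph_set (B i)" shows "closed_graph_set (\<Inter>i. B i)"
proof -
 have "\<forall>i. \<exists>b :: 'a => nat => real. b \<in> borel_measurable borel & closed {(x, b x) |x. x \<in> B i}"
  using assms by (simp add: closed_graph_set_def)
 from choice[OF this] obtain b :: "nat => 'a => nat => real"
  where b: "!!i. b i \<in> borel_measurable borel" "!!i. closed {(x, b i x) |x. x \<in> B i}" by blast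
 let ?b = "%x n. b (fst (prod_decode n)) x (snd (prod_decode n))"
 have "{(x, ?b x) |x. x \<in> (\<Inter>i. B i)} = (\<Inter>i. {p. (fst p, %m. snd p (prod_encode (i, m))) \<in> {(x, b i x) |x. x \<in> B i}})" (is "?L = ?R")
 proof
  show "?L \<subseteq> ?R" by auto
  show "?R \<subseteq> ?L"
  proof (rule subsetI)
   fix p assume p: "p \<in> ?R"
   hence *: "fst p \<in> B i" "(%m. snd p (prod_encode (i, m))) = b i (fst p)" for i by auto
   have "snd p n = ?b (fst p) n" for n using fun_cong[OF *(2)[of "fst (prod_decode n)"], of "snd (prod_decode n)"] by simp
   hence "snd p = ?b (fst p)" by (rule ext)
   thus "p \<in> ?L" using *(1) by (cases p) auto
  qed
 qed
 moreover have "closed ?R" by (intro closed_INT ballI closed_graph_set_preimage b(2))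
 moreover have "?b \<in> borel_measurable borel" by (rule measurable_coordinatewise_then_product) (rule measurable_function_coordinate[OF b(1)])
 ultimately show ?thesis unfolding closed_graph_set_def by auto
qed

text \<open>A further coordinate records the member that contains the point.\<close>

lemma closed_graph_set_disjoint_Union:
 assumes B: "!!i :: nat. closed_graph_set (B i)" and dis: "disjoint_family B"
  and meas: "!!i. B i \<in> sets borel"
 shows "closed_graph_set (\<Union>i. B i)"
proof -
 have "\<forall>i. \<exists>b :: 'a => nat => real. b \<in> borel_measurable borel & closed {(x, b x) |x. x \<in> B i}"
  using B by (simp add: closed_graph_set_def)
 from choice[OF this] obtain b :: "nat => 'a => nat => real"
  where b: "!!i. b i \<in> borel_measurable borel" "!!i. closed {(x, b i x) |x. x \<in> B i}" by blast
 define idx where "idx = (%x. LEAST i. x \<in> B i)"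
 have idx: "idx x = i" if "x \<in> B i" for x i
  unfolding idx_def using that dis by (intro Least_equality) (auto simp: disjoint_family_on_def, metis IntI empty_iff le_cases)
 have midx: "idx \<in> measurable borel (count_space UNIV)" unfolding idx_def by (intro measurable_Least) (use meas in measurable)
 let ?b = "%x n. if n = 0 then real (idx x) else b (idx x) x (n - 1)"
 let ?Q = "%i. {p. (fst p, %m. snd p (Suc m)) \<in> {(x, b i x) |x. x \<in> B i}}"
 have "{(x, ?b x) |x. x \<in> (\<Union>i. B i)} = {p. snd p 0 \<in> \<nat>} Int (\<Inter>i. {p. 1 <= \<bar>snd p 0 - real i\<bar>} Un ?Q i)" (is "?L = ?R")
 proof
  show "?L \<subseteq> ?R"
  proof clarify
   fix x i assume x: "x \<in> B i"
   have "(x, ?b x) \<in> {p. 1 <= \<bar>snd p 0 - real j\<bar>} Un ?Q j" for j using x idx[OF x] by (cases "j = i") (auto simp: abs_if)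
   thus "(x, ?b x) \<in> ?R" by auto
  qed
  show "?R \<subseteq> ?L"
  proof (rule subsetI)
   fix p assume p: "p \<in> ?R"
   then obtain i where i: "snd p 0 = real i" by (auto simp: Nats_def)
   hence "p \<in> ?Q i" using p by force
   hence x: "fst p \<in> B i" and e: "(%m. snd p (Suc m)) = b i (fst p)" by auto
   have "snd p n = ?b (fst p) n" for n using i idx[OF x] fun_cong[OF e, of "n - 1"] by (cases n) auto
   hence "snd p = ?b (fst p)" by (rule ext)
   hence "p = (fst p, ?b (fst p))" by (simp add: prod_eq_iff)
   thus "p \<in> ?L" using x by blast
  qed
 qed
 moreover have "closed ?R"
 proof (intro closed_Int closed_INT ballI closed_Un closed_graph_set_preimage b(2))
  have c: "continuous_on UNIV (%p :: 'a \<times> (nat => real). snd p 0)"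
   by (intro continuous_on_compose2[OF continuous_on_product_coordinates continuous_on_snd] continuous_intros) auto
  have "closed ((%p :: 'a \<times> (nat => real). snd p 0) -` \<nat>)" by (rule closed_vimage[OF closed_Nats c])
  thus "closed {p :: 'a \<times> (nat => real). snd p 0 \<in> \<nat>}" by (simp add: vimage_def)
  show "closed {p :: 'a \<times> (nat => real). 1 <= \<bar>snd p 0 - real i\<bar>}" for i by (intro closed_Collect_le continuous_intros c)
 qed
 moreover have "?b \<in> borel_measurable borel"
 proof (rule measurable_coordinatewise_then_product)
  fix n
  have 1: "(%x. real (idx x)) \<in> borel_measurable borel" by (rule measurable_compose[OF midx]) simp
  have 2: "(%x. b (idx x) x (n - 1)) \<in> borel_measurable borel"
   by (rule measurable_compose_countable[OF measurable_function_coordinate[OF b(1)] midx])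
  show "(%x. ?b x n) \<in> borel_measurable borel" using 1 2 by (cases "n = 0") simp_all
 qed
 ultimately show ?thesis unfolding closed_graph_set_def by auto
qed

lemma closed_graph_set_Int:
 assumes "closed_graph_set A" "closed_graph_set B" shows "closed_graph_set (A Int B)"
proof -
 have "(\<Inter>i::nat. if i = 0 then A else B) = A Int B"
 proof
  show "(\<Inter>i::nat. if i = 0 then A else B) \<subseteq> A Int B"
   using INT_lower[of 0 UNIV "%i::nat. if i = 0 then A else B"] INT_lower[of 1 UNIV "%i::nat. if i = 0 then A else B"] by simp
 qed auto
 moreover have "closed_graph_set (\<Inter>i::nat. if i = 0 then A else B)" by (rule closed_graph_set_Inter) (use assms in simp)
 ultimately show ?thesis by simp
qed

text \<open>Induction for a set and its complement simultaneously; unions are made disjoint with the help of the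
 complements.\<close>

lemma borel_closed_graph_set:
 fixes B :: "'a::polish_space set"
 assumes "B \<in> sets borel" shows "closed_graph_set B"
proof -
 have "B \<in> sigma_sets UNIV {S :: 'a set. open S}" using assms by (simp add: borel_def)
 hence "closed_graph_set B & closed_graph_set (- B)"
 proof (induction rule: sigma_sets.induct)
  case (Basic a)
  thus ?case using closed_graph_set_open[of a] closed_graph_set_closed[of "- a"] by (simp add: closed_Compl)
 next
  case (Compl a)
  thus ?case by (simp add: Compl_eq_Diff_UNIV[symmetric])
 next
  case (Union A)
  let ?D = "%i. A i Int (\<Inter>j. if j < i then - A j else UNIV)"
  have A: "A i \<in> sets borel" for i using Union.hyps[of i] by (simp add: borel_def)
  have "closed_graph_set (?D i)" for i
   by (intro closed_graph_set_Int closed_graph_set_Inter) (use Union.IH closed_graph_set_closed[OF closed_UNIV] in auto)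
  moreover have "disjoint_family ?D" unfolding disjoint_family_on_def
  proof (intro ballI impI)
   fix m n :: nat assume "m ~= n"
   then consider "m < n" | "n < m" by linarith
   thus "?D m Int ?D n = {}"
   proof cases
    case 1
    hence "?D n \<subseteq> - A m" using INT_lower[of m UNIV "%j. if j < n then - A j else UNIV"] by auto
    thus ?thesis by blast
   next
    case 2
    hence "?D m \<subseteq> - A n" using INT_lower[of n UNIV "%j. if j < m then - A j else UNIV"] by auto
    thus ?thesis by blast
   qed
  qed
  moreover have "?D i \<in> sets borel" for i
  proof (intro sets.Int A sets.countable_INT)
   show "range (%j. if j < i then - A j else UNIV) \<subseteq> sets borel" using A by (auto simp: Compl_in_sets_lebesgue sets.compl_sets Compl_eq_Diff_UNIV)
  qed auto
  ultimately have "closed_graph_set (\<Union>i. ?D i)" by (rule closed_graph_set_disjoint_Union)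
  moreover have "(\<Union>i. ?D i) = (\<Union>i. A i)"
  proof
   show "(\<Union>i. A i) \<subseteq> (\<Union>i. ?D i)"
   proof
    fix x assume "x \<in> (\<Union>i. A i)"
    then obtain i where "x \<in> A i" by blast
    hence "x \<in> ?D (LEAST i. x \<in> A i)" by (auto intro: LeastI dest: not_less_Least)
    thus "x \<in> (\<Union>i. ?D i)" by blast
   qed
  qed auto
  moreover have "closed_graph_set (\<Inter>i. - A i)" using Union.IH by (intro closed_graph_set_Inter) simp
  ultimately show ?case by (simp add: Compl_UN)
 qed (simp add: closed_graph_set_closed)
 thus ?thesis ..
qed

lemma inj_polish_real: "\<exists>j :: 'a::polish_space => real. inj j"
proof -
 obtain \<B> :: "'a set set" where B: "countable \<B>" "!!C. C \<in> \<B> ==> open C" "!!S. open S ==> \<exists>U. U \<subseteq> \<B> & S = \<Union>U"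
  using univ_second_countable by blast
 let ?f = "%x :: 'a. {n :: nat. n \<in> to_nat_on \<B> ` {C \<in> \<B>. x \<in> C}}"
 have "inj ?f"
 proof (rule injI, rule ccontr)
  fix x y assume f: "?f x = ?f y" and "x ~= y"
  then obtain S where S: "open S" "x \<in> S" "y \<notin> S" using t1_space[of x y] by blast
  then obtain C where C: "C \<in> \<B>" "x \<in> C" "y \<notin> C" using B(3)[OF S(1)] by blast
  hence "to_nat_on \<B> C \<in> ?f y" using f by blast
  then obtain C' where "C' \<in> \<B>" "y \<in> C'" "to_nat_on \<B> C' = to_nat_on \<B> C" by auto
  thus False using C B(1) by (metis inj_on_to_nat_on inj_onD)
 qed
 moreover obtain g :: "nat set => real" where "bij g" using nat_sets_eqpoll_reals by (auto simp: eqpoll_def)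
 ultimately have "inj (g \<circ> ?f)" using inj_compose[OF bij_is_inj] by blast
 thus ?thesis by blast
qed

text \<open>The topology of the graph is transported along an injection into the reals.\<close>

lemma real_model_of_borel_subset:
 fixes Q :: "'w measure" and Phi :: "'w => 'a::polish_space"
 assumes inj: "inj_on Phi (space Q)" and im: "Phi ` space Q \<in> sets borel" and meas: "Phi \<in> borel_measurable Q"
  and gen: "!!E. E \<in> sets Q ==> \<exists>B\<in>sets borel. E = Phi -` B Int space Q"
 shows "\<exists>(iota :: 'w => real) tau. inj_on iota (space Q) & polish_topology tau & topspace tau = iota ` space Q &
   sets (borel_of tau) = {iota ` E |E. E \<in> sets Q}"
proof -
 obtain b :: "'a => nat => real" where b: "b \<in> borel_measurable borel" "closed {(x, b x) |x. x \<in> Phi ` space Q}"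
  using borel_closed_graph_set[OF im] by (auto simp: closed_graph_set_def)
 define C where "C = {(x, b x) |x. x \<in> Phi ` space Q}"
 define psi where "psi = (%w. (Phi w, b (Phi w)))"
 have psi: "psi \<in> borel_measurable Q" unfolding psi_def using meas measurable_compose[OF meas b(1)] by (rule borel_measurable_Pair)
 obtain j :: "'a => real" where j: "inj j" using inj_polish_real by blast
 define iota where "iota = j \<circ> Phi"
 have iota: "inj_on iota (space Q)" unfolding iota_def using inj j by (intro comp_inj_on) (auto intro: inj_on_subset)
 define S where "S = iota ` space Q"
 define f where "f = (%r. psi (inv_into (space Q) iota r))"
 have fiota: "f (iota w) = psi w" if "w \<in> space Q" for w using iota that by (simp add: f_def inv_into_f_f)
 define tau where "tau = pullback_topology S f (top_of_set C)"
 have fS: "f ` S = C" using fiota by (auto simp: S_def C_def psi_def image_iff) 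
 have injf: "inj_on f S" using fiota inj unfolding S_def by (intro inj_onI) (auto simp: psi_def dest: inj_onD)
 have ts: "topspace tau = S" unfolding tau_def topspace_pullback_topology using fS by auto
 have op: "openin tau U \<longleftrightarrow> (\<exists>W. open W & U = f -` W Int S)" for U
  unfolding tau_def openin_pullback_topology openin_open using fS by auto
 have "homeomorphic_map tau (top_of_set C) f" unfolding homeomorphic_map_def quotient_map_def
 proof (intro conjI allI impI)
  show "f ` topspace tau = topspace (top_of_set C)" using fS ts by simp
  show "inj_on f (topspace tau)" using injf ts by simp
  fix U assume "U \<subseteq> topspace (top_of_set C)"
  hence U: "U \<subseteq> C" by simp
  show "openin tau {x \<in> topspace tau. f x \<in> U} \<longleftrightarrow> openin (top_of_set C) U"
  proof
   assume "openin tau {x \<in> topspace tau. f x \<in> U}"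
   then obtain W where W: "open W" "{x \<in> S. f x \<in> U} = f -` W Int S" unfolding op ts by blast
   have "U = C Int W"
   proof
    show "U \<subseteq> C Int W"
    proof
     fix y assume y: "y \<in> U"
     then obtain s where s: "s \<in> S" "f s = y" using U fS by blast
     hence "s \<in> f -` W Int S" using W(2) y by blast
     thus "y \<in> C Int W" using s y U by auto
    qed
    show "C Int W \<subseteq> U"
    proof
     fix y assume y: "y \<in> C Int W"
     then obtain s where s: "s \<in> S" "f s = y" using fS by blast
     hence "s \<in> {x \<in> S. f x \<in> U}" using W(2) y by blast
     thus "y \<in> U" using s by simp
    qed
   qed
   thus "openin (top_of_set C) U" using W(1) by (auto simp: openin_open)
  next
   assume "openin (top_of_set C) U"
   then obtain W where "open W" "U = C Int W" by (auto simp: openin_open)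
   thus "openin tau {x \<in> topspace tau. f x \<in> U}" unfolding op ts using fS by (intro exI[of _ W]) auto
  qed
 qed
 hence hom: "tau homeomorphic_space top_of_set C" by (rule homeomorphic_map_imp_homeomorphic_space)
 have "completely_metrizable_space (top_of_set C)" by (rule completely_metrizable_space_closedin[OF completely_metrizable_space_euclidean])
    (use b(2) in \<open>simp add: C_def closed_closedin[symmetric]\<close>)
 moreover have "separable_space (top_of_set C)"
 proof (rule second_countable_imp_separable_space, rule second_countable_subtopology)
  show "second_countable (euclidean :: ('a \<times> (nat => real)) topology)"
   unfolding second_countable_def using ex_countable_basis[where 'a = "'a \<times> (nat => real)"]
   by (metis open_openin topological_basisE topological_basis_open)
 qed
 ultimately have "polish_topology tau"
  unfolding polish_topology_def using hom homeomorphic_completely_metrizable_space homeomorphic_separable_space by blast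
 moreover have "sets (borel_of tau) = {iota ` E |E. E \<in> sets Q}"
 proof -
  have "sets (borel_of tau) = sigma_sets S {U. openin tau U}" unfolding borel_of_def ts by (rule sets_measure_of) (use ts openin_subset in blast)
  also have "{U. openin tau U} = {f -` W Int S |W. W \<in> {W. open W}}" using op by auto
  also have "sigma_sets S \<dots> = {f -` W Int S |W. W \<in> sigma_sets UNIV {W. open W}}" by (rule sigma_sets_vimage_commute[symmetric]) simp
  also have "\<dots> = {f -` W Int S |W. W \<in> sets borel}" by (simp add: borel_def)
  also have "\<dots> = {iota ` E |E. E \<in> sets Q}"
  proof
   have *: "f -` W Int S = iota ` (psi -` W Int space Q)" for W using fiota by (auto simp: S_def)
   show "{f -` W Int S |W. W \<in> sets borel} \<subseteq> {iota ` E |E. E \<in> sets Q}" unfolding * using measurable_sets[OF psi] by blast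
   show "{iota ` E |E. E \<in> sets Q} \<subseteq> {f -` W Int S |W. W \<in> sets borel}"
   proof
    fix X assume "X \<in> {iota ` E |E. E \<in> sets Q}"
    then obtain E B where E: "X = iota ` E" "B \<in> sets borel" "E = Phi -` B Int space Q" using gen by blast
    have "fst -` B \<in> sets (borel :: ('a \<times> (nat => real)) measure)"
     using measurable_sets[OF borel_measurable_continuous_onI[OF continuous_on_fst[OF continuous_on_id]] E(2)] by simp
    moreover have "X = f -` (fst -` B) Int S" unfolding * E by (auto simp: psi_def)
    ultimately show "X \<in> {f -` W Int S |W. W \<in> sets borel}" by blast
   qed
  qed
  finally show ?thesis .
 qed
 ultimately show ?thesis using iota ts by (intro exI[of _ iota] exI[of _ tau]) (simp add: S_def)
qed

section \<open>The Poisson point process\<close>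

text \<open>The bands \<open>Bn\<close> have finite measure, and on each of them the mark is uniform on \<open>[0,1)\<close>. The sets \<open>W k\<close>
 have infinite measure and are almost surely met. The point \<open>z0\<close> is a default value.\<close>

locale poisson_system =
 fixes nu :: "'z::polish_space measure" and Bn :: "nat => 'z set" and mark :: "'z => real"
  and W :: "nat => 'z set" and z0 :: 'z
 assumes sets_nu: "sets nu = {S \<in> sets borel. S \<subseteq> space nu}"
  and z0: "z0 \<notin> space nu"
  and Bn: "Bn n \<in> sets nu" "disjoint_family Bn" "(\<Union>n. Bn n) = space nu"
  and Bn_measure: "0 < emeasure nu (Bn n)" "emeasure nu (Bn n) < \<infinity>"
  and mark: "mark \<in> borel_measurable borel" "!!z. z \<in> space nu ==> 0 <= mark z & mark z < 1"
  and mark_uniform: "!!n s t. 0 <= s ==> s <= t ==> t <= 1 ==>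
    emeasure nu (Bn n Int mark -` {s..<t}) = ennreal (t - s) * emeasure nu (Bn n)"
  and W: "W k \<in> sets nu" "emeasure nu (W k) = \<infinity>"
begin

text \<open>Countably many almost sure properties are built in, so that later statements hold for every configuration.\<close>

definition configs :: "'z set set" where
 "configs = {om. om \<subseteq> space nu & (\<forall>n. finite (om Int Bn n)) & inj_on mark om & (\<forall>k. om Int W k ~= {})}"

definition void :: "'z set => 'z set set" where
 "void B = {om \<in> configs. om Int B = {}}"

definition void_prob :: "'z set => real" where
 "void_prob B = (if emeasure nu B = \<infinity> then 0 else exp (- measure nu B))"

definition rate :: "nat => real" where
 "rate n = measure nu (Bn n)"

definition band :: "nat => 'z measure" where
 "band n = restrict_space (uniform_measure nu (Bn n)) (Bn n)"

text \<open>A Poisson number of points, taken from an infinite reservoir of independent ones.\<close>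

definition pack :: "nat => (nat \<times> (nat => 'z)) measure" where
 "pack n = measure_pmf (poisson_pmf (rate n)) \<Otimes>\<^sub>M (\<Pi>\<^sub>M j\<in>UNIV. band n)"

definition samples :: "(nat => nat \<times> (nat => 'z)) measure" where
 "samples = (\<Pi>\<^sub>M n\<in>UNIV. pack n)"

definition pts :: "(nat => nat \<times> (nat => 'z)) => 'z set" where
 "pts th = {snd (th n) j |n j. j < fst (th n)}"

lemma rate_pos: "0 < rate n" and emeasure_Bn: "emeasure nu (Bn n) = ennreal (rate n)"
 using Bn_measure[of n] emeasure_eq_ennreal_measure[of nu "Bn n"] by (auto simp: rate_def measure_def enn2real_positive_iff)

lemma finite_piece: "emeasure nu (S Int Bn n) ~= \<infinity>"
proof -
 have "emeasure nu (S Int Bn n) <= emeasure nu (Bn n)" by (rule emeasure_mono) (use Bn in auto)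
 thus ?thesis using Bn_measure(2)[of n] by (auto simp: top_unique)
qed

lemma space_band [simp]: "space (band n) = Bn n"
 using sets.sets_into_space[OF Bn(1)] by (auto simp: band_def space_restrict_space)

lemma sets_band: "S \<in> sets (band n) \<longleftrightarrow> S \<in> sets nu & S \<subseteq> Bn n"
 unfolding band_def using Bn(1)[of n] by (subst sets_restrict_space_iff) (auto simp: Int_absorb1 sets.sets_into_space)

lemma emeasure_band: "S \<in> sets nu ==> S \<subseteq> Bn n ==> emeasure (band n) S = ennreal (measure nu S / rate n)"
proof -
 assume S: "S \<in> sets nu" "S \<subseteq> Bn n"
 have "emeasure (band n) S = emeasure (uniform_measure nu (Bn n)) S"
  unfolding band_def using S Bn(1)[of n] by (subst emeasure_restrict_space) (auto simp: Int_absorb1 sets.sets_into_space)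
 also have "\<dots> = emeasure nu S / ennreal (rate n)" using S Bn(1)[of n] by (simp add: emeasure_uniform_measure Int_absorb1 emeasure_Bn)
 also have "emeasure nu S = ennreal (measure nu S)" using finite_piece[of S n] S by (simp add: emeasure_eq_ennreal_measure Int_absorb2)
 finally show ?thesis using rate_pos[of n] by (simp add: divide_ennreal)
qed

lemma prob_space_band: "prob_space (band n)"
 by (rule prob_spaceI) (use emeasure_band[OF Bn(1) subset_refl, of n] rate_pos[of n] in \<open>simp add: rate_def\<close>)

lemma prob_space_band_PiM: "prob_space (\<Pi>\<^sub>M j\<in>UNIV. band n)"
 by (rule prob_space_PiM) (rule prob_space_band)

lemma prob_space_pack: "prob_space (pack n)"
 unfolding pack_def by (rule prob_space_pair[OF measure_pmf.prob_space_axioms prob_space_band_PiM])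

lemma prob_space_samples: "prob_space samples"
 unfolding samples_def by (rule prob_space_PiM) (rule prob_space_pack)

definition avoid :: "nat => 'z set => (nat \<times> (nat => 'z)) set" where
 "avoid n B = {y \<in> space (pack n). \<forall>j<fst y. snd y j \<in> Bn n - B}"

lemma space_pack: "y \<in> space (pack n) \<longleftrightarrow> (\<forall>j. snd y j \<in> Bn n)"
 by (cases y) (auto simp: pack_def space_pair_measure space_PiM PiE_iff)

lemma measurable_point: "(%y. snd y j) \<in> measurable (pack n) (band n)"
 unfolding pack_def by measurable

lemma measurable_count: "fst \<in> measurable (pack n) (count_space UNIV)"
 unfolding pack_def by measurable

lemma avoid_sets:
 assumes "B \<in> sets nu" shows "avoid n B \<in> sets (pack n)"
proof -
 have [measurable]: "Bn n - B \<in> sets (band n)" using assms Bn(1)[of n] by (auto simp: sets_band)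
 note measurable_point[measurable] measurable_count[measurable]
 show ?thesis unfolding avoid_def by measurable
qed

text \<open>Given the number of points, each avoids \<open>B\<close> independently; summing over the Poisson weights gives the
 exponential.\<close>

lemma emeasure_avoid:
 assumes B: "B \<in> sets nu"
 shows "emeasure (pack n) (avoid n B) = ennreal (exp (- measure nu (B Int Bn n)))"
proof -
 interpret P: prob_space "\<Pi>\<^sub>M j\<in>(UNIV :: nat set). band n" by (rule prob_space_band_PiM)
 interpret PP: product_prob_space "%_::nat. band n" UNIV
  by (simp add: product_prob_space_def product_prob_space_axioms_def product_sigma_finite_def prob_space_band
    prob_space_imp_sigma_finite)
 define q where "q = measure nu (Bn n - B) / rate n"
 have q0: "0 <= q" using rate_pos[of n] by (simp add: q_def)
 have "measure nu (Bn n - B) = measure nu (Bn n) - measure nu (B Int Bn n)"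
  using measure_Diff[of nu "Bn n" "B Int Bn n"] finite_piece[of UNIV n] B Bn(1)[of n]
  by (simp add: Diff_Int_distrib2) (metis Diff_Int2 Diff_Int_distrib2 Int_commute Int_lower2 inf.idem set_diff_eq)
 hence q: "rate n * q = rate n - measure nu (B Int Bn n)" using rate_pos[of n] by (simp add: q_def rate_def)
 have slice: "emeasure (\<Pi>\<^sub>M j\<in>UNIV. band n) (Pair k -` avoid n B) = ennreal (q ^ k)" for k
 proof -
  have "Pair k -` avoid n B = prod_emb UNIV (%_. band n) {..<k} (\<Pi>\<^sub>E j\<in>{..<k}. Bn n - B)"
   by (auto simp: avoid_def prod_emb_def space_pack space_PiM PiE_iff extensional_def)
  hence "emeasure (\<Pi>\<^sub>M j\<in>UNIV. band n) (Pair k -` avoid n B) = (\<Prod>j<k. emeasure (band n) (Bn n - B))"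
   using PP.emeasure_PiM_emb[of "{..<k}" "%_. Bn n - B"] B Bn(1)[of n] by (simp add: sets_band)
  also have "emeasure (band n) (Bn n - B) = ennreal q" unfolding q_def by (rule emeasure_band) (use B Bn(1)[of n] in auto)
  finally show ?thesis using q0 by (simp add: ennreal_power)
 qed
 have "emeasure (pack n) (avoid n B) = (\<integral>\<^sup>+ k. emeasure (\<Pi>\<^sub>M j\<in>UNIV. band n) (Pair k -` avoid n B) \<partial>measure_pmf (poisson_pmf (rate n)))"
  using avoid_sets[OF B, of n] unfolding pack_def by (rule P.emeasure_pair_measure_alt)
 also have "\<dots> = (\<Sum>k. ennreal (pmf (poisson_pmf (rate n)) k) * ennreal (q ^ k))"
  unfolding slice nn_integral_measure_pmf by (rule nn_integral_count_space_nat)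
 also have "\<dots> = (\<Sum>k. ennreal (exp (- rate n) * ((rate n * q) ^ k /\<^sub>R fact k)))" using rate_pos[of n] q0
  by (intro suminf_cong) (simp add: ennreal_mult[symmetric] power_mult_distrib field_simps)
 also have "\<dots> = ennreal (exp (- rate n) * exp (rate n * q))"
 proof (rule suminf_ennreal_eq)
  show "(%k. exp (- rate n) * ((rate n * q) ^ k /\<^sub>R fact k)) sums (exp (- rate n) * exp (rate n * q))" by (intro sums_mult exp_converges)
  show "0 <= exp (- rate n) * ((rate n * q) ^ k /\<^sub>R fact k)" for k using rate_pos[of n] q0 by simp
 qed
 also have "exp (- rate n) * exp (rate n * q) = exp (- measure nu (B Int Bn n))" by (simp add: q mult_exp_exp)
 finally show ?thesis .
qed

lemma space_samples: "th \<in> space samples \<longleftrightarrow> (\<forall>n j. snd (th n) j \<in> Bn n)"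
 by (auto simp: samples_def space_PiM PiE_iff space_pack)

definition avoiding :: "'z set => (nat => nat \<times> (nat => 'z)) set" where
 "avoiding B = {th \<in> space samples. pts th Int B = {}}"

lemma measure_avoid_first:
 assumes B: "B \<in> sets nu"
 shows "{th \<in> space samples. \<forall>n<m. th n \<in> avoid n B} \<in> sets samples" (is "?A \<in> _")
  and "measure samples {th \<in> space samples. \<forall>n<m. th n \<in> avoid n B} = exp (- (\<Sum>n<m. measure nu (B Int Bn n)))"
proof -
 interpret PP: product_prob_space pack UNIV
  by (simp add: product_prob_space_def product_prob_space_axioms_def product_sigma_finite_def prob_space_pack
    prob_space_imp_sigma_finite)
 have A: "?A = prod_emb UNIV pack {..<m} (\<Pi>\<^sub>E n\<in>{..<m}. avoid n B)" by (auto simp: samples_def prod_emb_def space_PiM PiE_iff)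
 show "?A \<in> sets samples" unfolding A unfolding samples_def by (intro sets_PiM_I_finite measurable_prod_emb) (use avoid_sets[OF B] in auto)
 have "emeasure samples ?A = (\<Prod>n<m. ennreal (exp (- measure nu (B Int Bn n))))"
  unfolding A unfolding samples_def using PP.emeasure_PiM_emb[of "{..<m}" "%n. avoid n B"] avoid_sets[OF B] by (simp add: emeasure_avoid[OF B])
 also have "\<dots> = ennreal (exp (- (\<Sum>n<m. measure nu (B Int Bn n))))" by (simp add: prod_ennreal exp_sum sum_negf[symmetric])
 finally show "measure samples ?A = exp (- (\<Sum>n<m. measure nu (B Int Bn n)))" by (simp add: measure_def)
qed

lemma avoiding_eq: "avoiding B = (\<Inter>m. {th \<in> space samples. \<forall>n<m. th n \<in> avoid n B})"
proof -
 have *: "th n \<in> avoid n B \<longleftrightarrow> (\<forall>j<fst (th n). snd (th n) j \<notin> B)" if "th \<in> space samples" for th n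
  using that by (auto simp: avoid_def space_samples space_pack)
 have **: "pts th Int B = {} \<longleftrightarrow> (\<forall>n. \<forall>j<fst (th n). snd (th n) j \<notin> B)" for th by (auto simp: pts_def)
 show ?thesis unfolding avoiding_def ** using * by (auto intro: lessI)
qed

lemma measure_avoiding:
 assumes B: "B \<in> sets nu"
 shows "avoiding B \<in> sets samples" and "measure samples (avoiding B) = void_prob B"
proof -
 interpret prob_space samples by (rule prob_space_samples)
 let ?A = "%m. {th \<in> space samples. \<forall>n<m. th n \<in> avoid n B}"
 let ?s = "%m. \<Sum>n<m. measure nu (B Int Bn n)"
 show "avoiding B \<in> sets samples" unfolding avoiding_eq
 proof (rule sets.countable_INT)
  show "range ?A \<subseteq> sets samples" using measure_avoid_first(1)[OF B] by blast
 qed simp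
 have lim: "(%m. exp (- ?s m)) \<longlonglongrightarrow> measure samples (avoiding B)" unfolding avoiding_eq measure_avoid_first(2)[OF B, symmetric]
 proof (rule finite_Lim_measure_decseq)
  show "range ?A \<subseteq> sets samples" using measure_avoid_first(1)[OF B] by blast
  show "decseq ?A" by (auto simp: decseq_def)
 qed
 have UN: "(\<Union>n. B Int Bn n) = B" using Bn(3) sets.sets_into_space[OF B] by auto
 have dis: "disjoint_family (%n. B Int Bn n)" using Bn(2) by (auto simp: disjoint_family_on_def)
 have rng: "range (%n. B Int Bn n) \<subseteq> sets nu" using B Bn(1) by auto
 show "measure samples (avoiding B) = void_prob B"
 proof (cases "emeasure nu B = \<infinity>")
  case False
  hence "emeasure nu (\<Union>n. B Int Bn n) ~= \<infinity>" by (simp only: UN not_False_eq_True)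
  from measure_UNION[OF rng dis this]
  have "(%n. measure nu (B Int Bn n)) sums measure nu B" by (simp only: UN)
  hence "(%m. exp (- ?s m)) \<longlonglongrightarrow> exp (- measure nu B)" unfolding sums_def by (intro tendsto_intros)
  thus ?thesis using LIMSEQ_unique[OF lim] False by (simp add: void_prob_def)
 next
  case True
  have "measure samples (avoiding B) = 0"
  proof (rule ccontr)
   assume "measure samples (avoiding B) ~= 0"
   hence c: "0 < measure samples (avoiding B)" (is "0 < ?c") by (simp add: zero_less_measure_iff)
   have "?c <= exp (- ?s m)" for m unfolding measure_avoid_first(2)[OF B, symmetric] avoiding_eq
    by (rule finite_measure_mono[OF _ measure_avoid_first(1)[OF B]]) blast
   hence l: "ln ?c <= - ?s m" for m using c ln_le_cancel_iff[of ?c "exp (- ?s m)"] by simp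
   have s: "?s m <= - ln ?c" for m using l[of m] by linarith
   have le: "(\<Sum>n. emeasure nu (B Int Bn n)) <= ennreal (- ln ?c)"
   proof (rule suminf_le_const)
    fix m
    have "(\<Sum>n<m. emeasure nu (B Int Bn n)) = (\<Sum>n<m. ennreal (measure nu (B Int Bn n)))"
     using finite_piece by (intro sum.cong refl emeasure_eq_ennreal_measure) auto
    also have "\<dots> = ennreal (?s m)" by (simp add: sum_ennreal)
    also have "\<dots> <= ennreal (- ln ?c)" using s by (rule ennreal_leI)
    finally show "(\<Sum>n<m. emeasure nu (B Int Bn n)) <= ennreal (- ln ?c)" .
   qed simp
   have "emeasure nu B <= ennreal (- ln ?c)" using le unfolding suminf_emeasure[OF rng dis] UN .
   thus False using True by (simp add: top_unique)
  qed
  thus ?thesis using True by (simp add: void_prob_def)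
 qed
qed

lemma void_prob_Un:
 assumes "S \<in> sets nu" "S' \<in> sets nu" "S Int S' = {}" "emeasure nu S ~= \<infinity>" "emeasure nu S' ~= \<infinity>"
 shows "void_prob (S Un S') = void_prob S * void_prob S'"
proof -
 have "emeasure nu (S Un S') ~= \<infinity>" using assms emeasure_subadditive[OF assms(1,2)] by (auto simp: top_unique)
 moreover have "measure nu (S Un S') = measure nu S + measure nu S'" by (rule measure_Union) (use assms in auto)
 ultimately show ?thesis using assms by (simp add: void_prob_def exp_add[symmetric])
qed

text \<open>Independence, and \<open>1 - exp (- x) \<le> x\<close>.\<close>

lemma measure_two_hits:
 assumes S: "S \<in> sets nu" "S' \<in> sets nu" "S Int S' = {}" "emeasure nu S ~= \<infinity>" "emeasure nu S' ~= \<infinity>"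
 shows "measure samples (space samples - (avoiding S Un avoiding S')) <= measure nu S * measure nu S'"
proof -
 interpret prob_space samples by (rule prob_space_samples)
 note av = measure_avoiding[OF S(1)] measure_avoiding[OF S(2)]
 have "avoiding S Int avoiding S' = avoiding (S Un S')" by (auto simp: avoiding_def)
 hence "prob (avoiding S Int avoiding S') = void_prob S * void_prob S'" using measure_avoiding(2)[of "S Un S'"] S by (simp add: void_prob_Un)
 hence "prob (avoiding S Un avoiding S') = void_prob S + void_prob S' - void_prob S * void_prob S'"
  using measure_Un3[of "avoiding S" samples "avoiding S'"] av by (simp add: fmeasurable_eq_sets)
 hence "measure samples (space samples - (avoiding S Un avoiding S')) = (1 - void_prob S) * (1 - void_prob S')"
  using prob_compl[of "avoiding S Un avoiding S'"] av by (simp add: algebra_simps)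
 also have "\<dots> <= measure nu S * measure nu S'"
 proof (rule mult_mono)
  have "1 - exp (- x) <= x" for x :: real using exp_ge_add_one_self[of "- x"] by linarith
  thus "1 - void_prob S <= measure nu S" "1 - void_prob S' <= measure nu S'" using S by (auto simp: void_prob_def)
  show "0 <= 1 - void_prob S'" by (simp add: void_prob_def)
 qed simp
 finally show ?thesis .
qed

text \<open>Cut \<open>[0,1)\<close> into \<open>K\<close> equal intervals. Points in both sets with marks in a common interval
 occur with probability of order \<open>K \<cdot> (1/K)\<^sup>2\<close>.\<close>

lemma AE_no_coincidence:
 assumes O: "O1 \<in> sets nu" "O2 \<in> sets nu" "O1 Int O2 = {}" "emeasure nu O1 ~= \<infinity>" "emeasure nu O2 ~= \<infinity>"
  and bound: "!!s t. 0 <= s ==> s <= t ==> t <= 1 ==> measure nu (O1 Int mark -` {s..<t}) <= C * (t - s)"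
   "!!s t. 0 <= s ==> s <= t ==> t <= 1 ==> measure nu (O2 Int mark -` {s..<t}) <= C * (t - s)"
 shows "AE th in samples. \<forall>z\<in>pts th Int O1. \<forall>z'\<in>pts th Int O2. mark z ~= mark z'"
proof -
 interpret prob_space samples by (rule prob_space_samples)
 define J where "J = (%K l. mark -` {real l / real (Suc K)..<real (Suc l) / real (Suc K)})"
 define D where "D = (%K. \<Union>l\<in>{..<Suc K}. space samples - (avoiding (O1 Int J K l) Un avoiding (O2 Int J K l)))"
 have C0: "0 <= C" using order_trans[OF measure_nonneg bound(1)[of 0 1]] by simp
 have sJ: "S Int J K l \<in> sets nu" if "S \<in> sets nu" for S K l
 proof -
  have "J K l \<in> sets borel" using measurable_sets[OF mark(1), of "{real l / real (Suc K)..<real (Suc l) / real (Suc K)}"] by (simp add: J_def)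
  thus ?thesis using that by (auto simp: sets_nu)
 qed
 have fin: "emeasure nu (S Int T) ~= \<infinity>" if "S \<in> sets nu" "emeasure nu S ~= \<infinity>" for S T
  using emeasure_mono[of "S Int T" S nu] that by (auto simp: top_unique)
 have D: "D K \<in> sets samples" for K unfolding D_def using measure_avoiding(1) sJ O by (intro sets.finite_UN) auto
 have le0: "measure samples (D K) <= C * C / real (Suc K)" for K
 proof -
  have "measure samples (D K) <= (\<Sum>l<Suc K. measure samples (space samples - (avoiding (O1 Int J K l) Un avoiding (O2 Int J K l))))"
   unfolding D_def using measure_avoiding(1) sJ O by (intro finite_measure_subadditive_finite) auto
  also have "\<dots> <= (\<Sum>l<Suc K. (C / real (Suc K)) * (C / real (Suc K)))"
  proof (rule sum_mono)
   fix l assume "l \<in> {..<Suc K}"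
   hence l: "real (Suc l) / real (Suc K) <= 1" by (simp add: field_simps)
   have d: "real (Suc l) / real (Suc K) - real l / real (Suc K) = 1 / real (Suc K)" by (simp add: field_simps)
   have b: "measure nu (O1 Int J K l) <= C / real (Suc K)" "measure nu (O2 Int J K l) <= C / real (Suc K)"
    using bound(1)[of "real l / real (Suc K)" "real (Suc l) / real (Suc K)"]
     bound(2)[of "real l / real (Suc K)" "real (Suc l) / real (Suc K)"] l unfolding d by (auto simp: J_def divide_right_mono)
   have "measure samples (space samples - (avoiding (O1 Int J K l) Un avoiding (O2 Int J K l)))
     <= measure nu (O1 Int J K l) * measure nu (O2 Int J K l)" using O sJ fin by (intro measure_two_hits) auto
   also have "\<dots> <= (C / real (Suc K)) * (C / real (Suc K))" using b C0 by (intro mult_mono) auto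
   finally show "measure samples (space samples - (avoiding (O1 Int J K l) Un avoiding (O2 Int J K l)))
     <= (C / real (Suc K)) * (C / real (Suc K))" .
  qed
  also have "\<dots> = C * C / real (Suc K)" by simp
  finally show ?thesis .
 qed
 have le: "measure samples (\<Inter>K. D K) <= C * C / real (Suc K)" for K
 proof -
  have "(\<Inter>K. D K) \<subseteq> D K" by blast
  from finite_measure_mono[OF this D] le0[of K] show ?thesis by (rule order_trans)
 qed
 have "(%K. C * C / real (Suc K)) \<longlonglongrightarrow> 0" using LIMSEQ_Suc[OF lim_const_over_n[of "C * C"]] by simp
 hence "measure samples (\<Inter>K. D K) <= 0" by (rule LIMSEQ_le_const) (use le in blast)
 hence null: "(\<Inter>K. D K) \<in> null_sets samples" using D by (intro null_setsI) (auto simp: emeasure_eq_measure measure_le_0_iff)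
 show ?thesis
 proof (rule AE_I'[OF null], rule subsetI)
  fix th assume "th \<in> {th \<in> space samples. ~ (\<forall>z\<in>pts th Int O1. \<forall>z'\<in>pts th Int O2. mark z ~= mark z')}"
  then obtain z z' where z: "th \<in> space samples" "z \<in> pts th Int O1" "z' \<in> pts th Int O2" "mark z = mark z'" by blast
  have m: "0 <= mark z" "mark z < 1" using mark(2)[of z] z sets.sets_into_space[OF O(1)] by auto
  show "th \<in> (\<Inter>K. D K)"
  proof (rule INT_I)
   fix K
   define x where "x = mark z * real (Suc K)"
   define l where "l = nat \<lfloor>x\<rfloor>"
   have "0 <= \<lfloor>x\<rfloor>" using m by (simp add: x_def zero_le_floor)
   hence rl: "real l = of_int \<lfloor>x\<rfloor>" unfolding l_def by simp
   have l1: "real l <= x" "x < real (Suc l)" using rl of_int_floor_le[of x] real_of_int_floor_add_one_gt[of x] by linarith+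
   have "mark z * real (Suc K) < 1 * real (Suc K)" using m by (intro mult_strict_right_mono) auto
   hence "x < real (Suc K)" by (simp add: x_def)
   hence "real l < real (Suc K)" using l1(1) by (rule le_less_trans[rotated])
   hence l: "l < Suc K" by simp
   have mz: "mark z = x / real (Suc K)" by (simp add: x_def)
   have "mark z \<in> {real l / real (Suc K)..<real (Suc l) / real (Suc K)}"
    unfolding mz using l1 by (simp add: divide_right_mono divide_strict_right_mono del: of_nat_Suc)
   hence "z \<in> J K l" "z' \<in> J K l" using z(4) by (auto simp: J_def)
   hence "th \<notin> avoiding (O1 Int J K l) Un avoiding (O2 Int J K l)" using z by (auto simp: avoiding_def)
   thus "th \<in> D K" unfolding D_def using l z(1) by blast
  qed
 qed
qed

text \<open>For distinct marks, two points are separated by disjoint members of a countable base.\<close>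

lemma AE_configs: "AE th in samples. pts th \<in> configs"
proof -
 interpret prob_space samples by (rule prob_space_samples)
 have sub: "pts th \<subseteq> space nu" if "th \<in> space samples" for th using that unfolding pts_def space_samples Bn(3)[symmetric] by blast
 have fin: "finite (pts th Int Bn n)" if "th \<in> space samples" for th n
 proof -
  have "pts th Int Bn n \<subseteq> snd (th n) ` {..<fst (th n)}"
  proof
   fix z assume z: "z \<in> pts th Int Bn n"
   then obtain m j where mj: "z = snd (th m) j" "j < fst (th m)" by (auto simp: pts_def)
   hence "z \<in> Bn m" using that by (simp add: space_samples)
   hence "m = n" using z Bn(2) by (auto simp: disjoint_family_on_def)
   thus "z \<in> snd (th n) ` {..<fst (th n)}" using mj by auto
  qed
  thus ?thesis by (rule finite_subset) simp
 qed
 have hit: "AE th in samples. pts th Int W k ~= {}" for k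
 proof (rule AE_I')
  show "avoiding (W k) \<in> null_sets samples"
   using measure_avoiding[OF W(1)[of k]] W(2)[of k] by (intro null_setsI) (simp_all add: emeasure_eq_measure void_prob_def)
 qed (auto simp: avoiding_def)
 obtain \<B> :: "'z set set" where B: "countable \<B>" "!!C. C \<in> \<B> ==> open C" "!!S. open S ==> \<exists>U. U \<subseteq> \<B> & S = \<Union>U"
  by (rule univ_second_countable[where 'a = 'z]) (rule that)
 have inj: "AE th in samples. \<forall>z\<in>pts th Int (C Int Bn m). \<forall>z'\<in>pts th Int (C' Int Bn n). mark z ~= mark z'"
  if C: "C \<in> \<B>" "C' \<in> \<B>" "C Int C' = {}" for C C' m n
 proof (rule AE_no_coincidence[where C = "max (rate m) (rate n)"])
  have s: "D Int Bn k \<in> sets nu" if "D \<in> \<B>" for D k using B(2)[OF that] Bn(1)[of k] by (auto simp: sets_nu)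
  show "C Int Bn m \<in> sets nu" "C' Int Bn n \<in> sets nu" using C s by auto
  show "C Int Bn m Int (C' Int Bn n) = {}" using C by auto
  show "emeasure nu (C Int Bn m) ~= \<infinity>" "emeasure nu (C' Int Bn n) ~= \<infinity>" using finite_piece by auto
  have b1: "measure nu (D Int Bn k Int mark -` {s..<t}) <= rate k * (t - s)"
   if "D \<in> \<B>" "0 <= s" "s <= t" "t <= 1" for D k s t
  proof -
   have mk: "mark -` {s..<t} \<in> sets borel" using measurable_sets[OF mark(1), of "{s..<t}"] by simp
   have "measure nu (D Int Bn k Int mark -` {s..<t}) <= measure nu (Bn k Int mark -` {s..<t})"
   proof (rule measure_mono_fmeasurable)
    show "Bn k Int mark -` {s..<t} \<in> fmeasurable nu"
     using mk Bn(1)[of k] finite_piece[of "mark -` {s..<t}" k] by (auto simp: fmeasurable_def sets_nu Int_commute top.not_eq_extremum)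
    show "D Int Bn k Int mark -` {s..<t} \<in> sets nu" using mk s[OF that(1), of k] by (auto simp: sets_nu)
   qed auto
   also have "\<dots> = rate k * (t - s)" unfolding measure_def mark_uniform[OF that(2-4)] emeasure_Bn
    using that rate_pos[of k] by (simp add: ennreal_mult[symmetric] mult.commute less_imp_le)
   finally show ?thesis .
  qed
  have b2: "rate k * (t - s) <= max (rate m) (rate n) * (t - s)" if "s <= t" "k = m | k = n" for k s t using that by (intro mult_right_mono) auto
  have fin: "measure nu (D Int Bn k Int mark -` {s..<t}) <= max (rate m) (rate n) * (t - s)"
   if "D \<in> \<B>" "k = m | k = n" "0 <= s" "s <= t" "t <= 1" for D k s t by (rule order_trans[OF b1[OF that(1,3-5)] b2[OF that(4,2)]])
  show "measure nu (C Int Bn m Int mark -` {s..<t}) <= max (rate m) (rate n) * (t - s)"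
   if "0 <= s" "s <= t" "t <= 1" for s t by (rule fin[OF C(1) disjI1[OF refl] that])
  show "measure nu (C' Int Bn n Int mark -` {s..<t}) <= max (rate m) (rate n) * (t - s)"
   if "0 <= s" "s <= t" "t <= 1" for s t by (rule fin[OF C(2) disjI2[OF refl] that])
 qed
 have "AE th in samples. \<forall>p\<in>{p \<in> \<B> \<times> \<B>. fst p Int snd p = {}}. \<forall>m n. \<forall>z\<in>pts th Int (fst p Int Bn m). \<forall>z'\<in>pts th Int (snd p Int Bn n). mark z ~= mark z'"
 proof (subst AE_ball_countable)
  show "countable {p \<in> \<B> \<times> \<B>. fst p Int snd p = {}}" using B(1) by (intro countable_subset[OF _ countable_SIGMA]) auto
  show "\<forall>p\<in>{p \<in> \<B> \<times> \<B>. fst p Int snd p = {}}. AE th in samples. \<forall>m n. \<forall>z\<in>pts th Int (fst p Int Bn m). \<forall>z'\<in>pts th Int (snd p Int Bn n). mark z ~= mark z'"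
   unfolding AE_all_countable using inj by auto
 qed
 moreover have "AE th in samples. \<forall>k. pts th Int W k ~= {}" unfolding AE_all_countable using hit by blast
 ultimately show ?thesis using AE_space
 proof eventually_elim
  case (elim th)
  have "inj_on mark (pts th)"
  proof (rule inj_onI, rule ccontr)
   fix z z' assume z: "z \<in> pts th" "z' \<in> pts th" "mark z = mark z'" "z ~= z'"
   obtain S S' where S: "open S" "open S'" "z \<in> S" "z' \<in> S'" "S Int S' = {}" using hausdorff[OF z(4)] by blast
   obtain C where C: "C \<in> \<B>" "z \<in> C" "C \<subseteq> S" using B(3)[OF S(1)] S(3) by blast
   obtain C' where C': "C' \<in> \<B>" "z' \<in> C'" "C' \<subseteq> S'" using B(3)[OF S(2)] S(4) by blast
   obtain m n where "z \<in> Bn m" "z' \<in> Bn n" using sub[OF elim(3)] z Bn(3) by blast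
   moreover have "(C, C') \<in> {p \<in> \<B> \<times> \<B>. fst p Int snd p = {}}" using C C' S(5) by auto
   ultimately show False using elim(1) z C C' by fastforce
  qed
  thus ?case unfolding configs_def using sub fin elim by blast
 qed
qed

text \<open>The void events are stable under intersection, so a law is determined by its void probabilities.\<close>

definition config_space :: "'z set measure" where
 "config_space = sigma configs {void B |B. B \<in> sets nu}"

lemma space_config_space [simp]: "space config_space = configs"
 unfolding config_space_def by (rule space_measure_of) (auto simp: void_def)

lemma sets_config_space: "sets config_space = sigma_sets configs {void B |B. B \<in> sets nu}"
 unfolding config_space_def by (rule sets_measure_of) (auto simp: void_def)

lemma poisson_law_exists:
 "\<exists>Q. prob_space Q & sets Q = sets config_space & (\<forall>B\<in>sets nu. measure Q (void B) = void_prob B)"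
proof -
 interpret prob_space samples by (rule prob_space_samples)
 obtain E where E: "{th \<in> space samples. ~ pts th \<in> configs} \<subseteq> E" "emeasure samples E = 0" "E \<in> sets samples"
  using AE_configs by (rule AE_E)
 define M where "M = restrict_space samples (space samples - E)"
 have spM: "space M = space samples - E" by (auto simp: M_def space_restrict_space)
 have E1: "emeasure samples (space samples - E) = 1" using E emeasure_compl[of E samples] by (simp add: emeasure_space_1)
 have M: "prob_space M" unfolding M_def by (rule prob_space_restrict_space) (use E E1 in auto)
 have pre: "pts -` void B Int space M = avoiding B Int (space samples - E)" for B unfolding spM using E(1) by (auto simp: void_def avoiding_def)
 have meas: "pts \<in> measurable M config_space" unfolding config_space_def
 proof (rule measurable_measure_of)
  show "{void B |B. B \<in> sets nu} \<subseteq> Pow configs" by (auto simp: void_def)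
  show "pts \<in> space M \<rightarrow> configs" using spM E(1) by auto
  fix y assume "y \<in> {void B |B. B \<in> sets nu}"
  then obtain B where B: "B \<in> sets nu" "y = void B" by blast
  thus "pts -` y Int space M \<in> sets M"
   unfolding B(2) pre unfolding M_def using measure_avoiding(1)[OF B(1)] E(3) by (subst sets_restrict_space_iff) auto
 qed
 define Q where "Q = distr M config_space pts"
 have "measure Q (void B) = void_prob B" if B: "B \<in> sets nu" for B
 proof -
  have "void B \<in> sets config_space" using B by (auto simp: sets_config_space)
  hence "measure Q (void B) = measure M (pts -` void B Int space M)" unfolding Q_def by (rule measure_distr[OF meas])
  also have "\<dots> = measure samples (avoiding B Int (space samples - E))"
   unfolding pre unfolding M_def using measure_avoiding(1)[OF B] E(3) by (subst measure_restrict_space) auto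
  also have "avoiding B Int (space samples - E) = avoiding B - E" by (auto simp: avoiding_def)
  also have "measure samples (avoiding B - E) = measure samples (avoiding B)"
   using E measure_avoiding(1)[OF B] by (intro measure_Diff_null_set) (auto intro: null_setsI)
  finally show ?thesis using measure_avoiding(2)[OF B] by simp
 qed
 moreover have "prob_space Q" unfolding Q_def by (rule prob_space.prob_space_distr[OF M meas])
 ultimately show ?thesis by (intro exI[of _ Q]) (simp add: Q_def)
qed

end

section \<open>Configurations form a standard Borel space\<close>

context poisson_system
begin

text \<open>In a band a configuration has finitely many distinct marks, so cells with rational bounds isolate its points.\<close>

definition cell :: "nat \<times> rat \<times> rat => 'z set" where
 "cell = (%(n, q, q'). Bn n Int mark -` {real_of_rat q<..<real_of_rat q'})"

definition point :: "'z set => nat \<times> rat \<times> rat => 'z" where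
 "point om i = (if \<exists>z. om Int cell i = {z} then the_elem (om Int cell i) else z0)"

lemma mark_vimage: "S \<in> sets borel ==> mark -` S \<in> sets borel"
 using measurable_sets[OF mark(1)] by simp

lemma cell_sets: "cell i \<in> sets nu"
 using Bn(1)[of "fst i"] mark_vimage by (auto simp: cell_def sets_nu split_beta)

lemma cell_space: "cell i \<subseteq> space nu"
 using sets.sets_into_space[OF cell_sets] .

lemma configsD: "om \<in> configs ==> om \<subseteq> space nu" "om \<in> configs ==> finite (om Int Bn n)"
 "om \<in> configs ==> inj_on mark om" "om \<in> configs ==> om Int W k ~= {}" by (auto simp: configs_def)

lemma range_point:
 assumes om: "om \<in> configs" shows "range (point om) Int space nu = om"
proof
 show "range (point om) Int space nu \<subseteq> om"
 proof
  fix x assume "x \<in> range (point om) Int space nu"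
  then obtain i where i: "x = point om i" "x \<in> space nu" by (elim IntE rangeE)
  hence "point om i ~= z0" using z0 by metis
  with i(1) obtain z where "om Int cell i = {z}" "x = z" by (auto simp: point_def split: if_splits)
  thus "x \<in> om" by blast
 qed
 show "om \<subseteq> range (point om) Int space nu"
 proof
  fix z assume z: "z \<in> om"
  then obtain n where n: "z \<in> Bn n" using configsD(1)[OF om] Bn(3) by blast
  have "finite (mark ` (om Int Bn n))" using configsD(2)[OF om] by simp
  then obtain d where d: "d > 0" "!!y. y \<in> mark ` (om Int Bn n) ==> y ~= mark z ==> d <= dist (mark z) y"
   using finite_set_avoid[of "mark ` (om Int Bn n)" "mark z"] by metis
  obtain q where q: "mark z - d < real_of_rat q" "real_of_rat q < mark z" using of_rat_dense[of "mark z - d" "mark z"] d by auto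
  obtain q' where q': "mark z < real_of_rat q'" "real_of_rat q' < mark z + d" using of_rat_dense[of "mark z" "mark z + d"] d by auto
  have "om Int cell (n, q, q') = {z}"
  proof
   show "om Int cell (n, q, q') \<subseteq> {z}"
   proof
    fix w assume w: "w \<in> om Int cell (n, q, q')"
    hence "~ d <= dist (mark z) (mark w)" using q q' by (auto simp: cell_def dist_real_def)
    hence "mark w = mark z" using d(2)[of "mark w"] w by (auto simp: cell_def)
    thus "w \<in> {z}" using configsD(3)[OF om] w z by (auto dest: inj_onD)
   qed
  qed (use z n q q' in \<open>auto simp: cell_def\<close>)
  hence "point om (n, q, q') = z" by (simp add: point_def)
  thus "z \<in> range (point om) Int space nu" using z configsD(1)[OF om] by blast
 qed
qed

lemma void_sets: "B \<in> sets nu ==> void B \<in> sets config_space"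
 by (auto simp: sets_config_space)

definition hit :: "'z set => 'z set set" where "hit B = {om \<in> configs. om Int B ~= {}}"

lemma hit_sets: "B \<in> sets nu ==> hit B \<in> sets config_space"
proof -
 assume "B \<in> sets nu"
 moreover have "hit B = space config_space - void B" by (auto simp: hit_def void_def)
 ultimately show ?thesis using sets.Diff[OF sets.top void_sets] by metis
qed

text \<open>A second point would be separated from the first by a rational mark.\<close>

lemma lone_sets: "{om \<in> configs. \<exists>z. om Int cell i = {z}} \<in> sets config_space"
proof -
 let ?lo = "%s::rat. cell i Int mark -` {..<real_of_rat s}" and ?hi = "%s::rat. cell i Int mark -` {real_of_rat s..}"
 have lh: "?lo s \<in> sets nu" "?hi s \<in> sets nu" for s using cell_sets[of i] mark_vimage by (auto simp: sets_nu)
 have "{om \<in> configs. \<exists>z. om Int cell i = {z}} = hit (cell i) - (\<Union>s. hit (?lo s) Int hit (?hi s))" (is "?L = ?R")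
 proof
  show "?L \<subseteq> ?R"
  proof
   fix om assume "om \<in> ?L"
   then obtain z where z: "om \<in> configs" "om Int cell i = {z}" by blast
   have "~ (om Int ?lo s ~= {} & om Int ?hi s ~= {})" for s
   proof
    assume "om Int ?lo s ~= {} & om Int ?hi s ~= {}"
    then obtain x y where "x \<in> om Int cell i" "y \<in> om Int cell i" "mark x < real_of_rat s" "real_of_rat s <= mark y" by blast
    thus False using z by auto
   qed
   thus "om \<in> ?R" using z by (auto simp: hit_def)
  qed
  show "?R \<subseteq> ?L"
  proof
   fix om assume R: "om \<in> ?R"
   hence om: "om \<in> configs" by (auto simp: hit_def)
   obtain z where z: "z \<in> om Int cell i" using R by (auto simp: hit_def)
   have no: "~ (mark x < mark y)" if xy: "x \<in> om Int cell i" "y \<in> om Int cell i" for x y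
   proof
    assume "mark x < mark y"
    then obtain s where "mark x < real_of_rat s" "real_of_rat s < mark y" using of_rat_dense by blast
    hence "om \<in> hit (?lo s) Int hit (?hi s)" using xy om by (auto simp: hit_def)
    thus False using R by blast
   qed
   have "w = z" if w: "w \<in> om Int cell i" for w
   proof -
    have "mark w = mark z" using no[OF w z] no[OF z w] by linarith
    thus ?thesis using configsD(3)[OF om] w z by (auto dest: inj_onD)
   qed
   hence "om Int cell i = {z}" using z by blast
   thus "om \<in> ?L" using om by blast
  qed
 qed
 moreover have "?R \<in> sets config_space" using hit_sets[OF cell_sets] hit_sets[OF lh(1)] hit_sets[OF lh(2)] by (intro sets.Diff sets.countable_UN') auto
 ultimately show ?thesis by simp
qed

lemma point_measurable: "(%om. point om i) \<in> borel_measurable config_space"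
proof (rule measurableI)
 fix B :: "'z set" assume B: "B \<in> sets borel"
 let ?lone = "{om \<in> configs. \<exists>z. om Int cell i = {z}}"
 have "(%om. point om i) -` B Int space config_space =
   (?lone Int hit (cell i Int B)) Un (if z0 \<in> B then configs - ?lone else {})"
 proof (rule Set.set_eqI)
  fix om
  show "om \<in> (%om. point om i) -` B Int space config_space \<longleftrightarrow>
   om \<in> (?lone Int hit (cell i Int B)) Un (if z0 \<in> B then configs - ?lone else {})"
  proof (cases "\<exists>z. om Int cell i = {z}")
   case True
   then obtain z where z: "om Int cell i = {z}" by (elim exE)
   have "om Int (cell i Int B) = {z} Int B" using z by (simp add: Int_assoc[symmetric])
   hence "om Int (cell i Int B) ~= {} \<longleftrightarrow> z \<in> B" by simp
   thus ?thesis using z by (simp add: point_def hit_def) blast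
  next
   case False
   hence "point om i = z0" by (simp add: point_def)
   thus ?thesis using False by (simp add: hit_def)
  qed
 qed
 moreover have "hit (cell i Int B) \<in> sets config_space" using B cell_sets[of i] by (intro hit_sets) (auto simp: sets_nu)
 ultimately show "(%om. point om i) -` B Int space config_space \<in> sets config_space"
  using lone_sets[of i] sets.top[of config_space] by (auto intro!: sets.Un sets.Int sets.Diff)
qed simp

lemma points_measurable: "point \<in> borel_measurable config_space"
 by (rule measurable_coordinatewise_then_product) (rule point_measurable)

text \<open>A Borel description of the families \<open>point om\<close>: the range is a configuration, and every entry is the one that
 the range prescribes. Finiteness is expressed by lists of indices, of which there are countably many.\<close>

definition enumeration :: "(nat \<times> rat \<times> rat => 'z) => bool" where
 "enumeration F \<longleftrightarrow> (\<forall>i j. F i \<in> space nu & F j \<in> space nu & mark (F i) = mark (F j) --> F i = F j) &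
   (\<forall>n. \<exists>L :: (nat \<times> rat \<times> rat) list. \<forall>i. F i \<in> Bn n --> (\<exists>j\<in>set L. F i = F j)) & (\<forall>k. \<exists>i. F i \<in> W k) &
   (\<forall>i. (F i \<in> cell i & (\<forall>j. F j \<in> cell i --> F j = F i)) |
    (F i = z0 & ~ (\<exists>j. F j \<in> cell i & (\<forall>k. F k \<in> cell i --> F k = F j))))"

lemma point_enumeration:
 assumes om: "om \<in> configs" shows "enumeration (point om)" unfolding enumeration_def
proof (intro conjI allI impI)
 have r: "x \<in> om \<longleftrightarrow> x \<in> space nu & (\<exists>i. x = point om i)" for x using range_point[OF om] by blast
 show "point om i = point om j" if "point om i \<in> space nu & point om j \<in> space nu & mark (point om i) = mark (point om j)" for i j
  using inj_onD[OF configsD(3)[OF om]] that r by blast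
 show "\<exists>L. \<forall>i. point om i \<in> Bn n --> (\<exists>j\<in>set L. point om i = point om j)" for n
 proof -
  have "om Int Bn n \<subseteq> point om ` UNIV" using r by auto
  from finite_subset_image[OF configsD(2)[OF om] this] obtain C where C: "finite C" "om Int Bn n = point om ` C" by metis
  obtain L where L: "set L = C" using C(1) finite_list by blast
  have "\<exists>j\<in>set L. point om i = point om j" if "point om i \<in> Bn n" for i
  proof -
   have "point om i \<in> space nu" using that Bn(3) by blast
   hence "point om i \<in> om Int Bn n" using r that by blast
   thus ?thesis using C(2) L by blast
  qed
  thus ?thesis by blast
 qed
 show "\<exists>i. point om i \<in> W k" for k
 proof -
  obtain x where "x \<in> om" "x \<in> W k" using configsD(4)[OF om, of k] by (metis disjoint_iff)
  thus ?thesis using r[of x] by metis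
 qed
 fix i
 show "(point om i \<in> cell i & (\<forall>j. point om j \<in> cell i --> point om j = point om i)) |
   (point om i = z0 & ~ (\<exists>j. point om j \<in> cell i & (\<forall>k. point om k \<in> cell i --> point om k = point om j)))"
 proof (cases "\<exists>z. om Int cell i = {z}")
  case True
  then obtain z where z: "om Int cell i = {z}" by blast
  hence "point om i = z" by (simp add: point_def)
  moreover have "point om j = z" if "point om j \<in> cell i" for j using that z r[of "point om j"] cell_space[of i] by blast
  ultimately show ?thesis using z by blast
 next
  case False
  have "~ (\<exists>j. point om j \<in> cell i & (\<forall>k. point om k \<in> cell i --> point om k = point om j))"
  proof
   assume "\<exists>j. point om j \<in> cell i & (\<forall>k. point om k \<in> cell i --> point om k = point om j)"
   then obtain j where j: "point om j \<in> cell i" "!!k. point om k \<in> cell i ==> point om k = point om j" by blast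
   have "point om j \<in> om" using r[of "point om j"] j(1) cell_space[of i] by blast
   moreover have "x = point om j" if "x \<in> om Int cell i" for x using that r[of x] j(2) by blast
   ultimately have "om Int cell i = {point om j}" using j(1) by blast
   thus False using False by blast
  qed
  moreover have "point om i = z0" using False by (simp add: point_def)
  ultimately show ?thesis by blast
 qed
qed

lemma enumeration_point:
 assumes F: "enumeration F"
 shows "range F Int space nu \<in> configs" and "point (range F Int space nu) = F"
proof -
 let ?om = "range F Int space nu"
 have F1: "F i = F j" if "F i \<in> space nu" "F j \<in> space nu" "mark (F i) = mark (F j)" for i j using F that unfolding enumeration_def by blast
 have F2: "\<exists>L :: (nat \<times> rat \<times> rat) list. \<forall>i. F i \<in> Bn n --> (\<exists>j\<in>set L. F i = F j)" for n
  using F unfolding enumeration_def by blast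
 have F3: "\<exists>i. F i \<in> W k" for k using F unfolding enumeration_def by blast
 have F4: "(F i \<in> cell i & (\<forall>j. F j \<in> cell i --> F j = F i)) |
    (F i = z0 & ~ (\<exists>j. F j \<in> cell i & (\<forall>k. F k \<in> cell i --> F k = F j)))" for i using F unfolding enumeration_def by blast
 show "?om \<in> configs" unfolding configs_def
 proof (intro CollectI conjI allI)
  show "finite (?om Int Bn n)" for n
  proof -
   obtain L where "\<forall>i. F i \<in> Bn n --> (\<exists>j\<in>set L. F i = F j)" using F2 by blast
   hence "?om Int Bn n \<subseteq> F ` set L" by blast
   thus ?thesis by (rule finite_subset) simp
  qed
  show "inj_on mark ?om" using F1 by (intro inj_onI) blast
  show "?om Int W k ~= {}" for k using F3[of k] sets.sets_into_space[OF W(1)[of k]] by blast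
 qed simp
 show "point ?om = F"
 proof (rule ext)
  fix i
  show "point ?om i = F i" using F4[of i]
  proof
   assume c: "F i \<in> cell i & (\<forall>j. F j \<in> cell i --> F j = F i)"
   hence "?om Int cell i = {F i}" using cell_space[of i] by blast
   thus ?thesis by (simp add: point_def)
  next
   assume c: "F i = z0 & ~ (\<exists>j. F j \<in> cell i & (\<forall>k. F k \<in> cell i --> F k = F j))"
   have "~ (\<exists>z. ?om Int cell i = {z})"
   proof
    assume "\<exists>z. ?om Int cell i = {z}"
    then obtain z where z: "?om Int cell i = {z}" by blast
    have "z \<in> ?om Int cell i" unfolding z by simp
    then obtain j where j: "z = F j" "F j \<in> cell i" by (elim IntE rangeE) simp
    have "F k = z" if "F k \<in> cell i" for k
    proof -
     have "F k \<in> ?om Int cell i" using that subsetD[OF cell_space that] by simp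
     thus ?thesis unfolding z by simp
    qed
    thus False using c j by metis
   qed
   thus ?thesis using c by (simp add: point_def)
  qed
 qed
qed

abbreviation "sequences \<equiv> borel :: (nat \<times> rat \<times> rat => 'z) measure"

lemma enumerations_borel: "{F. enumeration F} \<in> sets borel"
proof -
 have coord: "(%F. F i) \<in> borel_measurable sequences" for i by (rule measurable_function_coordinate) simp
 have b: "space nu \<in> sets borel" "Bn n \<in> sets borel" "W n \<in> sets borel" "cell i \<in> sets borel" for n i
  using sets.top[of nu] Bn(1)[of n] W(1)[of n] cell_sets[of i] unfolding sets_nu by auto
 have P [measurable]: "Measurable.pred sequences (%F. F i \<in> S)" if "S \<in> sets borel" for i S
 proof -
  have "(%F. F i) -` S Int space borel \<in> sets sequences" using coord that by (rule measurable_sets)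
  thus ?thesis by (simp add: pred_def vimage_def)
 qed
 have [measurable]: "Measurable.pred sequences (%F. F i \<in> space nu)"
  "Measurable.pred sequences (%F. F i \<in> Bn n)"
  "Measurable.pred sequences (%F. F i \<in> W n)"
  "Measurable.pred sequences (%F. F i \<in> cell j)" for i j n using b by (auto intro!: P)
 have [measurable]: "Measurable.pred sequences (%F. mark (F i) = mark (F j))" for i j
 proof -
  have m: "(%F :: nat \<times> rat \<times> rat => 'z. mark (F i)) \<in> borel_measurable borel" for i using measurable_compose[OF coord mark(1)] .
  show ?thesis using borel_measurable_eq[OF m m, of i j] by (simp add: pred_def)
 qed
 have [measurable]: "Measurable.pred sequences (%F. F i = F j)" for i j
 proof -
  have "closed {F :: nat \<times> rat \<times> rat => 'z. F i = F j}" by (intro closed_Collect_eq continuous_on_product_coordinates)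
  thus ?thesis by (simp add: pred_def borel_closed)
 qed
 have [measurable]: "Measurable.pred sequences (%F. F i = z0)" for i
 proof -
  have "closed {F :: nat \<times> rat \<times> rat => 'z. F i = z0}"
   by (rule closed_Collect_eq[OF continuous_on_product_coordinates continuous_on_const])
  thus ?thesis by (simp add: pred_def borel_closed)
 qed
 have "{F \<in> space borel. enumeration F} \<in> sets borel" unfolding enumeration_def by measurable
 thus ?thesis by simp
qed

lemma points_image: "point ` configs = {F. enumeration F}"
proof (rule Set.set_eqI)
 fix F
 show "F \<in> point ` configs \<longleftrightarrow> F \<in> {F. enumeration F}"
 proof
  assume "F \<in> point ` configs"
  thus "F \<in> {F. enumeration F}" using point_enumeration by (elim imageE) simp
 next
  assume "F \<in> {F. enumeration F}"
  hence F: "enumeration F" by simp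
  show "F \<in> point ` configs" by (rule image_eqI[where x = "range F Int space nu"]) (simp_all add: enumeration_point[OF F])
 qed
qed

lemma config_sets_from_points:
 assumes "E \<in> sets config_space" shows "\<exists>B\<in>sets borel. E = point -` B Int configs" using assms unfolding sets_config_space
proof (induction rule: sigma_sets.induct)
 case (Basic E)
 then obtain B where B: "B \<in> sets nu" "E = void B" by blast
 have [measurable]: "(%F. F i) \<in> borel_measurable sequences" for i by (rule measurable_function_coordinate) simp
 have [measurable]: "B \<in> sets borel" using B by (simp add: sets_nu)
 have "{F \<in> space borel. \<forall>i :: nat \<times> rat \<times> rat. F i \<notin> B} \<in> sets borel" by measurable
 hence "{F. \<forall>i :: nat \<times> rat \<times> rat. F i \<notin> B} \<in> sets borel" by simp
 moreover have "E = point -` {F. \<forall>i. F i \<notin> B} Int configs"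
 proof -
  have "om Int B = {} \<longleftrightarrow> (\<forall>i. point om i \<notin> B)" if "om \<in> configs" for om
  proof
   assume 1: "om Int B = {}"
   show "\<forall>i. point om i \<notin> B"
   proof (intro allI notI)
    fix i assume 2: "point om i \<in> B"
    have "point om i \<in> range (point om) Int space nu" using subsetD[OF sets.sets_into_space[OF B(1)] 2] by simp
    hence "point om i \<in> om" unfolding range_point[OF that] .
    thus False using 1 2 by (metis disjoint_iff)
   qed
  next
   assume 1: "\<forall>i. point om i \<notin> B"
   have "om \<subseteq> range (point om)" using range_point[OF that] by (metis inf_le1)
   thus "om Int B = {}" using 1 by (metis disjoint_iff rangeE subsetD)
  qed
  thus ?thesis unfolding B(2) void_def by (auto cong: conj_cong)
 qed
 ultimately show ?case by blast
next
 case Empty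
 thus ?case by (intro bexI[of _ "{}"]) auto
next
 case (Compl a)
 then obtain B where "B \<in> sets borel" "a = point -` B Int configs" by blast
 thus ?case by (intro bexI[of _ "- B"]) (auto simp: Compl_eq_Diff_UNIV)
next
 case (Union a)
 hence "\<forall>i. \<exists>B. B \<in> sets borel & a i = point -` B Int configs" by (metis (no_types))
 from choice[OF this] obtain B where "!!i. B i \<in> sets borel" "!!i. a i = point -` B i Int configs" by (elim exE) metis
 thus ?case by (intro bexI[of _ "\<Union>i. B i"]) auto
qed

text \<open>Configurations correspond to a Borel set of sequences.\<close>

lemma real_model_of_configs:
 assumes Q: "sets Q = sets config_space"
 shows "\<exists>(iota :: 'z set => real) tau. inj_on iota configs & polish_topology tau & topspace tau = iota ` configs &
   sets (borel_of tau) = {iota ` E |E. E \<in> sets Q}"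
proof -
 have sp: "space Q = configs" using sets_eq_imp_space_eq[OF Q] by simp
 have "inj_on point configs" using range_point by (metis inj_onI)
 moreover have "point \<in> borel_measurable Q" using points_measurable measurable_cong_sets[OF Q refl] by blast
 ultimately show ?thesis using real_model_of_borel_subset[of point Q] points_image enumerations_borel config_sets_from_points unfolding sp Q by simp
qed

end

section \<open>Poisson suspensions of measure preserving actions\<close>

text \<open>A Dynkin argument, in which the limit passes through disjoint unions by dominated convergence of series.\<close>

lemma limit_on_sigma_algebra:
 fixes p :: "nat => 'a set => real"
 assumes M: "prob_space M" and gen: "sets M = sigma_sets (space M) \<G>" "Int_stable \<G>" "\<G> \<subseteq> Pow (space M)"
  and p: "!!n B. B \<in> sets M ==> 0 <= p n B" "!!n B. B \<in> sets M ==> p n B <= measure M B"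
  and add: "!!n B. range B \<subseteq> sets M ==> disjoint_family B ==> (%k. p n (B k)) sums p n (\<Union>k::nat. B k)"
  and sp: "(%n. p n (space M)) \<longlonglongrightarrow> kap"
  and lim: "!!B. B \<in> \<G> ==> (%n. p n B) \<longlonglongrightarrow> kap * measure M B"
  and B: "B \<in> sets M"
 shows "(%n. p n B) \<longlonglongrightarrow> kap * measure M B"
proof -
 interpret prob_space M by (rule M)
 have p0: "p n {} = 0" for n using p[of "{}" n] by simp
 from gen(2,3) B[unfolded gen(1)] show ?thesis
 proof (induction rule: sigma_sets_induct_disjoint)
  case (compl A)
  have A: "A \<in> sets M" using compl gen(1) by simp
  have "p n (space M - A) = p n (space M) - p n A" for n
  proof -
   have "(%k. p n (binaryset A (space M - A) k)) sums p n (\<Union>k. binaryset A (space M - A) k)"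
   proof (rule add)
    show "range (binaryset A (space M - A)) \<subseteq> sets M" using A by (auto simp: range_binaryset_eq)
    show "disjoint_family (binaryset A (space M - A))" by (auto simp: disjoint_family_on_def binaryset_def)
   qed
   moreover have "(\<Union>k. binaryset A (space M - A) k) = space M" using A sets.sets_into_space[OF A] by (auto simp: UN_binaryset_eq)
   moreover have "(%k. p n (binaryset A (space M - A) k)) sums (p n A + p n (space M - A))" by (rule binaryset_sums) (rule p0)
   ultimately have "p n A + p n (space M - A) = p n (space M)" using sums_unique2 by metis
   thus ?thesis by simp
  qed
  hence "(%n. p n (space M - A)) \<longlonglongrightarrow> kap - kap * measure M A" using tendsto_diff[OF sp compl(2)] by simp
  thus ?case by (simp add: prob_compl[OF A] right_diff_distrib)
 next
  case (union A)
  have A: "range A \<subseteq> sets M" using union(2) gen(1) by simp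
  have "(%n. \<Sum>k. p n (A k)) \<longlonglongrightarrow> (\<Sum>k. kap * measure M (A k))"
  proof (rule tannerys_theorem[THEN conjunct2, THEN conjunct2])
   show "summable (%k. measure M (A k))" using finite_measure_UNION[OF A union(1)] by (rule sums_summable)
   show "\<forall>\<^sub>F (k, n) in at_top \<times>\<^sub>F sequentially. norm (p n (A k)) <= measure M (A k)"
    using A p by (auto simp: case_prod_unfold abs_of_nonneg)
  qed (use union(3) in auto)
  moreover have "(\<Sum>k. p n (A k)) = p n (\<Union>k. A k)" for n using add[OF A union(1)] by (rule sums_unique[symmetric])
  moreover have "(\<Sum>k. kap * measure M (A k)) = kap * measure M (\<Union>k. A k)"
   using sums_mult[OF finite_measure_UNION[OF A union(1)], of kap] by (rule sums_unique[symmetric])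
  ultimately show ?case by simp
 qed (use lim p0 in auto)
qed

text \<open>Compatibility with the bands, the marks and the sets \<open>W k\<close> makes the group act on all configurations.\<close>

locale poisson_action = poisson_system nu Bn mark W z0
 for nu :: "'z::polish_space measure" and Bn :: "nat => 'z set" and mark :: "'z => real"
  and W :: "nat => 'z set" and z0 :: 'z +
 fixes G :: "('g, 'b) monoid_scheme" and tau :: "'g topology" and act :: "'g => 'z => 'z" and gs :: "nat => 'g"
 assumes grp: "group G" and top: "topspace tau = carrier G"
  and act_meas: "(%(g, z). act g z) \<in> measurable (borel_of tau \<Otimes>\<^sub>M nu) nu"
  and act_one: "!!z. z \<in> space nu ==> act \<one>\<^bsub>G\<^esub> z = z"
  and act_mult: "!!g h z. g \<in> carrier G ==> h \<in> carrier G ==> z \<in> space nu ==> act g (act h z) = act (g \<otimes>\<^bsub>G\<^esub> h) z"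
  and act_preserves: "!!g B. g \<in> carrier G ==> B \<in> sets nu ==> emeasure nu {z \<in> space nu. act g z \<in> B} = emeasure nu B"
  and act_band: "!!g n. g \<in> carrier G ==> \<exists>m. \<forall>z\<in>Bn n. \<exists>k<m. act g z \<in> Bn k"
  and act_mark: "!!g z. g \<in> carrier G ==> z \<in> space nu ==> mark (act g z) = mark z"
  and act_W: "!!g k. g \<in> carrier G ==> \<exists>l. \<forall>z\<in>W l. act g z \<in> W k"
  and act_free: "!!g. g \<in> carrier G ==> g ~= \<one>\<^bsub>G\<^esub> ==> \<exists>k. \<forall>z\<in>W k. act g z ~= z"
  and gs: "!!n. gs n \<in> carrier G"
  and act_mixing: "!!A B. A \<in> sets nu ==> B \<in> sets nu ==> emeasure nu A ~= \<infinity> ==> emeasure nu B ~= \<infinity> ==>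
    (%n. measure nu (A Int {z \<in> space nu. act (gs n) z \<in> B})) \<longlonglongrightarrow> 0"
begin

lemma space_borel_of: "space (borel_of tau) = carrier G"
 unfolding borel_of_def using openin_subset top by (subst space_measure_of) (auto simp: )

lemma act_measurable: "g \<in> carrier G ==> act g \<in> measurable nu nu"
 using measurable_compose[OF measurable_Pair1'[of g "borel_of tau" nu] act_meas] by (simp add: space_borel_of)

lemma act_space: "g \<in> carrier G ==> z \<in> space nu ==> act g z \<in> space nu"
 using measurable_space[OF act_measurable] .

lemma act_vimage_sets: "g \<in> carrier G ==> B \<in> sets nu ==> {z \<in> space nu. act g z \<in> B} \<in> sets nu"
 using measurable_sets[OF act_measurable, of g B] by (simp add: vimage_def Int_def conj_commute)

abbreviation push :: "'g => 'z set => 'z set" where "push g om \<equiv> act g ` om"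

lemma push_configs:
 assumes g: "g \<in> carrier G" and om: "om \<in> configs" shows "push g om \<in> configs" unfolding configs_def
proof (intro CollectI conjI allI)
 interpret group G by (rule grp)
 note sub = configsD(1)[OF om]
 show "push g om \<subseteq> space nu" using act_space[OF g] sub by blast
 show "finite (push g om Int Bn n)" for n
 proof -
  obtain m where m: "\<forall>z\<in>Bn n. \<exists>k<m. act (inv\<^bsub>G\<^esub> g) z \<in> Bn k" using act_band[of "inv\<^bsub>G\<^esub> g" n] g by auto
  have "push g om Int Bn n \<subseteq> push g (\<Union>k<m. om Int Bn k)"
  proof
   fix y assume y: "y \<in> push g om Int Bn n"
   then obtain z where z: "z \<in> om" "y = act g z" by blast
   have "act (inv\<^bsub>G\<^esub> g) y = z" using z sub g act_mult[of "inv\<^bsub>G\<^esub> g" g z] act_one[of z] by auto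
   then obtain k where "k < m" "z \<in> Bn k" using m y by blast
   thus "y \<in> push g (\<Union>k<m. om Int Bn k)" using z by blast
  qed
  thus ?thesis by (rule finite_subset) (intro finite_imageI finite_UN_I finite_lessThan configsD(2)[OF om])
 qed
 show "inj_on mark (push g om)"
 proof (rule inj_onI)
  fix x y assume "x \<in> push g om" "y \<in> push g om" and m: "mark x = mark y"
  then obtain z w where z: "z \<in> om" "x = act g z" and w: "w \<in> om" "y = act g w" by (elim imageE) simp
  have "mark z = mark w" using m act_mark[OF g subsetD[OF sub z(1)]] act_mark[OF g subsetD[OF sub w(1)]] z w by simp
  hence "z = w" using inj_onD[OF configsD(3)[OF om]] z w by simp
  thus "x = y" using z w by simp
 qed
 show "push g om Int W k ~= {}" for k using act_W[OF g, of k] configsD(4)[OF om] by blast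
qed

lemma push_one: "om \<in> configs ==> push \<one>\<^bsub>G\<^esub> om = om"
 using act_one configsD(1) by (force simp: image_iff)

lemma push_mult: "g \<in> carrier G ==> h \<in> carrier G ==> om \<in> configs ==> push g (push h om) = push (g \<otimes>\<^bsub>G\<^esub> h) om"
 unfolding image_image by (intro image_cong refl act_mult) (use subsetD[OF configsD(1)] in simp_all)

text \<open>Marks identify the points of a configuration, so a fixed configuration is fixed pointwise.\<close>

lemma push_free:
 assumes g: "g \<in> carrier G" "g ~= \<one>\<^bsub>G\<^esub>" and om: "om \<in> configs" shows "push g om ~= om"
proof
 assume eq: "push g om = om"
 obtain k where k: "\<forall>z\<in>W k. act g z ~= z" using act_free g by blast
 obtain z where z: "z \<in> om" "z \<in> W k" using configsD(4)[OF om] by blast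
 have "act g z \<in> om" using eq z by blast
 moreover have "mark (act g z) = mark z" using act_mark[OF g(1)] z configsD(1)[OF om] by blast
 ultimately show False using configsD(3)[OF om] z k by (auto dest: inj_onD)
qed

lemma push_vimage_void:
 assumes g: "g \<in> carrier G" and B: "B \<in> sets nu"
 shows "push g -` void B Int configs = void {z \<in> space nu. act g z \<in> B}" using push_configs[OF g] configsD(1) by (auto simp: void_def)

lemma void_Int: "void A Int void B = void (A Un B)"
 by (auto simp: void_def)

lemma Int_stable_void: "Int_stable {void B |B. B \<in> sets nu}"
 unfolding Int_stable_def using void_Int by blast

text \<open>The points of a configuration form a countable measurable family.\<close>

lemma push_joint_measurable: "(%(g, om). push g om) \<in> measurable (borel_of tau \<Otimes>\<^sub>M config_space) config_space"
proof -
 obtain z1 where z1: "z1 \<in> space nu" using W(2)[of 0] sets.sets_into_space[OF W(1)[of 0]] by (metis all_not_in_conv emeasure_empty ennreal_zero_neq_top infinity_ennreal_def subsetD)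
 have spn: "space nu \<in> sets borel" using sets.top[of nu] by (simp add: sets_nu)
 define pt where "pt = (%i om. if point om i \<in> space nu then point om i else z1)"
 have pin: "{om \<in> space config_space. point om i \<in> space nu} \<in> sets config_space" for i
  using measurable_sets[OF point_measurable[of i] spn] by (simp add: vimage_def Int_def conj_commute)
 have pt: "pt i \<in> measurable config_space nu" for i
 proof (rule measurableI)
  show "pt i om \<in> space nu" for om using z1 by (simp add: pt_def)
  fix B assume B: "B \<in> sets nu"
  have 1: "(%om. point om i) -` B Int space config_space \<in> sets config_space"
   using measurable_sets[OF point_measurable[of i], of B] B by (simp add: sets_nu)
  have "pt i -` B Int space config_space = ((%om. point om i) -` B Int space config_space) Un
    (if z1 \<in> B then space config_space - {om \<in> space config_space. point om i \<in> space nu} else {})"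
  proof (rule Set.set_eqI)
   fix om
   show "om \<in> pt i -` B Int space config_space \<longleftrightarrow> om \<in> ((%om. point om i) -` B Int space config_space) Un
    (if z1 \<in> B then space config_space - {om \<in> space config_space. point om i \<in> space nu} else {})"
    using subsetD[OF sets.sets_into_space[OF B], of "point om i"] by (cases "point om i \<in> space nu") (simp_all add: pt_def, metis)
  qed
  moreover have "\<dots> \<in> sets config_space" using 1 sets.Diff[OF sets.top pin[of i]] by (cases "z1 \<in> B") (simp_all add: sets.Un)
  ultimately show "pt i -` B Int space config_space \<in> sets config_space" by simp
 qed
 show ?thesis unfolding config_space_def
 proof (rule measurable_measure_of)
  show "{void B |B. B \<in> sets nu} \<subseteq> Pow configs" by (auto simp: void_def)
  show "(%(g, om). push g om) \<in> space (borel_of tau \<Otimes>\<^sub>M sigma configs {void B |B. B \<in> sets nu}) \<rightarrow> configs"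
   using push_configs by (auto simp: space_pair_measure space_borel_of config_space_def[symmetric])
  fix y assume "y \<in> {void B |B. B \<in> sets nu}"
  then obtain B where B: "B \<in> sets nu" "y = void B" by blast
  let ?M = "borel_of tau \<Otimes>\<^sub>M config_space"
  have 1: "{p \<in> space ?M. point (snd p) i \<in> space nu & act (fst p) (pt i (snd p)) \<in> B} \<in> sets ?M" for i
  proof -
   have m: "(%p. act (fst p) (pt i (snd p))) \<in> measurable ?M nu"
    using measurable_compose[OF measurable_Pair[OF measurable_fst measurable_compose[OF measurable_snd pt[of i]]] act_meas]
    by (simp add: case_prod_unfold)
   have "{p \<in> space ?M. point (snd p) i \<in> space nu & act (fst p) (pt i (snd p)) \<in> B} =
     (snd -` {om \<in> space config_space. point om i \<in> space nu} Int space ?M) Int ((%p. act (fst p) (pt i (snd p))) -` B Int space ?M)"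
    by (auto simp: space_pair_measure)
   thus ?thesis using measurable_sets[OF measurable_snd pin[of i]] measurable_sets[OF m B(1)] by auto
  qed
  have "(%(g, om). push g om) -` y Int space ?M =
    space ?M - (\<Union>i. {p \<in> space ?M. point (snd p) i \<in> space nu & act (fst p) (pt i (snd p)) \<in> B})"
  proof -
   have "push g om \<in> void B \<longleftrightarrow> ~ (\<exists>i. point om i \<in> space nu & act g (pt i om) \<in> B)"
    if g: "g \<in> carrier G" and om: "om \<in> configs" for g om
   proof -
    have r: "x \<in> om \<longleftrightarrow> x \<in> space nu & (\<exists>i. x = point om i)" for x using range_point[OF om] by blast
    have "push g om Int B = {} \<longleftrightarrow> (\<forall>x\<in>om. act g x \<notin> B)" by blast
    also have "\<dots> \<longleftrightarrow> ~ (\<exists>i. point om i \<in> space nu & act g (point om i) \<in> B)" using r by metis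
    also have "\<dots> \<longleftrightarrow> ~ (\<exists>i. point om i \<in> space nu & act g (pt i om) \<in> B)" by (simp add: pt_def cong: conj_cong)
    finally show ?thesis using push_configs[OF g om] by (simp add: void_def)
   qed
   thus ?thesis by (auto simp: space_pair_measure space_borel_of B(2))
  qed
  thus "(%(g, om). push g om) -` y Int space (borel_of tau \<Otimes>\<^sub>M sigma configs {void B |B. B \<in> sets nu})
    \<in> sets (borel_of tau \<Otimes>\<^sub>M sigma configs {void B |B. B \<in> sets nu})" unfolding config_space_def[symmetric] using 1 by auto
 qed
qed

context
 fixes Q assumes Q: "prob_space Q" "sets Q = sets config_space" "!!B. B \<in> sets nu ==> measure Q (void B) = void_prob B"
begin

interpretation Q: prob_space Q by (rule Q(1))

lemma space_Q [simp]: "space Q = configs"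
 using sets_eq_imp_space_eq[OF Q(2)] by simp

lemma push_measurable: "g \<in> carrier G ==> push g \<in> measurable Q Q"
 using measurable_compose[OF measurable_Pair1'[of g "borel_of tau" config_space] push_joint_measurable]
 by (simp add: space_borel_of measurable_cong_sets[OF Q(2) Q(2)])

lemma gen_Q: "sets Q = sigma_sets configs {void B |B. B \<in> sets nu}"
 using Q(2) sets_config_space by simp

lemma push_preserves:
 assumes g: "g \<in> carrier G" and E: "E \<in> sets Q"
 shows "measure Q (push g -` E Int configs) = measure Q E"
proof -
 have "distr Q Q (push g) = Q"
 proof (rule measure_eqI_generator_eq[OF Int_stable_void, where A = "%_. void {}" and \<Omega> = configs])
  fix X assume "X \<in> {void B |B. B \<in> sets nu}"
  then obtain B where B: "B \<in> sets nu" "X = void B" by blast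
  let ?B = "{z \<in> space nu. act g z \<in> B}"
  have "emeasure (distr Q Q (push g)) X = emeasure Q (void ?B)"
   using B push_vimage_void[OF g B(1)] void_sets Q(2) by (simp add: emeasure_distr push_measurable[OF g])
  moreover have "measure Q (void ?B) = measure Q X"
  proof -
   have "void_prob ?B = void_prob B" unfolding void_prob_def measure_def act_preserves[OF g B(1)] ..
   thus ?thesis using Q(3)[OF act_vimage_sets[OF g B(1)]] Q(3)[OF B(1)] B(2) by simp
  qed
  ultimately show "emeasure (distr Q Q (push g)) X = emeasure Q X" unfolding Q.emeasure_eq_measure by simp
 next
  show "emeasure (distr Q Q (push g)) ((%_. void {}) i) ~= \<infinity>" for i :: nat
   using finite_measure.emeasure_finite[OF prob_space.finite_measure[OF Q.prob_space_distr[OF push_measurable[OF g]]]] by simp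
  show "range (%_. void {}) \<subseteq> {void B |B. B \<in> sets nu}" by auto
  show "(\<Union>i :: nat. void {}) = configs" by (simp add: void_def)
  show "{void B |B. B \<in> sets nu} \<subseteq> Pow configs" by (auto simp: void_def)
 qed (simp_all add: gen_Q)
 hence "measure Q E = measure (distr Q Q (push g)) E" by simp
 also have "\<dots> = measure Q (push g -` E Int configs)" using measure_distr[OF push_measurable[OF g] E] by simp
 finally show ?thesis by simp
qed

lemma push_vimage_sets: "g \<in> carrier G ==> E \<in> sets Q ==> push g -` E Int configs \<in> sets Q"
 using measurable_sets[OF push_measurable] by simp

text \<open>Up to sign, the logarithm of the joint void probability is
 \<open>nu A + nu B\<close> minus the measure of the overlap of \<open>A\<close> with the preimage of \<open>B\<close>, which tends to \<open>0\<close>.\<close>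

lemma mixing_void:
 assumes A: "A \<in> sets nu" and B: "B \<in> sets nu"
 shows "(%n. measure Q (void A Int (push (gs n) -` void B Int configs))) \<longlonglongrightarrow> measure Q (void A) * measure Q (void B)"
proof -
 let ?B = "%n. {z \<in> space nu. act (gs n) z \<in> B}"
 have Bn': "?B n \<in> sets nu" "emeasure nu (?B n) = emeasure nu B" for n using act_vimage_sets[OF gs B] act_preserves[OF gs B] by auto
 have eq: "measure Q (void A Int (push (gs n) -` void B Int configs)) = void_prob (A Un ?B n)" for n
  using push_vimage_void[OF gs B] void_Int Q(3)[of "A Un ?B n"] A Bn' by simp
 show ?thesis
 proof (cases "emeasure nu A = \<infinity> | emeasure nu B = \<infinity>")
  case True
  have "emeasure nu (A Un ?B n) = \<infinity>" for n
   using True emeasure_mono[of A "A Un ?B n" nu] emeasure_mono[of "?B n" "A Un ?B n" nu] A Bn'[of n] by (auto simp: top_unique)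
  hence "void_prob (A Un ?B n) = 0" for n by (simp add: void_prob_def)
  moreover have "measure Q (void A) * measure Q (void B) = 0" using True Q(3)[OF A] Q(3)[OF B] by (auto simp: void_prob_def)
  ultimately have "\<forall>n. measure Q (void A Int (push (gs n) -` void B Int configs)) = measure Q (void A) * measure Q (void B)"
   unfolding eq by simp
  thus ?thesis by (simp only: tendsto_const)
 next
  case False
  hence fA: "emeasure nu A ~= \<infinity>" and fB: "emeasure nu B ~= \<infinity>" by auto
  have "void_prob (A Un ?B n) = exp (- (measure nu A + measure nu B - measure nu (A Int ?B n)))" for n
  proof -
   have f: "emeasure nu (A Un ?B n) ~= \<infinity>" using emeasure_subadditive[of A nu "?B n"] A Bn'[of n] fA fB by (auto simp: top_unique)
   have "measure nu (A Un ?B n) = measure nu A + measure nu (?B n) - measure nu (A Int ?B n)"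
    by (rule measure_Un3) (use A Bn'[of n] fA fB in \<open>auto simp: fmeasurable_def top.not_eq_extremum\<close>)
   moreover have "measure nu (?B n) = measure nu B" using Bn'(2)[of n] by (simp add: measure_def)
   ultimately show ?thesis using f by (simp add: void_prob_def)
  qed
  moreover have "(%n. exp (- (measure nu A + measure nu B - measure nu (A Int ?B n)))) \<longlonglongrightarrow> exp (- (measure nu A + measure nu B - 0))"
   by (intro tendsto_intros act_mixing A B fA fB)
  moreover have "exp (- (measure nu A + measure nu B - 0)) = measure Q (void A) * measure Q (void B)"
   using fA fB Q(3)[OF A] Q(3)[OF B] by (simp add: void_prob_def exp_add[symmetric])
  ultimately show ?thesis unfolding eq by simp
 qed
qed

text \<open>From void events to all events, in one argument at a time.\<close>

lemma mixing:
 assumes E: "E \<in> sets Q" and E': "E' \<in> sets Q"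
 shows "(%n. measure Q (E Int (push (gs n) -` E' Int configs))) \<longlonglongrightarrow> measure Q E * measure Q E'"
proof -
 note sub = gen_Q[folded space_Q] Int_stable_void
 have gsub: "{void B |B. B \<in> sets nu} \<subseteq> Pow (space Q)" by (auto simp: void_def)
 have first: "(%n. measure Q (void A Int (push (gs n) -` E' Int configs))) \<longlonglongrightarrow> measure Q (void A) * measure Q E'"
  if A: "A \<in> sets nu" for A
 proof (rule limit_on_sigma_algebra[OF Q(1) sub gsub, where p = "%n E'. measure Q (void A Int (push (gs n) -` E' Int configs))"])
  have vA: "void A \<in> sets Q" using void_sets[OF A] Q(2) by simp
  show "measure Q (void A Int (push (gs n) -` B Int configs)) <= measure Q B" if "B \<in> sets Q" for n B
   unfolding push_preserves[OF gs that, symmetric, of n] using push_vimage_sets[OF gs that] by (intro Q.finite_measure_mono) auto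
  show "(%k. measure Q (void A Int (push (gs n) -` B k Int configs))) sums
    measure Q (void A Int (push (gs n) -` (\<Union>k. B k) Int configs))" if B: "range B \<subseteq> sets Q" "disjoint_family B" for n B
  proof -
   have eq: "void A Int (push (gs n) -` (\<Union>k. B k) Int configs) = (\<Union>k. void A Int (push (gs n) -` B k Int configs))" by auto
   have "range (%k. void A Int (push (gs n) -` B k Int configs)) \<subseteq> sets Q" using B vA push_vimage_sets[OF gs] by blast
   moreover have "disjoint_family (%k. void A Int (push (gs n) -` B k Int configs))" using B(2) by (auto simp: disjoint_family_on_def)
   ultimately show ?thesis unfolding eq by (rule Q.finite_measure_UNION)
  qed
  have "void A Int (push (gs n) -` space Q Int configs) = void A" for n using push_configs[OF gs] by (auto simp: void_def)
  thus "(%n. measure Q (void A Int (push (gs n) -` space Q Int configs))) \<longlonglongrightarrow> measure Q (void A)" by simp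
  show "(%n. measure Q (void A Int (push (gs n) -` B Int configs))) \<longlonglongrightarrow> measure Q (void A) * measure Q B"
   if "B \<in> {void B |B. B \<in> sets nu}" for B using that mixing_void[OF A] by blast
 qed (use E' in simp_all)
 have "(%n. measure Q (E Int (push (gs n) -` E' Int configs))) \<longlonglongrightarrow> measure Q E' * measure Q E"
 proof (rule limit_on_sigma_algebra[OF Q(1) sub gsub, where p = "%n E. measure Q (E Int (push (gs n) -` E' Int configs))"])
  have vE: "push (gs n) -` E' Int configs \<in> sets Q" for n by (rule push_vimage_sets[OF gs E'])
  show "measure Q (B Int (push (gs n) -` E' Int configs)) <= measure Q B" if "B \<in> sets Q" for n B using that by (intro Q.finite_measure_mono) auto
  show "(%k. measure Q (B k Int (push (gs n) -` E' Int configs))) sums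
    measure Q ((\<Union>k. B k) Int (push (gs n) -` E' Int configs))" if B: "range B \<subseteq> sets Q" "disjoint_family B" for n B
  proof -
   have eq: "(\<Union>k. B k) Int (push (gs n) -` E' Int configs) = (\<Union>k. B k Int (push (gs n) -` E' Int configs))" by auto
   have "range (%k. B k Int (push (gs n) -` E' Int configs)) \<subseteq> sets Q" using B vE by blast
   moreover have "disjoint_family (%k. B k Int (push (gs n) -` E' Int configs))" using B(2) by (auto simp: disjoint_family_on_def)
   ultimately show ?thesis unfolding eq by (rule Q.finite_measure_UNION)
  qed
  have "space Q Int (push (gs n) -` E' Int configs) = push (gs n) -` E' Int configs" for n by auto
  thus "(%n. measure Q (space Q Int (push (gs n) -` E' Int configs))) \<longlonglongrightarrow> measure Q E'" using push_preserves[OF gs E'] by simp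
  show "(%n. measure Q (B Int (push (gs n) -` E' Int configs))) \<longlonglongrightarrow> measure Q E' * measure Q B"
   if "B \<in> {void B |B. B \<in> sets nu}" for B using that first by (auto simp: mult.commute)
 qed (use E in simp_all)
 thus ?thesis by (simp add: mult.commute)
qed

lemma ergodic:
 assumes E: "E \<in> sets Q" and inv: "!!g. g \<in> carrier G ==> measure Q (sym_diff E (push g -` E Int configs)) = 0"
 shows "measure Q E = 0 | measure Q E = 1"
proof -
 have "measure Q (E Int (push (gs n) -` E Int configs)) = measure Q E" for n
 proof -
  let ?F = "push (gs n) -` E Int configs"
  have F: "?F \<in> sets Q" by (rule push_vimage_sets[OF gs E])
  have "measure Q E <= measure Q ((E Int ?F) Un sym_diff E ?F)" by (rule Q.finite_measure_mono) (use E F in auto)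
  also have "\<dots> <= measure Q (E Int ?F) + measure Q (sym_diff E ?F)" by (rule measure_Un_le) (use E F in auto)
  finally have "measure Q E <= measure Q (E Int ?F)" using inv[OF gs] by simp
  moreover have "measure Q (E Int ?F) <= measure Q E" by (rule Q.finite_measure_mono) (use E in auto)
  ultimately show ?thesis by simp
 qed
 hence "(%n. measure Q E) \<longlonglongrightarrow> measure Q E * measure Q E" using mixing[OF E E] by simp
 hence "measure Q E = measure Q E * measure Q E" by (simp only: LIMSEQ_const_iff)
 thus ?thesis by simp
qed

text \<open>If \<open>E\<close> is not of full measure, mixing produces a part of measure close to the square of that of \<open>E\<close>;
 otherwise a void event cuts it.\<close>

lemma nonatomic_Q:
 assumes E: "E \<in> sets Q" "0 < measure Q E"
 shows "\<exists>F\<in>sets Q. F \<subseteq> E & 0 < measure Q F & measure Q F < measure Q E"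
proof (cases "measure Q E = 1")
 case True
 have v: "void (Bn 0) \<in> sets Q" using void_sets[OF Bn(1)] Q(2) by simp
 have p: "measure Q (void (Bn 0)) = exp (- rate 0)"
  using Q(3)[OF Bn(1)[of 0]] Bn_measure(2)[of 0] by (simp add: void_prob_def rate_def less_top[symmetric])
 have "AE x in Q. x \<in> E" using True E Q.prob_eq_1 by blast
 hence "measure Q (E Int void (Bn 0)) = measure Q (void (Bn 0))" by (intro Q.finite_measure_eq_AE) (use E v in auto)
 thus ?thesis using p rate_pos[of 0] True E v by (intro bexI[of _ "E Int void (Bn 0)"]) auto
next
 case False
 hence lt: "measure Q E < 1" using Q.prob_le_1[of E] by linarith
 \<comment> \<open>the limit lies strictly between the two bounds unless the measure is \<open>0\<close> or \<open>1\<close>\<close>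
 let ?F = "%n. E Int (push (gs n) -` E Int configs)"
 have "0 < measure Q E * measure Q E" "measure Q E * measure Q E < measure Q E" using E lt by auto
 hence "\<forall>\<^sub>F n in sequentially. 0 < measure Q (?F n) & measure Q (?F n) < measure Q E"
  using order_tendstoD[OF mixing[OF E(1) E(1)]] by (auto intro: eventually_conj)
 then obtain n where "0 < measure Q (?F n) & measure Q (?F n) < measure Q E" using eventually_happens'[OF sequentially_bot] by blast
 thus ?thesis using push_vimage_sets[OF gs E(1)] E(1) by (intro bexI[of _ "?F n"]) auto
qed

end

text \<open>The law and the action are carried over to a set of reals.\<close>

theorem poisson_suspension:
 "\<exists>(P :: real measure) T. standard_prob_space P & spatial_action G tau P T & ergodic_action G P T & free_action G P T"
proof -
 obtain Q where Q: "prob_space Q" "sets Q = sets config_space" "!!B. B \<in> sets nu ==> measure Q (void B) = void_prob B"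
  using poisson_law_exists by blast
 interpret Q: prob_space Q by (rule Q(1))
 have spQ [simp]: "space Q = configs" by (rule space_Q[OF Q])
 obtain iota :: "'z set => real" and tau' where iota: "inj_on iota configs" "polish_topology tau'" "topspace tau' = iota ` configs"
  "sets (borel_of tau') = {iota ` E |E. E \<in> sets Q}" using real_model_of_configs[OF Q(2)] by blast
 define kap where "kap = inv_into configs iota"
 have kapiota [simp]: "kap (iota om) = om" if "om \<in> configs" for om using that iota(1) by (simp add: kap_def)
 have kapin: "kap x \<in> configs" if "x \<in> iota ` configs" for x using that by auto
 have sub: "E \<subseteq> configs" if "E \<in> sets Q" for E using sets.sets_into_space[OF that] by simp
 define N where "N = vimage_algebra (iota ` configs) kap Q"
 define P where "P = distr Q N iota"
 define T where "T = (%g x. iota (push g (kap x)))"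
 have spP: "space P = iota ` configs" by (simp add: P_def N_def)
 have setsP: "sets P = {iota ` E |E. E \<in> sets Q}"
 proof -
  have "kap -` E Int iota ` configs = iota ` E" if "E \<in> sets Q" for E
  proof
   show "iota ` E \<subseteq> kap -` E Int iota ` configs"
   proof (rule image_subsetI)
    fix om assume "om \<in> E"
    thus "iota om \<in> kap -` E Int iota ` configs" using subsetD[OF sub[OF that]] by simp
   qed
   show "kap -` E Int iota ` configs \<subseteq> iota ` E"
   proof
    fix x assume x: "x \<in> kap -` E Int iota ` configs"
    then obtain om where "om \<in> configs" "x = iota om" by (elim IntE imageE)
    thus "x \<in> iota ` E" using x by simp
   qed
  qed
  moreover have "sets P = {kap -` E Int iota ` configs |E. E \<in> sets Q}" unfolding P_def N_def by (simp add: sets_vimage_algebra2 kapin Pi_iff)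
  ultimately show ?thesis by (auto; metis)
 qed
 have iotam: "iota \<in> measurable Q N" unfolding N_def
 proof (rule measurable_vimage_algebra2)
  show "(%om. kap (iota om)) \<in> measurable Q Q" by (subst measurable_cong[where g = "%om. om"]) auto
 qed auto
 have kapm: "kap \<in> measurable P Q"
 proof -
  have "kap \<in> measurable N Q" unfolding N_def by (rule measurable_vimage_algebra1) (use kapin in auto)
  thus ?thesis unfolding P_def by simp
 qed
 have pull: "iota -` (iota ` E) Int configs = E" if "E \<in> sets Q" for E using sub[OF that] iota(1) by (auto dest: inj_onD)
 have em: "emeasure P (iota ` E) = ennreal (measure Q E)" if "E \<in> sets Q" for E
 proof -
  have "iota ` E \<in> sets N" using that setsP by (auto simp: P_def)
  thus ?thesis unfolding P_def by (simp add: emeasure_distr[OF iotam] pull[OF that] Q.emeasure_eq_measure)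
 qed
 have prob: "prob_space P" unfolding P_def by (rule Q.prob_space_distr[OF iotam])
 have Tiota: "T g (iota om) = iota (push g om)" if "om \<in> configs" for g om using that by (simp add: T_def)
 have pre: "T g -` (iota ` E) Int space P = iota ` (push g -` E Int configs)" if g: "g \<in> carrier G" and E: "E \<in> sets Q" for g E
 proof
  show "T g -` (iota ` E) Int space P \<subseteq> iota ` (push g -` E Int configs)"
  proof
   fix x assume x: "x \<in> T g -` (iota ` E) Int space P"
   then obtain om where om: "om \<in> configs" "x = iota om" by (auto simp: spP)
   hence "iota (push g om) \<in> iota ` E" using x Tiota by auto
   hence "push g om \<in> E" using pull[OF E] push_configs[OF g om(1)] by blast
   thus "x \<in> iota ` (push g -` E Int configs)" using om by blast
  qed
  show "iota ` (push g -` E Int configs) \<subseteq> T g -` (iota ` E) Int space P" using Tiota by (auto simp: spP)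
 qed
 have std: "standard_prob_space P" unfolding standard_prob_space_def
 proof (intro conjI prob)
  show "nonatomic P" unfolding nonatomic_def
  proof (intro ballI impI)
   fix A assume A: "A \<in> sets P" "0 < emeasure P A"
   then obtain E where E: "A = iota ` E" "E \<in> sets Q" using setsP by blast
   have "0 < measure Q E" using A em[OF E(2)] by (simp add: E(1))
   then obtain F where F: "F \<in> sets Q" "F \<subseteq> E" "0 < measure Q F" "measure Q F < measure Q E" using nonatomic_Q[OF Q E(2)] by blast
   thus "\<exists>B\<in>sets P. B \<subseteq> A & 0 < emeasure P B & emeasure P B < emeasure P A"
    using setsP em E by (intro bexI[of _ "iota ` F"]) (auto simp: ennreal_less_iff)
  qed
  show "\<exists>tau. polish_topology tau & topspace tau = space P & sets P = sets (borel_of tau)" using iota spP setsP by (intro exI[of _ tau']) simp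
 qed
 have spat: "spatial_action G tau P T" unfolding spatial_action_def
 proof (intro conjI ballI)
  have j: "(%(g, om). push g om) \<in> measurable (borel_of tau \<Otimes>\<^sub>M Q) Q"
   using push_joint_measurable measurable_cong_sets[OF sets_pair_measure_cong[OF refl Q(2)] Q(2)] by blast
  have "(%p. iota (push (fst p) (kap (snd p)))) \<in> measurable (borel_of tau \<Otimes>\<^sub>M P) N"
   using measurable_compose[OF measurable_compose[OF measurable_Pair[OF measurable_fst measurable_compose[OF measurable_snd kapm]] j] iotam]
   by (simp add: case_prod_unfold)
  thus "(%(g, x). T g x) \<in> measurable (borel_of tau \<Otimes>\<^sub>M P) P" by (simp add: T_def case_prod_unfold P_def)
  show "T \<one>\<^bsub>G\<^esub> x = x" if "x \<in> space P" for x using that Tiota push_one by (auto simp: spP)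
  show "T g (T h x) = T (g \<otimes>\<^bsub>G\<^esub> h) x" if "g \<in> carrier G" "h \<in> carrier G" "x \<in> space P" for g h x
   using that Tiota push_configs push_mult by (auto simp: spP)
  show "emeasure P (T g -` B Int space P) = emeasure P B" if g: "g \<in> carrier G" and B: "B \<in> sets P" for g B
  proof -
   obtain E where E: "B = iota ` E" "E \<in> sets Q" using B setsP by blast
   show ?thesis using pre[OF g E(2)] em[OF E(2)] em[OF push_vimage_sets[OF Q g E(2)]] push_preserves[OF Q g E(2)] unfolding E(1) by simp
  qed
 qed
 have erg: "ergodic_action G P T" unfolding ergodic_action_def
 proof (intro ballI impI)
  fix B assume B: "B \<in> sets P" and inv: "\<forall>g\<in>carrier G. emeasure P (sym_diff B (T g -` B Int space P)) = 0"
  obtain E where E: "B = iota ` E" "E \<in> sets Q" using B setsP by blast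
  have "measure Q (sym_diff E (push g -` E Int configs)) = 0" if g: "g \<in> carrier G" for g
  proof -
   let ?F = "push g -` E Int configs"
   have F: "?F \<in> sets Q" by (rule push_vimage_sets[OF Q g E(2)])
   have "sym_diff B (T g -` B Int space P) = sym_diff (iota ` E) (iota ` ?F)" unfolding E(1) pre[OF g E(2)] ..
   also have "\<dots> = iota ` (sym_diff E ?F)"
    using inj_on_image_set_diff[OF iota(1), of E ?F] inj_on_image_set_diff[OF iota(1), of ?F E] sub[OF E(2)] by (simp add: image_Un Diff_subset_conv) blast
   finally have "emeasure P (iota ` (sym_diff E ?F)) = 0" using inv g by metis
   moreover have "sym_diff E ?F \<in> sets Q" using E(2) F by blast
   ultimately show ?thesis using em by simp
  qed
  from ergodic[OF Q E(2) this] show "emeasure P B = 0 | emeasure P B = 1" using em[OF E(2)] E(1) by auto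
 qed
 have fre: "free_action G P T" unfolding free_action_def
 proof (intro ballI impI)
  fix x g assume x: "x \<in> space P" and g: "g \<in> carrier G" "g ~= \<one>\<^bsub>G\<^esub>"
  obtain om where om: "om \<in> configs" "x = iota om" using x by (auto simp: spP)
  thus "T g x ~= x" using Tiota[OF om(1)] push_free[OF g om(1)] push_configs[OF g(1) om(1)] iota(1) by (auto dest: inj_onD)
 qed
 show ?thesis using std spat erg fre by blast
qed

end

section \<open>Contractions supported in coordinate balls\<close>

lemma flat_exp_le_2: "flat_exp 2 x <= 2"
proof (cases "x > 0")
 case True
 have "(inverse x)\<^sup>2 / 2 <= exp (inverse x)"
  using exp_lower_Taylor_quadratic[of "inverse x"] True positive_imp_inverse_positive[OF True] by linarith
 hence "(inverse x)\<^sup>2 <= 2 * exp (inverse x)" by simp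
 hence "exp (- inverse x) * (inverse x)\<^sup>2 <= exp (- inverse x) * (2 * exp (inverse x))" by (intro mult_left_mono) auto
 also have "\<dots> = 2" by (simp add: exp_minus)
 finally show ?thesis using True by (simp add: flat_exp_def)
qed (simp add: flat_exp_def)

definition smooth_bijection :: "('e::euclidean_space => 'e) => ('e => 'e) => 'e => real => bool" where
 "smooth_bijection F H p rho \<longleftrightarrow> (\<forall>n x. C_germ n F x & C_germ n H x) & (\<forall>x. F (H x) = x & H (F x) = x) &
   (\<forall>x. x \<notin> cball p rho --> F x = x)"

lemma smooth_bijectionD:
 assumes "smooth_bijection F H p rho"
 shows "C_germ n F x" "C_germ n H x" "F (H x) = x" "H (F x) = x" "x \<notin> cball p rho ==> F x = x"
  "smooth_bijection H F p rho" using assms unfolding smooth_bijection_def by metis+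

lemma smooth_bijection_id: "smooth_bijection (%x. x) (%x. x) p rho"
 unfolding smooth_bijection_def by (auto intro: C_family_bounded_linear[OF order_refl bounded_linear_ident])

lemma smooth_bijection_compose:
 assumes F: "smooth_bijection F H p rho" and F': "smooth_bijection F' H' p rho"
 shows "smooth_bijection (%x. F (F' x)) (%x. H' (H x)) p rho" unfolding smooth_bijection_def
 using C_family_compose[where f = "%_. F'" and g = "%_. F", OF order_refl smooth_bijectionD(1)[OF F'] smooth_bijectionD(1)[OF F]]
  C_family_compose[where f = "%_. H" and g = "%_. H'", OF order_refl smooth_bijectionD(2)[OF F] smooth_bijectionD(2)[OF F']]
  smooth_bijectionD(3-5)[OF F] smooth_bijectionD(3-5)[OF F'] by auto

text \<open>Subtracting a small multiple of a compactly supported radial field from the identity gives a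
 bijection, by the contraction principle, and pulls every point of the open ball towards the centre.\<close>

lemma radial_pull:
 fixes p :: "'e::euclidean_space"
 assumes rho: "0 < rho"
 defines "F \<equiv> %y. y - (1/10) *\<^sub>R (flat_exp 0 (1 - (y - p) \<bullet> (y - p) / rho\<^sup>2) *\<^sub>R (y - p))"
 obtains H where "smooth_bijection F H p rho"
proof -
 define w where "w = (%y. 1 - (y - p) \<bullet> (y - p) / rho\<^sup>2)"
 define G where "G = (%y. (1/10) *\<^sub>R (flat_exp 0 (w y) *\<^sub>R (y - p)))"
 define D where "D = (%y h. (1/10) *\<^sub>R (flat_exp 0 (w y) *\<^sub>R h + (flat_exp 2 (w y) * (- (2 * ((y - p) \<bullet> h) / rho\<^sup>2))) *\<^sub>R (y - p)))"
 have F: "F = (%y. y - G y)" by (simp add: F_def G_def w_def)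
 have rho2: "rho\<^sup>2 ~= 0" using rho by simp
 have wd: "(w has_derivative (%h. - (2 * ((y - p) \<bullet> h) / rho\<^sup>2))) (at y)" for y
 proof -
  have "((%y. 1 - inverse (rho\<^sup>2) * ((y - p) \<bullet> (y - p))) has_derivative (%h. 0 - inverse (rho\<^sup>2) * ((y - p) \<bullet> (h - 0) + (h - 0) \<bullet> (y - p)))) (at y)"
   by (intro derivative_intros)
  thus ?thesis by (simp add: w_def divide_inverse mult.commute inner_commute)
 qed
 have fd: "(flat_exp 0 has_derivative (%h. flat_exp 2 x * h)) (at x)" for x
  using flat_exp_has_derivative[of 0 x] by (simp add: has_field_derivative_def numeral_2_eq_2)
 have Gd: "(G has_derivative D y) (at y)" for y
  unfolding G_def D_def by (rule derivative_eq_intros has_derivative_compose[OF wd fd] refl)+ (simp add: fun_eq_iff algebra_simps)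
 have Db: "norm (D y h) <= (1/2) * norm h" for y h
 proof -
  have 1: "norm (flat_exp 0 (w y) *\<^sub>R h) <= norm h" using flat_exp_bounds[of "w y"] by (simp add: mult_left_le_one_le)
  have 2: "norm ((flat_exp 2 (w y) * (- (2 * ((y - p) \<bullet> h) / rho\<^sup>2))) *\<^sub>R (y - p)) <= 4 * norm h"
  proof (cases "w y > 0")
   case True
   hence "(norm (y - p))\<^sup>2 / rho\<^sup>2 <= 1" by (simp add: w_def dot_square_norm)
   hence a: "(norm (y - p) * norm (y - p)) / rho\<^sup>2 <= 1" by (simp add: power2_eq_square)
   have "norm ((flat_exp 2 (w y) * (- (2 * ((y - p) \<bullet> h) / rho\<^sup>2))) *\<^sub>R (y - p)) =
     flat_exp 2 (w y) * (2 * (\<bar>(y - p) \<bullet> h\<bar> * norm (y - p)) / rho\<^sup>2)" by (simp add: abs_mult flat_exp_def)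
   also have "\<dots> <= 2 * (2 * ((norm (y - p) * norm h) * norm (y - p)) / rho\<^sup>2)"
    using flat_exp_le_2[of "w y"] Cauchy_Schwarz_ineq2[of "y - p" h] by (intro mult_mono divide_right_mono mult_left_mono mult_right_mono) auto
   also have "\<dots> = 4 * (((norm (y - p) * norm (y - p)) / rho\<^sup>2) * norm h)" by simp
   also have "\<dots> <= 4 * (1 * norm h)" using a by (intro mult_left_mono mult_right_mono) auto
   finally show ?thesis by simp
  qed (simp add: flat_exp_def)
  have 3: "norm (flat_exp 0 (w y) *\<^sub>R h + (flat_exp 2 (w y) * (- (2 * ((y - p) \<bullet> h) / rho\<^sup>2))) *\<^sub>R (y - p)) <= norm h + 4 * norm h"
   by (rule order_trans[OF norm_triangle_ineq add_mono[OF 1 2]])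
  have "norm (D y h) = (1/10) * norm (flat_exp 0 (w y) *\<^sub>R h + (flat_exp 2 (w y) * (- (2 * ((y - p) \<bullet> h) / rho\<^sup>2))) *\<^sub>R (y - p))"
   by (simp add: D_def del: scaleR_add_right scaleR_right_diff_distrib)
  also have "\<dots> <= (1/10) * (norm h + 4 * norm h)" by (rule mult_left_mono[OF 3]) simp
  finally show ?thesis by simp
 qed
 have Gl: "norm (G x - G y) <= (1/2) * norm (x - y)" for x y
 proof (rule differentiable_bound[of UNIV])
  show "(G has_derivative D y) (at y within UNIV)" for y using Gd by simp
  show "onorm (D y) <= 1/2" for y using Db by (rule onorm_le)
 qed auto
 have "\<exists>!y. z + G y = y" for z by (rule banach_fix_type[of "1/2"]) (use Gl in \<open>auto simp: dist_norm\<close>)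
 then obtain H where H: "!!z. z + G (H z) = H z" by metis
 have FH: "F (H z) = z" for z using H[of z] by (simp add: F algebra_simps)
 have Flow: "norm (x - y) <= 2 * norm (F x - F y)" for x y
 proof -
  have "x - y = (F x - F y) + (G x - G y)" by (simp add: F)
  hence "norm (x - y) <= norm (F x - F y) + norm (G x - G y)" by (metis norm_triangle_ineq)
  thus ?thesis using Gl[of x y] by linarith
 qed
 have HF: "H (F x) = x" for x using Flow[of "H (F x)" x] FH by simp
 have Hc: "isCont H y" for y
 proof -
  have "dist (H x) (H y) <= 2 * dist x y" for x y using Flow[of "H x" "H y"] FH by (simp add: dist_norm)
  hence "2-lipschitz_on UNIV H" by (intro lipschitz_onI) auto
  thus ?thesis using lipschitz_on_continuous_on continuous_on_eq_continuous_at open_UNIV by blast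
 qed
 have wC: "C_germ n w x" for n x
 proof -
  have l: "C_germ n (%y. y - p) x" by (intro order_refl C_family_minus C_family_bounded_linear[OF order_refl bounded_linear_ident] C_family_const)
  have "C_germ n (%y. 1 - inverse (rho\<^sup>2) *\<^sub>R ((y - p) \<bullet> (y - p))) x"
   by (intro order_refl C_family_minus C_family_const C_family_linear_image[OF order_refl bounded_linear_scaleR_right] C_family_bilinear[OF order_refl bounded_bilinear_inner l l])
  thus ?thesis by (simp add: w_def divide_inverse mult.commute)
 qed
 have FC: "C_germ n F x" for n x
 proof -
  have l: "C_germ n (%y. y - p) x" by (intro order_refl C_family_minus C_family_bounded_linear[OF order_refl bounded_linear_ident] C_family_const)
  have f: "C_germ n (%y. flat_exp 0 (w y)) x" by (rule C_family_compose[where f = "%_. w" and g = "%_. flat_exp 0", OF order_refl wC C_germ_flat_exp])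
  show ?thesis unfolding F G_def
   by (intro order_refl C_family_minus C_family_bounded_linear[OF order_refl bounded_linear_ident] C_family_linear_image[OF order_refl bounded_linear_scaleR_right]
     C_family_bilinear[OF order_refl bounded_bilinear_scaleR f l])
 qed
 have HC: "C_germ n H x" for n x
 proof (rule C_family_inverse[where f = "%_. F" and ?x0.0 = "H x"])
  have Fd: "(F has_derivative (%h. h - D y h)) (at y)" for y unfolding F by (rule has_derivative_diff[OF has_derivative_ident Gd])
  have fr: "frechet_derivative F (at y) = (%h. h - D y h)" for y using frechet_derivative_at[OF Fd] by simp
  have lin: "linear (%h. h - D y h)" for y using has_derivative_linear[OF Fd] .
  have "inj (%h. h - D y h)" for y unfolding linear_injective_0[OF lin]
  proof (intro allI impI)
   fix h assume "h - D y h = 0"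
   hence "norm h <= (1/2) * norm h" using Db[of y h] by simp
   thus "h = 0" by simp
  qed
  thus "jdet (frechet_derivative F (at (H x))) ~= 0" unfolding fr using jdet_nonzero_iff_inj[OF lin] by blast
  show "C_germ 0 H x" using Hc[of x] by (simp add: tendsto_unit_times isCont_def tendsto_at_iff_tendsto_nhds)
  show "\<forall>\<^sub>F (s, y) in principal {()} \<times>\<^sub>F nhds x. F (H y) = y" "\<forall>\<^sub>F (s, y) in principal {()} \<times>\<^sub>F nhds x. isCont H y"
   by (rule always_eventually, simp add: FH Hc)+
 qed (simp_all add: FC)
 have "F x = x" if "x \<notin> cball p rho" for x
 proof -
  have "rho < norm (x - p)" using that by (simp add: dist_norm norm_minus_commute)
  hence "rho\<^sup>2 <= (norm (x - p))\<^sup>2" using rho by (intro power_mono) auto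
  hence "w x <= 0" using rho by (simp add: w_def dot_square_norm)
  thus ?thesis by (simp add: F G_def flat_exp_def)
 qed
 hence "smooth_bijection F H p rho" using FC HC FH HF unfolding smooth_bijection_def by blast
 thus ?thesis by (rule that)
qed

text \<open>Iterating the pull contracts a smaller concentric ball at a uniform rate.\<close>

lemma ball_squeeze:
 fixes p :: "'e::euclidean_space"
 assumes rho: "0 < rho" and th: "0 < th" "th < 1" and eta: "0 < eta"
 obtains F H where "smooth_bijection F H p rho" "F ` cball p (th * rho) \<subseteq> cball p eta"
proof -
 define k where "k = (%y. (1/10) * flat_exp 0 (1 - (y - p) \<bullet> (y - p) / rho\<^sup>2))"
 define F where "F = (%y. y - (1/10) *\<^sub>R (flat_exp 0 (1 - (y - p) \<bullet> (y - p) / rho\<^sup>2) *\<^sub>R (y - p)))"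
 obtain H where H: "smooth_bijection F H p rho" using radial_pull[OF rho] unfolding F_def by blast
 define kap where "kap = 1 - (1/10) * flat_exp 0 (1 - th\<^sup>2)"
 have "th\<^sup>2 < 1" using th by (simp add: abs_square_less_1)
 hence kap: "0 < kap" "kap < 1" using flat_exp_bounds[of "1 - th\<^sup>2"] by (auto simp: kap_def)
 have step: "norm (F y - p) <= kap * norm (y - p)" if y: "norm (y - p) <= th * rho" for y
 proof -
  have "(norm (y - p))\<^sup>2 <= (th * rho)\<^sup>2" using y by (intro power_mono) auto
  hence "(y - p) \<bullet> (y - p) / rho\<^sup>2 <= th\<^sup>2" using rho by (simp add: dot_square_norm power_mult_distrib field_simps)
  hence k: "1 - k y <= kap" using flat_exp_mono[of "1 - th\<^sup>2" "1 - (y - p) \<bullet> (y - p) / rho\<^sup>2"] by (simp add: k_def kap_def)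
  have "F y - p = (1 - k y) *\<^sub>R (y - p)" by (simp add: F_def k_def algebra_simps)
  moreover have "0 <= 1 - k y" using flat_exp_bounds(2)[of "1 - (y - p) \<bullet> (y - p) / rho\<^sup>2"] by (simp add: k_def)
  ultimately show ?thesis using k by (simp add: mult_right_mono)
 qed
 have iter: "\<exists>F' H'. smooth_bijection F' H' p rho & (\<forall>y. norm (y - p) <= th * rho --> norm (F' y - p) <= kap ^ m * norm (y - p))" for m
 proof (induction m)
  case 0
  show ?case by (intro exI conjI) (rule smooth_bijection_id, simp)
 next
  case (Suc m)
  then obtain F' H' where F': "smooth_bijection F' H' p rho" "!!y. norm (y - p) <= th * rho ==> norm (F' y - p) <= kap ^ m * norm (y - p)" by metis
  have "norm (F (F' y) - p) <= kap ^ Suc m * norm (y - p)" if y: "norm (y - p) <= th * rho" for y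
  proof -
   have "kap ^ m * norm (y - p) <= 1 * norm (y - p)" using kap by (intro mult_right_mono power_le_one) auto
   hence "norm (F' y - p) <= th * rho" using F'(2)[OF y] y by simp
   hence "norm (F (F' y) - p) <= kap * norm (F' y - p)" by (rule step)
   also have "\<dots> <= kap * (kap ^ m * norm (y - p))" using F'(2)[OF y] kap by (intro mult_left_mono) auto
   finally show ?thesis by (simp add: mult_ac)
  qed
  thus ?case using smooth_bijection_compose[OF H F'(1)] by (intro exI conjI) auto
 qed
 obtain m where m: "kap ^ m < eta / (th * rho)" using real_arch_pow_inv[of "eta / (th * rho)" kap] eta th rho kap by auto
 obtain F' H' where F': "smooth_bijection F' H' p rho" "!!y. norm (y - p) <= th * rho ==> norm (F' y - p) <= kap ^ m * norm (y - p)"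
  using iter[of m] by metis
 have "F' y \<in> cball p eta" if "y \<in> cball p (th * rho)" for y
 proof -
  have y: "norm (y - p) <= th * rho" using that by (simp add: dist_norm norm_minus_commute)
  have "norm (F' y - p) <= kap ^ m * norm (y - p)" by (rule F'(2)[OF y])
  also have "\<dots> <= (eta / (th * rho)) * (th * rho)" using m y kap eta th rho by (intro mult_mono) auto
  also have "\<dots> = eta" using th rho by simp
  finally show ?thesis by (simp add: dist_norm norm_minus_commute)
 qed
 thus ?thesis using that F'(1) by blast
qed

context compact_manifold
begin

definition transplant :: "('m, 'e) chart => ('e => 'e) => 'm => 'm" where
 "transplant c F x = (if x \<in> fst c then ichart c (F (snd c x)) else x)"

lemma smooth_bijection_stays:
 assumes F: "smooth_bijection F H p rho" and U: "cball p rho \<subseteq> U" and y: "y \<in> U"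
 shows "F y \<in> U"
proof (cases "F y \<in> cball p rho")
 case False
 \<comment> \<open>the inverse fixes \<open>F y\<close>, so \<open>F y = y\<close>\<close>
 hence "H (F y) = F y" by (rule smooth_bijectionD(5)[OF smooth_bijectionD(6)[OF F]])
 thus ?thesis using y smooth_bijectionD(4)[OF F] by simp
qed (use U in blast)

lemma
 assumes c: "c \<in> A" and F: "smooth_bijection F H p rho" and B: "cball p rho \<subseteq> snd c ` fst c"
 shows transplant_inverse: "x \<in> Xs ==> transplant c F (transplant c H x) = x"
  and transplant_in: "x \<in> Xs ==> transplant c F x \<in> Xs"
  and transplant_off: "x \<notin> ichart c ` cball p rho ==> transplant c F x = x"
  and C_map_transplant: "C_map r X A (transplant c F)"
proof -
 note st = smooth_bijection_stays[OF F B] smooth_bijection_stays[OF smooth_bijectionD(6)[OF F] B]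
 have inF: "transplant c F x \<in> fst c" "snd c (transplant c F x) = F (snd c x)" if "x \<in> fst c" for x
  using st(1)[of "snd c x"] that by (auto simp: transplant_def ichart_in chart_ichart)
 have inH: "transplant c H x \<in> fst c" "snd c (transplant c H x) = H (snd c x)" if "x \<in> fst c" for x
  using st(2)[of "snd c x"] that by (auto simp: transplant_def ichart_in chart_ichart)
 show "transplant c F (transplant c H x) = x" if "x \<in> Xs"
 proof (cases "x \<in> fst c")
  case True
  have "transplant c F (transplant c H x) = ichart c (F (H (snd c x)))" using inH[OF True] by (simp add: transplant_def)
  thus ?thesis using smooth_bijectionD(3)[OF F] chart_inverse[OF c True] by simp
 qed (simp add: transplant_def)
 show top: "transplant c F x \<in> Xs" if "x \<in> Xs" for x
  using inF[of x] subsetD[OF chart_subset[OF c]] that by (cases "x \<in> fst c") (auto simp: transplant_def)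
 show off: "transplant c F x = x" if "x \<notin> ichart c ` cball p rho" for x
 proof (cases "x \<in> fst c")
  case True
  hence "snd c x \<notin> cball p rho" using that chart_inverse[OF c True] by (metis image_eqI)
  thus ?thesis using smooth_bijectionD(5)[OF F] chart_inverse[OF c True] True by (simp add: transplant_def)
 qed (simp add: transplant_def)
 show "C_map r X A (transplant c F)" unfolding C_map_iff_smooth_family
 proof (intro ballI)
  fix s :: unit and x assume s: "s \<in> topspace one_point" and x: "x \<in> Xs"
  have s0: "s = ()" by simp
  show "smooth_family_at r one_point (%_. transplant c F) s x"
  proof (cases "x \<in> fst c")
   case True
   show ?thesis
   proof (rule smooth_family_atI[where h = "%_. transplant c F", OF s c True c inF(1)[OF True]])
    have 1: "filterlim (%x. F (snd c x)) (nhds (F (snd c x))) (nhdsin X x)"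
    proof (rule filterlim_compose[OF _ filterlim_chart[OF c True]])
     show "filterlim F (nhds (F (snd c x))) (nhds (snd c x))" using smooth_bijectionD(1)[OF F, of 0 "snd c x"] by (simp add: tendsto_unit_times)
    qed
    have "filterlim (%x. ichart c (F (snd c x))) (nhdsin X (transplant c F x)) (nhdsin X x)"
     by (rule filterlim_compose[OF filterlim_ichart[OF c inF(1)[OF True]]]) (use 1 in \<open>simp add: inF(2)[OF True]\<close>)
    moreover have "\<forall>\<^sub>F y in nhdsin X x. ichart c (F (snd c y)) = transplant c F y"
     using eventually_nhdsin_open[OF chart_facts(1)[OF c] True] by eventually_elim (simp add: transplant_def)
    ultimately have "filterlim (transplant c F) (nhdsin X (transplant c F x)) (nhdsin X x)" by (rule iffD1[OF filterlim_cong[OF refl refl], rotated])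
    thus "filterlim (%(s, x). transplant c F x) (nhdsin X (transplant c F x)) (nhdsin one_point s \<times>\<^sub>F nhdsin X x)"
     unfolding s0 nhdsin_unit filterlim_unit_times .
    have "\<forall>\<^sub>F y in nhds (snd c x). F y = local_rep c c (transplant c F) y"
     using eventually_in_chart[OF c True] by eventually_elim (auto simp: local_rep_def inF(2) chart_ichart ichart_in)
    hence "\<forall>\<^sub>F (s, y) in principal {()} \<times>\<^sub>F nhds (snd c x). F y = local_rep c c (transplant c F) y"
     unfolding eventually_unit_times .
    from C_family_cong_imp[OF order_refl this smooth_bijectionD(1)[OF F]]
    show "C_family n (nhdsin one_point s) s (%s. local_rep c c (transplant c F)) (snd c x)" for n unfolding s0 nhdsin_unit .
   qed
  next
   case False
   obtain d where d: "d \<in> A" "x \<in> fst d" using chart_exists[OF x] by blast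
   have fx: "transplant c F x = x" using False by (simp add: transplant_def)
   define U where "U = Xs - ichart c ` cball p rho"
   have "x \<notin> ichart c ` cball p rho" using False B ichart_in by blast
   moreover have "openin X U" unfolding U_def
    by (intro openin_diff openin_topspace compactin_imp_closedin[OF Hausdorff] compactin_ichart[OF c compact_cball B])
   ultimately have U: "openin X U" "x \<in> U" using x by (auto simp: U_def)
   have eq: "transplant c F y = y" if "y \<in> U" for y using off that by (simp add: U_def)
   have fxd: "transplant c F x \<in> fst d" using fx d by simp
   show ?thesis
   proof (rule smooth_family_atI[where h = "%_. transplant c F", OF s d d(1) fxd])
    have "\<forall>\<^sub>F y in nhdsin X x. y = transplant c F y" using eventually_nhdsin_open[OF U] by eventually_elim (simp add: eq)
    hence "filterlim (transplant c F) (nhdsin X (transplant c F x)) (nhdsin X x)"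
     unfolding fx by (rule iffD1[OF filterlim_cong[OF refl refl] filterlim_ident])
    thus "filterlim (%(s, x). transplant c F x) (nhdsin X (transplant c F x)) (nhdsin one_point s \<times>\<^sub>F nhdsin X x)"
     unfolding s0 nhdsin_unit filterlim_unit_times .
    have "\<forall>\<^sub>F y in nhds (snd d x). ichart d y \<in> U"
     using filterlim_ichart[OF d] eventually_nhdsin_open[OF U] unfolding filterlim_iff by blast
    hence "\<forall>\<^sub>F y in nhds (snd d x). y = local_rep d d (transplant c F) y"
     using eventually_in_chart[OF d] by eventually_elim (simp add: local_rep_def eq chart_ichart)
    hence "\<forall>\<^sub>F (s, y) in principal {()} \<times>\<^sub>F nhds (snd d x). y = local_rep d d (transplant c F) y"
     unfolding eventually_unit_times .
    from C_family_cong_imp[OF order_refl this C_family_bounded_linear[OF order_refl bounded_linear_ident]]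
    show "C_family n (nhdsin one_point s) s (%s. local_rep d d (transplant c F)) (snd d x)" for n unfolding s0 nhdsin_unit .
   qed
  qed
 qed
qed

lemma transplant_diffeo:
 assumes c: "c \<in> A" and F: "smooth_bijection F H p rho" and B: "cball p rho \<subseteq> snd c ` fst c"
 shows "restrict (transplant c F) (Xs) \<in> diffeos r X A"
proof (rule diffeosI)
 note F' = smooth_bijectionD(6)[OF F]
 note i = transplant_inverse[OF c F B] transplant_inverse[OF c F' B] transplant_in[OF c F B] transplant_in[OF c F' B]
 show bij: "bij_betw (transplant c F) (Xs) (Xs)" by (rule bij_betw_byWitness[where f' = "transplant c H"]) (use i in auto)
 show "C_map r X A (transplant c F)" by (rule C_map_transplant[OF c F B])
 have "transplant c H x = inv_into (Xs) (transplant c F) x" if x: "x \<in> Xs" for x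
  by (rule inv_into_f_eq[OF bij_betw_imp_inj_on[OF bij], symmetric]) (use i x in auto)
 thus "C_map r X A (inv_into (Xs) (transplant c F))" using C_map_transplant[OF c F' B] by (rule C_map_cong)
qed

lemma ball_squeeze_diffeo:
 assumes c: "c \<in> A" and B: "cball p rho \<subseteq> snd c ` fst c" and rho: "0 < rho" and th: "0 < th" "th < 1" and eta: "0 < eta"
 obtains g where "g \<in> diffeos r X A" "!!x. x \<in> Xs ==> x \<notin> ichart c ` cball p rho ==> g x = x"
  "g ` ichart c ` cball p (th * rho) \<subseteq> ichart c ` cball p eta"
proof -
 obtain F H where F: "smooth_bijection F H p rho" "F ` cball p (th * rho) \<subseteq> cball p eta" using ball_squeeze[OF rho th eta] .
 let ?g = "restrict (transplant c F) (Xs)"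
 have "th * rho <= rho" using th rho by simp
 hence sub: "cball p (th * rho) \<subseteq> snd c ` fst c" using B subset_cball[of "th * rho" rho p] by blast
 show ?thesis
 proof (rule that)
  show "?g \<in> diffeos r X A" by (rule transplant_diffeo[OF c F(1) B])
  show "?g x = x" if "x \<in> Xs" "x \<notin> ichart c ` cball p rho" for x using that transplant_off[OF c F(1) B] by simp
  show "?g ` ichart c ` cball p (th * rho) \<subseteq> ichart c ` cball p eta" unfolding image_image
  proof (rule image_subsetI)
   fix y assume y: "y \<in> cball p (th * rho)"
   have y': "y \<in> snd c ` fst c" using sub y by blast
   have "?g (ichart c y) = ichart c (F y)"
    using ichart_in[OF y'] subsetD[OF chart_subset[OF c] ichart_in[OF y']] chart_ichart[OF y'] by (simp add: transplant_def)
   thus "?g (ichart c y) \<in> ichart c ` cball p eta" using F(2) y by (simp add: image_subset_iff)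
  qed
 qed
qed

end

section \<open>Diffeomorphism groups are not Levy groups\<close>

text \<open>Cover the subgroup by finitely many sets \<open>U\<close> with all quotients of elements of \<open>U\<close> in \<open>V\<close>; two powers of \<open>h\<close>
 lie in the same one.\<close>

lemma compact_subgroup_recurrence:
 assumes G: "topological_group G tau" and K: "subgroup K G" "compactin tau K" and h: "h \<in> K"
  and V: "openin tau V" "\<one>\<^bsub>G\<^esub> \<in> V"
 shows "\<exists>j. h [^]\<^bsub>G\<^esub> Suc j \<in> V"
proof -
 interpret G: group G using G by (simp add: topological_group_def)
 have ts: "topspace tau = carrier G" and mul: "continuous_map (prod_topology tau tau) tau (%(g, h). g \<otimes>\<^bsub>G\<^esub> h)"
  and inv: "continuous_map tau tau (%g. inv\<^bsub>G\<^esub> g)" using G by (simp_all add: topological_group_def)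
 have hG: "h \<in> carrier G" using subgroup.mem_carrier[OF K(1) h] .
 have hK: "h [^]\<^bsub>G\<^esub> (j::nat) \<in> K" for j by (induction j) (use subgroup.one_closed[OF K(1)] subgroup.m_closed[OF K(1) _ h] in auto)
 have cont: "continuous_map (prod_topology tau tau) tau (%p. inv\<^bsub>G\<^esub> (fst p) \<otimes>\<^bsub>G\<^esub> snd p)"
 proof -
  have "continuous_map (prod_topology tau tau) (prod_topology tau tau) (%p. (inv\<^bsub>G\<^esub> (fst p), snd p))"
   by (intro continuous_map_pairedI continuous_map_snd continuous_map_compose[OF continuous_map_fst inv, unfolded comp_def])
  from continuous_map_compose[OF this mul] show ?thesis by (simp add: comp_def)
 qed
 have nb: "\<exists>U. openin tau U & f \<in> U & (\<forall>a\<in>U. \<forall>b\<in>U. inv\<^bsub>G\<^esub> a \<otimes>\<^bsub>G\<^esub> b \<in> V)" if f: "f \<in> carrier G" for f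
 proof -
  let ?P = "{p \<in> topspace (prod_topology tau tau). inv\<^bsub>G\<^esub> (fst p) \<otimes>\<^bsub>G\<^esub> snd p \<in> V}"
  have "openin (prod_topology tau tau) ?P" using openin_continuous_map_preimage[OF cont V(1)] .
  moreover have "(f, f) \<in> ?P" using f V(2) by (simp add: ts)
  ultimately have "\<exists>U1 U2. openin tau U1 & openin tau U2 & f \<in> U1 & f \<in> U2 & U1 \<times> U2 \<subseteq> ?P"
   unfolding openin_prod_topology_alt by simp
  then obtain U1 U2 where U: "openin tau U1" "openin tau U2" "f \<in> U1" "f \<in> U2" "U1 \<times> U2 \<subseteq> ?P" by (elim exE conjE)
  have "inv\<^bsub>G\<^esub> a \<otimes>\<^bsub>G\<^esub> b \<in> V" if "a \<in> U1 Int U2" "b \<in> U1 Int U2" for a b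
   using subsetD[OF U(5), of "(a, b)"] that by simp
  thus ?thesis using U by (intro exI[of _ "U1 Int U2"]) (auto intro: openin_Int)
 qed
 let ?\<U> = "{U. openin tau U & (\<forall>a\<in>U. \<forall>b\<in>U. inv\<^bsub>G\<^esub> a \<otimes>\<^bsub>G\<^esub> b \<in> V)}"
 have "K \<subseteq> \<Union>?\<U>"
 proof
  fix f assume "f \<in> K"
  hence "f \<in> carrier G" by (rule subgroup.mem_carrier[OF K(1)])
  from nb[OF this] show "f \<in> \<Union>?\<U>" by (elim exE conjE) (intro UnionI CollectI, auto)
 qed
 then obtain \<F> where \<F>: "finite \<F>" "\<F> \<subseteq> ?\<U>" "K \<subseteq> \<Union>\<F>" using compactinD[OF K(2), of ?\<U>] by (metis (no_types, lifting) mem_Collect_eq)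
 define pick where "pick = (%j::nat. SOME U. U \<in> \<F> & h [^]\<^bsub>G\<^esub> j \<in> U)"
 have pick: "pick j \<in> \<F>" "h [^]\<^bsub>G\<^esub> j \<in> pick j" for j
 proof -
  have "\<exists>U. U \<in> \<F> & h [^]\<^bsub>G\<^esub> j \<in> U" using hK[of j] \<F>(3) by blast
  from someI_ex[OF this] show "pick j \<in> \<F>" "h [^]\<^bsub>G\<^esub> j \<in> pick j" unfolding pick_def by blast+
 qed
 have "~ inj pick"
 proof
  assume "inj pick"
  moreover have "finite (range pick)" using pick(1) \<F>(1) by (meson finite_subset image_subsetI)
  ultimately show False using finite_imageD infinite_UNIV_nat by blast
 qed
 then obtain i j where ij: "i < j" "pick i = pick j" unfolding inj_def by (metis linorder_neqE_nat)
 have "inv\<^bsub>G\<^esub> (h [^]\<^bsub>G\<^esub> i) \<otimes>\<^bsub>G\<^esub> (h [^]\<^bsub>G\<^esub> j) \<in> V" using pick[of i] pick(2)[of j] \<F>(2) ij(2) by blast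
 moreover have "h [^]\<^bsub>G\<^esub> j = h [^]\<^bsub>G\<^esub> i \<otimes>\<^bsub>G\<^esub> h [^]\<^bsub>G\<^esub> Suc (j - Suc i)"
  using ij(1) hG by (simp add: G.nat_pow_mult del: G.nat_pow_Suc nat_pow_Suc)
 ultimately have "h [^]\<^bsub>G\<^esub> Suc (j - Suc i) \<in> V" using hG by (simp add: G.m_assoc[symmetric] del: G.nat_pow_Suc nat_pow_Suc)
 thus ?thesis by blast
qed

context compact_manifold
begin

lemma openin_evaluation:
 assumes x: "x \<in> Xs" and U: "openin X U"
 shows "openin (Diff_topology r X A) {f \<in> diffeos r X A. f x \<in> U}" unfolding openin_iff_nhdsin
proof (intro conjI ballI)
 let ?tau = "Diff_topology r X A"
 show "{f \<in> diffeos r X A. f x \<in> U} \<subseteq> topspace ?tau" by auto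
 fix f assume f: "f \<in> {f \<in> diffeos r X A. f x \<in> U}"
 have "smooth_family r ?tau (%f. f)" by (rule continuous_map_imp_smooth_family) simp
 hence "smooth_family_at r ?tau (%f. f) f x" using f x by auto
 hence "filterlim (%(s, x). s x) (nhdsin X (f x)) (nhdsin ?tau f \<times>\<^sub>F nhdsin X x)" by (rule smooth_family_at_lim)
 hence "\<forall>\<^sub>F p in nhdsin ?tau f \<times>\<^sub>F nhdsin X x. (case p of (s, x) => s x) \<in> U"
  unfolding filterlim_iff using eventually_nhdsin_open[OF U] f by blast
 moreover have "filterlim (%s. (s, x)) (nhdsin ?tau f \<times>\<^sub>F nhdsin X x) (nhdsin ?tau f)"
 proof (rule filterlim_Pair[OF filterlim_ident])
  show "filterlim (%s. x) (nhdsin X x) (nhdsin ?tau f)"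
   unfolding filterlim_iff using x eventually_nhdsin by (metis (mono_tags, lifting) always_eventually)
 qed
 ultimately have "\<forall>\<^sub>F s in nhdsin ?tau f. s x \<in> U" unfolding filterlim_iff by fastforce
 thus "\<forall>\<^sub>F s in nhdsin ?tau f. s \<in> {f \<in> diffeos r X A. f x \<in> U}"
  using eventually_nhdsin_topspace[of ?tau f] by eventually_elim simp
qed

text \<open>Every diffeomorphism uniformly close to \<open>g\<close> maps a ball into the concentric ball of half the radius, and so
 do all its positive powers. A boundary point of the ball prevents these from being close to the identity.\<close>

theorem not_levy_group_Diff:
 assumes r: "1 <= r"
 shows "~ levy_group (Diff r X A) (Diff_topology r X A)"
proof
 let ?G = "Diff r X A" and ?tau = "Diff_topology r X A"
 assume "levy_group ?G ?tau"
 hence "\<exists>K. (\<forall>n::nat. subgroup (K n) ?G) & (\<forall>n. compactin ?tau (K n)) & ?tau closure_of (\<Union>n. K n) = carrier ?G"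
  unfolding levy_group_def by (elim exE conjE) (intro exI conjI, simp_all)
 then obtain K where K: "!!n::nat. subgroup (K n) ?G" "!!n. compactin ?tau (K n)" "?tau closure_of (\<Union>n. K n) = carrier ?G"
  by (elim exE conjE) (simp; blast)
 obtain q where q: "q \<in> Xs" using nonempty by blast
 obtain c where c: "c \<in> A" "q \<in> fst c" using chart_exists[OF q] by blast
 define p where "p = snd c q"
 obtain rho where rho: "0 < rho" "cball p rho \<subseteq> snd c ` fst c"
  using chart_facts(2)[OF c(1)] c(2) unfolding open_contains_cball p_def by blast
 let ?D = "%s. ichart c ` cball p s"
 have sub: "cball p s \<subseteq> snd c ` fst c" if "s <= rho" for s using rho(2) subset_cball[OF that] by blast
 have Dc: "snd c y \<in> cball p s" "y \<in> fst c" if "y \<in> ?D s" "s <= rho" for y s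
 proof -
  from that(1) obtain z where z: "z \<in> cball p s" "y = ichart c z" by (elim imageE) simp
  have z': "z \<in> snd c ` fst c" using subsetD[OF sub[OF that(2)] z(1)] .
  show "snd c y \<in> cball p s" "y \<in> fst c" using z chart_ichart[OF z'] ichart_in[OF z'] by simp_all
 qed
 have Dm: "y \<in> ?D s" if "y \<in> fst c" "snd c y \<in> cball p s" for y s using chart_inverse[OF c(1) that(1)] that(2) by (metis image_eqI)
 have rho8: "0 < rho / 8" using rho by simp
 obtain g where g: "g \<in> diffeos r X A" "g ` ?D (1/2 * rho) \<subseteq> ?D (rho / 8)"
  by (rule ball_squeeze_diffeo[OF c(1) rho(2) rho(1) _ _ rho8, of "1/2"]) auto
 define N where "N = diff_nhd r X A 0 g c c (?D (rho / 2)) (rho / 8)"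
 have "openin ?tau N" unfolding N_def
 proof (rule openin_diff_nhd[OF _ g(1) c(1) c(1)])
  show "compactin X (?D (rho / 2))" using rho by (intro compactin_ichart[OF c(1)] compact_cball sub) simp
  show "?D (rho / 2) \<subseteq> fst c" using Dc(2) rho by force
  show "g ` ?D (rho / 2) \<subseteq> fst c"
  proof (rule image_subsetI)
   fix x assume "x \<in> ?D (rho / 2)"
   hence "g x \<in> ?D (rho / 8)" using g(2) by auto
   thus "g x \<in> fst c" by (rule Dc(2)) (use rho in simp)
  qed
 qed (use rho in \<open>auto simp: zero_enat_def[symmetric]\<close>)
 moreover have gN: "g \<in> N"
 proof -
  have "g x \<in> fst c" if "x \<in> ?D (rho / 2)" for x by (rule Dc(2)[of _ "rho / 8"]) (use g(2) that rho in auto)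
  thus ?thesis unfolding N_def diff_nhd_def using g(1) rho(1) by auto
 qed
 moreover have "g \<in> ?tau closure_of (\<Union>n. K n)" using K(3) g(1) by simp
 ultimately obtain h where h: "h \<in> (\<Union>n. K n)" "h \<in> N" unfolding in_closure_of by metis
 then obtain n where n: "h \<in> K n" by blast
 have hd: "h \<in> diffeos r X A" and hN: "h ` ?D (rho / 2) \<subseteq> fst c"
  and hN': "!!x. x \<in> snd c ` ?D (rho / 2) ==> norm (local_rep c c h x - local_rep c c g x) < rho / 8"
  using h(2) unfolding N_def diff_nhd_def by (auto dest!: bspec spec[of _ "[]"])
 have hD: "h x \<in> ?D (rho / 4)" if x: "x \<in> ?D (rho / 2)" for x
 proof (rule Dm)
  show "h x \<in> fst c" using hN x by blast
  have xc: "x \<in> fst c" using Dc(2)[OF x] rho by simp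
  have "norm (snd c (h x) - snd c (g x)) < rho / 8" using hN'[OF imageI[OF x]] chart_inverse[OF c(1) xc] by (simp add: local_rep_def)
  moreover have "dist p (snd c (g x)) <= rho / 8"
  proof -
   have "g x \<in> ?D (rho / 8)" using g(2) x by auto
   from Dc(1)[OF this] show ?thesis using rho by simp
  qed
  ultimately show "snd c (h x) \<in> cball p (rho / 4)"
   using dist_triangle[of p "snd c (h x)" "snd c (g x)"] by (simp add: dist_norm norm_minus_commute)
 qed
 have D42: "?D (rho / 4) \<subseteq> ?D (rho / 2)" using rho(1) by (intro image_mono subset_cball) simp
 have top2: "x \<in> Xs" if "x \<in> ?D (rho / 2)" for x using subsetD[OF chart_subset[OF c(1)]] Dc(2)[OF that] rho by simp
 interpret G: group ?G by (rule group_Diff)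
 have pow: "(h [^]\<^bsub>?G\<^esub> Suc j) x \<in> ?D (rho / 4)" if "x \<in> ?D (rho / 2)" for x j using that
 proof (induction j arbitrary: x)
  case 0
  thus ?case using hD hd G.l_one[of h] by (simp del: one_Diff)
 next
  case (Suc j)
  have "h [^]\<^bsub>?G\<^esub> Suc j \<in> diffeos r X A" using G.nat_pow_closed[of h "Suc j"] hd by simp
  hence "(h [^]\<^bsub>?G\<^esub> Suc (Suc j)) x = (h [^]\<^bsub>?G\<^esub> Suc j) (h x)" using mult_Diff_apply[OF _ hd top2[OF Suc.prems]] by simp
  moreover have "h x \<in> ?D (rho / 2)" using hD[OF Suc.prems] D42 by blast
  ultimately show ?case using Suc.IH by simp
 qed
 \<comment> \<open>a point of the larger ball that \<open>h\<close> can never bring back\<close>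
 obtain b :: 'e where b: "b \<in> Basis" using nonempty_Basis by blast
 define x where "x = ichart c (p + (rho / 2) *\<^sub>R b)"
 have xb: "p + (rho / 2) *\<^sub>R b \<in> cball p (rho / 2)" using rho b by (simp add: dist_norm)
 have x2: "x \<in> ?D (rho / 2)" using xb by (simp add: x_def)
 have "snd c x = p + (rho / 2) *\<^sub>R b" unfolding x_def using sub[of "rho / 2"] xb rho by (intro chart_ichart) auto
 hence x4: "x \<notin> ?D (rho / 4)" using Dc(1)[of x "rho / 4"] rho b by (auto simp: dist_norm)
 let ?V = "{f \<in> diffeos r X A. f x \<in> Xs - ?D (rho / 4)}"
 have "openin ?tau ?V" by (intro openin_evaluation top2[OF x2] openin_diff openin_topspace compactin_imp_closedin[OF Hausdorff]
    compactin_ichart[OF c(1)] compact_cball sub) (use rho in simp)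
 moreover have "\<one>\<^bsub>?G\<^esub> \<in> ?V" using top2[OF x2] x4 G.one_closed by simp
 ultimately obtain j where "h [^]\<^bsub>?G\<^esub> Suc j \<in> ?V"
  using compact_subgroup_recurrence[OF topological_group_Diff[OF r] K(1) K(2) n] by blast
 thus False using pow[OF x2, of j] by simp
qed

end

section \<open>Jacobians\<close>

abbreviation leb :: "'a::euclidean_space set => ennreal" where "leb \<equiv> emeasure lborel"

lemma lborel_to_vec: "distr lborel lborel to_vec = (lborel :: (real^'e::euclidean_space coord) measure)"
proof (rule lborel_eqI[symmetric])
 have m: "to_vec \<in> borel_measurable (borel :: 'e measure)"
  using linear_continuous_on[OF linear_conv_bounded_linear[THEN iffD1, OF linear_to_vec]] by (rule borel_measurable_continuous_onI)
 fix l u :: "real^'e coord" assume le: "!!b. b \<in> Basis ==> l \<bullet> b <= u \<bullet> b"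
 have B: "Basis = range (%i :: 'e coord. axis i (1::real))" by (auto simp: Basis_vec_def)
 have inj: "inj (%i :: 'e coord. axis i (1::real))" by (auto simp: inj_def axis_eq_axis)
 have ov: "of_vec v \<bullet> basis_vec i = v $ i" for v :: "real^'e coord" and i by (metis to_vec_of_vec to_vec_def vec_lambda_beta)
 have le': "l $ i <= u $ i" for i using le[of "axis i 1"] by (simp add: B inner_axis)
 have rB: "(Basis :: 'e set) = range basis_vec" using bij_betw_basis_vec unfolding bij_betw_def by blast
 have "to_vec -` box l u = box (of_vec l) (of_vec u :: 'e)" by (auto simp: mem_box_cart mem_box rB ov to_vec_def)
 hence "emeasure (distr lborel lborel to_vec) (box l u) = leb (box (of_vec l) (of_vec u :: 'e))" using m by (simp add: emeasure_distr)
 also have "\<dots> = (\<Prod>b\<in>Basis. (of_vec u - of_vec l :: 'e) \<bullet> b)" by (rule emeasure_lborel_box) (auto simp: rB ov le')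
 also have "(\<Prod>b\<in>Basis. (of_vec u - of_vec l :: 'e) \<bullet> b) = (\<Prod>i\<in>UNIV. u $ i - l $ i)"
  unfolding prod_Basis_coord by (simp add: inner_diff_left ov)
 also have "\<dots> = (\<Prod>b\<in>Basis. (u - l) \<bullet> b)" unfolding B by (subst prod.reindex[OF inj]) (simp add: inner_axis)
 finally show "emeasure (distr lborel lborel to_vec) (box l u) = (\<Prod>b\<in>Basis. (u - l) \<bullet> b)" .
qed simp

text \<open>Coordinates preserve Lebesgue measure and determinants, which reduces the claim to vectors.\<close>

lemma emeasure_jacobian_image:
 fixes f :: "'e::euclidean_space => 'e"
 assumes S: "S \<in> sets borel" "leb S < \<infinity>" and fS: "f ` S \<in> sets borel"
  and der: "!!x. x \<in> S ==> (f has_derivative f' x) (at x)" and inj: "inj_on f S"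
  and meas: "(%x. indicat_real S x * \<bar>jdet (f' x)\<bar>) \<in> borel_measurable borel"
  and bound: "!!x. x \<in> S ==> \<bar>jdet (f' x)\<bar> <= B"
 shows "leb (f ` S) = (\<integral>\<^sup>+x. ennreal (indicat_real S x * \<bar>jdet (f' x)\<bar>) \<partial>lborel)"
proof -
 let ?h = "%x. indicat_real S x * \<bar>jdet (f' x)\<bar>"
 let ?S = "to_vec ` S" and ?f = "to_vec \<circ> f \<circ> of_vec" and ?g = "%v. to_vec \<circ> f' (of_vec v) \<circ> of_vec"
 have bl: "bounded_linear to_vec" "bounded_linear of_vec" using linear_to_vec linear_of_vec by (simp_all add: linear_conv_bounded_linear)
 have tm: "to_vec \<in> borel_measurable (borel :: 'e measure)" and om: "of_vec \<in> borel_measurable (borel :: (real^'e coord) measure)"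
  using bl by (auto intro!: borel_measurable_continuous_onI linear_continuous_on)
 have image: "to_vec ` T = of_vec -` T" for T :: "'e set"
 proof
  show "of_vec -` T \<subseteq> to_vec ` T"
  proof
   fix v assume "v \<in> of_vec -` T"
   thus "v \<in> to_vec ` T" by (intro image_eqI[of _ _ "of_vec v"]) auto
  qed
 qed auto
 have sets: "to_vec ` T \<in> sets borel" if "T \<in> sets borel" for T :: "'e set" unfolding image using measurable_sets[OF om that] by simp
 have em: "leb (to_vec ` T) = leb T" if T: "T \<in> sets borel" for T :: "'e set"
 proof -
  have "leb (to_vec ` T) = emeasure (distr lborel lborel to_vec) (to_vec ` T)" by (simp add: lborel_to_vec)
  also have "\<dots> = leb (to_vec -` to_vec ` T)" using tm sets[OF T] by (subst emeasure_distr) auto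
  also have "to_vec -` to_vec ` T = T" unfolding image by auto
  finally show ?thesis .
 qed
 have int: "integrable lborel ?h"
 proof (rule Bochner_Integration.integrable_bound)
  show "integrable lborel (%x. indicat_real S x * B)" using S by (intro integrable_mult_left integrable_real_indicator) auto
  show "AE x in lborel. norm (?h x) <= norm (indicat_real S x * B)"
   using bound by (intro AE_I2) (auto simp: indicator_def intro: order_trans[OF _ abs_ge_self])
 qed (use meas in simp)
 have int': "integrable lborel (%v. ?h (of_vec v))"
 proof -
  have "integrable (distr lborel lborel to_vec) (%v. ?h (of_vec v))"
   using int meas tm measurable_compose[OF om meas] by (subst integrable_distr_eq) auto
  thus ?thesis by (simp add: lborel_to_vec)
 qed
 have intv: "integral\<^sup>L lborel (%v. ?h (of_vec v)) = integral\<^sup>L lborel ?h"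
 proof -
  have "integral\<^sup>L (distr lborel lborel to_vec) (%v. ?h (of_vec v)) = integral\<^sup>L lborel ?h"
   using tm measurable_compose[OF om meas] by (subst integral_distr) auto
  thus ?thesis by (simp add: lborel_to_vec)
 qed
 have g: "\<bar>det (matrix (?g v))\<bar> = \<bar>jdet (f' (of_vec v))\<bar>" for v by (simp add: matrix_of_eq)
 have "((%v. ?h (of_vec v)) has_integral integral\<^sup>L lborel ?h) UNIV" using has_integral_integral_lborel[OF int'] unfolding intv .
 moreover have "(%v. ?h (of_vec v)) = (%v. if v \<in> ?S then \<bar>det (matrix (?g v))\<bar> else 0)"
  unfolding g unfolding image by (auto simp: fun_eq_iff indicator_def)
 ultimately have hi: "((%v. \<bar>det (matrix (?g v))\<bar>) has_integral integral\<^sup>L lborel ?h) ?S" by (simp only: has_integral_restrict_UNIV)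
 have "?f ` ?S \<in> lmeasurable & measure lebesgue (?f ` ?S) = integral\<^sup>L lborel ?h"
 proof (subst has_measure_differentiable_image)
  show "?S \<in> sets lebesgue" using sets[OF S(1)] by simp
  show "(?f has_derivative ?g v) (at v within ?S)" if "v \<in> ?S" for v
  proof (rule has_derivative_at_withinI)
   have "of_vec v \<in> S" using that unfolding image by simp
   from der[OF this] show "(?f has_derivative ?g v) (at v)" by (intro diff_chain_at bounded_linear_imp_has_derivative bl)
  qed
  show "inj_on ?f ?S"
  proof (rule inj_onI)
   fix v w assume v: "v \<in> ?S" "w \<in> ?S" and eq: "?f v = ?f w"
   have "of_vec (to_vec (f (of_vec v))) = of_vec (to_vec (f (of_vec w)))" using eq by simp
   hence "f (of_vec v) = f (of_vec w)" by (simp only: of_vec_to_vec)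
   moreover have "of_vec v \<in> S" "of_vec w \<in> S" using v unfolding image by auto
   ultimately have "of_vec v = of_vec w" using inj by (auto dest: inj_onD)
   hence "to_vec (of_vec v) = to_vec (of_vec w)" by simp
   thus "v = w" by (simp only: to_vec_of_vec)
  qed
 qed (rule hi)
 moreover have "?f ` ?S = to_vec ` f ` S" by (simp add: image_comp comp_def)
 ultimately have L: "to_vec ` f ` S \<in> lmeasurable" "measure lebesgue (to_vec ` f ` S) = integral\<^sup>L lborel ?h" by auto
 have "leb (f ` S) = emeasure lebesgue (to_vec ` f ` S)" using em[OF fS] sets[OF fS] by simp
 also have "\<dots> = ennreal (measure lebesgue (to_vec ` f ` S))" using L(1) by (rule emeasure_eq_measure2)
 also have "\<dots> = (\<integral>\<^sup>+x. ennreal (?h x) \<partial>lborel)" unfolding L(2) using nn_integral_eq_integral[OF int] by simp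
 finally show ?thesis .
qed

lemma jdet_family_lim:
 fixes f :: "'s => 'e::euclidean_space => 'e"
 assumes F: "principal {s0} <= F" and f: "C_family (Suc 0) F s0 f x0"
 shows "((%(s, x). jdet (frechet_derivative (f s) (at x))) \<longlongrightarrow> jdet (frechet_derivative (f s0) (at x0))) (F \<times>\<^sub>F nhds x0)"
proof -
 have "C_family 0 F s0 (%s. dd v (f s)) x0" if "v \<in> Basis" for v using f that by simp
 from C_family_linear_image[OF F bounded_linear_inner_left this]
 have "C_family 0 F s0 (%s x. frechet_derivative (f s) (at x) (basis_vec j) \<bullet> basis_vec i) x0" for i j by simp
 hence "C_family 0 F s0 (%s x. det (\<chi> i j. frechet_derivative (f s) (at x) (basis_vec j) \<bullet> basis_vec i)) x0"
  by (intro C_family_det[OF F])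
 from C_family_tendsto[OF this] show ?thesis unfolding matrix_of_def .
qed

context compact_manifold
begin

definition jac :: "('m, 'e) chart => ('m, 'e) chart => ('m => 'm) => 'm => real" where
 "jac c d f x = jdet (frechet_derivative (local_rep c d f) (at (snd c x)))"

lemma local_rep_differentiable:
 assumes "1 <= r" "C_map r X A f" "c \<in> A" "d \<in> A" "x \<in> fst c" "f x \<in> fst d"
 shows "local_rep c d f differentiable (at (snd c x))"
proof -
 have "enat (Suc 0) <= r" using assms(1) by (simp add: one_enat_def)
 from C_map_germ[OF assms(2-6) this]
 have "\<forall>\<^sub>F (s, y) in principal {()} \<times>\<^sub>F nhds (snd c x). local_rep c d f differentiable (at y)" by simp
 thus ?thesis unfolding eventually_unit_times by (rule eventually_nhds_x_imp_x)
qed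

lemma eventually_ichart:
 assumes "c \<in> A" "x \<in> fst c" "openin X U" "x \<in> U"
 shows "\<forall>\<^sub>F y in nhds (snd c x). y \<in> snd c ` fst c & ichart c y \<in> U"
 using eventually_in_chart[OF assms(1,2)] filterlim_ichart[OF assms(1,2)] eventually_nhdsin_open[OF assms(3,4)]
 unfolding filterlim_iff by (auto intro: eventually_conj)

lemma jac_cong:
 assumes c: "c \<in> A" "x \<in> fst c" and eq: "!!y. y \<in> Xs ==> f y = f' y"
 shows "jac c d f x = jac c d f' x"
proof -
 have "\<forall>\<^sub>F y in nhds (snd c x). local_rep c d f y = local_rep c d f' y"
  using eventually_ichart[OF c openin_topspace subsetD[OF chart_subset[OF c(1)] c(2)]] by eventually_elim (simp add: local_rep_def eq)
 from frechet_derivative_cong_nhds(1)[OF this] show ?thesis by (simp add: jac_def)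
qed

lemma jac_chain:
 assumes r: "1 <= r" and f: "C_map r X A f" and g: "C_map r X A g"
  and c: "c \<in> A" "x \<in> fst c" and d: "d \<in> A" "f x \<in> fst d" and e: "e \<in> A" "g (f x) \<in> fst e"
 shows "jac c e (%x. g (f x)) x = jac d e g (f x) * jac c d f x"
proof -
 have df: "local_rep c d f differentiable (at (snd c x))" by (rule local_rep_differentiable[OF r f c(1) d(1) c(2) d(2)])
 have fx: "local_rep c d f (snd c x) = snd d (f x)" using c by (simp add: local_rep_def)
 have dg: "local_rep d e g differentiable (at (local_rep c d f (snd c x)))"
  unfolding fx by (rule local_rep_differentiable[OF r g d(1) e(1) d(2) e(2)])
 have fc: "continuous_map X X f" using f by (simp add: C_map_def)
 have "openin X {y \<in> Xs. f y \<in> fst d}" by (rule openin_continuous_map_preimage[OF fc chart_facts(1)[OF d(1)]])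
 moreover have "x \<in> {y \<in> Xs. f y \<in> fst d}" using subsetD[OF chart_subset[OF c(1)] c(2)] d(2) by simp
 ultimately have "\<forall>\<^sub>F y in nhds (snd c x). y \<in> snd c ` fst c & ichart c y \<in> {y \<in> Xs. f y \<in> fst d}"
  by (rule eventually_ichart[OF c])
 hence "\<forall>\<^sub>F y in nhds (snd c x). local_rep c e (%x. g (f x)) y = (local_rep d e g \<circ> local_rep c d f) y"
  by (rule eventually_mono) (auto simp: local_rep_def chart_inverse[OF d(1)])
 from frechet_derivative_cong_nhds(1)[OF this]
 have "frechet_derivative (local_rep c e (%x. g (f x))) (at (snd c x)) =
   frechet_derivative (local_rep d e g) (at (snd d (f x))) \<circ> frechet_derivative (local_rep c d f) (at (snd c x))"
  unfolding frechet_derivative_compose[OF df dg] fx .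
 thus ?thesis using jdet_compose linear_frechet_derivative[OF df] linear_frechet_derivative[OF dg] fx by (simp add: jac_def)
qed

lemma jac_ident:
 assumes c: "c \<in> A" "x \<in> fst c" shows "jac c c (%x. x) x = 1"
proof -
 have "\<forall>\<^sub>F y in nhds (snd c x). local_rep c c (%x. x) y = y"
  using eventually_in_chart[OF c] by eventually_elim (simp add: local_rep_def chart_ichart)
 from frechet_derivative_cong_nhds(1)[OF this] show ?thesis by (simp add: jac_def frechet_derivative_at[OF has_derivative_ident, symmetric] jdet_id)
qed

text \<open>The chain rule for the map and its inverse.\<close>

lemma jac_nonzero:
 assumes r: "1 <= r" and g: "g \<in> diffeos r X A" and c: "c \<in> A" "x \<in> fst c" and d: "d \<in> A" "g x \<in> fst d"
 shows "jac c d g x ~= 0"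
proof -
 let ?h = "inv_into (Xs) g"
 have x: "x \<in> Xs" by (rule subsetD[OF chart_subset[OF c(1)] c(2)])
 have hx: "?h (g x) \<in> fst c" using diffeo_inv(2)[OF g x] c(2) by simp
 have "jac c c (%x. ?h (g x)) x = jac c c (%x. x) x" by (rule jac_cong[OF c]) (rule diffeo_inv(2)[OF g])
 hence "jac d c ?h (g x) * jac c d g x = 1" using jac_chain[OF r diffeosD(3)[OF g] diffeosD(4)[OF g] c d c(1) hx] jac_ident[OF c] by simp
 thus ?thesis by auto
qed

end

section \<open>A measurable Euclidean model of the manifold\<close>

lemma sets_borel_of: "sets (borel_of tau) = sigma_sets (topspace tau) {U. openin tau U}"
 unfolding borel_of_def by (rule sets_measure_of) (use openin_subset in blast)

lemma space_borel_of_topspace [simp]: "space (borel_of tau) = topspace tau"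
 unfolding borel_of_def using openin_subset by (subst space_measure_of) auto

lemma openin_sets_borel_of: "openin tau U ==> U \<in> sets (borel_of tau)"
 unfolding sets_borel_of by blast

text \<open>One second countable factor suffices to write open sets of a product as countable unions of rectangles.\<close>

lemma sets_pair_locally:
 fixes W :: "('s \<times> 'e::second_countable_topology) set"
 assumes W: "!!g q. (g, q) \<in> W ==> g \<in> topspace tau & (\<forall>\<^sub>F (s, y) in nhdsin tau g \<times>\<^sub>F nhds q. (s, y) \<in> W)"
 shows "W \<in> sets (borel_of tau \<Otimes>\<^sub>M borel)"
proof -
 obtain \<B> :: "'e set set" where \<B>: "countable \<B>" "topological_basis \<B>" using ex_countable_basis by blast
 define U where "U = (%B. \<Union>{U. openin tau U & U \<times> B \<subseteq> W})"
 have U: "openin tau (U B)" for B unfolding U_def by (intro openin_Union) auto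
 have "W = (\<Union>B\<in>\<B>. U B \<times> B)"
 proof
  show "(\<Union>B\<in>\<B>. U B \<times> B) \<subseteq> W" unfolding U_def by blast
  show "W \<subseteq> (\<Union>B\<in>\<B>. U B \<times> B)"
  proof
   fix p assume p: "p \<in> W"
   obtain g q where gq: "p = (g, q)" by (cases p)
   have gt: "g \<in> topspace tau" and ev: "\<forall>\<^sub>F p in nhdsin tau g \<times>\<^sub>F nhds q. p \<in> W" using W[of g q] p gq by (simp_all add: case_prod_unfold)
   obtain P R where PR: "eventually P (nhdsin tau g)" "eventually R (nhds q)" "!!s y. P s ==> R y ==> (s, y) \<in> W"
    using ev unfolding eventually_prod_filter by metis
   obtain S where S: "openin tau S" "g \<in> S" "\<forall>x\<in>S. P x" using PR(1) gt unfolding eventually_nhdsin by metis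
   obtain T where T: "open T" "q \<in> T" "\<forall>x\<in>T. R x" using PR(2) unfolding eventually_nhds by metis
   obtain B where B: "B \<in> \<B>" "q \<in> B" "B \<subseteq> T" using topological_basisE[OF \<B>(2) T(1,2)] by metis
   have "S \<times> B \<subseteq> W" using S(3) T(3) B(3) PR(3) by auto
   hence "g \<in> U B" using S(1,2) unfolding U_def by blast
   thus "p \<in> (\<Union>B\<in>\<B>. U B \<times> B)" using B gq by blast
  qed
 qed
 moreover have "U B \<times> B \<in> sets (borel_of tau \<Otimes>\<^sub>M borel)" if "B \<in> \<B>" for B
  using openin_sets_borel_of[OF U] topological_basis_open[OF \<B>(2) that] by (intro pair_measureI) auto
 ultimately show ?thesis using \<B>(1) by (metis (no_types, lifting) sets.countable_UN'')
qed

locale model_manifold = covered_manifold X A N c a R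
 for X :: "'m topology" and A :: "('m, 'e::euclidean_space) chart set" and N c a R +
 fixes r :: enat
 assumes r1: "1 <= r"
begin

abbreviation \<open>Dr \<equiv> diffeos r X A\<close>

abbreviation \<open>tau \<equiv> Diff_topology r X A\<close>

definition piece :: "'m => nat" where "piece x = (LEAST i. i < N & x \<in> V i)"

text \<open>The pieces are moved apart along an axis, so that one copy of the model space holds all of them.\<close>

definition shift :: "nat => 'e" where "shift i = (3 * real i) *\<^sub>R (SOME b. b \<in> Basis) - a i"

definition code :: "'m => 'e" where "code x = snd (c (piece x)) x + shift (piece x)"

definition point_at :: "nat => 'e => 'm" where "point_at i q = ichart (c i) (q - shift i)"

definition decode :: "'e => 'm" where "decode = inv_into (Xs) code"

definition Q :: "'e set" where "Q = code ` Xs"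

lemma piece:
 assumes "x \<in> Xs" shows "piece x < N" "x \<in> V (piece x)" "x \<in> fst (c (piece x))"
proof -
 from LeastI_ex[OF V_cover[OF assms]] show "piece x < N" and V: "x \<in> V (piece x)" unfolding piece_def by blast+
 thus "x \<in> fst (c (piece x))" using subsetD[OF V_subset] by blast
qed

lemma piece_iff:
 assumes "x \<in> Xs" "i < N" shows "piece x = i \<longleftrightarrow> x \<in> V i & (\<forall>k<i. x \<notin> V k)"
proof
 assume "piece x = i"
 thus "x \<in> V i & (\<forall>k<i. x \<notin> V k)"
  using piece(2)[OF assms(1)] not_less_Least[of _ "%i. i < N & x \<in> V i"] assms(2) unfolding piece_def by auto
next
 assume "x \<in> V i & (\<forall>k<i. x \<notin> V k)"
 thus "piece x = i" unfolding piece_def using assms(2) by (intro Least_equality) (auto simp: not_less[symmetric])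
qed

lemma piece_chart: "x \<in> Xs ==> c (piece x) \<in> A"
 using cA piece(1) by blast

lemma code_shift [simp]: "code x - shift (piece x) = snd (c (piece x)) x"
 by (simp add: code_def)

lemma point_at_code [simp]: "x \<in> Xs ==> point_at (piece x) (code x) = x"
 by (simp add: point_at_def chart_inverse[OF piece_chart piece(3)])

lemma code_ball: "x \<in> Xs ==> dist (code x) ((3 * real (piece x)) *\<^sub>R (SOME b. b \<in> Basis)) < 1"
proof -
 assume x: "x \<in> Xs"
 have "dist (a (piece x)) (snd (c (piece x)) x) < 1" using piece[OF x] R(2)[OF piece(1)[OF x]] by (auto simp: V_def)
 thus ?thesis by (simp add: code_def shift_def dist_norm norm_minus_commute algebra_simps)
qed

lemma piece_code:
 assumes x: "x \<in> Xs" and y: "y \<in> Xs" and eq: "code x = code y"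
 shows "piece x = piece y"
proof -
 let ?b = "SOME b :: 'e. b \<in> Basis"
 have b: "norm ?b = 1" using someI_ex[of "%b :: 'e. b \<in> Basis"] nonempty_Basis by auto
 have "dist ((3 * real (piece x)) *\<^sub>R ?b) ((3 * real (piece y)) *\<^sub>R ?b) < 2"
  using dist_triangle_lt[of "(3 * real (piece x)) *\<^sub>R ?b" "code x" "(3 * real (piece y)) *\<^sub>R ?b" 2]
   code_ball[OF x] code_ball[OF y] eq by (simp add: dist_commute)
 hence "\<bar>3 * real (piece x) - 3 * real (piece y)\<bar> < 2" by (simp add: dist_norm scaleR_diff_left[symmetric] b)
 thus ?thesis by (auto simp: abs_if split: if_splits)
qed

lemma inj_code: "inj_on code (Xs)"
proof (rule inj_onI)
 fix x y assume xy: "x \<in> Xs" "y \<in> Xs" "code x = code y"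
 have "x = point_at (piece x) (code x)" using xy(1) by simp
 also have "\<dots> = point_at (piece y) (code y)" unfolding piece_code[OF xy] xy(3) ..
 also have "\<dots> = y" using xy(2) by simp
 finally show "x = y" .
qed

lemma decode_code [simp]: "x \<in> Xs ==> decode (code x) = x"
 unfolding decode_def by (rule inv_into_f_f[OF inj_code])

lemma decode_in: "q \<in> Q ==> decode q \<in> Xs" and code_decode: "q \<in> Q ==> code (decode q) = q"
 by (auto simp: Q_def)

lemma code_in: "x \<in> Xs ==> code x \<in> Q"
 by (simp add: Q_def)

definition slot :: "nat => 'e set" where "slot i = {q. q - shift i \<in> snd (c i) ` fst (c i)}"

lemma slot_facts:
 assumes i: "i < N" and q: "q \<in> slot i"
 shows "point_at i q \<in> fst (c i)" "point_at i q \<in> Xs" "snd (c i) (point_at i q) = q - shift i"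
 using q ichart_in[of "q - shift i" "c i"] chart_ichart[of "q - shift i" "c i"] subsetD[OF chart_subset[OF cA[OF i]]]
 by (auto simp: slot_def point_at_def)

lemma code_slot: "x \<in> Xs ==> code x \<in> slot (piece x)"
 using piece(3) by (simp add: slot_def)

lemma code_point_at: "i < N ==> q \<in> slot i ==> piece (point_at i q) = i ==> code (point_at i q) = q"
 using slot_facts(3)[of i q] by (simp add: code_def)

lemma Q_piece_iff:
 assumes "i < N" shows "q \<in> Q & piece (decode q) = i \<longleftrightarrow> q \<in> slot i & piece (point_at i q) = i"
proof
 assume q: "q \<in> Q & piece (decode q) = i"
 have "code (decode q) \<in> slot (piece (decode q))" "point_at (piece (decode q)) (code (decode q)) = decode q"
  using code_slot point_at_code decode_in q by blast+
 thus "q \<in> slot i & piece (point_at i q) = i" using q code_decode[of q] by simp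
next
 assume q: "q \<in> slot i & piece (point_at i q) = i"
 hence e: "code (point_at i q) = q" by (intro code_point_at assms) auto
 thus "q \<in> Q & piece (decode q) = i" using q code_in[OF slot_facts(2)[OF assms]] decode_code[OF slot_facts(2)[OF assms]] by metis
qed

lemma decode_point_at: "i < N ==> q \<in> slot i ==> piece (point_at i q) = i ==> decode q = point_at i q"
 using code_point_at[of i q] decode_code[OF slot_facts(2)[of i q]] by metis

lemma filterlim_shift: "filterlim (%q. q - shift i) (nhds (q - shift i)) (nhds q)"
 by (intro tendsto_intros filterlim_ident)

lemma filterlim_point_at:
 assumes "i < N" "q \<in> slot i" shows "filterlim (point_at i) (nhdsin X (point_at i q)) (nhds q)"
proof -
 have "filterlim (ichart (c i)) (nhdsin X (point_at i q)) (nhds (q - shift i))"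
  using filterlim_ichart[OF cA[OF assms(1)] slot_facts(1)[OF assms]] unfolding slot_facts(3)[OF assms] .
 from filterlim_compose[OF this filterlim_shift] show ?thesis unfolding point_at_def .
qed

lemma eventually_slot:
 assumes "i < N" "q \<in> slot i" shows "\<forall>\<^sub>F q in nhds q. q \<in> slot i"
proof -
 have "open {q. q - shift i \<in> snd (c i) ` fst (c i)}" using open_vimage[OF chart_facts(2)[OF cA[OF assms(1)]], of "%q. q - shift i"]
  by (simp add: vimage_def continuous_intros)
 thus ?thesis using assms(2) unfolding slot_def by (rule eventually_nhds_in_open)
qed

definition transit :: "nat => 'm set => 'm set => (('m => 'm) \<times> 'e) set" where
 "transit i U U' = {(g, q). g \<in> Dr & q \<in> slot i & point_at i q \<in> U & g (point_at i q) \<in> U'}"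

lemma smooth_identity: "smooth_family r tau (%f. f)"
 by (rule continuous_map_imp_smooth_family) simp

lemma filterlim_transit:
 assumes i: "i < N" "q \<in> slot i" and g: "g \<in> Dr"
 shows "filterlim (%(s, q). s (point_at i q)) (nhdsin X (g (point_at i q))) (nhdsin tau g \<times>\<^sub>F nhds q)"
proof -
 have "smooth_family_at r tau (%f. f) g (point_at i q)" using smooth_identity g slot_facts(2)[OF i] by simp
 from smooth_family_at_lim(1)[OF this]
 have "filterlim (%(s, x). s x) (nhdsin X (g (point_at i q))) (nhdsin tau g \<times>\<^sub>F nhdsin X (point_at i q))" by simp
 from filterlim_chart_family[OF this filterlim_point_at[OF i]] show ?thesis by simp
qed

lemma eventually_transit:
 assumes i: "i < N" and U: "openin X U" "openin X U'" and gq: "(g, q) \<in> transit i U U'"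
 shows "\<forall>\<^sub>F p in nhdsin tau g \<times>\<^sub>F nhds q. p \<in> transit i U U'"
proof -
 have q: "q \<in> slot i" "point_at i q \<in> U" and g: "g \<in> Dr" "g (point_at i q) \<in> U'" using gq by (auto simp: transit_def)
 have 1: "\<forall>\<^sub>F p in nhdsin tau g \<times>\<^sub>F nhds q. (case p of (s, q) => s (point_at i q)) \<in> U'"
  using filterlim_transit[OF i q(1) g(1)] eventually_nhdsin_open[OF U(2) g(2)] unfolding filterlim_iff by blast
 have 2: "\<forall>\<^sub>F q in nhds q. q \<in> slot i & point_at i q \<in> U"
  using eventually_slot[OF i q(1)] filterlim_point_at[OF i q(1)] eventually_nhdsin_open[OF U(1) q(2)]
  unfolding filterlim_iff by (auto intro: eventually_conj)
 have 3: "\<forall>\<^sub>F s in nhdsin tau g. s \<in> Dr" using eventually_nhdsin_topspace[of tau g] by simp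
 show ?thesis using eventually_conj[OF 1 eventually_prodI[OF 3 2]] by eventually_elim (auto simp: transit_def)
qed

lemma transit_sets:
 assumes "i < N" "openin X U" "openin X U'" shows "transit i U U' \<in> sets (borel_of tau \<Otimes>\<^sub>M borel)"
proof (rule sets_pair_locally)
 fix g q assume gq: "(g, q) \<in> transit i U U'"
 thus "g \<in> topspace tau & (\<forall>\<^sub>F (s, y) in nhdsin tau g \<times>\<^sub>F nhds q. (s, y) \<in> transit i U U')"
  using eventually_transit[OF assms gq] by (auto simp: transit_def case_prod_unfold)
qed

definition local_pair :: "nat => nat => ('m => 'm) \<times> 'e => 'e \<times> real" where
 "local_pair i j = (%(g, q). (local_rep (c i) (c j) g (q - shift i) + shift j,
   \<bar>jdet (frechet_derivative (local_rep (c i) (c j) g) (at (q - shift i)))\<bar>))"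

lemma local_pair_sets:
 assumes i: "i < N" and j: "j < N" and B: "open B"
 shows "transit i (fst (c i)) (fst (c j)) Int local_pair i j -` B \<in> sets (borel_of tau \<Otimes>\<^sub>M borel)"
proof (rule sets_pair_locally)
 let ?W = "transit i (fst (c i)) (fst (c j))"
 fix g q assume gq: "(g, q) \<in> ?W Int local_pair i j -` B"
 hence q: "q \<in> slot i" and g: "g \<in> Dr" "g (point_at i q) \<in> fst (c j)" and W: "(g, q) \<in> ?W" by (auto simp: transit_def)
 have "smooth_family_at r tau (%f. f) g (point_at i q)" using smooth_identity g slot_facts(2)[OF i q] by simp
 from smooth_family_at_C[where h = "%f. f", OF this cA[OF i] cA[OF j] slot_facts(1)[OF i q] g(2), of "Suc 0"]
 have C: "C_family (Suc 0) (nhdsin tau g) g (%s. local_rep (c i) (c j) s) (q - shift i)" using r1 slot_facts(3)[OF i q] by (simp add: one_enat_def)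
 have F: "principal {g} <= nhdsin tau g" by (rule principal_le_nhdsin) (simp add: g)
 have l1: "((%(s, y). local_rep (c i) (c j) s y) \<longlongrightarrow> local_rep (c i) (c j) g (q - shift i)) (nhdsin tau g \<times>\<^sub>F nhds (q - shift i))"
  by (rule C_family_tendsto[OF C])
 note l2 = jdet_family_lim[OF F C]
 have l: "(local_pair i j \<longlongrightarrow> local_pair i j (g, q)) (nhdsin tau g \<times>\<^sub>F nhds q)"
  using filterlim_chart_family[OF l1 filterlim_shift] filterlim_chart_family[OF l2 filterlim_shift]
  unfolding local_pair_def case_prod_unfold by (intro tendsto_intros) auto
 have "\<forall>\<^sub>F p in nhdsin tau g \<times>\<^sub>F nhds q. local_pair i j p \<in> B" by (rule topological_tendstoD[OF l B]) (use gq in auto)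
 moreover have "\<forall>\<^sub>F p in nhdsin tau g \<times>\<^sub>F nhds q. p \<in> ?W"
  by (rule eventually_transit[OF i chart_facts(1)[OF cA[OF i]] chart_facts(1)[OF cA[OF j]] W])
 ultimately have "\<forall>\<^sub>F p in nhdsin tau g \<times>\<^sub>F nhds q. p \<in> ?W Int local_pair i j -` B" by eventually_elim simp
 thus "g \<in> topspace tau & (\<forall>\<^sub>F (s, y) in nhdsin tau g \<times>\<^sub>F nhds q. (s, y) \<in> ?W Int local_pair i j -` B)"
  using g(1) by (simp add: case_prod_unfold)
qed

definition dilation :: "('m => 'm) => 'm => real" where
 "dilation g x = \<bar>jac (c (piece x)) (c (piece (g x))) g x\<bar>"

definition move :: "('m => 'm) => 'e => 'e" where "move g q = code (g (decode q))"

text \<open>Constant outside \<open>Q\<close>, so that it is measurable on the whole product.\<close>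

definition move_pair :: "('m => 'm) \<times> 'e => 'e \<times> real" where
 "move_pair = (%(g, q). if q \<in> Q then (move g q, dilation g (decode q)) else (0, 1))"

text \<open>On these finitely many Borel pieces the action is given by fixed charts and is continuous.\<close>

definition cell_pair :: "nat => nat => (('m => 'm) \<times> 'e) set" where
 "cell_pair i j = {(g, q). g \<in> Dr & q \<in> Q & piece (decode q) = i & piece (g (decode q)) = j}"

lemma cell_pair_facts:
 assumes "i < N" "j < N" "(g, q) \<in> cell_pair i j"
 shows "q \<in> slot i" "decode q = point_at i q" "(g, q) \<in> transit i (fst (c i)) (fst (c j))" "move_pair (g, q) = local_pair i j (g, q)"
proof -
 have g: "g \<in> Dr" and q: "q \<in> Q" "piece (decode q) = i" "piece (g (decode q)) = j" using assms by (auto simp: cell_pair_def)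
 show s: "q \<in> slot i" and d: "decode q = point_at i q" using Q_piece_iff[OF assms(1), of q] q decode_point_at[OF assms(1)] by auto
 have gx: "g (decode q) \<in> Xs" using diffeo_in[OF g decode_in[OF q(1)]] .
 show "(g, q) \<in> transit i (fst (c i)) (fst (c j))" using slot_facts(1)[OF assms(1) s] piece(3)[OF gx] g s d q by (auto simp: transit_def)
 show "move_pair (g, q) = local_pair i j (g, q)" using q slot_facts(3)[OF assms(1) s] d
  by (simp add: move_pair_def local_pair_def move_def dilation_def jac_def code_def local_rep_def point_at_def)
qed

lemma cell_pair_sets:
 assumes i: "i < N" and j: "j < N" shows "cell_pair i j \<in> sets (borel_of tau \<Otimes>\<^sub>M borel)"
proof -
 have "cell_pair i j = transit i (V i) (V j) - ((\<Union>k<i. transit i (V k) (Xs)) Un (\<Union>k<j. transit i (Xs) (V k)))" (is "_ = ?R")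
 proof (rule Set.set_eqI, clarify)
  fix g q
  show "(g, q) \<in> cell_pair i j \<longleftrightarrow> (g, q) \<in> ?R"
  proof (cases "g \<in> Dr & q \<in> slot i")
   case True
   hence pt: "point_at i q \<in> Xs" "g (point_at i q) \<in> Xs" using slot_facts(2)[OF i] diffeo_in by blast+
   have "(g, q) \<in> cell_pair i j \<longleftrightarrow> piece (point_at i q) = i & piece (g (point_at i q)) = j"
    using Q_piece_iff[OF i, of q] decode_point_at[OF i, of q] True unfolding cell_pair_def by auto
   thus ?thesis using True pt unfolding piece_iff[OF pt(1) i] piece_iff[OF pt(2) j] transit_def by auto
  next
   case False
   thus ?thesis using cell_pair_facts(1)[OF i j] by (auto simp: transit_def cell_pair_def)
  qed
 qed
 thus ?thesis using i j openin_V by (auto intro!: sets.Diff sets.Un sets.finite_UN transit_sets)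
qed

lemma open_slot:
 assumes i: "i < N" and U: "openin X U" shows "open {q \<in> slot i. point_at i q \<in> U}"
proof (rule open_subopen[THEN iffD2], intro ballI)
 fix q assume "q \<in> {q \<in> slot i. point_at i q \<in> U}"
 hence q: "q \<in> slot i" "point_at i q \<in> U" by auto
 have "\<forall>\<^sub>F q in nhds q. q \<in> slot i & point_at i q \<in> U"
  using eventually_slot[OF i q(1)] filterlim_point_at[OF i q(1)] eventually_nhdsin_open[OF U q(2)]
  unfolding filterlim_iff by (auto intro: eventually_conj)
 thus "\<exists>T. open T & q \<in> T & T \<subseteq> {q \<in> slot i. point_at i q \<in> U}" unfolding eventually_nhds by blast
qed

lemma decode_sets:
 assumes U: "openin X U" shows "{q \<in> Q. decode q \<in> U} \<in> sets borel"
proof -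
 have "{q \<in> Q. decode q \<in> U} = (\<Union>i<N. {q \<in> slot i. point_at i q \<in> U Int V i} - (\<Union>k<i. {q \<in> slot i. point_at i q \<in> V k}))"
  (is "_ = (\<Union>i<N. ?P i)")
 proof -
  have P: "q \<in> ?P i \<longleftrightarrow> q \<in> Q & piece (decode q) = i & decode q \<in> U" if "i < N" for i q
  proof (cases "q \<in> slot i")
   case True
   have "q \<in> ?P i \<longleftrightarrow> piece (point_at i q) = i & point_at i q \<in> U"
    unfolding piece_iff[OF slot_facts(2)[OF that True] that] using True by auto
   thus ?thesis using Q_piece_iff[OF that, of q] decode_point_at[OF that True] True by auto
  next
   case False
   thus ?thesis using Q_piece_iff[OF that, of q] by auto
  qed
  show ?thesis
  proof (rule Set.set_eqI)
   fix q
   show "q \<in> {q \<in> Q. decode q \<in> U} \<longleftrightarrow> q \<in> (\<Union>i<N. ?P i)"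
    using P[of _ q] piece(1)[OF decode_in, of q] unfolding UN_iff by auto
  qed
 qed
 moreover have "?P i \<in> sets borel" if "i < N" for i
  by (intro sets.Diff sets.finite_UN borel_open open_slot openin_Int U openin_V that) (use that in auto)
 ultimately show ?thesis by (auto intro!: sets.finite_UN)
qed

lemma Q_borel: "Q \<in> sets borel"
proof -
 have "{q \<in> Q. decode q \<in> Xs} = Q" using decode_in by auto
 thus ?thesis using decode_sets[OF openin_topspace] by simp
qed

lemma move_pair_measurable: "move_pair \<in> measurable (borel_of tau \<Otimes>\<^sub>M borel) borel"
proof (rule borel_measurableI)
 let ?M = "borel_of tau \<Otimes>\<^sub>M (borel :: 'e measure)"
 fix B :: "('e \<times> real) set" assume B: "open B"
 have sp: "space ?M = Dr \<times> UNIV" by (simp add: space_pair_measure)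
 have "move_pair -` B Int space ?M = (\<Union>i<N. \<Union>j<N. cell_pair i j Int (transit i (fst (c i)) (fst (c j)) Int local_pair i j -` B)) Un
   (if (0, 1) \<in> B then Dr \<times> (- Q) else {})" (is "_ = ?R")
 proof (rule Set.set_eqI, clarify)
  fix g q
  show "(g, q) \<in> move_pair -` B Int space ?M \<longleftrightarrow> (g, q) \<in> ?R"
  proof (cases "g \<in> Dr & q \<in> Q")
   case True
   let ?i = "piece (decode q)" and ?j = "piece (g (decode q))"
   have x: "decode q \<in> Xs" "g (decode q) \<in> Xs" using True decode_in diffeo_in by blast+
   have ij: "?i < N" "?j < N" using piece(1) x by auto
   have in': "(g, q) \<in> cell_pair ?i ?j" using True by (simp add: cell_pair_def)
   have "(g, q) \<in> ?R \<longleftrightarrow> (g, q) \<in> transit ?i (fst (c ?i)) (fst (c ?j)) Int local_pair ?i ?j -` B"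
    using ij True by (auto simp: cell_pair_def)
   thus ?thesis using cell_pair_facts(3,4)[OF ij in'] True by (simp add: sp)
  next
   case False
   thus ?thesis by (auto simp: cell_pair_def sp move_pair_def)
  qed
 qed
 moreover have "Dr \<times> (- Q) \<in> sets ?M" using sets.top[of "borel_of tau"] Q_borel by (intro pair_measureI) auto
 ultimately show "move_pair -` B Int space ?M \<in> sets ?M" using cell_pair_sets local_pair_sets B by (auto intro!: sets.Un sets.finite_UN sets.Int)
qed

end

section \<open>The action on the model and its density cocycle\<close>

context model_manifold
begin

abbreviation \<open>\<G> \<equiv> Diff r X A\<close>

lemma dilation_mult:
 assumes g: "g \<in> Dr" and h: "h \<in> Dr" and x: "x \<in> Xs"
 shows "dilation (g \<otimes>\<^bsub>\<G>\<^esub> h) x = dilation g (h x) * dilation h x"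
proof -
 have hx: "h x \<in> Xs" and ghx: "g (h x) \<in> Xs" using diffeo_in g h x by blast+
 have e: "(g \<otimes>\<^bsub>\<G>\<^esub> h) y = g (h y)" if "y \<in> Xs" for y by (rule mult_Diff_apply[OF g h that])
 have "jac (c (piece x)) (c (piece (g (h x)))) (g \<otimes>\<^bsub>\<G>\<^esub> h) x = jac (c (piece x)) (c (piece (g (h x)))) (%x. g (h x)) x"
  by (rule jac_cong[OF piece_chart[OF x] piece(3)[OF x] e])
 also have "\<dots> = jac (c (piece (h x))) (c (piece (g (h x)))) g (h x) * jac (c (piece x)) (c (piece (h x))) h x"
  by (rule jac_chain[OF r1 diffeosD(3)[OF h] diffeosD(3)[OF g] piece_chart[OF x] piece(3)[OF x]
     piece_chart[OF hx] piece(3)[OF hx] piece_chart[OF ghx] piece(3)[OF ghx]])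
 finally show ?thesis by (simp add: dilation_def e[OF x] abs_mult)
qed

lemma dilation_one: "x \<in> Xs ==> dilation \<one>\<^bsub>\<G>\<^esub> x = 1"
 using jac_cong[OF piece_chart[of x] piece(3)[of x], of "\<one>\<^bsub>\<G>\<^esub>" "%x. x"] jac_ident[OF piece_chart[of x] piece(3)[of x]]
 by (simp add: dilation_def)

lemma dilation_pos: "g \<in> Dr ==> x \<in> Xs ==> 0 < dilation g x"
 using jac_nonzero[OF r1 _ piece_chart piece(3) piece_chart piece(3), of g x] diffeo_in[of g r x] by (simp add: dilation_def)

text \<open>The closed coordinate balls with radii scaled by \<open>s\<close>; those with \<open>s = 1\<close> contain the pieces.\<close>

definition disc :: "nat => real => 'm set" where "disc i s = ichart (c i) ` cball (a i) (s * R i)"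

lemma disc:
 assumes i: "i < N" and s: "s <= 2"
 shows "disc i s \<subseteq> fst (c i)" "x \<in> disc i s \<longleftrightarrow> x \<in> fst (c i) & snd (c i) x \<in> cball (a i) (s * R i)"
  "compactin X (disc i s)" "closedin X (disc i s)"
proof -
 have "s * R i <= 2 * R i" using s R(1)[OF i] by simp
 hence sub: "cball (a i) (s * R i) \<subseteq> snd (c i) ` fst (c i)" using cball_chart[OF i] subset_cball by blast
 show c1: "disc i s \<subseteq> fst (c i)" unfolding disc_def using sub ichart_in by blast
 show "x \<in> disc i s \<longleftrightarrow> x \<in> fst (c i) & snd (c i) x \<in> cball (a i) (s * R i)"
 proof
  assume x: "x \<in> disc i s"
  then obtain y where y: "y \<in> cball (a i) (s * R i)" "x = ichart (c i) y" unfolding disc_def by (elim imageE)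
  thus "x \<in> fst (c i) & snd (c i) x \<in> cball (a i) (s * R i)" using subsetD[OF c1 x] chart_ichart[OF subsetD[OF sub y(1)]] by simp
 next
  assume "x \<in> fst (c i) & snd (c i) x \<in> cball (a i) (s * R i)"
  thus "x \<in> disc i s" unfolding disc_def using chart_inverse[OF cA[OF i]] by (metis image_eqI)
 qed
 show "compactin X (disc i s)" unfolding disc_def by (rule compactin_ichart[OF cA[OF i] compact_cball sub])
 thus "closedin X (disc i s)" by (rule compactin_imp_closedin[OF Hausdorff])
qed

lemma piece_closed: "x \<in> Xs ==> x \<in> disc (piece x) 1"
 using piece[of x] disc(2)[OF piece(1), of x 1 x] by (auto simp: V_def)

text \<open>The pieces are not compact, but between the closed balls containing them the Jacobian is continuous.\<close>

lemma dilation_bounds: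
 assumes g: "g \<in> Dr"
 obtains k :: nat where "!!x. x \<in> Xs ==> 1 / real (Suc k) <= dilation g x & dilation g x <= real (Suc k)"
proof -
 have gc: "continuous_map X X g" using diffeosD(3)[OF g] by (simp add: C_map_def)
 have "\<exists>k::nat. \<forall>x. x \<in> disc i 1 & g x \<in> disc j 1 -->
   1 / real (Suc k) <= \<bar>jac (c i) (c j) g x\<bar> & \<bar>jac (c i) (c j) g x\<bar> <= real (Suc k)" if i: "i < N" and j: "j < N" for i j
 proof -
  note Di = disc[OF i, of 1, simplified] and Dj = disc[OF j, of 1, simplified]
  define K where "K = disc i 1 Int {x \<in> Xs. g x \<in> disc j 1}"
  have "closedin X {x \<in> Xs. g x \<in> disc j 1}" by (rule closedin_continuous_map_preimage[OF gc Dj(4)])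
  hence "compactin X K" unfolding K_def using Di(3) by (rule compact_Int_closedin[rotated])
  moreover have Ki: "K \<subseteq> fst (c i)" using Di(1) by (auto simp: K_def)
  ultimately have "compactin (subtopology X (fst (c i))) K" by (simp add: compactin_subtopology)
  from image_compactin[OF this chart_facts(4)[OF cA[OF i]]] have L: "compact (snd (c i) ` K)" by simp
  define F where "F = (%y. \<bar>jdet (frechet_derivative (local_rep (c i) (c j) g) (at y))\<bar>)"
  have Fx: "F (snd (c i) x) = \<bar>jac (c i) (c j) g x\<bar>" for x by (simp add: F_def jac_def)
  have pos: "0 < F y" if "y \<in> snd (c i) ` K" for y
  proof -
   from that obtain x where x: "x \<in> K" "y = snd (c i) x" by blast
   hence "x \<in> fst (c i)" "g x \<in> fst (c j)" using Ki Dj(1) by (auto simp: K_def)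
   thus ?thesis using jac_nonzero[OF r1 g cA[OF i] _ cA[OF j]] by (simp add: x(2) Fx)
  qed
  have "continuous_on (snd (c i) ` K) F"
  proof (intro continuous_at_imp_continuous_on ballI)
   fix y assume "y \<in> snd (c i) ` K"
   then obtain x where x: "x \<in> K" "y = snd (c i) x" by blast
   hence x': "x \<in> fst (c i)" "g x \<in> fst (c j)" using Ki Dj(1) by (auto simp: K_def)
   have "C_germ (Suc 0) (local_rep (c i) (c j) g) y"
    unfolding x(2) using r1 by (intro C_map_germ[OF diffeosD(3)[OF g] cA[OF i] cA[OF j] x']) (simp add: one_enat_def)
   from jdet_family_lim[OF order_refl this]
   have "((%y. jdet (frechet_derivative (local_rep (c i) (c j) g) (at y))) \<longlongrightarrow>
     jdet (frechet_derivative (local_rep (c i) (c j) g) (at y))) (nhds y)" unfolding tendsto_unit_times .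
   hence "(F \<longlongrightarrow> F y) (nhds y)" unfolding F_def by (rule tendsto_rabs)
   thus "isCont F y" unfolding isCont_def by (rule filterlim_mono) (simp_all add: at_within_def)
  qed
  moreover have "\<forall>y\<in>snd (c i) ` K. F y ~= 0" using pos by (metis less_irrefl)
  ultimately have comp: "compact (F ` snd (c i) ` K)" and comp': "compact ((%y. inverse (F y)) ` snd (c i) ` K)"
   by (intro compact_continuous_image L continuous_on_inverse, simp_all)+
  obtain B1 where "\<forall>z\<in>F ` snd (c i) ` K. \<bar>z\<bar> <= B1" using compact_imp_bounded[OF comp] unfolding bounded_real by blast
  hence B1: "F y <= B1" if "y \<in> snd (c i) ` K" for y using that by (meson abs_le_D1 imageI)
  obtain B2 where "\<forall>z\<in>(%y. inverse (F y)) ` snd (c i) ` K. \<bar>z\<bar> <= B2" using compact_imp_bounded[OF comp'] unfolding bounded_real by blast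
  hence B2: "inverse (F y) <= B2" if "y \<in> snd (c i) ` K" for y using that by (meson abs_le_D1 imageI)
  obtain k :: nat where k: "B1 <= real k" "B2 <= real k" using real_arch_simple[of "max B1 B2"] by auto
  have "1 / real (Suc k) <= F y & F y <= real (Suc k)" if y: "y \<in> snd (c i) ` K" for y
  proof
   have "inverse (F y) <= real (Suc k)" using B2[OF y] k by simp
   hence "inverse (real (Suc k)) <= inverse (inverse (F y))" using pos[OF y] by (intro le_imp_inverse_le) auto
   thus "1 / real (Suc k) <= F y" by (simp add: inverse_eq_divide)
   show "F y <= real (Suc k)" using B1[OF y] k by simp
  qed
  hence "1 / real (Suc k) <= \<bar>jac (c i) (c j) g x\<bar> & \<bar>jac (c i) (c j) g x\<bar> <= real (Suc k)"
   if "x \<in> disc i 1" "g x \<in> disc j 1" for x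
   using that subsetD[OF chart_subset[OF cA[OF i]]] subsetD[OF Di(1)] unfolding Fx[symmetric] K_def by auto
  thus ?thesis by blast
 qed
 then obtain kap where kap: "!!i j x. i < N ==> j < N ==> x \<in> disc i 1 ==> g x \<in> disc j 1 ==>
   1 / real (Suc (kap i j)) <= \<bar>jac (c i) (c j) g x\<bar> & \<bar>jac (c i) (c j) g x\<bar> <= real (Suc (kap i j))" by metis
 \<comment> \<open>a common bound for all pairs of pieces\<close>
 define k where "k = (\<Sum>i<N. \<Sum>j<N. kap i j)"
 have k: "kap i j <= k" if "i < N" "j < N" for i j
 proof -
  have "kap i j <= (\<Sum>j<N. kap i j)" using that by (intro member_le_sum) auto
  also have "\<dots> <= k" unfolding k_def using that by (intro member_le_sum[where f = "%i. \<Sum>j<N. kap i j"]) auto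
  finally show ?thesis .
 qed
 show ?thesis
 proof (rule that[of k])
  fix x assume x: "x \<in> Xs"
  hence gx: "g x \<in> Xs" using diffeo_in[OF g] by blast
  note ij = piece(1)[OF x] piece(1)[OF gx]
  have "1 / real (Suc k) <= 1 / real (Suc (kap (piece x) (piece (g x))))" using k[OF ij] by (intro divide_left_mono) auto
  moreover have "real (Suc (kap (piece x) (piece (g x)))) <= real (Suc k)" using k[OF ij] by simp
  ultimately show "1 / real (Suc k) <= dilation g x & dilation g x <= real (Suc k)"
   using kap[OF ij piece_closed[OF x] piece_closed[OF gx]] unfolding dilation_def by linarith
 qed
qed

lemma
 assumes g: "g \<in> Dr" and q: "q \<in> Q"
 shows move_in: "move g q \<in> Q" and decode_move: "decode (move g q) = g (decode q)"
 using diffeo_in[OF g decode_in[OF q]] by (simp_all add: move_def code_in)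

lemma move_mult:
 assumes "g \<in> Dr" "h \<in> Dr" "q \<in> Q" shows "move g (move h q) = move (g \<otimes>\<^bsub>\<G>\<^esub> h) q"
 using decode_move[OF assms(2,3)] mult_Diff_apply[OF assms(1,2) decode_in[OF assms(3)]] by (simp add: move_def)

lemma move_one: "q \<in> Q ==> move \<one>\<^bsub>\<G>\<^esub> q = q"
 using decode_in[of q] code_decode[of q] by (simp add: move_def)

lemma move_inverse:
 assumes "g \<in> Dr" "q \<in> Q"
 shows "move (inv\<^bsub>\<G>\<^esub> g) (move g q) = q" "move g (move (inv\<^bsub>\<G>\<^esub> g) q) = q" "inv\<^bsub>\<G>\<^esub> g \<in> Dr"
proof -
 interpret G: group \<G> by (rule group_Diff)
 show i: "inv\<^bsub>\<G>\<^esub> g \<in> Dr" using G.inv_closed[of g] assms by simp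
 show "move (inv\<^bsub>\<G>\<^esub> g) (move g q) = q" using move_mult[OF i assms(1,2)] move_one[OF assms(2)] G.l_inv[of g] assms(1) by (simp del: one_Diff)
 show "move g (move (inv\<^bsub>\<G>\<^esub> g) q) = q" using move_mult[OF assms(1) i assms(2)] move_one[OF assms(2)] G.r_inv[of g] assms(1) by (simp del: one_Diff)
qed

lemma move_pair_section:
 assumes g: "g \<in> Dr" shows "(%q. move_pair (g, q)) \<in> borel_measurable borel"
 using measurable_compose[OF measurable_Pair1'[of g "borel_of tau" borel] move_pair_measurable] g by simp

lemma move_sets:
 assumes g: "g \<in> Dr" and B: "B \<in> sets borel" shows "{q \<in> Q. move g q \<in> B} \<in> sets borel"
proof -
 have "(%q. fst (move_pair (g, q))) \<in> borel_measurable borel"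
  using move_pair_section[OF g] by (intro measurable_compose[OF _ borel_measurable_continuous_onI[of fst]] continuous_intros)
 from measurable_sets[OF this B] have "Q Int (%q. fst (move_pair (g, q))) -` B \<in> sets borel" using Q_borel by (intro sets.Int) auto
 moreover have "Q Int (%q. fst (move_pair (g, q))) -` B = {q \<in> Q. move g q \<in> B}" by (auto simp: move_pair_def)
 ultimately show ?thesis by simp
qed

lemma weight_measurable:
 assumes g: "g \<in> Dr" and S: "S \<in> sets borel" "S \<subseteq> Q"
 shows "(%q. indicat_real S q * dilation g (decode q)) \<in> borel_measurable borel"
proof -
 have m: "(%q. snd (move_pair (g, q))) \<in> borel_measurable borel"
  using move_pair_section[OF g] by (intro measurable_compose[OF _ borel_measurable_continuous_onI[of snd]] continuous_intros)
 have "(%q. indicat_real S q * snd (move_pair (g, q))) \<in> borel_measurable borel"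
  using S(1) by (intro borel_measurable_times m borel_measurable_indicator) auto
 moreover have "(%q. indicat_real S q * snd (move_pair (g, q))) = (%q. indicat_real S q * dilation g (decode q))"
  using S(2) by (auto simp: fun_eq_iff indicator_def move_pair_def)
 ultimately show ?thesis by simp
qed

lemma Q_finite: "leb Q < \<infinity>"
proof -
 let ?b = "SOME b :: 'e. b \<in> Basis"
 have "Q \<subseteq> (\<Union>i<N. ball ((3 * real i) *\<^sub>R ?b) 1)"
 proof
  fix q assume "q \<in> Q"
  then obtain x where x: "x \<in> Xs" "q = code x" unfolding Q_def by blast
  show "q \<in> (\<Union>i<N. ball ((3 * real i) *\<^sub>R ?b) 1)"
   using code_ball[OF x(1)] piece(1)[OF x(1)] by (intro UN_I[of "piece x"]) (auto simp: x(2) dist_commute)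
 qed
 hence "bounded Q" by (rule bounded_subset[rotated]) auto
 thus ?thesis by (rule emeasure_bounded_finite)
qed

lemma image_move:
 assumes g: "g \<in> Dr" and S: "S \<subseteq> Q" shows "move g ` S = {q \<in> Q. move (inv\<^bsub>\<G>\<^esub> g) q \<in> S}"
proof
 show "move g ` S \<subseteq> {q \<in> Q. move (inv\<^bsub>\<G>\<^esub> g) q \<in> S}"
 proof (rule image_subsetI)
  fix q assume "q \<in> S"
  thus "move g q \<in> {q \<in> Q. move (inv\<^bsub>\<G>\<^esub> g) q \<in> S}" using move_in[OF g] move_inverse(1)[OF g] subsetD[OF S] by simp
 qed
 show "{q \<in> Q. move (inv\<^bsub>\<G>\<^esub> g) q \<in> S} \<subseteq> move g ` S"
 proof
  fix q assume "q \<in> {q \<in> Q. move (inv\<^bsub>\<G>\<^esub> g) q \<in> S}"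
  thus "q \<in> move g ` S" using move_inverse(2)[OF g, of q] by (intro image_eqI[of q _ "move (inv\<^bsub>\<G>\<^esub> g) q"]) auto
 qed
qed

lemma inj_move:
 assumes g: "g \<in> Dr" shows "inj_on (move g) Q"
 by (rule inj_on_inverseI[where g = "move (inv\<^bsub>\<G>\<^esub> g)"]) (rule move_inverse(1)[OF g])

lemma move_image_sets:
 assumes g: "g \<in> Dr" and S: "S \<in> sets borel" "S \<subseteq> Q" shows "move g ` S \<in> sets borel"
 unfolding image_move[OF g S(2)] by (rule move_sets[OF _ S(1)]) (use move_inverse(3)[OF g] Q_borel nonempty code_in in blast)

text \<open>Change of variables on each of the finitely many parts on which source and target piece are constant.\<close>

lemma emeasure_move_image:
 assumes g: "g \<in> Dr" and S: "S \<in> sets borel" "S \<subseteq> Q"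
 shows "leb (move g ` S) = (\<integral>\<^sup>+q. ennreal (indicat_real S q * dilation g (decode q)) \<partial>lborel)"
proof -
 define I where "I = {..<N} \<times> {..<N}"
 define P where "P = (%(i, j). S Int {q. (g, q) \<in> cell_pair i j})"
 have fin: "finite I" by (simp add: I_def)
 have P_sets: "P p \<in> sets borel" if pI: "p \<in> I" for p
 proof -
  obtain i j where p: "p = (i, j)" "i < N" "j < N" using pI unfolding I_def by (elim SigmaE) simp
  have "Pair g -` cell_pair i j \<in> sets (borel :: 'e measure)" by (rule sets_Pair1[OF cell_pair_sets[OF p(2,3)]])
  thus ?thesis using S(1) by (auto simp: P_def p(1) vimage_def)
 qed
 have P_Q: "P p \<subseteq> Q" for p using S(2) by (auto simp: P_def split: prod.splits)
 have P_UN: "(\<Union>p\<in>I. P p) = S"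
 proof
  show "S \<subseteq> (\<Union>p\<in>I. P p)"
  proof
   fix q assume q: "q \<in> S"
   hence "q \<in> Q" using S(2) by blast
   thus "q \<in> (\<Union>p\<in>I. P p)" using q g piece(1)[OF decode_in] piece(1)[OF diffeo_in[OF g decode_in]]
    by (intro UN_I[of "(piece (decode q), piece (g (decode q)))"]) (auto simp: I_def P_def cell_pair_def)
  qed
 qed (auto simp: P_def)
 have P_disj: "disjoint_family_on P I" by (auto simp: disjoint_family_on_def P_def cell_pair_def)
 obtain k where k: "!!x. x \<in> Xs ==> 1 / real (Suc k) <= dilation g x & dilation g x <= real (Suc k)" using dilation_bounds[OF g] by blast
 have main: "leb (move g ` P p) = (\<integral>\<^sup>+q. ennreal (indicat_real (P p) q * dilation g (decode q)) \<partial>lborel)"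
  if pI: "p \<in> I" for p
 proof -
  obtain i j where p: "p = (i, j)" "i < N" "j < N" using pI unfolding I_def by (elim SigmaE) simp
  define f where "f = (%q. local_rep (c i) (c j) g (q - shift i) + shift j)"
  define f' where "f' = (%q. frechet_derivative (local_rep (c i) (c j) g) (at (q - shift i)))"
  have inP: "q \<in> Q" "move g q = f q" "dilation g (decode q) = \<bar>jdet (f' q)\<bar>" "(f has_derivative f' q) (at q)" if q: "q \<in> P p" for q
  proof -
   show qQ: "q \<in> Q" using P_Q q by blast
   have cp: "(g, q) \<in> cell_pair i j" using q by (simp add: P_def p)
   note cf = cell_pair_facts[OF p(2,3) cp]
   show "move g q = f q" "dilation g (decode q) = \<bar>jdet (f' q)\<bar>" using cf(4) qQ by (auto simp: move_pair_def local_pair_def f_def f'_def)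
   have "point_at i q \<in> fst (c i)" "g (point_at i q) \<in> fst (c j)" using cf(3) by (auto simp: transit_def)
   from local_rep_differentiable[OF r1 diffeosD(3)[OF g] cA[OF p(2)] cA[OF p(3)] this]
   have "(local_rep (c i) (c j) g has_derivative f' q) (at (q - shift i))"
    unfolding slot_facts(3)[OF p(2) cf(1)] f'_def by (simp add: frechet_derivative_works)
   from has_derivative_add_const[OF has_derivative_compose[OF has_derivative_diff[OF has_derivative_ident has_derivative_const] this]]
   show "(f has_derivative f' q) (at q)" by (simp add: f_def)
  qed
  have im: "move g ` P p = f ` P p" by (rule image_cong) (auto simp: inP)
  have eq: "indicat_real (P p) q * \<bar>jdet (f' q)\<bar> = indicat_real (P p) q * dilation g (decode q)" for q by (simp add: indicator_def inP(3))
  have "leb (f ` P p) = (\<integral>\<^sup>+q. ennreal (indicat_real (P p) q * \<bar>jdet (f' q)\<bar>) \<partial>lborel)"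
  proof (rule emeasure_jacobian_image[OF P_sets[OF that]])
   show "leb (P p) < \<infinity>" by (rule le_less_trans[OF emeasure_mono[OF P_Q] Q_finite]) (simp add: Q_borel)
   show "f ` P p \<in> sets borel" unfolding im[symmetric] by (rule move_image_sets[OF g P_sets[OF that] P_Q])
   show "inj_on f (P p)" using inj_on_subset[OF inj_move[OF g] P_Q, of p] inj_on_cong[of "P p" "move g" f] inP(2) by blast
   show "(%q. indicat_real (P p) q * \<bar>jdet (f' q)\<bar>) \<in> borel_measurable borel"
    unfolding eq by (rule weight_measurable[OF g P_sets[OF that] P_Q])
   show "\<bar>jdet (f' q)\<bar> <= real (Suc k)" if "q \<in> P p" for q using k[OF decode_in[OF inP(1)[OF that]]] inP(3)[OF that] by simp
  qed (rule inP(4))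
  thus ?thesis unfolding im eq .
 qed
 have "leb (move g ` S) = leb (\<Union>p\<in>I. move g ` P p)" by (simp add: P_UN[symmetric] image_UN)
 also have "\<dots> = (\<Sum>p\<in>I. leb (move g ` P p))"
 proof (rule sum_emeasure[symmetric, OF _ _ fin])
  show "(%p. move g ` P p) ` I \<subseteq> sets lborel" using move_image_sets[OF g P_sets P_Q] by auto
  have "move g ` P p Int move g ` P p' = {}" if "p \<in> I" "p' \<in> I" "p ~= p'" for p p'
   using inj_on_image_Int[OF inj_move[OF g] P_Q P_Q, of p p'] P_disj that by (auto simp: disjoint_family_on_def)
  thus "disjoint_family_on (%p. move g ` P p) I" by (auto simp: disjoint_family_on_def)
 qed
 also have "\<dots> = (\<Sum>p\<in>I. \<integral>\<^sup>+q. ennreal (indicat_real (P p) q * dilation g (decode q)) \<partial>lborel)"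
  by (rule sum.cong[OF refl main])
 also have "\<dots> = (\<integral>\<^sup>+q. (\<Sum>p\<in>I. ennreal (indicat_real (P p) q * dilation g (decode q))) \<partial>lborel)"
  using weight_measurable[OF g P_sets P_Q] by (intro nn_integral_sum[symmetric]) simp
 also have "\<dots> = (\<integral>\<^sup>+q. ennreal (indicat_real S q * dilation g (decode q)) \<partial>lborel)"
 proof (rule nn_integral_cong)
  fix q
  have "0 <= dilation g (decode q)" by (simp add: dilation_def)
  hence "(\<Sum>p\<in>I. ennreal (indicat_real (P p) q * dilation g (decode q))) =
    ennreal ((\<Sum>p\<in>I. indicat_real (P p) q) * dilation g (decode q))" unfolding sum_distrib_right by (subst sum_ennreal) auto
  also have "(\<Sum>p\<in>I. indicat_real (P p) q) = indicat_real S q"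
   unfolding P_UN[symmetric] by (rule indicator_UN_disjoint[OF fin P_disj, symmetric])
  finally show "(\<Sum>p\<in>I. ennreal (indicat_real (P p) q * dilation g (decode q))) =
    ennreal (indicat_real S q * dilation g (decode q))" .
 qed
 finally show ?thesis .
qed

lemma nn_integral_move:
 assumes g: "g \<in> Dr" and f: "f \<in> borel_measurable borel"
 shows "(\<integral>\<^sup>+q. ennreal (indicat_real Q q * dilation g (decode q)) * f (move g q) \<partial>lborel) = (\<integral>\<^sup>+q. indicator Q q * f q \<partial>lborel)"
proof -
 define w where "w = (%q. ennreal (indicat_real Q q * dilation g (decode q)))"
 define T where "T = (%q. fst (move_pair (g, q)))"
 have w: "w \<in> borel_measurable lborel" unfolding w_def using weight_measurable[OF g Q_borel] by simp
 have T: "T \<in> borel_measurable borel" unfolding T_def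
  using move_pair_section[OF g] by (intro measurable_compose[OF _ borel_measurable_continuous_onI[of fst]] continuous_intros)
 have TQ: "T q = move g q" if "q \<in> Q" for q using that by (simp add: T_def move_pair_def)
 have "distr (density lborel w) borel T = density lborel (indicator Q)"
 proof (rule measure_eqI)
  fix B assume "B \<in> sets (distr (density lborel w) borel T)"
  hence B: "B \<in> sets borel" by simp
  let ?S = "{q \<in> Q. move g q \<in> B}"
  have S: "?S \<in> sets borel" "?S \<subseteq> Q" using move_sets[OF g B] by auto
  have "emeasure (distr (density lborel w) borel T) B = emeasure (density lborel w) (T -` B)" using B T by (subst emeasure_distr) auto
  also have "\<dots> = (\<integral>\<^sup>+q. w q * indicator (T -` B) q \<partial>lborel)"
   using w measurable_sets[OF T B] by (intro emeasure_density) auto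
  also have "\<dots> = (\<integral>\<^sup>+q. ennreal (indicat_real ?S q * dilation g (decode q)) \<partial>lborel)"
   by (intro nn_integral_cong) (auto simp: w_def indicator_def TQ)
  also have "\<dots> = leb (move g ` ?S)" by (rule emeasure_move_image[OF g S, symmetric])
  also have "move g ` ?S = Q Int B"
  proof
   show "move g ` ?S \<subseteq> Q Int B" using move_in[OF g] by auto
   show "Q Int B \<subseteq> move g ` ?S"
   proof
    fix q assume q: "q \<in> Q Int B"
    thus "q \<in> move g ` ?S" using move_inverse(2,3)[OF g, of q] move_in[OF move_inverse(3)[OF g, of q], of q]
     by (intro image_eqI[of q _ "move (inv\<^bsub>\<G>\<^esub> g) q"]) auto
   qed
  qed
  also have "leb (Q Int B) = emeasure (density lborel (indicator Q)) B"
   using B Q_borel by (subst emeasure_density) (auto simp: indicator_inter_arith[symmetric])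
  finally show "emeasure (distr (density lborel w) borel T) B = emeasure (density lborel (indicator Q)) B" .
 qed simp
 hence "(\<integral>\<^sup>+q. f q \<partial>distr (density lborel w) borel T) = (\<integral>\<^sup>+q. f q \<partial>density lborel (indicator Q))" by simp
 moreover have "(\<integral>\<^sup>+q. f q \<partial>distr (density lborel w) borel T) = (\<integral>\<^sup>+q. w q * f (T q) \<partial>lborel)"
  using T f w measurable_compose[OF T f] by (subst nn_integral_distr) (auto intro!: nn_integral_density)
 moreover have "(\<integral>\<^sup>+q. w q * f (T q) \<partial>lborel) = (\<integral>\<^sup>+q. w q * f (move g q) \<partial>lborel)"
  by (intro nn_integral_cong) (auto simp: w_def indicator_def TQ)
 moreover have "(\<integral>\<^sup>+q. f q \<partial>density lborel (indicator Q)) = (\<integral>\<^sup>+q. indicator Q q * f q \<partial>lborel)"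
  using f Q_borel by (intro nn_integral_density) auto
 ultimately show ?thesis unfolding w_def by metis
qed

end

section \<open>Squeezing almost all of the manifold\<close>

context model_manifold
begin

definition lift :: "'m set => 'e set" where "lift S = {q \<in> Q. decode q \<in> S}"

lemma lift_Q: "lift S \<subseteq> Q"
 by (auto simp: lift_def)

lemma lift_closed: "closedin X S ==> lift S \<in> sets borel"
proof -
 assume S: "closedin X S"
 have "lift S = Q - {q \<in> Q. decode q \<in> Xs - S}" using decode_in by (auto simp: lift_def)
 thus ?thesis using Q_borel decode_sets[of "Xs - S"] S by (simp add: closedin_def)
qed

lemma finite_in_Q: "S \<subseteq> Q ==> leb S ~= \<infinity>"
 using le_less_trans[OF emeasure_mono[of S Q lborel] Q_finite] Q_borel by auto

lemma small_in_decseq: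
 assumes S: "!!k. S k \<in> sets borel" "!!k. S k \<subseteq> Q" "decseq S" and z: "leb (\<Inter>k. S k) = 0" and eps: "0 < eps"
 shows "\<exists>k. leb (S k) < ennreal eps"
proof -
 have "(%k. leb (S k)) \<longlonglongrightarrow> leb (\<Inter>k. S k)" by (rule Lim_emeasure_decseq) (use S finite_in_Q in auto)
 hence "\<forall>\<^sub>F k in sequentially. leb (S k) < ennreal eps" unfolding z by (rule order_tendstoD) (simp add: eps)
 thus ?thesis by (rule eventually_happens'[OF sequentially_bot])
qed

lemma le_from_shrinking:
 fixes d :: real
 assumes "0 < rho" "!!k. d <= (s + 1 / real (Suc k)) * rho" shows "d <= s * rho"
proof (rule LIMSEQ_le_const)
 show "(%k. (s + 1 / real (Suc k)) * rho) \<longlonglongrightarrow> s * rho"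
  using tendsto_mult[OF tendsto_add[OF tendsto_const[of s] lim_1_over_n[THEN LIMSEQ_Suc]] tendsto_const[of rho]] by simp
 show "\<exists>N. \<forall>n\<ge>N. d <= (s + 1 / real (Suc n)) * rho" using assms(2) by blast
qed

lemma lift_piece:
 assumes "i < N" "s <= 2"
 shows "q \<in> lift (disc i s) \<longleftrightarrow> q \<in> Q & decode q \<in> fst (c i) & dist (a i) (snd (c i) (decode q)) <= s * R i"
 by (simp add: lift_def disc(2)[OF assms])

text \<open>The annuli decrease to the empty set.\<close>

lemma thin_annulus:
 assumes i: "i < N" and eps: "0 < eps"
 obtains s where "1 < s" "s <= 2" "leb (lift (disc i s) - lift (disc i 1)) < ennreal eps"
proof -
 define s where "s = (%k. 1 + 1 / real (Suc k))"
 let ?S = "%k. lift (disc i (s k)) - lift (disc i 1)"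
 have s: "1 < s k" "s k <= 2" for k by (auto simp: s_def field_simps)
 note l1 = lift_piece[OF i, of 1, simplified] and ls = lift_piece[OF i s(2)]
 have "\<exists>k. leb (?S k) < ennreal eps"
 proof (rule small_in_decseq[OF _ _ _ _ eps])
  show "?S k \<in> sets borel" for k using lift_closed disc(4)[OF i s(2)] disc(4)[OF i, of 1] by auto
  show "?S k \<subseteq> Q" for k using lift_Q by blast
  show "decseq ?S"
  proof (rule decseq_SucI)
   fix k
   have "s (Suc k) * R i <= s k * R i" using R(1)[OF i] unfolding s_def by (intro mult_right_mono add_left_mono divide_left_mono) auto
   thus "?S (Suc k) \<subseteq> ?S k" by (auto simp: ls l1)
  qed
  have "(\<Inter>k. ?S k) = {}"
  proof (rule ccontr)
   assume "(\<Inter>k. ?S k) ~= {}"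
   then obtain q where q: "!!k. q \<in> ?S k" by blast
   have "dist (a i) (snd (c i) (decode q)) <= s k * R i" for k using q[of k] by (simp add: ls)
   from le_from_shrinking[OF R(1)[OF i] this[unfolded s_def]] show False using q[of 0] by (auto simp: ls l1)
  qed
  thus "leb (\<Inter>k. ?S k) = 0" by (simp only: emeasure_empty)
 qed
 thus ?thesis using that s by blast
qed

text \<open>The balls shrink to a point, and \<open>move g\<close> maps points to points.\<close>

lemma tiny_ball:
 assumes i: "i < N" and g: "g \<in> Dr" and eps: "0 < eps"
 obtains s where "0 < s" "s <= 1" "leb (move g ` lift (disc i s)) < ennreal eps"
proof -
 define s where "s = (%k. 0 + 1 / real (Suc k))"
 let ?S = "%k. move g ` lift (disc i (s k))"
 have s: "0 < s k" "s k <= 1" "s k <= 2" for k by (auto simp: s_def field_simps)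
 note ls = lift_piece[OF i s(3)]
 have "\<exists>k. leb (?S k) < ennreal eps"
 proof (rule small_in_decseq[OF _ _ _ _ eps])
  show "?S k \<in> sets borel" for k by (rule move_image_sets[OF g lift_closed[OF disc(4)[OF i s(3)]] lift_Q])
  show "?S k \<subseteq> Q" for k using lift_Q move_in[OF g] by blast
  show "decseq ?S"
  proof (rule decseq_SucI)
   fix k
   have "s (Suc k) * R i <= s k * R i" using R(1)[OF i] unfolding s_def by (intro mult_right_mono add_left_mono divide_left_mono) auto
   thus "?S (Suc k) \<subseteq> ?S k" by (intro image_mono) (auto simp: ls)
  qed
  have "(\<Inter>k. ?S k) \<subseteq> {move g (code (ichart (c i) (a i)))}"
  proof
   fix y assume y: "y \<in> (\<Inter>k. ?S k)"
   then obtain q where q: "q \<in> lift (disc i (s 0))" "y = move g q" by blast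
   have qk: "q \<in> lift (disc i (s k))" for k
   proof -
    from y obtain q' where q': "q' \<in> lift (disc i (s k))" "y = move g q'" by blast
    have "q = q'" by (rule inj_onD[OF inj_move[OF g]]) (use q q' lift_Q in auto)
    thus ?thesis using q' by simp
   qed
   have "dist (a i) (snd (c i) (decode q)) <= s k * R i" for k using qk[of k] by (simp add: ls)
   from le_from_shrinking[OF R(1)[OF i] this[unfolded s_def]] have "snd (c i) (decode q) = a i" by simp
   moreover have "decode q \<in> fst (c i)" using qk[of 0] by (simp add: ls)
   ultimately have "decode q = ichart (c i) (a i)" using chart_inverse[OF cA[OF i]] by metis
   thus "y \<in> {move g (code (ichart (c i) (a i)))}" using q code_decode[of q] by (simp add: lift_def)
  qed
  hence "leb (\<Inter>k. ?S k) <= leb {move g (code (ichart (c i) (a i)))}" by (intro emeasure_mono) auto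
  thus "leb (\<Inter>k. ?S k) = 0" by simp
 qed
 thus ?thesis using that s by blast
qed

text \<open>Before \<open>g\<close>, which deals with the first \<open>i\<close> balls, apply a diffeomorphism \<open>f\<close> that squeezes the next ball into
 one so small that its image under \<open>g\<close> has small measure. Since \<open>f\<close> moves points only in a thin annulus
 and in the ball itself, the points of \<open>C\<close> outside lose nothing.\<close>

lemma squeeze_pieces:
 assumes eps: "0 < eps" and n: "n <= N"
 shows "\<exists>g\<in>Dr. \<exists>C. lift C \<in> sets borel &
   leb (lift (\<Union>j<n. disc j 1) - lift C) <= ennreal (real n * eps) &
   leb (move g ` lift C) <= ennreal (real n * eps)" using n
proof (induction n)
 case 0
 interpret G: group \<G> by (rule group_Diff)
 have "\<one>\<^bsub>\<G>\<^esub> \<in> Dr" using G.one_closed by (simp del: one_Diff)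
 moreover have "lift {} = {}" by (simp add: lift_def)
 ultimately show ?case by (intro bexI[of _ "\<one>\<^bsub>\<G>\<^esub>"] exI[of _ "{}"]) auto
next
 case (Suc i)
 interpret G: group \<G> by (rule group_Diff)
 have i: "i < N" using Suc.prems by simp
 obtain g C where g: "g \<in> Dr" and C: "lift C \<in> sets borel"
  "leb (lift (\<Union>j<i. disc j 1) - lift C) <= ennreal (real i * eps)"
  "leb (move g ` lift C) <= ennreal (real i * eps)" using Suc i by auto
 obtain s where s: "1 < s" "s <= 2" "leb (lift (disc i s) - lift (disc i 1)) < ennreal eps" using thin_annulus[OF i eps] .
 obtain t where t: "0 < t" "t <= 1" "leb (move g ` lift (disc i t)) < ennreal eps" using tiny_ball[OF i g eps] .
 have sR: "cball (a i) (s * R i) \<subseteq> snd (c i) ` fst (c i)" using subset_trans[OF subset_cball cball_chart[OF i]] s R(1)[OF i] by simp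
 obtain f where f: "f \<in> Dr" "!!x. x \<in> Xs ==> x \<notin> disc i s ==> f x = x"
  "f ` disc i 1 \<subseteq> disc i t"
 proof (rule ball_squeeze_diffeo[OF cA[OF i] sR, of "1 / s" "t * R i"])
  fix g assume g: "g \<in> Dr" "!!x. x \<in> Xs ==> x \<notin> ichart (c i) ` cball (a i) (s * R i) ==> g x = x"
   "g ` ichart (c i) ` cball (a i) (1 / s * (s * R i)) \<subseteq> ichart (c i) ` cball (a i) (t * R i)"
  have "1 / s * (s * R i) = 1 * R i" using s by simp
  thus thesis using that[OF g(1)] g(2,3) unfolding disc_def by simp
 qed (use s t R(1)[OF i] in auto)
 define C' where "C' = disc i 1 Un (C - disc i s)"
 have L1: "lift (disc i 1) \<in> sets borel" and Ls: "lift (disc i s) \<in> sets borel" and Lt: "lift (disc i t) \<in> sets borel"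
  using lift_closed disc(4)[OF i] s t by auto
 have LC': "lift C' = lift (disc i 1) Un (lift C - lift (disc i s))" by (auto simp: lift_def C'_def)
 have add: "ennreal (real i * eps) + ennreal eps = ennreal (real (Suc i) * eps)"
  using eps by (simp add: ennreal_plus[symmetric] algebra_simps del: ennreal_plus)
 have fg: "g \<otimes>\<^bsub>\<G>\<^esub> f \<in> Dr" using G.m_closed[of g f] g f(1) by simp
 have U: "lift (\<Union>j<i. disc j 1) \<in> sets borel" using i disc(4)[of _ 1] by (intro lift_closed closedin_Union) auto
 show ?case
 proof (intro bexI[OF _ fg] exI[of _ C'] conjI)
  show "lift C' \<in> sets borel" unfolding LC' using L1 Ls C(1) by auto
  have "lift (\<Union>j<Suc i. disc j 1) - lift C' \<subseteq>
    (lift (\<Union>j<i. disc j 1) - lift C) Un (lift (disc i s) - lift (disc i 1))" by (auto simp: lift_def C'_def lessThan_Suc)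
  hence "leb (lift (\<Union>j<Suc i. disc j 1) - lift C') <=
    leb ((lift (\<Union>j<i. disc j 1) - lift C) Un (lift (disc i s) - lift (disc i 1)))" using U C(1) L1 Ls by (intro emeasure_mono) auto
  also have "\<dots> <= leb (lift (\<Union>j<i. disc j 1) - lift C) + leb (lift (disc i s) - lift (disc i 1))"
   using U C(1) L1 Ls by (intro emeasure_subadditive) auto
  also have "\<dots> <= ennreal (real i * eps) + ennreal eps" using C(2) s(3) by (intro add_mono) auto
  finally show "leb (lift (\<Union>j<Suc i. disc j 1) - lift C') <= ennreal (real (Suc i) * eps)" unfolding add .
  have "move (g \<otimes>\<^bsub>\<G>\<^esub> f) ` lift C' \<subseteq> move g ` lift C Un move g ` lift (disc i t)"
  proof (rule image_subsetI)
   fix q assume q: "q \<in> lift C'"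
   hence qQ: "q \<in> Q" using lift_Q by blast
   have m: "move (g \<otimes>\<^bsub>\<G>\<^esub> f) q = move g (move f q)" by (rule move_mult[OF g f(1) qQ, symmetric])
   show "move (g \<otimes>\<^bsub>\<G>\<^esub> f) q \<in> move g ` lift C Un move g ` lift (disc i t)"
   proof (cases "decode q \<in> disc i 1")
    case True
    hence "f (decode q) \<in> disc i t" using f(3) by blast
    hence "move f q \<in> lift (disc i t)" using move_in[OF f(1) qQ] decode_move[OF f(1) qQ] by (simp add: lift_def)
    thus ?thesis unfolding m by blast
   next
    case False
    hence qC: "q \<in> lift C" "decode q \<notin> disc i s" using q by (auto simp: lift_def C'_def)
    hence "f (decode q) = decode q" using f(2) decode_in[OF qQ] by blast
    hence "move f q = q" using code_decode[OF qQ] by (simp add: move_def)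
    thus ?thesis unfolding m using qC(1) by simp
   qed
  qed
  hence "leb (move (g \<otimes>\<^bsub>\<G>\<^esub> f) ` lift C') <= leb (move g ` lift C Un move g ` lift (disc i t))"
   using move_image_sets[OF g C(1) lift_Q] move_image_sets[OF g Lt lift_Q] by (intro emeasure_mono) auto
  also have "\<dots> <= leb (move g ` lift C) + leb (move g ` lift (disc i t))"
   using move_image_sets[OF g C(1) lift_Q] move_image_sets[OF g Lt lift_Q] by (intro emeasure_subadditive) auto
  also have "\<dots> <= ennreal (real i * eps) + ennreal eps" using C(3) t(3) by (intro add_mono) auto
  finally show "leb (move (g \<otimes>\<^bsub>\<G>\<^esub> f) ` lift C') <= ennreal (real (Suc i) * eps)" unfolding add .
 qed
qed

lemma squeeze:
 assumes eps: "0 < eps"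
 shows "\<exists>g\<in>Dr. \<exists>D. D \<in> sets borel & D \<subseteq> Q & leb (Q - D) <= ennreal eps & leb (move g ` D) <= ennreal eps"
proof -
 have N: "0 < N" using nonempty piece(1) by fastforce
 have "lift (\<Union>j<N. disc j 1) = Q" using piece_closed piece(1) decode_in by (fastforce simp: lift_def)
 thus ?thesis using squeeze_pieces[of "eps / real N" N] N eps lift_Q by fastforce
qed

section \<open>The infinite measure preserving action\<close>

text \<open>A point of the model, a height and a mark.\<close>

definition Z :: "('e \<times> real \<times> real) set" where "Z = Q \<times> {0<..} \<times> {0..<1}"

definition vol :: "('e \<times> real \<times> real) measure" where "vol = restrict_space lborel Z"

definition slab :: "nat => ('e \<times> real \<times> real) set" where "slab n = Q \<times> ({real n..<real n + 1} Int {0<..}) \<times> {0..<1}"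

abbreviation mark :: "'e \<times> real \<times> real => real" where "mark z \<equiv> snd (snd z)"

definition act :: "('m => 'm) => 'e \<times> real \<times> real => 'e \<times> real \<times> real" where
 "act g z = (move g (fst z), fst (snd z) / dilation g (decode (fst z)), mark z)"

lemma Times_borel:
 "S \<in> sets borel ==> T \<in> sets borel ==> S \<times> T \<in> sets (borel :: ('a::second_countable_topology \<times> 'b::second_countable_topology) measure)"
 unfolding borel_prod[symmetric] by (rule pair_measureI)

lemma Z_borel: "Z \<in> sets borel"
 unfolding Z_def using Q_borel by (intro Times_borel) auto

lemma space_vol [simp]: "space vol = Z"
 by (simp add: vol_def space_restrict_space)

lemma sets_vol: "sets vol = {S \<in> sets borel. S \<subseteq> Z}"
 unfolding vol_def sets_restrict_space using Z_borel by (auto simp: image_iff)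

lemma emeasure_vol: "S \<in> sets borel ==> S \<subseteq> Z ==> emeasure vol S = leb S"
 unfolding vol_def using Z_borel by (intro emeasure_restrict_space) auto

lemma emeasure_lborel_Times:
 fixes S :: "'a::euclidean_space set" and T :: "'b::euclidean_space set"
 assumes "S \<in> sets borel" "T \<in> sets borel"
 shows "leb (S \<times> T) = leb S * leb T" using lborel.emeasure_pair_measure_Times[of S lborel T] assms by (simp add: lborel_prod)

lemma emeasure_prism:
 assumes "S \<in> sets borel" "T \<in> sets borel" "U \<in> sets borel" "S \<subseteq> Q" "T \<subseteq> {0<..}" "U \<subseteq> {0..<1}"
 shows "S \<times> T \<times> U \<in> sets vol" "emeasure vol (S \<times> T \<times> U) = leb S * (leb T * leb U)"
proof -
 have sub: "S \<times> T \<times> U \<subseteq> Z" using assms(4-6) by (auto simp: Z_def)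
 have b: "S \<times> T \<times> U \<in> sets borel" using assms(1-3) by (intro Times_borel)
 show "S \<times> T \<times> U \<in> sets vol" using b sub by (simp add: sets_vol)
 show "emeasure vol (S \<times> T \<times> U) = leb S * (leb T * leb U)"
  using assms(1-3) by (simp add: emeasure_vol[OF b sub] emeasure_lborel_Times Times_borel)
qed

lemma band_time: "leb ({real n..<real n + 1} Int {0<..}) = 1"
proof (cases n)
 case 0
 have "{real n..<real n + 1} Int {0<..} = {0<..<1}" using 0 by auto
 thus ?thesis by simp
next
 case (Suc k)
 hence "{real n..<real n + 1} Int {0<..} = {real n..<real n + 1}" by auto
 thus ?thesis by simp
qed

text \<open>In the first piece that meets \<open>U\<close>, the intersection is open.\<close>

lemma emeasure_lift_pos:
 assumes U: "openin X U" "U ~= {}" shows "0 < leb (lift U)"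
proof -
 obtain x where x: "x \<in> U" "x \<in> Xs" using U openin_subset by blast
 hence ex: "\<exists>i. i < N & U Int V i ~= {}" using V_cover by blast
 define i where "i = (LEAST i. i < N & U Int V i ~= {})"
 have i: "i < N" "U Int V i ~= {}" using LeastI_ex[OF ex] unfolding i_def by auto
 have less: "U Int V k = {}" if "k < i" for k using not_less_Least[of k "%i. i < N & U Int V i ~= {}"] that i(1) unfolding i_def[symmetric] by auto
 have pc: "piece y = i" if "y \<in> U Int V i" for y
 proof -
  have "y \<in> Xs" using that openin_subset[OF U(1)] by blast
  from piece_iff[OF this i(1)] show ?thesis using that less by blast
 qed
 let ?S = "{q \<in> slot i. point_at i q \<in> U Int V i}"
 have o: "open ?S" by (rule open_slot[OF i(1) openin_Int[OF U(1) openin_V[OF i(1)]]])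
 obtain y where y: "y \<in> U Int V i" using i(2) by blast
 have yt: "y \<in> Xs" using y openin_subset[OF U(1)] by blast
 have "code y \<in> ?S" using code_slot[OF yt] point_at_code[OF yt] y pc[OF y] by simp
 hence "~ negligible ?S" using open_not_negligible[OF o] by blast
 hence "leb ?S ~= 0" using borel_open[OF o] by (simp add: negligible_iff_emeasure0)
 moreover have "?S \<subseteq> lift U"
 proof
  fix q assume q: "q \<in> ?S"
  hence "q \<in> slot i & piece (point_at i q) = i" using pc by blast
  thus "q \<in> lift U" using Q_piece_iff[OF i(1), of q] decode_point_at[OF i(1), of q] q by (simp add: lift_def)
 qed
 hence "leb ?S <= leb (lift U)" using decode_sets[OF U(1)] by (intro emeasure_mono) (auto simp: lift_def)
 ultimately show ?thesis using not_gr_zero by fastforce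
qed

text \<open>The members are nonempty, so that the sets above them in \<open>tower\<close> have infinite measure.\<close>

definition countable_base :: "(nat => 'm set) => bool" where
 "countable_base b \<longleftrightarrow> (\<forall>k. openin X (b k) & b k ~= {}) & (\<forall>U. openin X U & U ~= {} --> (\<exists>k. b k \<subseteq> U))"

lemma countable_base_exists: "\<exists>b. countable_base b"
proof -
 obtain \<B> :: "'e set set" where \<B>: "countable \<B>" "topological_basis \<B>" using ex_countable_basis by blast
 define f where "f = (%(i, B). {x \<in> fst (c i). snd (c i) x \<in> B})"
 define \<U> where "\<U> = f ` ({..<N} \<times> \<B>) - {{}}"
 have op: "openin X U" if "U \<in> \<U>" for U
  using that openin_chart_preimage[OF cA] topological_basis_open[OF \<B>(2)] by (auto simp: \<U>_def f_def)
 have sub: "\<exists>W\<in>\<U>. W \<subseteq> U" if U: "openin X U" "x \<in> U" for U x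
 proof -
  have "x \<in> Xs" using U openin_subset by blast
  then obtain i where i: "i < N" "x \<in> V i" using V_cover by blast
  have xc: "x \<in> fst (c i)" using i V_subset by blast
  have "open (snd (c i) ` (U Int fst (c i)))" by (rule open_chart_image[OF cA[OF i(1)] openin_Int[OF U(1) chart_facts(1)[OF cA[OF i(1)]]]]) simp
  moreover have "snd (c i) x \<in> snd (c i) ` (U Int fst (c i))" using U xc by blast
  ultimately obtain B where B: "B \<in> \<B>" "snd (c i) x \<in> B" "B \<subseteq> snd (c i) ` (U Int fst (c i))" using topological_basisE[OF \<B>(2)] by metis
  have "f (i, B) \<subseteq> U"
  proof
   fix y assume "y \<in> f (i, B)"
   hence y: "y \<in> fst (c i)" "snd (c i) y \<in> snd (c i) ` (U Int fst (c i))" using B(3) by (auto simp: f_def)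
   then obtain z where "z \<in> U" "z \<in> fst (c i)" "snd (c i) y = snd (c i) z" by blast
   thus "y \<in> U" using inj_onD[OF chart_facts(3)[OF cA[OF i(1)]]] y(1) by metis
  qed
  moreover have "x \<in> f (i, B)" using xc B(2) by (simp add: f_def)
  ultimately show ?thesis using i(1) B(1) unfolding \<U>_def by (intro bexI[of _ "f (i, B)"]) auto
 qed
 have ne: "\<U> ~= {}" using nonempty sub[OF openin_topspace] by blast
 have cnt: "countable \<U>" unfolding \<U>_def using \<B>(1) by (intro countable_Diff countable_image countable_SIGMA) auto
 have r: "range (from_nat_into \<U>) = \<U>" by (rule range_from_nat_into[OF ne cnt])
 show ?thesis unfolding countable_base_def
 proof (intro exI[of _ "from_nat_into \<U>"] conjI allI impI)
  fix k
  have "from_nat_into \<U> k \<in> \<U>" by (rule from_nat_into[OF ne])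
  thus "openin X (from_nat_into \<U> k)" "from_nat_into \<U> k ~= {}" using op by (auto simp: \<U>_def)
 next
  fix U assume U: "openin X U & U ~= {}"
  then obtain W where "W \<in> \<U>" "W \<subseteq> U" using sub by blast
  thus "\<exists>k. from_nat_into \<U> k \<subseteq> U" using r by (metis imageE)
 qed
qed

definition tower :: "'m set => ('e \<times> real \<times> real) set" where "tower U = lift U \<times> {0<..} \<times> {0..<1}"

lemma tower_facts:
 assumes U: "openin X U" "U ~= {}" shows "tower U \<in> sets vol" "emeasure vol (tower U) = \<infinity>"
proof -
 have "{0<..} = (\<Union>n. {0<..real n})" using real_arch_simple by fastforce
 have inf: "leb {0::real<..} = \<infinity>"
 proof (rule ccontr)
  assume "leb {0::real<..} ~= \<infinity>"
  then obtain b where b: "0 <= b" "leb {0::real<..} = ennreal b" by (cases "leb {0::real<..}") auto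
  have "leb {0::real<..b + 1} <= leb {0::real<..}" by (intro emeasure_mono) auto
  thus False using b by simp
 qed
 have l: "lift U \<in> sets borel" using decode_sets[OF U(1)] by (simp add: lift_def)
 show "tower U \<in> sets vol" unfolding tower_def by (rule emeasure_prism(1)) (use l lift_Q in auto)
 have "emeasure vol (tower U) = leb (lift U) * (leb {0::real<..} * leb {0::real..<1})"
  unfolding tower_def by (rule emeasure_prism(2)) (use l lift_Q in auto)
 thus "emeasure vol (tower U) = \<infinity>" using emeasure_lift_pos[OF U] inf by (simp add: ennreal_mult_top)
qed

lemma act_in:
 assumes g: "g \<in> Dr" and z: "z \<in> Z" shows "act g z \<in> Z" using z move_in[OF g] dilation_pos[OF g decode_in] by (auto simp: Z_def act_def)

lemma act_measurable: "(%(g, z). act g z) \<in> measurable (borel_of tau \<Otimes>\<^sub>M vol) vol"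
proof -
 let ?M = "borel_of tau \<Otimes>\<^sub>M vol"
 have id: "(%z. z) \<in> measurable vol borel" unfolding vol_def by (rule measurable_restrict_space1) simp
 have z: "(%p. snd p) \<in> measurable ?M borel" using measurable_compose[OF measurable_snd id] .
 have zc: "(%p. h (snd p)) \<in> borel_measurable ?M" if "continuous_on UNIV h" for h :: "'e \<times> real \<times> real => 'x::topological_space"
  using measurable_compose[OF z borel_measurable_continuous_onI[OF that]] .
 have q: "(%p. fst (snd p)) \<in> borel_measurable ?M" and t: "(%p. fst (snd (snd p))) \<in> borel_measurable ?M"
  and u: "(%p. mark (snd p)) \<in> borel_measurable ?M" by (intro zc continuous_intros)+
 have mp: "(%p. move_pair (fst p, fst (snd p))) \<in> borel_measurable ?M"
  using measurable_compose[OF measurable_Pair[OF measurable_fst q] move_pair_measurable] by simp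
 have m1: "(%p. fst (move_pair (fst p, fst (snd p)))) \<in> borel_measurable ?M"
  and m2: "(%p. snd (move_pair (fst p, fst (snd p)))) \<in> borel_measurable ?M"
  using mp by (auto intro!: measurable_compose[OF mp borel_measurable_continuous_onI] continuous_intros)
 have "(%p. (fst (move_pair (fst p, fst (snd p))), fst (snd (snd p)) / snd (move_pair (fst p, fst (snd p))), mark (snd p))) \<in> borel_measurable ?M"
  by (intro borel_measurable_Pair m1 borel_measurable_divide t m2 u)
 moreover have "act (fst p) (snd p) = (fst (move_pair (fst p, fst (snd p))), fst (snd (snd p)) / snd (move_pair (fst p, fst (snd p))), mark (snd p))"
  if "p \<in> space ?M" for p using that by (auto simp: space_pair_measure Z_def act_def move_pair_def)
 ultimately have "(%p. act (fst p) (snd p)) \<in> borel_measurable ?M" by (subst measurable_cong) auto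
 hence "(%p. act (fst p) (snd p)) \<in> measurable ?M (restrict_space lborel Z)"
  by (intro measurable_restrict_space2) (auto simp: space_pair_measure intro: act_in)
 thus ?thesis by (simp add: vol_def case_prod_unfold)
qed

lemma act_vimage:
 assumes g: "g \<in> Dr" and B: "B \<in> sets vol" shows "{z \<in> Z. act g z \<in> B} \<in> sets vol"
proof -
 have "act g \<in> measurable vol vol" using measurable_compose[OF measurable_Pair1'[of g "borel_of tau" vol] act_measurable] g by simp
 from measurable_sets[OF this B] show ?thesis by (simp add: vimage_def Int_def conj_commute)
qed

lemma emeasure_scale:
 assumes J: "0 < J" and C: "C \<in> sets (borel :: (real \<times> real) measure)"
 shows "leb {p. (fst p / J, snd p) \<in> C} = ennreal J * leb C"
proof -
 let ?C = "{p. (fst p / J, snd p) \<in> C}"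
 have "(%p::real \<times> real. (fst p / J, snd p)) \<in> borel_measurable borel"
  using J by (intro borel_measurable_continuous_onI continuous_intros) auto
 from measurable_sets[OF this C] have C': "?C \<in> sets borel" by (simp add: vimage_def)
 have alt: "leb S = (\<integral>\<^sup>+t. leb (Pair t -` S) \<partial>lborel)" if "S \<in> sets (borel :: (real \<times> real) measure)" for S
  using lborel.emeasure_pair_measure_alt[of S "lborel :: real measure"] that unfolding lborel_prod by (simp add: sets_lborel borel_prod)
 have m: "(%t. leb (Pair t -` C)) \<in> borel_measurable borel"
  using lborel.measurable_emeasure_Pair[of C "lborel :: real measure"] C unfolding lborel_prod by simp
 have m': "(%t. leb (Pair (t / J) -` C)) \<in> borel_measurable borel"
  using J by (intro measurable_compose[OF borel_measurable_continuous_onI m] continuous_intros) auto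
 have "leb ?C = (\<integral>\<^sup>+t. leb (Pair (t / J) -` C) \<partial>lborel)"
  unfolding alt[OF C'] by (intro nn_integral_cong arg_cong[where f = "leb"]) auto
 also have "\<dots> = ennreal \<bar>J\<bar> * (\<integral>\<^sup>+t. leb (Pair ((0 + J * t) / J) -` C) \<partial>lborel)"
  by (rule nn_integral_real_affine[OF m']) (use J in simp)
 also have "\<dots> = ennreal J * leb C" using J by (simp add: alt[OF C])
 finally show ?thesis .
qed

text \<open>Shrinking the second coordinate by the Jacobian compensates for the expansion of the first, fibre by fibre.\<close>

lemma act_preserves:
 assumes g: "g \<in> Dr" and B: "B \<in> sets vol" shows "emeasure vol {z \<in> Z. act g z \<in> B} = emeasure vol B"
proof -
 let ?S = "{z \<in> Z. act g z \<in> B}"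
 have B': "B \<in> sets borel" "B \<subseteq> Z" and S: "?S \<in> sets borel" "?S \<subseteq> Z" using B act_vimage[OF g B] by (auto simp: sets_vol)
 have alt: "leb S = (\<integral>\<^sup>+q. leb (Pair q -` S) \<partial>lborel)" if "S \<in> sets (borel :: ('e \<times> real \<times> real) measure)" for S
  using lborel.emeasure_pair_measure_alt[of S "lborel :: 'e measure"] that unfolding lborel_prod by simp
 define K where "K = (%q. leb (Pair q -` B))"
 have K: "K \<in> borel_measurable borel"
  unfolding K_def using lborel.measurable_emeasure_Pair[of B "lborel :: 'e measure"] B' unfolding lborel_prod by simp
 have sec: "leb (Pair q -` ?S) = ennreal (indicat_real Q q * dilation g (decode q)) * K (move g q)" for q
 proof (cases "q \<in> Q")
  case True
  let ?J = "dilation g (decode q)"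
  have J: "0 < ?J" by (rule dilation_pos[OF g decode_in[OF True]])
  have Cb: "Pair (move g q) -` B \<in> sets (borel :: (real \<times> real) measure)"
  proof -
   have "B \<in> sets (borel \<Otimes>\<^sub>M borel)" using B'(1) unfolding borel_prod .
   thus ?thesis by (rule sets_Pair1)
  qed
  have "Pair q -` ?S = {p. (fst p / ?J, snd p) \<in> Pair (move g q) -` B}"
  proof (rule Set.set_eqI)
   fix p :: "real \<times> real"
   have "(q, p) \<in> Z" if "(move g q, fst p / ?J, snd p) \<in> B"
    using subsetD[OF B'(2) that] J True by (cases p) (simp add: Z_def zero_less_divide_iff)
   thus "p \<in> Pair q -` ?S \<longleftrightarrow> p \<in> {p. (fst p / ?J, snd p) \<in> Pair (move g q) -` B}" by (auto simp: act_def)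
  qed
  thus ?thesis using emeasure_scale[OF J Cb] True by (simp add: K_def)
 next
  case False
  hence e: "Pair q -` ?S = {}" by (auto simp: Z_def)
  show ?thesis unfolding e using False by simp
 qed
 have "leb ?S = (\<integral>\<^sup>+q. ennreal (indicat_real Q q * dilation g (decode q)) * K (move g q) \<partial>lborel)"
  unfolding alt[OF S(1)] sec ..
 also have "\<dots> = (\<integral>\<^sup>+q. indicator Q q * K q \<partial>lborel)" by (rule nn_integral_move[OF g K])
 also have "\<dots> = (\<integral>\<^sup>+q. K q \<partial>lborel)"
 proof (rule nn_integral_cong)
  fix q
  have "K q = 0" if "q \<notin> Q"
  proof -
   have "Pair q -` B = {}" using that B'(2) by (auto simp: Z_def)
   thus ?thesis by (simp add: K_def)
  qed
  thus "indicator Q q * K q = K q" by (cases "q \<in> Q") auto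
 qed
 also have "\<dots> = leb B" unfolding alt[OF B'(1)] K_def ..
 finally show ?thesis by (simp add: emeasure_vol[OF B'] emeasure_vol[OF S])
qed

lemma act_mult:
 assumes "g \<in> Dr" "h \<in> Dr" "z \<in> Z" shows "act g (act h z) = act (g \<otimes>\<^bsub>\<G>\<^esub> h) z"
proof -
 have q: "fst z \<in> Q" using assms(3) by (auto simp: Z_def)
 show ?thesis using move_mult[OF assms(1,2) q] dilation_mult[OF assms(1,2) decode_in[OF q]] decode_move[OF assms(2) q]
  by (simp add: act_def mult.commute)
qed

lemma act_one: "z \<in> Z ==> act \<one>\<^bsub>\<G>\<^esub> z = z"
 using move_one[of "fst z"] dilation_one[OF decode_in, of "fst z"] by (auto simp: Z_def act_def simp del: one_Diff)

lemma band_cover: "(\<Union>n. slab n) = Z"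
proof
 show "Z \<subseteq> (\<Union>n. slab n)"
 proof
  fix z assume z: "z \<in> Z"
  have "0 < fst (snd z)" using z by (auto simp: Z_def)
  hence "real (nat \<lfloor>fst (snd z)\<rfloor>) <= fst (snd z)" "fst (snd z) < real (nat \<lfloor>fst (snd z)\<rfloor>) + 1" by linarith+
  hence "z \<in> slab (nat \<lfloor>fst (snd z)\<rfloor>)" using z by (cases z) (auto simp: Z_def slab_def)
  thus "z \<in> (\<Union>n. slab n)" by blast
 qed
qed (auto simp: slab_def Z_def)

lemma act_band:
 assumes g: "g \<in> Dr" shows "\<exists>m. \<forall>z\<in>slab n. \<exists>k<m. act g z \<in> slab k"
proof -
 obtain K where K: "!!x. x \<in> Xs ==> 1 / real (Suc K) <= dilation g x & dilation g x <= real (Suc K)" using dilation_bounds[OF g] by blast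
 have "\<exists>k<Suc n * Suc K. act g z \<in> slab k" if z: "z \<in> slab n" for z
 proof -
  have zZ: "z \<in> Z" using z band_cover by blast
  have q: "fst z \<in> Q" and t: "0 < fst (snd z)" "fst (snd z) < real n + 1" using z by (auto simp: slab_def)
  let ?J = "dilation g (decode (fst z))"
  have "1 <= ?J * real (Suc K)" using K[OF decode_in[OF q]] by (simp add: field_simps)
  hence "fst (snd z) * 1 <= fst (snd z) * (?J * real (Suc K))" using t by (intro mult_left_mono) auto
  hence "fst (snd z) / ?J <= fst (snd z) * real (Suc K)" using dilation_pos[OF g decode_in[OF q]] by (simp add: field_simps)
  also have "\<dots> < (real n + 1) * real (Suc K)" using t by (intro mult_strict_right_mono) auto
  also have "\<dots> = real (Suc n * Suc K)" by (simp add: algebra_simps)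
  finally have lt: "fst (snd (act g z)) < real (Suc n * Suc K)" by (simp add: act_def)
  obtain k where k: "act g z \<in> slab k" using act_in[OF g zZ] band_cover by blast
  hence "real k <= fst (snd (act g z))" by (auto simp: slab_def)
  hence "real k < real (Suc n * Suc K)" using lt by linarith
  hence "k < Suc n * Suc K" by (simp only: of_nat_less_iff)
  thus ?thesis using k by blast
 qed
 thus ?thesis by blast
qed

text \<open>Up to small measure both sets lie below a height \<open>b\<close>. Below it, a point over \<open>D n\<close> is moved over the
 image of \<open>D n\<close>, and both this image and the complement of \<open>D n\<close> have small measure.\<close>

lemma act_mixing:
 assumes gs: "!!n. gs n \<in> Dr" and D: "!!n. D n \<in> sets borel" "!!n. D n \<subseteq> Q"
  and small: "!!n. leb (Q - D n) <= ennreal (1 / real (Suc n))" "!!n. leb (move (gs n) ` D n) <= ennreal (1 / real (Suc n))"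
  and S: "S \<in> sets vol" "emeasure vol S ~= \<infinity>" and T: "T \<in> sets vol" "emeasure vol T ~= \<infinity>"
 shows "(%n. measure vol (S Int {z \<in> Z. act (gs n) z \<in> T})) \<longlonglongrightarrow> 0"
proof (rule LIMSEQ_I)
 fix e :: real assume e: "0 < e"
 \<comment> \<open>four error terms, and one to spare for strictness\<close>
 define dlt where "dlt = e / 5"
 have dlt: "0 < dlt" using e by (simp add: dlt_def)
 let ?high = "%b::nat. {z :: 'e \<times> real \<times> real. real b < fst (snd z)}"
 have "open (?high b)" for b by (intro open_Collect_less continuous_intros)
 hence hs: "Y Int ?high b \<in> sets vol" if "Y \<in> sets vol" for Y b using that by (auto simp: sets_vol)
 have tail: "\<forall>\<^sub>F b in sequentially. emeasure vol (Y Int ?high b) < ennreal dlt" if Y: "Y \<in> sets vol" "emeasure vol Y ~= \<infinity>" for Y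
 proof -
  have "(%b. emeasure vol (Y Int ?high b)) \<longlonglongrightarrow> emeasure vol (\<Inter>b. Y Int ?high b)"
  proof (rule Lim_emeasure_decseq)
   show "range (%b. Y Int ?high b) \<subseteq> sets vol" using hs[OF Y(1)] by auto
   show "decseq (%b. Y Int ?high b)" by (rule decseq_SucI) auto
   show "emeasure vol (Y Int ?high b) ~= \<infinity>" for b using emeasure_mono[of "Y Int ?high b" Y vol] Y by (auto simp: top_unique)
  qed
  moreover have "(\<Inter>b. Y Int ?high b) = {}"
  proof (rule equals0I)
   fix z assume z: "z \<in> (\<Inter>b. Y Int ?high b)"
   obtain b :: nat where "fst (snd z) <= real b" using real_arch_simple by blast
   moreover have "real b < fst (snd z)" using z by blast
   ultimately show False by simp
  qed
  ultimately have "(%b. emeasure vol (Y Int ?high b)) \<longlonglongrightarrow> 0" by simp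
  thus ?thesis by (rule order_tendstoD) (simp add: dlt)
 qed
 obtain b where b: "emeasure vol (S Int ?high b) < ennreal dlt" "emeasure vol (T Int ?high b) < ennreal dlt"
  using eventually_happens'[OF sequentially_bot eventually_conj[OF tail[OF S] tail[OF T]]] by blast
 obtain n0 :: nat where n0: "real b / dlt < real n0" using reals_Archimedean2 by blast
 show "\<exists>n0. \<forall>n\<ge>n0. norm (measure vol (S Int {z \<in> Z. act (gs n) z \<in> T}) - 0) < e"
 proof (intro exI allI impI)
  fix n assume n: "n0 <= n"
  have bn: "real b * (1 / real (Suc n)) <= dlt"
  proof -
   have "real b < real n0 * dlt" using n0 dlt by (simp add: field_simps)
   also have "\<dots> <= real (Suc n) * dlt" using n dlt by (intro mult_right_mono) auto
   finally show ?thesis by (simp add: field_simps)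
  qed
  let ?low = "%Y. Y \<times> {0<..real b} \<times> {0..<1::real}"
  have low: "?low Y \<in> sets vol" "emeasure vol (?low Y) <= ennreal dlt"
   if Y: "Y \<in> sets borel" "Y \<subseteq> Q" "leb Y <= ennreal (1 / real (Suc n))" for Y
  proof -
   show "?low Y \<in> sets vol" by (rule emeasure_prism(1)) (use Y in auto)
   have "emeasure vol (?low Y) = leb Y * (leb {0<..real b} * leb {0..<1::real})" by (rule emeasure_prism(2)) (use Y in auto)
   also have "\<dots> <= ennreal (1 / real (Suc n)) * ennreal (real b)" using Y(3) by (intro mult_mono) auto
   also have "\<dots> = ennreal (real b * (1 / real (Suc n)))" by (simp add: ennreal_mult[symmetric] mult.commute)
   also have "\<dots> <= ennreal dlt" using bn by (rule ennreal_leI)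
   finally show "emeasure vol (?low Y) <= ennreal dlt" .
  qed
  have QD: "Q - D n \<in> sets borel" using Q_borel D by auto
  have mD: "move (gs n) ` D n \<in> sets borel" "move (gs n) ` D n \<subseteq> Q" using move_image_sets[OF gs D] move_in[OF gs] D(2) by blast+
  note l1 = low[OF QD Diff_subset small(1)] and l2 = low[OF mD small(2)]
  let ?pre = "%Y. {z \<in> Z. act (gs n) z \<in> Y}"
  define P where "P = ((S Int ?high b) Un ?pre (T Int ?high b)) Un (?low (Q - D n) Un ?pre (?low (move (gs n) ` D n)))"
  have ps: "?pre Y \<in> sets vol" "emeasure vol (?pre Y) = emeasure vol Y" if "Y \<in> sets vol" for Y
   using act_vimage[OF gs that] act_preserves[OF gs that] by auto
  have "S Int ?pre T \<subseteq> P"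
  proof
   fix z assume z: "z \<in> S Int ?pre T"
   hence zZ: "z \<in> Z" and aZ: "act (gs n) z \<in> Z" using act_in[OF gs] by auto
   show "z \<in> P"
   proof (cases "real b < fst (snd z) | real b < fst (snd (act (gs n) z))")
    case True
    thus ?thesis using z by (auto simp: P_def)
   next
    case False
    show ?thesis
    proof (cases "fst z \<in> D n")
     case True
     hence "fst (act (gs n) z) \<in> move (gs n) ` D n" by (simp add: act_def)
     hence "act (gs n) z \<in> ?low (move (gs n) ` D n)" using aZ False by (cases "act (gs n) z") (auto simp: Z_def)
     thus ?thesis using zZ by (simp add: P_def)
    next
     case F: False
     hence "z \<in> ?low (Q - D n)" using zZ False by (cases z) (auto simp: Z_def)
     thus ?thesis by (simp add: P_def)
    qed
   qed
  qed
  moreover have Ps: "P \<in> sets vol" unfolding P_def using hs[OF S(1)] ps(1)[OF hs[OF T(1)]] l1(1) ps(1)[OF l2(1)] by (intro sets.Un)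
  ultimately have "emeasure vol (S Int ?pre T) <= emeasure vol P" by (intro emeasure_mono)
  also have "\<dots> <= (ennreal dlt + ennreal dlt) + (ennreal dlt + ennreal dlt)" unfolding P_def
   by (intro order_trans[OF emeasure_subadditive] add_mono sets.Un hs S ps(1) l1 l2(1) T)
    (use b l2(2) ps(2)[OF hs[OF T(1)]] ps(2)[OF l2(1)] in auto)
  also have "\<dots> = ennreal (4 * dlt)" using dlt by (simp add: ennreal_plus[symmetric] del: ennreal_plus)
  finally have "measure vol (S Int ?pre T) <= 4 * dlt" unfolding measure_def using dlt by (intro enn2real_leI) auto
  thus "norm (measure vol (S Int ?pre T) - 0) < e" using e by (simp add: dlt_def)
 qed
qed

theorem ergodic_free_action:
 "\<exists>(P :: real measure) T. standard_prob_space P & spatial_action \<G> tau P T & ergodic_action \<G> P T & free_action \<G> P T"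
proof -
 have "\<forall>n. \<exists>g D. g \<in> Dr & D \<in> sets borel & D \<subseteq> Q & leb (Q - D) <= ennreal (1 / real (Suc n)) &
   leb (move g ` D) <= ennreal (1 / real (Suc n))" using squeeze by (metis of_nat_0_less_iff zero_less_Suc zero_less_divide_1_iff)
 then obtain gs D where gs: "!!n. gs n \<in> Dr" and D: "!!n. D n \<in> sets borel" "!!n. D n \<subseteq> Q"
  "!!n. leb (Q - D n) <= ennreal (1 / real (Suc n))"
  "!!n. leb (move (gs n) ` D n) <= ennreal (1 / real (Suc n))" by metis
 obtain b where "countable_base b" using countable_base_exists by blast
 hence b: "!!k. openin X (b k)" "!!k. b k ~= {}" "!!U. openin X U ==> U ~= {} ==> \<exists>k. b k \<subseteq> U"
  unfolding countable_base_def by blast+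
 have Qpos: "0 < leb Q"
 proof -
  have "lift (Xs) = Q" using decode_in by (auto simp: lift_def)
  thus ?thesis using emeasure_lift_pos[OF openin_topspace nonempty] by simp
 qed
 have em_slab: "slab n \<in> sets vol" "emeasure vol (slab n) = leb Q" for n
  using emeasure_prism[OF Q_borel, of "{real n..<real n + 1} Int {0<..}" "{0..<1}"] band_time[of n] by (simp_all add: slab_def)
 have tower_sub: "\<exists>k. \<forall>z\<in>tower (b k). decode (fst z) \<in> U" if "openin X U" "U ~= {}" for U
  using b(3)[OF that] by (auto simp: tower_def lift_def)
 interpret poisson_action vol slab mark "%k. tower (b k)" 0 \<G> tau act gs
 proof (intro poisson_action.intro poisson_system.intro poisson_action_axioms.intro)
  show "sets vol = {S \<in> sets borel. S \<subseteq> space vol}" by (simp add: sets_vol)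
  show "0 \<notin> space vol" by (simp add: Z_def zero_prod_def)
  show "slab n \<in> sets vol" "0 < emeasure vol (slab n)" "emeasure vol (slab n) < \<infinity>" for n using em_slab Qpos Q_finite by auto
  have "m = n" if "z \<in> slab m" "z \<in> slab n" for m n z
  proof -
   have "real m < real n + 1" "real n < real m + 1" using that by (auto simp: slab_def)
   thus ?thesis by linarith
  qed
  thus "disjoint_family slab" by (auto simp: disjoint_family_on_def)
  show "(\<Union>n. slab n) = space vol" by (simp add: band_cover)
  show "mark \<in> borel_measurable borel" by (intro borel_measurable_continuous_onI continuous_intros)
  show "0 <= mark z & mark z < 1" if "z \<in> space vol" for z using that by (auto simp: Z_def)
  show "emeasure vol (slab n Int mark -` {s..<t}) = ennreal (t - s) * emeasure vol (slab n)" if st: "0 <= s" "s <= t" "t <= 1" for n s t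
  proof -
   have "slab n Int mark -` {s..<t} = Q \<times> ({real n..<real n + 1} Int {0<..}) \<times> {s..<t}" using st by (auto simp: slab_def)
   thus ?thesis using emeasure_prism(2)[OF Q_borel, of "{real n..<real n + 1} Int {0<..}" "{s..<t}"] st band_time[of n] em_slab(2)[of n]
    by (simp add: mult.commute)
  qed
  show "tower (b k) \<in> sets vol" "emeasure vol (tower (b k)) = \<infinity>" for k using tower_facts b(1,2) by auto
  show "group \<G>" by (rule group_Diff)
  show "topspace tau = carrier \<G>" by simp
  show "(%(g, z). act g z) \<in> borel_of tau \<Otimes>\<^sub>M vol \<rightarrow>\<^sub>M vol" by (rule act_measurable)
  show "act \<one>\<^bsub>\<G>\<^esub> z = z" if "z \<in> space vol" for z using act_one that by (simp del: one_Diff)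
  show "act g (act h z) = act (g \<otimes>\<^bsub>\<G>\<^esub> h) z" if "g \<in> carrier \<G>" "h \<in> carrier \<G>" "z \<in> space vol" for g h z using act_mult that by simp
  show "emeasure vol {z \<in> space vol. act g z \<in> B} = emeasure vol B" if "g \<in> carrier \<G>" "B \<in> sets vol" for g B using act_preserves that by simp
  show "\<exists>m. \<forall>z\<in>slab n. \<exists>k<m. act g z \<in> slab k" if "g \<in> carrier \<G>" for g n using act_band that by simp
  show "mark (act g z) = mark z" for g z by (simp add: act_def)
  show "\<exists>l. \<forall>z\<in>tower (b l). act g z \<in> tower (b k)" if "g \<in> carrier \<G>" for g k
  proof -
   have g: "g \<in> Dr" using that by simp
   have gc: "continuous_map X X g" using diffeosD(3)[OF g] by (simp add: C_map_def)
   let ?U = "{x \<in> Xs. g x \<in> b k}"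
   obtain y where y: "y \<in> b k" using b(2) by blast
   hence "y \<in> Xs" using openin_subset[OF b(1)] by blast
   hence "inv_into (Xs) g y \<in> ?U" using diffeo_inv[OF g] y by simp
   hence "?U ~= {}" by blast
   from tower_sub[OF openin_continuous_map_preimage[OF gc b(1)] this]
   obtain l where l: "\<forall>z\<in>tower (b l). decode (fst z) \<in> ?U" by blast
   have "act g z \<in> tower (b k)" if z: "z \<in> tower (b l)" for z
   proof -
    have zZ: "z \<in> Z" using z lift_Q by (auto simp: tower_def Z_def)
    hence q: "fst z \<in> Q" by (auto simp: Z_def)
    have "fst (act g z) \<in> lift (b k)" using l z move_in[OF g q] decode_move[OF g q] by (simp add: act_def lift_def)
    thus ?thesis using act_in[OF g zZ] by (cases "act g z") (auto simp: tower_def Z_def)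
   qed
   thus ?thesis by blast
  qed
  show "\<exists>k. \<forall>z\<in>tower (b k). act g z ~= z" if gG: "g \<in> carrier \<G>" and ne: "g ~= \<one>\<^bsub>\<G>\<^esub>" for g
  proof -
   have g: "g \<in> Dr" using gG by simp
   have gc: "continuous_map X X g" using diffeosD(3)[OF g] by (simp add: C_map_def)
   let ?U = "Xs - {x \<in> Xs. g x = x}"
   have "closedin X {x \<in> Xs. g x = x}" using closedin_continuous_maps_eq[OF Hausdorff gc continuous_map_id] by simp
   hence U: "openin X ?U" by blast
   have "?U ~= {}"
   proof
    assume "?U = {}"
    hence "g x = x" if "x \<in> Xs" for x using that by blast
    hence "g = (\<lambda>x\<in>Xs. x)" using diffeosD(2)[OF g] by (intro extensionalityI[of g "Xs"]) auto
    thus False using ne by simp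
   qed
   from tower_sub[OF U this] obtain k where k: "\<forall>z\<in>tower (b k). decode (fst z) \<in> ?U" by blast
   have "act g z ~= z" if z: "z \<in> tower (b k)" for z
   proof
    assume eq: "act g z = z"
    have q: "fst z \<in> Q" using z by (auto simp: tower_def lift_def)
    have "g (decode (fst z)) = decode (fst z)" using decode_move[OF g q] arg_cong[OF eq, of fst] by (simp add: act_def)
    thus False using k z by blast
   qed
   thus ?thesis by blast
  qed
  show "gs n \<in> carrier \<G>" for n using gs by simp
  show "(%n. measure vol (S Int {z \<in> space vol. act (gs n) z \<in> T})) \<longlonglongrightarrow> 0"
   if "S \<in> sets vol" "T \<in> sets vol" "emeasure vol S ~= \<infinity>" "emeasure vol T ~= \<infinity>" for S T
   using act_mixing[OF gs D that(1,3,2,4)] by simp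
 qed
 show ?thesis by (rule poisson_suspension)
qed

end

theorem theorem7:
  fixes X :: "'m topology"
    and A :: "('m, 'e::euclidean_space) chart set"
    and r :: enat
  assumes "smooth_atlas X A"
    and "topspace X \<noteq> {}"
    and "compact_space X" and "Hausdorff_space X" and "connected_space X"
    and "1 \<le> r"
  shows "polish_group (Diff r X A) (Diff_topology r X A) \<and>
    (\<exists>(P :: real measure) T. standard_prob_space P \<and>
        spatial_action (Diff r X A) (Diff_topology r X A) P T \<and>
        ergodic_action (Diff r X A) P T \<and>
        free_action (Diff r X A) P T) \<and>
    \<not> levy_group (Diff r X A) (Diff_topology r X A)"
proof -
  interpret compact_manifold X A
    using assms(1-4) by (rule compact_manifold.intro)
  obtain N c a R where "covered_manifold X A N c a R"
    by (rule finite_chart_cover)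
  then interpret model_manifold X A N c a R r
    using assms(6) by (intro model_manifold.intro model_manifold_axioms.intro)
  show ?thesis
    using polish_group_Diff[OF assms(6)] ergodic_free_action not_levy_group_Diff[OF assms(6)]
    by blast
qed

end
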